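(* Let $\mathbf G$ be a gerbe on a topological space $X$, and let $\{\mathbf N_p\}_{p\in\mathbb N}$ be a central filtration on it. Assume that $\mathbf G$ is complete with respect to $\{\mathbf N_p\}_{p\in\mathbb N}$, and that there are enough acyclic coverings with respect to $\{\mathbf N_p\}_{p\in\mathbb N}$. Let $U$ be an open set of $X$. (1) If $\mathrm H^1(U,\mathbf N_p/\mathbf N_{p+1})=1$ for every $p\ge 0$, then the groupoid $\mathbf G(U)$ is connected. (2) If $\mathrm H^2(U,\mathbf N_p/\mathbf N_{p+1})=1$ for every $p\ge 0$, then the groupoid $\mathbf G(U)$ is nonempty.
   Context: **Gerbes.** A prestack of groupoids $\mathbf G$ on a topological space $X$ is a pseudofunctor $U\mapsto\mathbf G(U)$ from the opposite of the poset of open sets of $X$ to categories, with values in groupoids. The restriction functors are written $i\mapsto i|_V$, and the coherence isomorphisms $(i|_V)|_W\cong i|_W$ are used tacitly. $\mathbf G(U)(i,j)$ is the set of morphisms $i\to j$ in $\mathbf G(U)$. For $i,j\in\operatorname{Ob}\mathbf G(U)$, $\mathbf G(i,j)$ is the presheaf $V\mapsto\mathbf G(V)(i|_V,j|_V)$ on $U$; for objects over different open sets $U,V$ it denotes the corresponding presheaf on $U\cap V$. $\mathbf G$ is a stack if all presheaves $\mathbf G(i,j)$ are sheaves and descent data for objects are effective. A gerbe is a stack of groupoids that is locally nonempty (each $x\in X$ has an open neighborhood $U$ with $\operatorname{Ob}\mathbf G(U)\ne\emptyset$) and locally connected (for $i,j\in\operatorname{Ob}\mathbf G(U)$ and $x\in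 U$ there is an open $V$ with $x\in V\subset U$ and $\mathbf G(V)(i|_V,j|_V)\neq\emptyset$). A local object is an object of $\mathbf G(U)$ for some open $U\subset X$. A groupoid is connected if any two of its objects are isomorphic. $\operatorname{Ad}(g)(f)=g\circ f\circ g^{-1}$. **Normal subgroupoids.** A normal subgroupoid $\mathbf N$ of a gerbe $\mathbf G$ assigns to each open $U$ and $i\in\operatorname{Ob}\mathbf G(U)$ a subgroup $\mathbf N(U)(i,i)\subset\mathbf G(U)(i,i)$ such that $\operatorname{Ad}(g)(\mathbf N(U)(i,i))=\mathbf N(U)(j,j)$ for all $g\in\mathbf G(U)(i,j)$, and such that $V\mapsto\mathbf N(V)(i|_V,i|_V)$ is a subsheaf of groups $\mathbf N(i,i)$ of $\mathbf G(i,i)$. **Filtrations of sheaves of groups.** Let $\mathcal G$ be a sheaf of groups. A central filtration of $\mathcal G$ is a descending sequence $\{\mathcal N_p\}_{p\in\mathbb N}$ of sheaves of normal subgroups of $\mathcal G$ with $\mathcal N_0=\mathcal G$, $\bigcap_p\mathcal N_p=1$, and $\mathcal N_p/\mathcal N_{p+1}$ central in $\mathcal G/\mathcal N_{p+1}$ for every $p$ (sheaf quotients). $\mathcal G$ is complete with respect to it if $\mathcal G\to\varprojlim_p\mathcal G/\mathcal N_p$ is an isomorphism of sheaves. An open set $U$ (of the space on which $\mathcal G$ lives) is acyclic with respect to $\{\mathcal N_p\}$ if (i) the sheaf cohomology $\mathrm H^i(U,\mathcal N_p/\mathcal N_{p+1})$ is trivial for all $p\ge0$, $i>0$; and (ii)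 $\Gamma(U,\mathcal N_p)\to\Gamma(U,\mathcal N_p/\mathcal N_q)$ is surjective for all $q\ge p\ge0$. **Filtrations of gerbes.** A central filtration of a gerbe $\mathbf G$ is a descending sequence $\{\mathbf N_p\}_{p\in\mathbb N}$ of normal subgroupoids such that for every local object $i$ the filtration $\{\mathbf N_p(i,i)\}_p$ of $\mathbf G(i,i)$ is central. $\mathbf G$ is complete with respect to $\{\mathbf N_p\}$ if for every local object $i$ the sheaf $\mathbf G(i,i)$ is complete with respect to $\{\mathbf N_p(i,i)\}_p$. For each $p$, $\mathbf N_p/\mathbf N_{p+1}$ is regarded as a single sheaf of abelian groups on $X$ (written multiplicatively; a trivial group is denoted $1$): it is the sheaf, unique up to unique isomorphism, equipped with isomorphisms $\chi_i:(\mathbf N_p/\mathbf N_{p+1})|_U\cong\mathbf N_p(i,i)/\mathbf N_{p+1}(i,i)$ for all $i\in\operatorname{Ob}\mathbf G(U)$, such that $\operatorname{Ad}(g)\circ\chi_i=\chi_j$ for every local isomorphism $g:i\to j$. (It is well defined because $\mathbf N_p(i,i)/\mathbf N_{p+1}(i,i)$ is central in $\mathbf G(i,i)/\mathbf N_{p+1}(i,i)$.) $\mathrm H^i$ is derived functor sheaf cohomology. **Acyclic coverings.** An open set $U\subset X$ is acyclic with respect to $\{\mathbf N_p\}$ if $\mathbf G(U)$ is nonempty and for every $i\in\operatorname{Ob}\mathbf G(U)$ the set $U$ is acyclic with respect to the central filtration $\{\mathbf N_p(i,i)\}_p$ of $\mathbf G(i,i)$. A collection $\{U_k\}_{k\in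 K}$ of open sets is acyclic if every finite intersection $U_{k_0}\cap\dots\cap U_{k_m}$ is acyclic. There are enough acyclic coverings with respect to $\{\mathbf N_p\}$ if every open covering of an open set $U\subset X$ has a refinement (an open covering of $U$) that is acyclic with respect to $\{\mathbf N_p\}$. *)

theory Defs
  imports "HOL-Algebra.Elementary_Groups" "HOL-Analysis.Abstract_Topology"
begin

section \<open>Sheaves of sets and of groups on a topological space\<close>

text \<open>
  A sheaf lives on a space \<open>T :: 'x topology\<close>; only its values on the open sets of \<open>T\<close> matter.
  Hence the restriction of a sheaf on \<open>T\<close> to an open subset \<open>U\<close> is the same data, regarded over
  \<open>subtopology T U\<close>. Coverings are sets of open sets.
\<close>

definition open_cover :: "'x topology \<Rightarrow> 'x set \<Rightarrow> 'x set set \<Rightarrow> bool" where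
  "open_cover T U \<U> \<longleftrightarrow> (\<forall>V\<in>\<U>. openin T V) \<and> \<Union>\<U> = U"

definition presheaf_of_sets ::
    "'x topology \<Rightarrow> ('x set \<Rightarrow> 'a set) \<Rightarrow> ('x set \<Rightarrow> 'x set \<Rightarrow> 'a \<Rightarrow> 'a) \<Rightarrow> bool" where
  "presheaf_of_sets T S r \<longleftrightarrow>
     (\<forall>U V. openin T U \<and> openin T V \<and> V \<subseteq> U \<longrightarrow> r U V \<in> S U \<rightarrow> S V) \<and>
     (\<forall>U. openin T U \<longrightarrow> (\<forall>s\<in>S U. r U U s = s)) \<and>
     (\<forall>U V W. openin T U \<and> openin T V \<and> openin T W \<and> V \<subseteq> U \<and> W \<subseteq> V \<longrightarrow>
        (\<forall>s\<in>S U. r V W (r U V s) = r U W s))"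

definition sheaf_of_sets ::
    "'x topology \<Rightarrow> ('x set \<Rightarrow> 'a set) \<Rightarrow> ('x set \<Rightarrow> 'x set \<Rightarrow> 'a \<Rightarrow> 'a) \<Rightarrow> bool" where
  "sheaf_of_sets T S r \<longleftrightarrow>
     presheaf_of_sets T S r \<and>
     (\<forall>U \<U> s. openin T U \<and> open_cover T U \<U> \<and> (\<forall>V\<in>\<U>. s V \<in> S V) \<and>
        (\<forall>V\<in>\<U>. \<forall>W\<in>\<U>. r V (V \<inter> W) (s V) = r W (V \<inter> W) (s W)) \<longrightarrow>
        (\<exists>!t. t \<in> S U \<and> (\<forall>V\<in>\<U>. r U V t = s V)))"

record ('x, 'a) group_presheaf =
  Sec :: "'x set \<Rightarrow> 'a monoid"
  Res :: "'x set \<Rightarrow> 'x set \<Rightarrow> 'a \<Rightarrow> 'a"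

definition sheaf_of_groups :: "'x topology \<Rightarrow> ('x, 'a) group_presheaf \<Rightarrow> bool" where
  "sheaf_of_groups T F \<longleftrightarrow>
     (\<forall>U. openin T U \<longrightarrow> group (Sec F U)) \<and>
     (\<forall>U V. openin T U \<and> openin T V \<and> V \<subseteq> U \<longrightarrow> Res F U V \<in> hom (Sec F U) (Sec F V)) \<and>
     sheaf_of_sets T (\<lambda>U. carrier (Sec F U)) (Res F)"

definition abelian_sheaf :: "'x topology \<Rightarrow> ('x, 'a) group_presheaf \<Rightarrow> bool" where
  "abelian_sheaf T F \<longleftrightarrow>
     sheaf_of_groups T F \<and> (\<forall>U. openin T U \<longrightarrow> comm_group (Sec F U))"

definition sheaf_morphism :: "'x topology \<Rightarrow> ('x, 'a) group_presheaf \<Rightarrow> ('x, 'b) group_presheaf \<Rightarrow>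
    ('x set \<Rightarrow> 'a \<Rightarrow> 'b) \<Rightarrow> bool" where
  "sheaf_morphism T F F' \<phi> \<longleftrightarrow>
     (\<forall>U. openin T U \<longrightarrow> \<phi> U \<in> hom (Sec F U) (Sec F' U)) \<and>
     (\<forall>U V. openin T U \<and> openin T V \<and> V \<subseteq> U \<longrightarrow>
        (\<forall>s\<in>carrier (Sec F U). \<phi> V (Res F U V s) = Res F' U V (\<phi> U s)))"

definition sheaf_iso :: "'x topology \<Rightarrow> ('x, 'a) group_presheaf \<Rightarrow> ('x, 'b) group_presheaf \<Rightarrow>
    ('x set \<Rightarrow> 'a \<Rightarrow> 'b) \<Rightarrow> bool" where
  "sheaf_iso T F F' \<phi> \<longleftrightarrow>
     sheaf_morphism T F F' \<phi> \<and> (\<forall>U. openin T U \<longrightarrow> \<phi> U \<in> iso (Sec F U) (Sec F' U))"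


section \<open>Sheafification\<close>

text \<open>
  The germ at \<open>x\<close> of a section \<open>s\<close> over \<open>U\<close> is the set of all pairs (neighbourhood of \<open>x\<close>,
  section) agreeing with \<open>s\<close> near \<open>x\<close>. Sections of the associated sheaf over \<open>U\<close> are
  functions from \<open>U\<close> to germs (\<open>undefined\<close> outside \<open>U\<close>) locally given by sections of the presheaf.
\<close>

definition germ :: "'x topology \<Rightarrow> ('x, 'a) group_presheaf \<Rightarrow> 'x set \<Rightarrow> 'a \<Rightarrow> 'x \<Rightarrow> ('x set \<times> 'a) set"
  where
  "germ T P U s x =
     {(V, t). openin T V \<and> x \<in> V \<and> t \<in> carrier (Sec P V) \<and>
        (\<exists>W. openin T W \<and> x \<in> W \<and> W \<subseteq> U \<inter> V \<and> Res P U W s = Res P V W t)}"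

definition germ_mult :: "'x topology \<Rightarrow> ('x, 'a) group_presheaf \<Rightarrow> 'x \<Rightarrow>
    ('x set \<times> 'a) set \<Rightarrow> ('x set \<times> 'a) set \<Rightarrow> ('x set \<times> 'a) set" where
  "germ_mult T P x a b =
     (\<Union>(V, s)\<in>a. \<Union>(W, t)\<in>b.
        germ T P (V \<inter> W) (Res P V (V \<inter> W) s \<otimes>\<^bsub>Sec P (V \<inter> W)\<^esub> Res P W (V \<inter> W) t) x)"

definition sheafify :: "'x topology \<Rightarrow> ('x, 'a) group_presheaf \<Rightarrow>
    ('x, 'x \<Rightarrow> ('x set \<times> 'a) set) group_presheaf" where
  "sheafify T P =
     \<lparr> Sec = \<lambda>U. \<lparr> carrier = {\<sigma> \<in> extensional U. \<forall>x\<in>U. \<exists>V t. openin T V \<and> x \<in> V \<and> V \<subseteq> U \<and>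
                               t \<in> carrier (Sec P V) \<and> (\<forall>y\<in>V. \<sigma> y = germ T P V t y)},
                  mult = \<lambda>\<sigma> \<tau>. \<lambda>x\<in>U. germ_mult T P x (\<sigma> x) (\<tau> x),
                  one = \<lambda>x\<in>U. germ T P U \<one>\<^bsub>Sec P U\<^esub> x \<rparr>,
       Res = \<lambda>U V \<sigma>. restrict \<sigma> V \<rparr>"

text \<open>
  The map on associated sheaves induced by a presheaf map \<open>\<phi>\<close> into a presheaf \<open>Q\<close> on \<open>T'\<close>. Here
  \<open>\<phi>\<close> need only be defined over the open subsets of \<open>W\<close>; the induced map is then
  meaningful over the open subsets of \<open>W\<close>.
\<close>

definition induced_map :: "'x topology \<Rightarrow> ('x, 'b) group_presheaf \<Rightarrow> 'x set \<Rightarrow>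
    ('x set \<Rightarrow> 'a \<Rightarrow> 'b) \<Rightarrow> 'x set \<Rightarrow>
    ('x \<Rightarrow> ('x set \<times> 'a) set) \<Rightarrow> ('x \<Rightarrow> ('x set \<times> 'b) set)" where
  "induced_map T' Q W \<phi> U \<sigma> =
     (\<lambda>x\<in>U. \<Union>(V, s)\<in>{(V, s)\<in>\<sigma> x. V \<subseteq> W}. germ T' Q V (\<phi> V s) x)"


section \<open>Quotients of sheaves of groups and central filtrations\<close>

text \<open>
  Sheaves of subgroups of \<open>F\<close> are given by their sets of sections \<open>N V\<close>. The quotients are
  taken of sheaves of subgroups \<open>N \<subseteq> M\<close> of \<open>F\<close>; restriction sends a coset \<open>N(V) s\<close> to the coset
  \<open>N(W) (s|\<^sub>W)\<close>.
\<close>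

definition normal_subsheaf ::
    "'x topology \<Rightarrow> ('x, 'a) group_presheaf \<Rightarrow> ('x set \<Rightarrow> 'a set) \<Rightarrow> bool" where
  "normal_subsheaf T F N \<longleftrightarrow>
     (\<forall>V. openin T V \<longrightarrow> N V \<lhd> Sec F V) \<and> sheaf_of_sets T N (Res F)"

definition total_sections :: "('x, 'a) group_presheaf \<Rightarrow> 'x set \<Rightarrow> 'a set" where
  "total_sections F = (\<lambda>V. carrier (Sec F V))"

definition quot_presheaf :: "('x, 'a) group_presheaf \<Rightarrow> ('x set \<Rightarrow> 'a set) \<Rightarrow> ('x set \<Rightarrow> 'a set) \<Rightarrow>
    ('x, 'a set) group_presheaf" where
  "quot_presheaf F M N =
     \<lparr> Sec = \<lambda>V. ((Sec F V)\<lparr>carrier := M V\<rparr>) Mod (N V),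
       Res = \<lambda>V W c. N W <#>\<^bsub>Sec F W\<^esub> (Res F V W ` c) \<rparr>"

definition quot_sheaf :: "'x topology \<Rightarrow> ('x, 'a) group_presheaf \<Rightarrow> ('x set \<Rightarrow> 'a set) \<Rightarrow>
    ('x set \<Rightarrow> 'a set) \<Rightarrow> ('x, 'x \<Rightarrow> ('x set \<times> 'a set) set) group_presheaf" where
  "quot_sheaf T F M N = sheafify T (quot_presheaf F M N)"

text \<open>The projection \<open>M \<rightarrow> M/N\<close>, and the canonical map \<open>M/N \<rightarrow> M'/N'\<close> for \<open>M \<subseteq> M'\<close> and \<open>N \<subseteq> N'\<close>.\<close>

definition quot_proj :: "'x topology \<Rightarrow> ('x, 'a) group_presheaf \<Rightarrow> ('x set \<Rightarrow> 'a set) \<Rightarrow>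
    ('x set \<Rightarrow> 'a set) \<Rightarrow> 'x set \<Rightarrow> 'a \<Rightarrow> ('x \<Rightarrow> ('x set \<times> 'a set) set)" where
  "quot_proj T F M N U s =
     (\<lambda>x\<in>U. germ T (quot_presheaf F M N) U (N U #>\<^bsub>Sec F U\<^esub> s) x)"

definition quot_map :: "'x topology \<Rightarrow> ('x, 'a) group_presheaf \<Rightarrow> ('x set \<Rightarrow> 'a set) \<Rightarrow>
    ('x set \<Rightarrow> 'a set) \<Rightarrow> 'x set \<Rightarrow>
    ('x \<Rightarrow> ('x set \<times> 'a set) set) \<Rightarrow> ('x \<Rightarrow> ('x set \<times> 'a set) set)" where
  "quot_map T F M' N' =
     induced_map T (quot_presheaf F M' N') (topspace T) (\<lambda>V c. N' V <#>\<^bsub>Sec F V\<^esub> c)"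

definition central_filtration ::
    "'x topology \<Rightarrow> ('x, 'a) group_presheaf \<Rightarrow> (nat \<Rightarrow> 'x set \<Rightarrow> 'a set) \<Rightarrow> bool" where
  "central_filtration T F N \<longleftrightarrow>
     sheaf_of_groups T F \<and>
     (\<forall>p. normal_subsheaf T F (N p)) \<and>
     (\<forall>p V. openin T V \<longrightarrow> N (Suc p) V \<subseteq> N p V) \<and>
     (\<forall>V. openin T V \<longrightarrow> N 0 V = carrier (Sec F V)) \<and>
     (\<forall>V. openin T V \<longrightarrow> (\<Inter>p. N p V) = {\<one>\<^bsub>Sec F V\<^esub>}) \<and>
     (\<forall>p V. openin T V \<longrightarrow>
        (\<forall>\<sigma> \<in> carrier (Sec (quot_sheaf T F (N p) (N (Suc p))) V).
         \<forall>\<tau> \<in> carrier (Sec (quot_sheaf T F (total_sections F) (N (Suc p))) V).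
           quot_map T F (total_sections F) (N (Suc p)) V \<sigma>
             \<otimes>\<^bsub>Sec (quot_sheaf T F (total_sections F) (N (Suc p))) V\<^esub> \<tau> =
           \<tau> \<otimes>\<^bsub>Sec (quot_sheaf T F (total_sections F) (N (Suc p))) V\<^esub>
             quot_map T F (total_sections F) (N (Suc p)) V \<sigma>))"

text \<open>The limit of the sheaves \<open>F/N\<^sub>p\<close> is formed sectionwise.\<close>

definition limit_sheaf :: "'x topology \<Rightarrow> ('x, 'a) group_presheaf \<Rightarrow> (nat \<Rightarrow> 'x set \<Rightarrow> 'a set) \<Rightarrow>
    ('x, nat \<Rightarrow> 'x \<Rightarrow> ('x set \<times> 'a set) set) group_presheaf" where
  "limit_sheaf T F N =
     (let Q = (\<lambda>p. quot_sheaf T F (total_sections F) (N p)) in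
     \<lparr> Sec = \<lambda>U. \<lparr> carrier = {\<sigma>. (\<forall>p. \<sigma> p \<in> carrier (Sec (Q p) U)) \<and>
                       (\<forall>p q. p \<le> q \<longrightarrow> quot_map T F (total_sections F) (N p) U (\<sigma> q) = \<sigma> p)},
                  mult = \<lambda>\<sigma> \<tau> p. \<sigma> p \<otimes>\<^bsub>Sec (Q p) U\<^esub> \<tau> p,
                  one = \<lambda>p. \<one>\<^bsub>Sec (Q p) U\<^esub> \<rparr>,
       Res = \<lambda>U V \<sigma> p. Res (Q p) U V (\<sigma> p) \<rparr>)"

definition complete_filtration ::
    "'x topology \<Rightarrow> ('x, 'a) group_presheaf \<Rightarrow> (nat \<Rightarrow> 'x set \<Rightarrow> 'a set) \<Rightarrow> bool" where
  "complete_filtration T F N \<longleftrightarrow>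
     sheaf_iso T F (limit_sheaf T F N) (\<lambda>U s p. quot_proj T F (total_sections F) (N p) U s)"


section \<open>Derived functor cohomology\<close>

definition injective_sheaf :: "'x topology \<Rightarrow> ('x, 'c) group_presheaf \<Rightarrow> bool" where
  "injective_sheaf T I \<longleftrightarrow>
     abelian_sheaf T I \<and>
     (\<forall>(A :: ('x, 'c) group_presheaf) (B :: ('x, 'c) group_presheaf) \<iota> f.
        abelian_sheaf T A \<and> abelian_sheaf T B \<and> sheaf_morphism T A B \<iota> \<and>
        (\<forall>U. openin T U \<longrightarrow> inj_on (\<iota> U) (carrier (Sec A U))) \<and> sheaf_morphism T A I f \<longrightarrow>
        (\<exists>h. sheaf_morphism T B I h \<and>
           (\<forall>U. openin T U \<longrightarrow> (\<forall>s\<in>carrier (Sec A U). h U (\<iota> U s) = f U s))))"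

text \<open>Exactness of sheaves at \<open>G\<close>: the image of \<open>\<phi>\<close> is the image sheaf, so it is tested locally.\<close>

definition exact_at :: "'x topology \<Rightarrow> ('x, 'a) group_presheaf \<Rightarrow> ('x, 'b) group_presheaf \<Rightarrow>
    ('x, 'c) group_presheaf \<Rightarrow> ('x set \<Rightarrow> 'a \<Rightarrow> 'b) \<Rightarrow> ('x set \<Rightarrow> 'b \<Rightarrow> 'c) \<Rightarrow> bool" where
  "exact_at T F G H \<phi> \<psi> \<longleftrightarrow>
     (\<forall>U. openin T U \<longrightarrow>
        kernel (Sec G U) (Sec H U) (\<psi> U) =
        {s \<in> carrier (Sec G U). \<forall>x\<in>U. \<exists>V. openin T V \<and> x \<in> V \<and> V \<subseteq> U \<and>
           Res G U V s \<in> \<phi> V ` carrier (Sec F V)})"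

definition injective_resolution :: "'x topology \<Rightarrow> ('x, 'a) group_presheaf \<Rightarrow>
    ('x set \<Rightarrow> 'a \<Rightarrow> 'c) \<Rightarrow> (nat \<Rightarrow> ('x, 'c) group_presheaf) \<Rightarrow> (nat \<Rightarrow> 'x set \<Rightarrow> 'c \<Rightarrow> 'c) \<Rightarrow> bool"
  where
  "injective_resolution T F \<epsilon> I d \<longleftrightarrow>
     (\<forall>n. injective_sheaf T (I n)) \<and>
     sheaf_morphism T F (I 0) \<epsilon> \<and>
     (\<forall>n. sheaf_morphism T (I n) (I (Suc n)) (d n)) \<and>
     (\<forall>U. openin T U \<longrightarrow> inj_on (\<epsilon> U) (carrier (Sec F U))) \<and>
     exact_at T F (I 0) (I 1) \<epsilon> (d 0) \<and>
     (\<forall>n. exact_at T (I n) (I (Suc n)) (I (Suc (Suc n))) (d n) (d (Suc n)))"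

definition section_cohomology :: "(nat \<Rightarrow> ('x, 'c) group_presheaf) \<Rightarrow>
    (nat \<Rightarrow> 'x set \<Rightarrow> 'c \<Rightarrow> 'c) \<Rightarrow> 'x set \<Rightarrow> nat \<Rightarrow> 'c set monoid" where
  "section_cohomology I d U n =
     ((Sec (I n) U)\<lparr>carrier := kernel (Sec (I n) U) (Sec (I (Suc n)) U) (d n U)\<rparr>) Mod
       (case n of 0 \<Rightarrow> {\<one>\<^bsub>Sec (I 0) U\<^esub>} | Suc m \<Rightarrow> d m U ` carrier (Sec (I m) U))"

text \<open>
  Injective objects and resolutions are taken in the category of abelian sheaves on \<open>T\<close> with
  sections in the type \<open>'x \<Rightarrow> nat \<Rightarrow> 'a option\<close>, where \<open>'a\<close> is the type of sections of the
  sheaf at hand. This type is large enough for the size restriction to be immaterial: its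
  cardinality \<open>\<kappa>\<close> satisfies \<open>\<kappa> \<ge> |'a|\<close>, \<open>\<kappa> \<ge> 2^|'x|\<close>, \<open>\<kappa> \<ge> \<aleph>\<^sub>0\<close> and \<open>\<kappa>^|'x| = \<kappa>\<close>. Hence it has room for
  the sheaves \<open>\<int>\<^sub>V\<close> (\<open>V\<close> open) and their subsheaves, so that, by Baer's criterion, the injective
  objects are injective against all abelian sheaves; and every abelian sheaf with at most \<open>\<kappa>\<close>
  sections embeds into an injective one of this size (the product of the skyscraper sheaves of
  the divisible hulls of the stalks), so that injective resolutions exist.

  As a derived functor is determined only up to canonical isomorphism, we define what it
  means for a group to be a model of \<open>H\<^sup>n(U,F) = R\<^sup>n\<Gamma>(U,-)(F)\<close>: it is computed by some
  injective resolution. All models are isomorphic.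
\<close>

type_synonym ('x, 'a) resolution_type = "'x \<Rightarrow> nat \<Rightarrow> 'a option"

definition is_sheaf_cohomology :: "'x topology \<Rightarrow> 'x set \<Rightarrow> ('x, 'a) group_presheaf \<Rightarrow> nat \<Rightarrow>
    ('x, 'a) resolution_type set monoid \<Rightarrow> bool" where
  "is_sheaf_cohomology T U F n H \<longleftrightarrow>
     (\<exists>\<epsilon> I d. injective_resolution T F \<epsilon> I d \<and> H = section_cohomology I d U n)"

definition cohomology_trivial ::
    "'x topology \<Rightarrow> 'x set \<Rightarrow> ('x, 'a) group_presheaf \<Rightarrow> nat \<Rightarrow> bool" where
  "cohomology_trivial T U F n \<longleftrightarrow> (\<exists>H. is_sheaf_cohomology T U F n H \<and> trivial_group H)"

definition acyclic_wrt_filtration ::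
    "'x topology \<Rightarrow> ('x, 'a) group_presheaf \<Rightarrow> (nat \<Rightarrow> 'x set \<Rightarrow> 'a set) \<Rightarrow> 'x set \<Rightarrow> bool" where
  "acyclic_wrt_filtration T F N U \<longleftrightarrow>
     (\<forall>p n. n > 0 \<longrightarrow> cohomology_trivial T U (quot_sheaf T F (N p) (N (Suc p))) n) \<and>
     (\<forall>p q. p \<le> q \<longrightarrow>
        quot_proj T F (N p) (N q) U ` N p U = carrier (Sec (quot_sheaf T F (N p) (N q)) U))"


section \<open>Prestacks, stacks and gerbes\<close>

locale groupoid =
  fixes Ob :: "'o set" and Mor :: "'o \<Rightarrow> 'o \<Rightarrow> 'm set"
    and Id :: "'o \<Rightarrow> 'm" and Comp :: "'m \<Rightarrow> 'm \<Rightarrow> 'm"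
  assumes id_mor: "i \<in> Ob \<Longrightarrow> Id i \<in> Mor i i"
    and comp_mor: "\<lbrakk>i \<in> Ob; j \<in> Ob; k \<in> Ob; f \<in> Mor i j; g \<in> Mor j k\<rbrakk> \<Longrightarrow> Comp g f \<in> Mor i k"
    and comp_id: "\<lbrakk>i \<in> Ob; j \<in> Ob; f \<in> Mor i j\<rbrakk> \<Longrightarrow> Comp f (Id i) = f"
    and id_comp: "\<lbrakk>i \<in> Ob; j \<in> Ob; f \<in> Mor i j\<rbrakk> \<Longrightarrow> Comp (Id j) f = f"
    and comp_assoc: "\<lbrakk>i \<in> Ob; j \<in> Ob; k \<in> Ob; l \<in> Ob; f \<in> Mor i j; g \<in> Mor j k; h \<in> Mor k l\<rbrakk>
          \<Longrightarrow> Comp h (Comp g f) = Comp (Comp h g) f"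
    and inverse_ex: "\<lbrakk>i \<in> Ob; j \<in> Ob; f \<in> Mor i j\<rbrakk>
          \<Longrightarrow> \<exists>h\<in>Mor j i. Comp h f = Id i \<and> Comp f h = Id j"

text \<open>
  Data of a pseudofunctor on the open sets. \<open>Cmp G U g f\<close> is \<open>g \<circ> f\<close>; for \<open>W \<subseteq> V \<subseteq> U\<close> and \<open>i\<close> over \<open>U\<close>,
  \<open>RObj G U V i\<close> is \<open>i|\<^sub>V\<close>, \<open>Coh G U V W i : (i|\<^sub>V)|\<^sub>W \<rightarrow> i|\<^sub>W\<close> is the coherence isomorphism for
  composition and \<open>Unt G U i : i|\<^sub>U \<rightarrow> i\<close> the one for the identity. Composition and
  restriction of morphisms do not carry the objects as arguments, and the sets of morphisms
  are not required to be disjoint.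
\<close>

record ('x, 'o, 'm) prestack_data =
  Obj :: "'x set \<Rightarrow> 'o set"
  Hom :: "'x set \<Rightarrow> 'o \<Rightarrow> 'o \<Rightarrow> 'm set"
  Idn :: "'x set \<Rightarrow> 'o \<Rightarrow> 'm"
  Cmp :: "'x set \<Rightarrow> 'm \<Rightarrow> 'm \<Rightarrow> 'm"
  RObj :: "'x set \<Rightarrow> 'x set \<Rightarrow> 'o \<Rightarrow> 'o"
  RHom :: "'x set \<Rightarrow> 'x set \<Rightarrow> 'm \<Rightarrow> 'm"
  Coh :: "'x set \<Rightarrow> 'x set \<Rightarrow> 'x set \<Rightarrow> 'o \<Rightarrow> 'm"
  Unt :: "'x set \<Rightarrow> 'o \<Rightarrow> 'm"

locale prestack_of_groupoids =
  fixes X :: "'x topology" and G :: "('x, 'o, 'm) prestack_data"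
  assumes groupoids: "openin X U \<Longrightarrow> groupoid (Obj G U) (Hom G U) (Idn G U) (Cmp G U)"
    and robj: "\<lbrakk>openin X U; openin X V; V \<subseteq> U; i \<in> Obj G U\<rbrakk> \<Longrightarrow> RObj G U V i \<in> Obj G V"
    and rhom: "\<lbrakk>openin X U; openin X V; V \<subseteq> U; i \<in> Obj G U; j \<in> Obj G U; f \<in> Hom G U i j\<rbrakk>
          \<Longrightarrow> RHom G U V f \<in> Hom G V (RObj G U V i) (RObj G U V j)"
    and rhom_id: "\<lbrakk>openin X U; openin X V; V \<subseteq> U; i \<in> Obj G U\<rbrakk>
          \<Longrightarrow> RHom G U V (Idn G U i) = Idn G V (RObj G U V i)"
    and rhom_comp: "\<lbrakk>openin X U; openin X V; V \<subseteq> U; i \<in> Obj G U; j \<in> Obj G U; k \<in> Obj G U;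
            f \<in> Hom G U i j; g \<in> Hom G U j k\<rbrakk>
          \<Longrightarrow> RHom G U V (Cmp G U g f) = Cmp G V (RHom G U V g) (RHom G U V f)"
    and coh: "\<lbrakk>openin X U; openin X V; openin X W; V \<subseteq> U; W \<subseteq> V; i \<in> Obj G U\<rbrakk>
          \<Longrightarrow> Coh G U V W i \<in> Hom G W (RObj G V W (RObj G U V i)) (RObj G U W i)"
    and coh_natural: "\<lbrakk>openin X U; openin X V; openin X W; V \<subseteq> U; W \<subseteq> V;
            i \<in> Obj G U; j \<in> Obj G U; f \<in> Hom G U i j\<rbrakk>
          \<Longrightarrow> Cmp G W (Coh G U V W j) (RHom G V W (RHom G U V f)) =
              Cmp G W (RHom G U W f) (Coh G U V W i)"
    and unt: "\<lbrakk>openin X U; i \<in> Obj G U\<rbrakk> \<Longrightarrow> Unt G U i \<in> Hom G U (RObj G U U i) i"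
    and unt_natural: "\<lbrakk>openin X U; i \<in> Obj G U; j \<in> Obj G U; f \<in> Hom G U i j\<rbrakk>
          \<Longrightarrow> Cmp G U (Unt G U j) (RHom G U U f) = Cmp G U f (Unt G U i)"
    and coh_assoc: "\<lbrakk>openin X U; openin X V; openin X W; openin X Z; V \<subseteq> U; W \<subseteq> V; Z \<subseteq> W;
            i \<in> Obj G U\<rbrakk>
          \<Longrightarrow> Cmp G Z (Coh G U W Z i) (RHom G W Z (Coh G U V W i)) =
              Cmp G Z (Coh G U V Z i) (Coh G V W Z (RObj G U V i))"
    and coh_unt_left: "\<lbrakk>openin X U; openin X V; V \<subseteq> U; i \<in> Obj G U\<rbrakk>
          \<Longrightarrow> Coh G U U V i = RHom G U V (Unt G U i)"
    and coh_unt_right: "\<lbrakk>openin X U; openin X V; V \<subseteq> U; i \<in> Obj G U\<rbrakk>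
          \<Longrightarrow> Coh G U V V i = Unt G V (RObj G U V i)"

definition Inv :: "('x, 'o, 'm) prestack_data \<Rightarrow> 'x set \<Rightarrow> 'o \<Rightarrow> 'o \<Rightarrow> 'm \<Rightarrow> 'm" where
  "Inv G U i j f =
     (THE h. h \<in> Hom G U j i \<and> Cmp G U h f = Idn G U i \<and> Cmp G U f h = Idn G U j)"

definition Ad :: "('x, 'o, 'm) prestack_data \<Rightarrow> 'x set \<Rightarrow> 'o \<Rightarrow> 'o \<Rightarrow> 'm \<Rightarrow> 'm \<Rightarrow> 'm" where
  "Ad G U i j g f = Cmp G U g (Cmp G U f (Inv G U i j g))"

text \<open>
  For \<open>i\<close> over \<open>U\<^sub>1\<close> and \<open>j\<close> over \<open>U\<^sub>2\<close>, the presheaf \<open>G(i,j)\<close> on \<open>U\<^sub>1 \<inter> U\<^sub>2\<close>. Its restriction maps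
  involve the coherence isomorphisms.
\<close>

definition hom_sec :: "('x, 'o, 'm) prestack_data \<Rightarrow> 'x set \<Rightarrow> 'o \<Rightarrow> 'x set \<Rightarrow> 'o \<Rightarrow> 'x set \<Rightarrow> 'm set"
  where
  "hom_sec G U1 i U2 j V = Hom G V (RObj G U1 V i) (RObj G U2 V j)"

definition hom_res :: "('x, 'o, 'm) prestack_data \<Rightarrow> 'x set \<Rightarrow> 'o \<Rightarrow> 'x set \<Rightarrow> 'o \<Rightarrow>
    'x set \<Rightarrow> 'x set \<Rightarrow> 'm \<Rightarrow> 'm" where
  "hom_res G U1 i U2 j V W f =
     Cmp G W (Coh G U2 V W j)
       (Cmp G W (RHom G V W f)
         (Inv G W (RObj G V W (RObj G U1 V i)) (RObj G U1 W i) (Coh G U1 V W i)))"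

text \<open>
  Effectiveness of a descent datum \<open>(i\<^sub>V, g\<^sub>V\<^sub>W : i\<^sub>V \<rightarrow> i\<^sub>W over V \<inter> W)\<close> on a covering \<open>\<U>\<close> of \<open>U\<close>: there are
  an object \<open>k\<close> over \<open>U\<close> and isomorphisms \<open>\<phi>\<^sub>V : k|\<^sub>V \<rightarrow> i\<^sub>V\<close> with \<open>g\<^sub>V\<^sub>W \<circ> \<phi>\<^sub>V = \<phi>\<^sub>W\<close> over \<open>V \<inter> W\<close>.
\<close>

definition descent_datum :: "('x, 'o, 'm) prestack_data \<Rightarrow> 'x set set \<Rightarrow>
    ('x set \<Rightarrow> 'o) \<Rightarrow> ('x set \<Rightarrow> 'x set \<Rightarrow> 'm) \<Rightarrow> bool" where
  "descent_datum G \<U> i g \<longleftrightarrow>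
     (\<forall>V\<in>\<U>. i V \<in> Obj G V) \<and>
     (\<forall>V\<in>\<U>. \<forall>W\<in>\<U>. g V W \<in> hom_sec G V (i V) W (i W) (V \<inter> W)) \<and>
     (\<forall>V\<in>\<U>. \<forall>W\<in>\<U>. \<forall>Z\<in>\<U>.
        Cmp G (V \<inter> W \<inter> Z)
          (hom_res G W (i W) Z (i Z) (W \<inter> Z) (V \<inter> W \<inter> Z) (g W Z))
          (hom_res G V (i V) W (i W) (V \<inter> W) (V \<inter> W \<inter> Z) (g V W)) =
        hom_res G V (i V) Z (i Z) (V \<inter> Z) (V \<inter> W \<inter> Z) (g V Z))"

definition effective_descent_datum :: "('x, 'o, 'm) prestack_data \<Rightarrow> 'x set \<Rightarrow> 'x set set \<Rightarrow>
    ('x set \<Rightarrow> 'o) \<Rightarrow> ('x set \<Rightarrow> 'x set \<Rightarrow> 'm) \<Rightarrow> bool" where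
  "effective_descent_datum G U \<U> i g \<longleftrightarrow>
     (\<exists>k\<in>Obj G U. \<exists>\<phi>.
        (\<forall>V\<in>\<U>. \<phi> V \<in> Hom G V (RObj G U V k) (i V)) \<and>
        (\<forall>V\<in>\<U>. \<forall>W\<in>\<U>.
           let r = (\<lambda>V'. Cmp G (V \<inter> W) (RHom G V' (V \<inter> W) (\<phi> V'))
                     (Inv G (V \<inter> W) (RObj G V' (V \<inter> W) (RObj G U V' k)) (RObj G U (V \<inter> W) k)
                       (Coh G U V' (V \<inter> W) k)))
           in Cmp G (V \<inter> W) (g V W) (r V) = r W))"

definition stack_of_groupoids :: "'x topology \<Rightarrow> ('x, 'o, 'm) prestack_data \<Rightarrow> bool" where
  "stack_of_groupoids X G \<longleftrightarrow>
     prestack_of_groupoids X G \<and>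
     (\<forall>U. openin X U \<longrightarrow> (\<forall>i\<in>Obj G U. \<forall>j\<in>Obj G U.
        sheaf_of_sets (subtopology X U) (hom_sec G U i U j) (hom_res G U i U j))) \<and>
     (\<forall>U \<U> i g. openin X U \<and> open_cover X U \<U> \<and> descent_datum G \<U> i g \<longrightarrow>
        effective_descent_datum G U \<U> i g)"

definition gerbe :: "'x topology \<Rightarrow> ('x, 'o, 'm) prestack_data \<Rightarrow> bool" where
  "gerbe X G \<longleftrightarrow>
     stack_of_groupoids X G \<and>
     (\<forall>x\<in>topspace X. \<exists>U. openin X U \<and> x \<in> U \<and> Obj G U \<noteq> {}) \<and>
     (\<forall>U. openin X U \<longrightarrow> (\<forall>i\<in>Obj G U. \<forall>j\<in>Obj G U. \<forall>x\<in>U.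
        \<exists>V. openin X V \<and> x \<in> V \<and> V \<subseteq> U \<and> Hom G V (RObj G U V i) (RObj G U V j) \<noteq> {}))"

definition connected_groupoid :: "'o set \<Rightarrow> ('o \<Rightarrow> 'o \<Rightarrow> 'm set) \<Rightarrow> bool" where
  "connected_groupoid Ob Mor \<longleftrightarrow> (\<forall>i\<in>Ob. \<forall>j\<in>Ob. Mor i j \<noteq> {})"


section \<open>Normal subgroupoids and central filtrations of gerbes\<close>

definition aut_group :: "('x, 'o, 'm) prestack_data \<Rightarrow> 'x set \<Rightarrow> 'o \<Rightarrow> 'm monoid" where
  "aut_group G U i = \<lparr> carrier = Hom G U i i, mult = Cmp G U, one = Idn G U i \<rparr>"

text \<open>The sheaf of groups \<open>G(i,i)\<close> on \<open>U\<close>, and the sections of its subsheaf \<open>N(i,i)\<close>.\<close>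

definition aut_sheaf :: "('x, 'o, 'm) prestack_data \<Rightarrow> 'x set \<Rightarrow> 'o \<Rightarrow> ('x, 'm) group_presheaf" where
  "aut_sheaf G U i =
     \<lparr> Sec = \<lambda>V. aut_group G V (RObj G U V i), Res = hom_res G U i U i \<rparr>"

definition sub_sec :: "('x, 'o, 'm) prestack_data \<Rightarrow> ('x set \<Rightarrow> 'o \<Rightarrow> 'm set) \<Rightarrow>
    'x set \<Rightarrow> 'o \<Rightarrow> 'x set \<Rightarrow> 'm set" where
  "sub_sec G N U i = (\<lambda>V. N V (RObj G U V i))"

definition normal_subgroupoid ::
    "'x topology \<Rightarrow> ('x, 'o, 'm) prestack_data \<Rightarrow> ('x set \<Rightarrow> 'o \<Rightarrow> 'm set) \<Rightarrow> bool" where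
  "normal_subgroupoid X G N \<longleftrightarrow>
     (\<forall>U. openin X U \<longrightarrow> (\<forall>i\<in>Obj G U. subgroup (N U i) (aut_group G U i))) \<and>
     (\<forall>U. openin X U \<longrightarrow> (\<forall>i\<in>Obj G U. \<forall>j\<in>Obj G U. \<forall>g\<in>Hom G U i j.
        Ad G U i j g ` N U i = N U j)) \<and>
     (\<forall>U. openin X U \<longrightarrow> (\<forall>i\<in>Obj G U.
        sheaf_of_sets (subtopology X U) (sub_sec G N U i) (hom_res G U i U i)))"

definition gerbe_central_filtration ::
    "'x topology \<Rightarrow> ('x, 'o, 'm) prestack_data \<Rightarrow> (nat \<Rightarrow> 'x set \<Rightarrow> 'o \<Rightarrow> 'm set) \<Rightarrow> bool" where
  "gerbe_central_filtration X G N \<longleftrightarrow>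
     (\<forall>p. normal_subgroupoid X G (N p)) \<and>
     (\<forall>p U. openin X U \<longrightarrow> (\<forall>i\<in>Obj G U. N (Suc p) U i \<subseteq> N p U i)) \<and>
     (\<forall>U. openin X U \<longrightarrow> (\<forall>i\<in>Obj G U.
        central_filtration (subtopology X U) (aut_sheaf G U i) (\<lambda>p. sub_sec G (N p) U i)))"

definition gerbe_complete ::
    "'x topology \<Rightarrow> ('x, 'o, 'm) prestack_data \<Rightarrow> (nat \<Rightarrow> 'x set \<Rightarrow> 'o \<Rightarrow> 'm set) \<Rightarrow> bool" where
  "gerbe_complete X G N \<longleftrightarrow>
     (\<forall>U. openin X U \<longrightarrow> (\<forall>i\<in>Obj G U.
        complete_filtration (subtopology X U) (aut_sheaf G U i) (\<lambda>p. sub_sec G (N p) U i)))"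

text \<open>The sheaf \<open>M(i,i)/N(i,i)\<close> on \<open>U\<close>, for an object \<open>i\<close> over \<open>U\<close>.\<close>

definition local_quot :: "'x topology \<Rightarrow> ('x, 'o, 'm) prestack_data \<Rightarrow>
    ('x set \<Rightarrow> 'o \<Rightarrow> 'm set) \<Rightarrow> ('x set \<Rightarrow> 'o \<Rightarrow> 'm set) \<Rightarrow> 'x set \<Rightarrow> 'o \<Rightarrow>
    ('x, 'x \<Rightarrow> ('x set \<times> 'm set) set) group_presheaf" where
  "local_quot X G M N U i =
     quot_sheaf (subtopology X U) (aut_sheaf G U i) (sub_sec G M U i) (sub_sec G N U i)"

text \<open>
  For \<open>i\<close> over \<open>U\<^sub>1\<close>, \<open>j\<close> over \<open>U\<^sub>2\<close> and \<open>g : i \<rightarrow> j\<close> over \<open>W \<subseteq> U\<^sub>1 \<inter> U\<^sub>2\<close>, the map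
  \<open>Ad(g) : (M(i,i)/N(i,i))|\<^sub>W \<rightarrow> (M(j,j)/N(j,j))|\<^sub>W\<close> on sections over an open subset of \<open>W\<close>.
\<close>

definition quot_Ad :: "'x topology \<Rightarrow> ('x, 'o, 'm) prestack_data \<Rightarrow>
    ('x set \<Rightarrow> 'o \<Rightarrow> 'm set) \<Rightarrow> ('x set \<Rightarrow> 'o \<Rightarrow> 'm set) \<Rightarrow>
    'x set \<Rightarrow> 'o \<Rightarrow> 'x set \<Rightarrow> 'o \<Rightarrow> 'x set \<Rightarrow> 'm \<Rightarrow> 'x set \<Rightarrow>
    ('x \<Rightarrow> ('x set \<times> 'm set) set) \<Rightarrow> ('x \<Rightarrow> ('x set \<times> 'm set) set)" where
  "quot_Ad X G M N U1 i U2 j W g =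
     induced_map (subtopology X U2)
       (quot_presheaf (aut_sheaf G U2 j) (sub_sec G M U2 j) (sub_sec G N U2 j)) W
       (\<lambda>V c. Ad G V (RObj G U1 V i) (RObj G U2 V j) (hom_res G U1 i U2 j W V g) ` c)"

text \<open>
  \<open>A\<close>, together with the isomorphisms \<open>\<chi>\<^sub>i\<close>, is the sheaf \<open>M/N\<close> on \<open>X\<close>. The compatibility for
  \<open>g = id\<close> includes that the \<open>\<chi>\<^sub>i\<close> are compatible with restriction of \<open>i\<close>.
\<close>

definition is_gerbe_quotient :: "'x topology \<Rightarrow> ('x, 'o, 'm) prestack_data \<Rightarrow>
    ('x set \<Rightarrow> 'o \<Rightarrow> 'm set) \<Rightarrow> ('x set \<Rightarrow> 'o \<Rightarrow> 'm set) \<Rightarrow> ('x, 'b) group_presheaf \<Rightarrow>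
    ('x set \<Rightarrow> 'o \<Rightarrow> 'x set \<Rightarrow> 'b \<Rightarrow> 'x \<Rightarrow> ('x set \<times> 'm set) set) \<Rightarrow> bool" where
  "is_gerbe_quotient X G M N A \<chi> \<longleftrightarrow>
     abelian_sheaf X A \<and>
     (\<forall>U. openin X U \<longrightarrow> (\<forall>i\<in>Obj G U.
        sheaf_iso (subtopology X U) A (local_quot X G M N U i) (\<chi> U i))) \<and>
     (\<forall>U1 U2 W V. openin X U1 \<and> openin X U2 \<and> openin X W \<and> openin X V \<and> W \<subseteq> U1 \<inter> U2 \<and> V \<subseteq> W \<longrightarrow>
        (\<forall>i\<in>Obj G U1. \<forall>j\<in>Obj G U2. \<forall>g\<in>hom_sec G U1 i U2 j W. \<forall>a\<in>carrier (Sec A V).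
           quot_Ad X G M N U1 i U2 j W g V (\<chi> U1 i V a) = \<chi> U2 j V a))"


section \<open>Acyclic coverings\<close>

definition gerbe_acyclic_open :: "'x topology \<Rightarrow> ('x, 'o, 'm) prestack_data \<Rightarrow>
    (nat \<Rightarrow> 'x set \<Rightarrow> 'o \<Rightarrow> 'm set) \<Rightarrow> 'x set \<Rightarrow> bool" where
  "gerbe_acyclic_open X G N U \<longleftrightarrow>
     openin X U \<and> Obj G U \<noteq> {} \<and>
     (\<forall>i\<in>Obj G U.
        acyclic_wrt_filtration (subtopology X U) (aut_sheaf G U i) (\<lambda>p. sub_sec G (N p) U i) U)"

definition gerbe_acyclic_collection :: "'x topology \<Rightarrow> ('x, 'o, 'm) prestack_data \<Rightarrow>
    (nat \<Rightarrow> 'x set \<Rightarrow> 'o \<Rightarrow> 'm set) \<Rightarrow> 'x set set \<Rightarrow> bool" where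
  "gerbe_acyclic_collection X G N \<U> \<longleftrightarrow>
     (\<forall>\<F>\<subseteq>\<U>. finite \<F> \<and> \<F> \<noteq> {} \<longrightarrow> gerbe_acyclic_open X G N (\<Inter>\<F>))"

definition enough_acyclic_coverings :: "'x topology \<Rightarrow> ('x, 'o, 'm) prestack_data \<Rightarrow>
    (nat \<Rightarrow> 'x set \<Rightarrow> 'o \<Rightarrow> 'm set) \<Rightarrow> bool" where
  "enough_acyclic_coverings X G N \<longleftrightarrow>
     (\<forall>U \<U>. openin X U \<and> open_cover X U \<U> \<longrightarrow>
        (\<exists>\<V>. open_cover X U \<V> \<and> (\<forall>V\<in>\<V>. \<exists>W\<in>\<U>. V \<subseteq> W) \<and> gerbe_acyclic_collection X G N \<V>))"

end

theory Submission
  imports Defs "HOL-Algebra.Product_Groups" "HOL-Algebra.Weak_Morphisms"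
begin

text \<open>
  An injective sheaf is a retract of the product of its stalks, hence its Cech cocycles bound on every
  covering. Therefore \<open>H\<^sup>1(U,F) = 0\<close> makes all Cech 1-cocycles of \<open>F\<close> on \<open>U\<close> bound, and \<open>H\<^sup>2(U,F) = 0\<close>
  makes those Cech 2-cocycles bound whose covering has members with vanishing \<open>H\<^sup>1\<close>.

  Two objects \<open>i, j\<close> over \<open>U\<close> are locally isomorphic. If local isomorphisms agree modulo \<open>N\<^sub>p\<close> on
  overlaps, their differences form a 1-cocycle in \<open>N\<^sub>p/N\<^sub>p\<^sub>+\<^sub>1\<close>; bounding it locally by elements of \<open>N\<^sub>p\<close>
  corrects them to agree modulo \<open>N\<^sub>p\<^sub>+\<^sub>1\<close>. Completeness provides the limit, which glues to a global
  isomorphism. In particular any two objects over an acyclic open set are isomorphic. For an acyclic covering of \<open>U\<close> this yields objects \<open>a\<^sub>k\<close> and isomorphisms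
  \<open>g\<^sub>k\<^sub>l : a\<^sub>k \<rightarrow> a\<^sub>l\<close> on the overlaps. If \<open>g\<^sub>k\<^sub>m\<inverse> g\<^sub>l\<^sub>m g\<^sub>k\<^sub>l\<close> lies in \<open>N\<^sub>p\<close>, its classes form a 2-cocycle in
  \<open>N\<^sub>p/N\<^sub>p\<^sub>+\<^sub>1\<close>; acyclicity lifts a bounding 1-cochain to \<open>N\<^sub>p\<close>, and correcting by it moves the defect
  into \<open>N\<^sub>p\<^sub>+\<^sub>1\<close>. The limit is a descent datum, and its descent is an object over \<open>U\<close>.
\<close>

section \<open>Presheaves of groups and their stalks\<close>

text \<open>The two halves treat coverings differently. In the H^1 argument a bounding cochain lifts
  to \<open>N\<^sub>p\<close> only near each point, so the neighbourhoods shrink at every step and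
  no common domain need survive. What saves the limit is that completeness concerns sections of
  sheaf quotients: measured against one arrow of the first step, the shrinking families glue, for
  each p, to sections of \<open>G(a,a)/N\<^sub>p\<close> over the whole domain of that arrow. In the
  H^2 argument the covering carries the chosen objects and stays fixed, hence lifts must exist over
  entire double overlaps.

  The groups are not commutative, yet the Cech calculus is: classes are taken in one sheaf of
  abelian groups on which conjugation by arbitrary arrows acts trivially, so that loops at different
  objects can be compared.

  Vanishing of cohomology provides some injective resolution, and this one is used directly. Its
  members are injective only against sheaves with sections in one fixed type, so a Godement sheaf
  must first be coded into that type.\<close>

locale presheaf_of_groups =
  fixes T :: "'x topology" and P :: "('x, 'a) group_presheaf"
  assumes group_Sec: "openin T U \<Longrightarrow> group (Sec P U)"
    and Res_hom: "\<lbrakk>openin T U; openin T V; V \<subseteq> U\<rbrakk> \<Longrightarrow> Res P U V \<in> hom (Sec P U) (Sec P V)"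
    and Res_self: "\<lbrakk>openin T U; s \<in> carrier (Sec P U)\<rbrakk> \<Longrightarrow> Res P U U s = s"
    and Res_Res: "\<lbrakk>openin T U; openin T V; openin T W; V \<subseteq> U; W \<subseteq> V; s \<in> carrier (Sec P U)\<rbrakk>
      \<Longrightarrow> Res P V W (Res P U V s) = Res P U W s"
begin

lemma Res_closed:
  "\<lbrakk>openin T U; openin T V; V \<subseteq> U; s \<in> carrier (Sec P U)\<rbrakk> \<Longrightarrow> Res P U V s \<in> carrier (Sec P V)"
  using Res_hom by (rule hom_in_carrier)

lemma Res_mult:
  "\<lbrakk>openin T U; openin T V; V \<subseteq> U; s \<in> carrier (Sec P U); t \<in> carrier (Sec P U)\<rbrakk>
    \<Longrightarrow> Res P U V (s \<otimes>\<^bsub>Sec P U\<^esub> t) = Res P U V s \<otimes>\<^bsub>Sec P V\<^esub> Res P U V t"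
  using Res_hom by (rule hom_mult)

lemma Res_one: "\<lbrakk>openin T U; openin T V; V \<subseteq> U\<rbrakk> \<Longrightarrow> Res P U V \<one>\<^bsub>Sec P U\<^esub> = \<one>\<^bsub>Sec P V\<^esub>"
  using Res_hom group_Sec by (meson hom_one)

lemma Res_inv:
  assumes "openin T U" "openin T V" "V \<subseteq> U" "s \<in> carrier (Sec P U)"
  shows "Res P U V (inv\<^bsub>Sec P U\<^esub> s) = inv\<^bsub>Sec P V\<^esub> (Res P U V s)"
  using assms Res_hom group_Sec by (simp add: group_hom.hom_inv group_hom.intro group_hom_axioms.intro)

lemma mem_germ_iff:
  "(V, t) \<in> germ T P U s x \<longleftrightarrow> openin T V \<and> x \<in> V \<and> t \<in> carrier (Sec P V) \<and>
    (\<exists>W. openin T W \<and> x \<in> W \<and> W \<subseteq> U \<inter> V \<and> Res P U W s = Res P V W t)"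
  unfolding germ_def by simp

lemma germ_self_mem:
  "\<lbrakk>openin T U; x \<in> U; s \<in> carrier (Sec P U)\<rbrakk> \<Longrightarrow> (U, s) \<in> germ T P U s x"
  unfolding germ_def by auto

lemma germ_eqI:
  assumes "openin T U" "openin T V" "openin T W" "x \<in> W" "W \<subseteq> U \<inter> V"
    and st: "s \<in> carrier (Sec P U)" "t \<in> carrier (Sec P V)" "Res P U W s = Res P V W t"
  shows "germ T P U s x = germ T P V t x"
proof -
  \<comment> \<open>Both inclusions are instances of this one, with the two sections
    exchanged.\<close>
  have sub: "germ T P U s x \<subseteq> germ T P V t x"
    if "openin T U" "openin T V" "W \<subseteq> U \<inter> V"
      "s \<in> carrier (Sec P U)" "t \<in> carrier (Sec P V)" "Res P U W s = Res P V W t" for U V s t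
  proof (clarify, goal_cases)
    case (1 Z z)
    then obtain Y where Z: "openin T Z" "x \<in> Z" "z \<in> carrier (Sec P Z)"
      and Y: "openin T Y" "x \<in> Y" "Y \<subseteq> U \<inter> Z" "Res P U Y s = Res P Z Y z"
      unfolding germ_def by auto
    have o: "openin T (W \<inter> Y)" using assms Y by auto
    have "Res P V (W \<inter> Y) t = Res P W (W \<inter> Y) (Res P V W t)"
      using Res_Res[of V W "W \<inter> Y" t] that o assms(3) by auto
    also have "\<dots> = Res P U (W \<inter> Y) s"
      using Res_Res[of U W "W \<inter> Y" s] that o assms(3) by auto
    also have "\<dots> = Res P Y (W \<inter> Y) (Res P U Y s)"
      using Res_Res[of U Y "W \<inter> Y" s] that o Y by auto
    also have "\<dots> = Res P Z (W \<inter> Y) z"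
      using Res_Res[of Z Y "W \<inter> Y" z] that o Y Z by auto
    finally show ?case
      unfolding germ_def using Z o Y assms that by (auto intro!: exI[of _ "W \<inter> Y"])
  qed
  show ?thesis
    using sub[of U V s t] sub[of V U t s] assms by auto
qed

lemma germ_eqD:
  assumes "germ T P U s x = germ T P V t x" "openin T V" "x \<in> V" "t \<in> carrier (Sec P V)"
  obtains W where "openin T W" "x \<in> W" "W \<subseteq> U \<inter> V" "Res P U W s = Res P V W t"
proof -
  have "(V, t) \<in> germ T P U s x" using germ_self_mem[OF assms(2-4)] assms(1) by simp
  then show thesis using that unfolding mem_germ_iff by blast
qed

lemma germ_Res:
  "\<lbrakk>openin T U; openin T V; V \<subseteq> U; x \<in> V; s \<in> carrier (Sec P U)\<rbrakk>
    \<Longrightarrow> germ T P V (Res P U V s) x = germ T P U s x"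
  by (rule germ_eqI[of _ _ V]) (auto intro: Res_closed Res_self)

lemma germ_memD:
  assumes "(V, t) \<in> germ T P U s x" "openin T U" "s \<in> carrier (Sec P U)"
  shows "openin T V" "x \<in> V" "t \<in> carrier (Sec P V)" "germ T P V t x = germ T P U s x"
proof -
  show 1: "openin T V" "x \<in> V" "t \<in> carrier (Sec P V)"
    using assms(1) unfolding germ_def by auto
  obtain W where "openin T W" "x \<in> W" "W \<subseteq> U \<inter> V" "Res P U W s = Res P V W t"
    using assms(1) unfolding germ_def by auto
  then show "germ T P V t x = germ T P U s x"
    by (intro germ_eqI[of V U W]) (use 1 assms in auto)
qed

text \<open>\<open>germ_mult\<close> is a union over all pairs of representatives. Every pair turns
  out to contribute the same germ, and as germs are inhabited the union equals that germ.\<close>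

lemma germ_mult_germ:
  assumes U: "openin T U" "x \<in> U" and s: "s \<in> carrier (Sec P U)" and t: "t \<in> carrier (Sec P U)"
  shows "germ_mult T P x (germ T P U s x) (germ T P U t x) = germ T P U (s \<otimes>\<^bsub>Sec P U\<^esub> t) x"
proof -
  have *: "germ T P (V \<inter> W) (Res P V (V \<inter> W) s' \<otimes>\<^bsub>Sec P (V \<inter> W)\<^esub> Res P W (V \<inter> W) t') x
      = germ T P U (s \<otimes>\<^bsub>Sec P U\<^esub> t) x"
    if ge: "(V, s') \<in> germ T P U s x" "(W, t') \<in> germ T P U t x" for V s' W t'
  proof -
    obtain Y where V: "openin T V" "x \<in> V" "s' \<in> carrier (Sec P V)"
      and Y: "openin T Y" "x \<in> Y" "Y \<subseteq> U \<inter> V" "Res P U Y s = Res P V Y s'"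
      using ge(1) unfolding mem_germ_iff by blast
    obtain Z where W: "openin T W" "x \<in> W" "t' \<in> carrier (Sec P W)"
      and Z: "openin T Z" "x \<in> Z" "Z \<subseteq> U \<inter> W" "Res P U Z t = Res P W Z t'"
      using ge(2) unfolding mem_germ_iff by blast
    let ?Q = "Y \<inter> Z"
    have o: "openin T ?Q" "openin T (V \<inter> W)" using Y Z V W by auto
    have g: "group (Sec P U)" "group (Sec P (V \<inter> W))" using group_Sec U o by auto
    have s': "Res P U ?Q s = Res P V ?Q s'"
      using Res_Res[of U Y ?Q s] Res_Res[of V Y ?Q s'] Y V U s o by auto
    have t': "Res P U ?Q t = Res P W ?Q t'"
      using Res_Res[of U Z ?Q t] Res_Res[of W Z ?Q t'] Z W U t o by auto
    have c: "Res P V (V \<inter> W) s' \<in> carrier (Sec P (V \<inter> W))"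
      "Res P W (V \<inter> W) t' \<in> carrier (Sec P (V \<inter> W))"
      using V W o by (auto intro!: Res_closed)
    have "Res P (V \<inter> W) ?Q (Res P V (V \<inter> W) s' \<otimes>\<^bsub>Sec P (V \<inter> W)\<^esub> Res P W (V \<inter> W) t')
      = Res P V ?Q s' \<otimes>\<^bsub>Sec P ?Q\<^esub> Res P W ?Q t'"
      using Res_mult[of "V \<inter> W" ?Q, OF _ _ _ c] Res_Res[of V "V \<inter> W" ?Q s']
        Res_Res[of W "V \<inter> W" ?Q t'] V W Y Z o by (simp add: subset_iff)
    also have "\<dots> = Res P U ?Q (s \<otimes>\<^bsub>Sec P U\<^esub> t)"
      using Res_mult[of U ?Q, OF _ _ _ s t] U(1) o(1) Y(3) s' t' by (simp add: le_infI1)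
    finally show ?thesis
      by (intro germ_eqI[of _ _ ?Q])
        (use o U Y Z c s t g in \<open>auto intro: monoid.m_closed group.is_monoid\<close>)
  qed
  show ?thesis
  proof (intro equalityI subsetI)
    fix z assume "z \<in> germ_mult T P x (germ T P U s x) (germ T P U t x)"
    then obtain V s' W t' where m: "(V, s') \<in> germ T P U s x" "(W, t') \<in> germ T P U t x"
      and "z \<in> germ T P (V \<inter> W)
        (Res P V (V \<inter> W) s' \<otimes>\<^bsub>Sec P (V \<inter> W)\<^esub> Res P W (V \<inter> W) t') x"
      unfolding germ_mult_def by blast
    with *[OF m] show "z \<in> germ T P U (s \<otimes>\<^bsub>Sec P U\<^esub> t) x" by simp
  next
    fix z assume "z \<in> germ T P U (s \<otimes>\<^bsub>Sec P U\<^esub> t) x"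
    with *[OF germ_self_mem[OF U s] germ_self_mem[OF U t]]
    have "z \<in> germ T P (U \<inter> U)
        (Res P U (U \<inter> U) s \<otimes>\<^bsub>Sec P (U \<inter> U)\<^esub> Res P U (U \<inter> U) t) x" by simp
    then show "z \<in> germ_mult T P x (germ T P U s x) (germ T P U t x)"
      unfolding germ_mult_def using germ_self_mem[OF U s] germ_self_mem[OF U t] by blast
  qed
qed

end

text \<open>A unit cannot depend on a neighbourhood of \<open>x\<close>, so it is represented by the
  unit section over the whole space; \<open>germ_one\<close> replaces it by the unit over any
  neighbourhood.\<close>

definition stalk :: "'x topology \<Rightarrow> ('x, 'a) group_presheaf \<Rightarrow> 'x \<Rightarrow> ('x set \<times> 'a) set monoid" where
  "stalk T P x =
     \<lparr> carrier = {germ T P U s x |U s. openin T U \<and> x \<in> U \<and> s \<in> carrier (Sec P U)},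
       mult = germ_mult T P x,
       one = germ T P (topspace T) \<one>\<^bsub>Sec P (topspace T)\<^esub> x \<rparr>"

lemma stalk_simps [simp]:
  "mult (stalk T P x) = germ_mult T P x"
  "one (stalk T P x) = germ T P (topspace T) \<one>\<^bsub>Sec P (topspace T)\<^esub> x"
  by (simp_all add: stalk_def)

lemma germ_in_stalk:
  "\<lbrakk>openin T U; x \<in> U; s \<in> carrier (Sec P U)\<rbrakk> \<Longrightarrow> germ T P U s x \<in> carrier (stalk T P x)"
  unfolding stalk_def by auto

section \<open>The group structure of the stalks\<close>

context presheaf_of_groups
begin

text \<open>Over the intersection of the three neighbourhoods the germs come from one group
  \<open>Sec P U\<close>, where the group axioms are known. Associativity needs three germs; the
  other axioms repeat an argument.\<close>

lemma stalkE:
  assumes "a \<in> carrier (stalk T P x)" "b \<in> carrier (stalk T P x)" "c \<in> carrier (stalk T P x)"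
  obtains U s t u where "openin T U" "x \<in> U" "s \<in> carrier (Sec P U)" "t \<in> carrier (Sec P U)"
    "u \<in> carrier (Sec P U)" "a = germ T P U s x" "b = germ T P U t x" "c = germ T P U u x"
proof -
  obtain U s V t W u where U: "openin T U" "x \<in> U" "s \<in> carrier (Sec P U)" "a = germ T P U s x"
    and V: "openin T V" "x \<in> V" "t \<in> carrier (Sec P V)" "b = germ T P V t x"
    and W: "openin T W" "x \<in> W" "u \<in> carrier (Sec P W)" "c = germ T P W u x"
    using assms unfolding stalk_def by auto
  let ?Q = "U \<inter> V \<inter> W"
  have "openin T ?Q" using U V W by auto
  then show thesis
    using U V W germ_Res[of U ?Q x s] germ_Res[of V ?Q x t] germ_Res[of W ?Q x u]
    by (intro that[of ?Q "Res P U ?Q s" "Res P V ?Q t" "Res P W ?Q u"]) (auto intro!: Res_closed)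
qed

lemma germ_one:
  assumes "openin T U" "x \<in> U"
  shows "germ T P (topspace T) \<one>\<^bsub>Sec P (topspace T)\<^esub> x = germ T P U \<one>\<^bsub>Sec P U\<^esub> x"
  using germ_Res[of "topspace T" U x "\<one>\<^bsub>Sec P (topspace T)\<^esub>"] assms Res_one[of "topspace T" U]
    openin_subset[of T U] group_Sec[of "topspace T"]
  by (simp add: group.is_monoid)

lemma group_stalk:
  assumes "x \<in> topspace T" shows "group (stalk T P x)"
proof (rule groupI)
  show "\<one>\<^bsub>stalk T P x\<^esub> \<in> carrier (stalk T P x)"
    using assms group_Sec[of "topspace T"] by (auto intro!: germ_in_stalk simp: group.is_monoid)
next
  fix a b assume a: "a \<in> carrier (stalk T P x)" and b: "b \<in> carrier (stalk T P x)"
  show "a \<otimes>\<^bsub>stalk T P x\<^esub> b \<in> carrier (stalk T P x)"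
    by (rule stalkE[OF a a b])
      (auto simp: germ_mult_germ group_Sec group.is_monoid monoid.m_closed intro!: germ_in_stalk)
next
  fix a b c assume a: "a \<in> carrier (stalk T P x)" and b: "b \<in> carrier (stalk T P x)"
    and c: "c \<in> carrier (stalk T P x)"
  show "a \<otimes>\<^bsub>stalk T P x\<^esub> b \<otimes>\<^bsub>stalk T P x\<^esub> c = a \<otimes>\<^bsub>stalk T P x\<^esub> (b \<otimes>\<^bsub>stalk T P x\<^esub> c)"
    by (rule stalkE[OF a b c])
      (simp add: germ_mult_germ group_Sec group.is_monoid monoid.m_closed monoid.m_assoc)
next
  fix a assume a: "a \<in> carrier (stalk T P x)"
  show "\<one>\<^bsub>stalk T P x\<^esub> \<otimes>\<^bsub>stalk T P x\<^esub> a = a"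
    by (rule stalkE[OF a a a])
      (simp add: germ_mult_germ germ_one group_Sec group.is_monoid)
  show "\<exists>b\<in>carrier (stalk T P x). b \<otimes>\<^bsub>stalk T P x\<^esub> a = \<one>\<^bsub>stalk T P x\<^esub>"
  proof (rule stalkE[OF a a a])
    fix U s assume s: "openin T U" "x \<in> U" "s \<in> carrier (Sec P U)" "a = germ T P U s x"
    interpret group "Sec P U" using s group_Sec by simp
    show ?thesis
      by (rule bexI[of _ "germ T P U (inv\<^bsub>Sec P U\<^esub> s) x"])
        (use s in \<open>auto simp: germ_mult_germ germ_one intro!: germ_in_stalk\<close>)
  qed
qed

lemma comm_group_stalk:
  assumes "\<And>U. openin T U \<Longrightarrow> comm_group (Sec P U)" "x \<in> topspace T"
  shows "comm_group (stalk T P x)"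
proof (rule group.group_comm_groupI[OF group_stalk[OF assms(2)]])
  fix a b assume a: "a \<in> carrier (stalk T P x)" and b: "b \<in> carrier (stalk T P x)"
  show "a \<otimes>\<^bsub>stalk T P x\<^esub> b = b \<otimes>\<^bsub>stalk T P x\<^esub> a"
    by (rule stalkE[OF a a b])
      (use assms(1) in \<open>simp add: germ_mult_germ comm_group.axioms(1) comm_monoid.m_comm\<close>)
qed

end

section \<open>Gluing\<close>

lemma presheaf_of_setsD:
  assumes "presheaf_of_sets T S r" "openin T U"
  shows "openin T V \<Longrightarrow> V \<subseteq> U \<Longrightarrow> s \<in> S U \<Longrightarrow> r U V s \<in> S V"
    and "s \<in> S U \<Longrightarrow> r U U s = s"
    and "\<lbrakk>openin T V; openin T W; V \<subseteq> U; W \<subseteq> V; s \<in> S U\<rbrakk> \<Longrightarrow> r V W (r U V s) = r U W s"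
  using assms unfolding presheaf_of_sets_def by (auto simp: Pi_iff)

text \<open>The open sets on which \<open>s\<close> and \<open>t\<close> agree cover
  \<open>U\<close>, and both sections glue the restrictions of \<open>s\<close> to them; uniqueness
  in the sheaf condition identifies them.\<close>

lemma sheaf_of_sets_eqI:
  assumes S: "sheaf_of_sets T S r" and U: "openin T U" and st: "s \<in> S U" "t \<in> S U"
    and loc: "\<And>x. x \<in> U \<Longrightarrow> \<exists>V. openin T V \<and> x \<in> V \<and> V \<subseteq> U \<and> r U V s = r U V t"
  shows "s = t"
proof -
  have pre: "presheaf_of_sets T S r" using S unfolding sheaf_of_sets_def by simp
  define \<U> where "\<U> = {V. openin T V \<and> V \<subseteq> U \<and> r U V s = r U V t}"
  have cov: "open_cover T U \<U>"
    unfolding open_cover_def \<U>_def using loc by auto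
  have "\<forall>V\<in>\<U>. r U V s \<in> S V"
    using presheaf_of_setsD(1)[OF pre U] st unfolding \<U>_def by simp
  moreover have "\<forall>V\<in>\<U>. \<forall>W\<in>\<U>. r V (V \<inter> W) (r U V s) = r W (V \<inter> W) (r U W s)"
  proof (intro ballI)
    fix V W assume "V \<in> \<U>" "W \<in> \<U>"
    then have "openin T V" "V \<subseteq> U" "openin T W" "W \<subseteq> U" "openin T (V \<inter> W)"
      unfolding \<U>_def by auto
    then have "r V (V \<inter> W) (r U V s) = r U (V \<inter> W) s"
      "r W (V \<inter> W) (r U W s) = r U (V \<inter> W) s"
      using presheaf_of_setsD(3)[OF pre U] st by auto
    then show "r V (V \<inter> W) (r U V s) = r W (V \<inter> W) (r U W s)" by simp
  qed
  ultimately have "\<exists>!u. u \<in> S U \<and> (\<forall>V\<in>\<U>. r U V u = r U V s)"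
    using S[unfolded sheaf_of_sets_def, THEN conjunct2, rule_format, of U \<U> "\<lambda>V. r U V s"] U cov
    by blast
  moreover have "\<forall>V\<in>\<U>. r U V t = r U V s" unfolding \<U>_def by auto
  ultimately show ?thesis using st by blast
qed

text \<open>The sheaf condition indexes a family by the members of the covering, whereas here
  \<open>W k = W l\<close> may hold for different indices. Agreement over
  \<open>W k \<inter> W l\<close> then forces \<open>s k = s l\<close>, so the choice
  \<open>i\<close> of an index for each member is immaterial.\<close>

lemma sheaf_of_sets_glue:
  assumes S: "sheaf_of_sets T S r" and W: "\<And>k. k \<in> K \<Longrightarrow> openin T (W k)" and U: "U = (\<Union>k\<in>K. W k)"
    and s: "\<And>k. k \<in> K \<Longrightarrow> s k \<in> S (W k)"
    and agree: "\<And>k l. k \<in> K \<Longrightarrow> l \<in> K \<Longrightarrow>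
      r (W k) (W k \<inter> W l) (s k) = r (W l) (W k \<inter> W l) (s l)"
  obtains t where "t \<in> S U" "\<And>k. k \<in> K \<Longrightarrow> r U (W k) t = s k"
proof -
  have pre: "presheaf_of_sets T S r" using S unfolding sheaf_of_sets_def by simp
  have s_eq: "s k = s l" if "k \<in> K" "l \<in> K" "W k = W l" for k l
    using agree[OF that(1,2)] presheaf_of_setsD(2)[OF pre W s] that by (metis Int_absorb)
  define i where "i V = (SOME k. k \<in> K \<and> W k = V)" for V
  have i: "i V \<in> K \<and> W (i V) = V" if "V \<in> W ` K" for V
    unfolding i_def by (rule someI_ex) (use that in auto)
  have cov: "openin T U" "open_cover T U (W ` K)"
    unfolding open_cover_def U using W by auto
  have "\<forall>V\<in>W ` K. s (i V) \<in> S V" using s i by metis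
  moreover have "\<forall>V\<in>W ` K. \<forall>V'\<in>W ` K. r V (V \<inter> V') (s (i V)) = r V' (V \<inter> V') (s (i V'))"
    using agree i by metis
  ultimately have "\<exists>!t. t \<in> S U \<and> (\<forall>V\<in>W ` K. r U V t = s (i V))"
    using S[unfolded sheaf_of_sets_def, THEN conjunct2, THEN spec, THEN spec, THEN spec,
        of U "W ` K" "\<lambda>V. s (i V)"] cov by blast
  then obtain t where t: "t \<in> S U" "\<forall>V\<in>W ` K. r U V t = s (i V)"
    using ex1_implies_ex by blast
  have "r U (W k) t = s k" if "k \<in> K" for k
    using bspec[OF t(2), of "W k"] s_eq[of "i (W k)" k] i[of "W k"] that by simp
  then show thesis by (rule that[OF t(1)])
qed

lemma presheaf_of_groups_sheaf:
  assumes "sheaf_of_groups T F" shows "presheaf_of_groups T F"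
proof (rule presheaf_of_groups.intro)
  have pre: "presheaf_of_sets T (\<lambda>U. carrier (Sec F U)) (Res F)"
    using assms unfolding sheaf_of_groups_def sheaf_of_sets_def by simp
  show "Res F U U s = s" if "openin T U" "s \<in> carrier (Sec F U)" for U s
    using presheaf_of_setsD(2)[OF pre that] .
  show "Res F V W (Res F U V s) = Res F U W s"
    if "openin T U" "openin T V" "openin T W" "V \<subseteq> U" "W \<subseteq> V" "s \<in> carrier (Sec F U)" for U V W s
    using presheaf_of_setsD(3)[OF pre] that by simp
qed (use assms in \<open>simp_all add: sheaf_of_groups_def\<close>)

section \<open>The Godement sheaf\<close>

text \<open>Unlike in \<open>sheafify\<close>, no local coherence is asked of a family of germs.
  Sections can therefore be defined by an arbitrary choice at each point, which is what later
  contracts the Cech complex.\<close>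

definition godement :: "'x topology \<Rightarrow> ('x, 'a) group_presheaf \<Rightarrow>
    ('x, 'x \<Rightarrow> ('x set \<times> 'a) set) group_presheaf" where
  "godement T P = \<lparr> Sec = \<lambda>U. product_group U (stalk T P), Res = \<lambda>U V \<sigma>. restrict \<sigma> V \<rparr>"

text \<open>Glueing is pointwise: the value at \<open>x\<close> is taken from any member of the
  covering that contains \<open>x\<close>.\<close>

lemma sheaf_of_sets_PiE: "sheaf_of_sets T (\<lambda>U. \<Pi>\<^sub>E x\<in>U. A x) (\<lambda>U V \<sigma>. restrict \<sigma> V)"
  unfolding sheaf_of_sets_def
proof (intro conjI allI impI)
  show "presheaf_of_sets T (\<lambda>U. \<Pi>\<^sub>E x\<in>U. A x) (\<lambda>U V \<sigma>. restrict \<sigma> V)"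
    unfolding presheaf_of_sets_def by (auto simp: PiE_restrict Int_absorb1 subset_iff)
next
  fix U \<U> s
  assume *: "openin T U \<and> open_cover T U \<U> \<and> (\<forall>V\<in>\<U>. s V \<in> (\<Pi>\<^sub>E x\<in>V. A x)) \<and>
    (\<forall>V\<in>\<U>. \<forall>W\<in>\<U>. restrict (s V) (V \<inter> W) = restrict (s W) (V \<inter> W))"
  then have U: "U = \<Union>\<U>" unfolding open_cover_def by auto
  define i where "i x = (SOME V. V \<in> \<U> \<and> x \<in> V)" for x
  have i: "i x \<in> \<U> \<and> x \<in> i x" if "x \<in> U" for x
    unfolding i_def by (rule someI_ex) (use that U in auto)
  have agree: "s V x = s W x" if "V \<in> \<U>" "W \<in> \<U>" "x \<in> V" "x \<in> W" for V W x
    using * that by (metis IntI restrict_apply')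
  show "\<exists>!t. t \<in> (\<Pi>\<^sub>E x\<in>U. A x) \<and> (\<forall>V\<in>\<U>. restrict t V = s V)"
  proof (rule ex1I[of _ "\<lambda>x\<in>U. s (i x) x"], intro conjI ballI)
    show "(\<lambda>x\<in>U. s (i x) x) \<in> (\<Pi>\<^sub>E x\<in>U. A x)"
      using * i by (auto simp: PiE_iff)
  next
    fix V assume V: "V \<in> \<U>"
    then have "s V \<in> extensional V" "V \<subseteq> U" using * U by (auto simp: PiE_iff)
    then show "restrict (\<lambda>x\<in>U. s (i x) x) V = s V"
      using i agree[OF _ V] by (intro extensionalityI[of _ V]) auto
  next
    fix t assume t: "t \<in> (\<Pi>\<^sub>E x\<in>U. A x) \<and> (\<forall>V\<in>\<U>. restrict t V = s V)"
    show "t = (\<lambda>x\<in>U. s (i x) x)"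
    proof (rule extensionalityI[of _ U])
      fix x assume "x \<in> U"
      then show "t x = (\<lambda>x\<in>U. s (i x) x) x"
        using t i[of x] by (metis restrict_apply')
    qed (use t in \<open>auto simp: PiE_iff\<close>)
  qed
qed

lemma abelian_sheafD:
  assumes "abelian_sheaf T F"
  shows "sheaf_of_groups T F" "presheaf_of_groups T F" "sheaf_of_sets T (\<lambda>U. carrier (Sec F U)) (Res F)"
    "\<And>U. openin T U \<Longrightarrow> comm_group (Sec F U)"
  using assms presheaf_of_groups_sheaf[of T F]
  by (simp_all add: abelian_sheaf_def sheaf_of_groups_def)

lemma comm_group_product_group:
  assumes "\<And>i. i \<in> I \<Longrightarrow> comm_group (G i)" shows "comm_group (product_group I G)"
proof (rule group.group_comm_groupI)
  show "group (product_group I G)" using assms by (simp add: comm_group.axioms(2))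
  show "x \<otimes>\<^bsub>product_group I G\<^esub> y = y \<otimes>\<^bsub>product_group I G\<^esub> x"
    if "x \<in> carrier (product_group I G)" "y \<in> carrier (product_group I G)" for x y
    using that assms by (auto simp: PiE_iff fun_eq_iff restrict_def comm_group.axioms(1) comm_monoid.m_comm)
qed

lemma abelian_sheaf_godement:
  assumes "abelian_sheaf T P" shows "abelian_sheaf T (godement T P)"
proof -
  interpret presheaf_of_groups T P using assms by (rule abelian_sheafD)
  have comm: "comm_group (product_group U (stalk T P))" if "openin T U" for U
    using comm_group_stalk abelian_sheafD(4)[OF assms] openin_subset[OF that]
    by (blast intro: comm_group_product_group)
  have hom: "(\<lambda>\<sigma>. restrict \<sigma> V) \<in> hom (product_group U (stalk T P)) (product_group V (stalk T P))"
    if "V \<subseteq> U" for U V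
    using that by (auto simp: hom_def PiE_restrict Int_absorb1 fun_eq_iff subset_iff)
  show ?thesis
    using comm comm_group.axioms(2)[OF comm] hom
      sheaf_of_sets_PiE[of T "\<lambda>x. carrier (stalk T P x)"]
    by (simp add: abelian_sheaf_def sheaf_of_groups_def godement_def)
qed

text \<open>For injective \<open>f\<close> this is \<open>F\<close> with renamed sections. It serves
  to move a sheaf into another type, since injectivity is tested only against sheaves with sections
  in one type.\<close>

definition image_presheaf :: "('x set \<Rightarrow> 'a \<Rightarrow> 'b) \<Rightarrow> ('x, 'a) group_presheaf \<Rightarrow> ('x, 'b) group_presheaf"
  where "image_presheaf f F =
    \<lparr> Sec = \<lambda>U. image_group (f U) (Sec F U),
      Res = \<lambda>U V s. f V (Res F U V (inv_into (carrier (Sec F U)) (f U) s)) \<rparr>"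

lemma sheaf_morphismD:
  assumes "sheaf_morphism T F F' \<phi>" "openin T U"
  shows "\<phi> U \<in> hom (Sec F U) (Sec F' U)"
    and "s \<in> carrier (Sec F U) \<Longrightarrow> \<phi> U s \<in> carrier (Sec F' U)"
    and "\<lbrakk>s \<in> carrier (Sec F U); t \<in> carrier (Sec F U)\<rbrakk>
      \<Longrightarrow> \<phi> U (s \<otimes>\<^bsub>Sec F U\<^esub> t) = \<phi> U s \<otimes>\<^bsub>Sec F' U\<^esub> \<phi> U t"
    and "\<lbrakk>openin T V; V \<subseteq> U; s \<in> carrier (Sec F U)\<rbrakk> \<Longrightarrow> \<phi> V (Res F U V s) = Res F' U V (\<phi> U s)"
  using assms by (auto simp: sheaf_morphism_def hom_def Pi_iff)

text \<open>A compatible family in \<open>S'\<close> is pulled back along the inverse bijections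
  \<open>g\<close>, glued in \<open>S\<close> and pushed forward again. Compatibility survives the
  pull-back because each \<open>f U\<close> is injective and natural.\<close>

lemma sheaf_of_sets_transport:
  assumes S: "sheaf_of_sets T S r" and bij: "\<And>U. openin T U \<Longrightarrow> bij_betw (f U) (S U) (S' U)"
    and nat: "\<And>U V s. \<lbrakk>openin T U; openin T V; V \<subseteq> U; s \<in> S U\<rbrakk> \<Longrightarrow> f V (r U V s) = r' U V (f U s)"
  shows "sheaf_of_sets T S' r'"
proof -
  have pre: "presheaf_of_sets T S r" using S unfolding sheaf_of_sets_def by simp
  define g where "g U = inv_into (S U) (f U)" for U
  have g: "g U t \<in> S U" "f U (g U t) = t" if "openin T U" "t \<in> S' U" for U t
    unfolding g_def using bij[OF that(1)] that(2)
    by (auto simp: bij_betw_def inv_into_into f_inv_into_f)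
  have f: "f U s \<in> S' U" if "openin T U" "s \<in> S U" for U s
    using bij[OF that(1)] that(2) by (auto simp: bij_betw_def)
  have f_inj: "s = t" if "openin T U" "s \<in> S U" "t \<in> S U" "f U s = f U t" for U s t
    using bij[OF that(1)] that(2-) by (auto simp: bij_betw_def inj_on_def)
  have r': "r' U V t = f V (r U V (g U t))" if "openin T U" "openin T V" "V \<subseteq> U" "t \<in> S' U" for U V t
    using nat[OF that(1-3)] g that by simp
  have r_cl: "r U V s \<in> S V" if "openin T U" "openin T V" "V \<subseteq> U" "s \<in> S U" for U V s
    using presheaf_of_setsD(1)[OF pre] that by simp
  have "presheaf_of_sets T S' r'"
    unfolding presheaf_of_sets_def
  proof (intro conjI allI impI ballI Pi_I; (elim conjE)?)
    fix U V t assume U: "openin T U" "openin T V" "V \<subseteq> U" "t \<in> S' U"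
    then show "r' U V t \<in> S' V" using r' g r_cl f by simp
  next
    fix U t assume "openin T U" "t \<in> S' U"
    then show "r' U U t = t" using r' g presheaf_of_setsD(2)[OF pre] by simp
  next
    fix U V W t assume U: "openin T U" "openin T V" "openin T W" "V \<subseteq> U" "W \<subseteq> V" "t \<in> S' U"
    then have "r' V W (r' U V t) = f W (r V W (r U V (g U t)))"
      using r' g r_cl nat by simp
    also have "\<dots> = r' U W t"
      using presheaf_of_setsD(3)[OF pre] U g r' by simp
    finally show "r' V W (r' U V t) = r' U W t" .
  qed
  moreover have glue: "\<exists>!t. t \<in> S' U \<and> (\<forall>V\<in>\<U>. r' U V t = s V)"
    if U: "openin T U" and cov: "open_cover T U \<U>" and s: "\<forall>V\<in>\<U>. s V \<in> S' V"
      and agree: "\<forall>V\<in>\<U>. \<forall>W\<in>\<U>. r' V (V \<inter> W) (s V) = r' W (V \<inter> W) (s W)" for U \<U> s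
  proof -
    have \<U>: "openin T V" "V \<subseteq> U" if "V \<in> \<U>" for V
      using cov that unfolding open_cover_def by auto
    have "r V (V \<inter> W) (g V (s V)) = r W (V \<inter> W) (g W (s W))" if VW: "V \<in> \<U>" "W \<in> \<U>" for V W
    proof -
      have o: "openin T V" "openin T W" "openin T (V \<inter> W)" "V \<inter> W \<subseteq> V" "V \<inter> W \<subseteq> W"
        using \<U> VW by auto
      have gV: "g V (s V) \<in> S V" "g W (s W) \<in> S W" using g o s VW by auto
      have "f (V \<inter> W) (r V (V \<inter> W) (g V (s V))) = f (V \<inter> W) (r W (V \<inter> W) (g W (s W)))"
        using bspec[OF bspec[OF agree VW(1)] VW(2)] r'[OF o(1,3,4), of "s V"] r'[OF o(2,3,5), of "s W"] s VW
        by simp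
      then show ?thesis using f_inj[OF o(3)] r_cl o gV by simp
    qed
    then obtain t where t: "t \<in> S U" "\<And>V. V \<in> \<U> \<Longrightarrow> r U V t = g V (s V)"
      using sheaf_of_sets_glue[OF S, of \<U> "\<lambda>V. V" U "\<lambda>V. g V (s V)"] \<U> cov g s
      unfolding open_cover_def by auto
    show ?thesis
    proof (rule ex1I[of _ "f U t"], intro conjI ballI)
      show "f U t \<in> S' U" using f U t by simp
      show "r' U V (f U t) = s V" if "V \<in> \<U>" for V
        using nat[OF U \<U>[OF that] t(1)] t(2)[OF that] g(2)[OF \<U>(1)[OF that]] s that by simp
    next
      fix t' assume t': "t' \<in> S' U \<and> (\<forall>V\<in>\<U>. r' U V t' = s V)"
      have eq: "r U V (g U t') = r U V t" if "V \<in> \<U>" for V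
      proof (rule f_inj)
        have "f V (r U V (g U t')) = r' U V t'" using r'[OF U \<U>[OF that]] t' by simp
        also have "\<dots> = f V (r U V t)"
          using t' t(2)[OF that] g(2)[OF \<U>(1)[OF that]] s that by simp
        finally show "f V (r U V (g U t')) = f V (r U V t)" .
      qed (use r_cl[OF U \<U>[OF that]] \<U>[OF that] g[OF U] t t' in auto)
      have "g U t' = t"
      proof (rule sheaf_of_sets_eqI[OF S U _ t(1)])
        show "g U t' \<in> S U" using g[OF U] t' by simp
        show "\<exists>V. openin T V \<and> x \<in> V \<and> V \<subseteq> U \<and> r U V (g U t') = r U V t" if x: "x \<in> U" for x
        proof -
          obtain V where "V \<in> \<U>" "x \<in> V" using x cov unfolding open_cover_def by auto
          then show ?thesis using \<U> eq by blast
        qed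
      qed
      then show "t' = f U t" using g[OF U] t' by auto
    qed
  qed
  ultimately show ?thesis unfolding sheaf_of_sets_def by (intro conjI allI impI glue; (elim conjE)?) assumption+
qed

lemma
  assumes F: "abelian_sheaf T F"
    and inj: "\<And>U. openin T U \<Longrightarrow> inj_on (f U) (carrier (Sec F U))"
  shows image_presheaf_morphism: "sheaf_morphism T F (image_presheaf f F) f"
    and abelian_sheaf_image_presheaf: "abelian_sheaf T (image_presheaf f F)"
proof -
  interpret presheaf_of_groups T F using abelian_sheafD(2)[OF F] .
  have iso: "f U \<in> iso (Sec F U) (image_group (f U) (Sec F U))" if "openin T U" for U
    using inj_imp_image_group_iso[OF inj[OF that]] .
  have comm: "comm_group (image_group (f U) (Sec F U))" if "openin T U" for U
    using comm_group.iso_imp_img_comm_group[OF abelian_sheafD(4)[OF F that] iso[OF that]]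
    by (simp add: image_group_def)
  show mor: "sheaf_morphism T F (image_presheaf f F) f"
    unfolding sheaf_morphism_def image_presheaf_def using iso inj
    by (simp add: iso_def inv_into_f_f)
  have sh: "sheaf_of_sets T (\<lambda>U. carrier (Sec (image_presheaf f F) U)) (Res (image_presheaf f F))"
    by (rule sheaf_of_sets_transport[OF abelian_sheafD(3)[OF F], of f])
      (use inj mor in \<open>auto simp: image_presheaf_def image_group_carrier bij_betw_def sheaf_morphism_def\<close>)
  have "Res (image_presheaf f F) U V \<in> hom (image_group (f U) (Sec F U)) (image_group (f V) (Sec F V))"
    if UV: "openin T U" "openin T V" "V \<subseteq> U" for U V
  proof (rule homI)
    note m = sheaf_morphismD[OF mor UV(1)] sheaf_morphismD[OF mor UV(2)]
    have S: "Sec (image_presheaf f F) W = image_group (f W) (Sec F W)" for W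
      by (simp add: image_presheaf_def)
    fix s t
    assume "s \<in> carrier (image_group (f U) (Sec F U))" "t \<in> carrier (image_group (f U) (Sec F U))"
    then obtain s' t' where s': "s = f U s'" "s' \<in> carrier (Sec F U)"
      and t': "t = f U t'" "t' \<in> carrier (Sec F U)"
      by (auto simp: image_group_carrier)
    have c: "s' \<otimes>\<^bsub>Sec F U\<^esub> t' \<in> carrier (Sec F U)"
      using group.is_monoid[OF group_Sec[OF UV(1)]] s' t' by (simp add: monoid.m_closed)
    have R: "Res (image_presheaf f F) U V (f U u) = f V (Res F U V u)" if "u \<in> carrier (Sec F U)" for u
      using m(4)[OF UV(2,3) that] by simp
    show "Res (image_presheaf f F) U V s \<in> carrier (image_group (f V) (Sec F V))"
      using R s' Res_closed[OF UV] by (simp add: image_group_carrier)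
    have "Res (image_presheaf f F) U V (s \<otimes>\<^bsub>image_group (f U) (Sec F U)\<^esub> t)
      = f V (Res F U V (s' \<otimes>\<^bsub>Sec F U\<^esub> t'))"
      using m(3)[OF s'(2) t'(2)] R[OF c] s' t' unfolding S by simp
    also have "\<dots> = f V (Res F U V s') \<otimes>\<^bsub>image_group (f V) (Sec F V)\<^esub> f V (Res F U V t')"
      using m(7) Res_closed[OF UV] Res_mult[OF UV] s' t' unfolding S by simp
    finally show "Res (image_presheaf f F) U V (s \<otimes>\<^bsub>image_group (f U) (Sec F U)\<^esub> t) =
      Res (image_presheaf f F) U V s \<otimes>\<^bsub>image_group (f V) (Sec F V)\<^esub> Res (image_presheaf f F) U V t"
      using R s' t' by simp
  qed
  with sh comm comm_group.axioms(2)[OF comm] show "abelian_sheaf T (image_presheaf f F)"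
    unfolding abelian_sheaf_def sheaf_of_groups_def by (simp add: image_presheaf_def)
qed

text \<open>The target consists of functions on \<open>'x \<times> nat\<close> with values in
  \<open>'a option\<close>, and the source can be coded by such functions on the square of
  \<open>'x \<times> nat\<close>. The factor \<open>nat\<close> makes this index set infinite even
  for a finite space, and an infinite set is equipotent with its square.\<close>

lemma ex_inj_into_resolution_type:
  "\<exists>h :: ('x \<Rightarrow> 'x set \<times> ('x, 'a) resolution_type) \<Rightarrow> ('x, 'a) resolution_type. inj h"
proof -
  have "infinite (UNIV :: ('x \<times> nat) set)"
    by (simp add: finite_prod)
  from card_of_Times_same_infinite[OF this]
  obtain g :: "('x \<times> nat) \<times> ('x \<times> nat) \<Rightarrow> 'x \<times> nat" where "bij_betw g (UNIV \<times> UNIV) UNIV"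
    unfolding card_of_ordIso[symmetric] by blast
  then have g: "inj g" by (simp add: bij_betw_def)
  \<comment> \<open>The slot \<open>n = 0\<close> records whether \<open>y\<close> lies in the set
    \<open>fst (f x)\<close>, as \<open>Some undefined\<close> against \<open>None\<close>; the
    slots \<open>Suc m\<close> record the section. The ignored component only completes the
    square.\<close>
  define code :: "('x \<Rightarrow> 'x set \<times> ('x, 'a) resolution_type) \<Rightarrow> ('x \<times> nat) \<times> ('x \<times> nat) \<Rightarrow> 'a option"
    where "code f = (\<lambda>((x, _), (y, n)). case n of
      0 \<Rightarrow> if y \<in> fst (f x) then Some undefined else None | Suc m \<Rightarrow> snd (f x) y m)" for f
  define h where "h f = (\<lambda>y n. code f (inv_into UNIV g (y, n)))" for f :: "'x \<Rightarrow> 'x set \<times> ('x, 'a) resolution_type"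
  have "inj h"
  proof (rule injI)
    fix f f' assume "h f = h f'"
    then have "code f z = code f' z" for z
      using g unfolding h_def by (metis inv_f_f surj_pair)
    then have *: "code f ((x, 0), (y, n)) = code f' ((x, 0), (y, n))" for x y n by blast
    have "y \<in> fst (f x) \<longleftrightarrow> y \<in> fst (f' x)" "snd (f x) y n = snd (f' x) y n" for x y n
      using *[of x y 0] *[of x y "Suc n"] by (auto simp: code_def split: if_splits)
    then show "f = f'" by (auto simp: fun_eq_iff prod_eq_iff)
  qed
  then show ?thesis by blast
qed

section \<open>Injective sheaves have no Cech cohomology\<close>

lemma (in presheaf_of_groups) germs_in_godement:
  assumes "openin T U" "s \<in> carrier (Sec P U)"
  shows "(\<lambda>x\<in>U. germ T P U s x) \<in> carrier (Sec (godement T P) U)"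
  using assms by (simp add: godement_def germ_in_stalk)

text \<open>An injective sheaf embeds into its Godement sheaf, which is small enough to be encoded in the
  type of sections that is relevant for injectivity; hence it is a retract of it.\<close>

lemma injective_sheaf_retract_godement:
  fixes I :: "('x, ('x, 'a) resolution_type) group_presheaf"
  assumes I: "injective_sheaf T I"
  obtains r where "sheaf_morphism T (godement T I) I r"
    "\<And>U s. \<lbrakk>openin T U; s \<in> carrier (Sec I U)\<rbrakk> \<Longrightarrow> r U (\<lambda>x\<in>U. germ T I U s x) = s"
proof -
  have ab: "abelian_sheaf T I" using I unfolding injective_sheaf_def by simp
  interpret presheaf_of_groups T I using abelian_sheafD(2)[OF ab] .
  let ?D = "godement T I"
  obtain h :: "('x \<Rightarrow> 'x set \<times> ('x, 'a) resolution_type) \<Rightarrow> ('x, 'a) resolution_type" where h: "inj h"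
    using ex_inj_into_resolution_type by blast
  \<comment> \<open>A germ is a set of pairs, one power set too large for \<open>h\<close>. A single
    chosen member of a germ determines it, so a family of germs is coded through a family of
    pairs.\<close>
  define enc where "enc U \<sigma> = h (\<lambda>x. SOME p. p \<in> \<sigma> x)"
    for U :: "'x set" and \<sigma> :: "'x \<Rightarrow> ('x set \<times> ('x, 'a) resolution_type) set"
  have enc: "inj_on (enc U) (carrier (Sec ?D U))" if "openin T U" for U
  proof (rule inj_onI)
    fix \<sigma> \<tau> assume \<sigma>: "\<sigma> \<in> carrier (Sec ?D U)" and \<tau>: "\<tau> \<in> carrier (Sec ?D U)"
      and eq: "enc U \<sigma> = enc U \<tau>"
    have "(\<lambda>x. SOME p. p \<in> \<sigma> x) = (\<lambda>x. SOME p. p \<in> \<tau> x)"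
      using eq unfolding enc_def inj_eq[OF h] .
    then have some_eq: "(SOME p. p \<in> \<sigma> x) = (SOME p. p \<in> \<tau> x)" for x
      by (rule fun_cong)
    have st: "\<sigma> x \<in> carrier (stalk T I x)" "\<tau> x \<in> carrier (stalk T I x)" if "x \<in> U" for x
      using that \<sigma> \<tau> by (auto simp: godement_def)
    have rep: "a = germ T I (fst (SOME p. p \<in> a)) (snd (SOME p. p \<in> a)) x"
      if "a \<in> carrier (stalk T I x)" for a x
    proof -
      obtain V s where V: "openin T V" "x \<in> V" "s \<in> carrier (Sec I V)" "a = germ T I V s x"
        using \<open>a \<in> carrier (stalk T I x)\<close> unfolding stalk_def by auto
      then have "(SOME p. p \<in> a) \<in> a"
        using germ_self_mem[OF V(1-3)] by (metis someI)
      then show ?thesis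
        using germ_memD(4)[of "fst (SOME p. p \<in> a)" "snd (SOME p. p \<in> a)" V s x] V by simp
    qed
    show "\<sigma> = \<tau>"
    proof (rule extensionalityI[of _ U])
      show "\<sigma> x = \<tau> x" if "x \<in> U" for x
        using rep[OF st(1)[OF that]] rep[OF st(2)[OF that]] some_eq by metis
    qed (use \<sigma> \<tau> in \<open>auto simp: godement_def PiE_iff\<close>)
  qed
  have D: "abelian_sheaf T ?D" using abelian_sheaf_godement[OF ab] .
  let ?B = "image_presheaf enc ?D"
  have B: "abelian_sheaf T ?B" "sheaf_morphism T ?D ?B enc"
    using abelian_sheaf_image_presheaf[OF D enc] image_presheaf_morphism[OF D enc] by auto
  define \<gamma> where "\<gamma> U s = (\<lambda>x\<in>U. germ T I U s x)" for U s
  have \<gamma>: "\<gamma> U s \<in> carrier (Sec ?D U)" if "openin T U" "s \<in> carrier (Sec I U)" for U s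
    unfolding \<gamma>_def using germs_in_godement[OF that] .
  have \<gamma>_mor: "sheaf_morphism T I ?D \<gamma>"
    unfolding sheaf_morphism_def
  proof (intro conjI allI impI ballI; (elim conjE)?)
    fix U assume U: "openin T U"
    show "\<gamma> U \<in> hom (Sec I U) (Sec ?D U)"
      by (rule homI) (use \<gamma>[OF U] U in \<open>auto simp: \<gamma>_def godement_def germ_mult_germ restrict_def fun_eq_iff\<close>)
  next
    fix U V s assume "openin T U" "openin T V" "V \<subseteq> U" "s \<in> carrier (Sec I U)"
    then show "\<gamma> V (Res I U V s) = Res ?D U V (\<gamma> U s)"
      by (auto simp: \<gamma>_def godement_def germ_Res restrict_def fun_eq_iff)
  qed
  have \<gamma>_inj: "inj_on (\<gamma> U) (carrier (Sec I U))" if U: "openin T U" for U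
  proof (rule inj_onI)
    fix s t assume s: "s \<in> carrier (Sec I U)" and t: "t \<in> carrier (Sec I U)" and eq: "\<gamma> U s = \<gamma> U t"
    show "s = t"
    proof (rule sheaf_of_sets_eqI[OF abelian_sheafD(3)[OF ab] U s t])
      fix x assume x: "x \<in> U"
      have "germ T I U s x = germ T I U t x"
        using fun_cong[OF eq, of x] x by (simp add: \<gamma>_def)
      from germ_eqD[OF this U x t] show "\<exists>V. openin T V \<and> x \<in> V \<and> V \<subseteq> U \<and> Res I U V s = Res I U V t"
        by (metis Int_absorb)
    qed
  qed
  have \<iota>: "sheaf_morphism T I ?B (\<lambda>U s. enc U (\<gamma> U s))"
    unfolding sheaf_morphism_def
  proof (intro conjI allI impI ballI; (elim conjE)?)
    fix U assume U: "openin T U"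
    show "(\<lambda>s. enc U (\<gamma> U s)) \<in> hom (Sec I U) (Sec ?B U)"
      using hom_compose[OF sheaf_morphismD(1)[OF \<gamma>_mor U] sheaf_morphismD(1)[OF B(2) U]]
      by (simp add: comp_def)
  next
    fix U V s assume "openin T U" "openin T V" "V \<subseteq> U" "s \<in> carrier (Sec I U)"
    then show "enc V (\<gamma> V (Res I U V s)) = Res ?B U V (enc U (\<gamma> U s))"
      using sheaf_morphismD(4)[OF \<gamma>_mor] sheaf_morphismD(4)[OF B(2)] \<gamma> by simp
  qed
  have \<iota>_inj: "inj_on (\<lambda>s. enc U (\<gamma> U s)) (carrier (Sec I U))" if "openin T U" for U
  proof -
    have "inj_on (enc U) (\<gamma> U ` carrier (Sec I U))"
      using enc[OF that] \<gamma>[OF that] by (meson inj_on_subset image_subsetI)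
    with \<gamma>_inj[OF that] show ?thesis using comp_inj_on by (fastforce simp: comp_def)
  qed
  have id: "sheaf_morphism T I I (\<lambda>U s. s)"
    unfolding sheaf_morphism_def by (simp add: hom_def)
  \<comment> \<open>Injectivity extends the identity of \<open>I\<close> along the embedding into
    the coded Godement sheaf; the extension is the retraction.\<close>
  obtain r' where r': "sheaf_morphism T ?B I r'"
    "\<And>U s. openin T U \<Longrightarrow> s \<in> carrier (Sec I U) \<Longrightarrow> r' U (enc U (\<gamma> U s)) = s"
    using I[unfolded injective_sheaf_def, THEN conjunct2, THEN spec, THEN spec, THEN spec, THEN spec,
        of I ?B "\<lambda>U s. enc U (\<gamma> U s)" "\<lambda>U s. s"] ab B(1) \<iota> \<iota>_inj id by auto
  show thesis
  proof (rule that[of "\<lambda>U \<sigma>. r' U (enc U \<sigma>)"])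
    show "sheaf_morphism T ?D I (\<lambda>U \<sigma>. r' U (enc U \<sigma>))"
      unfolding sheaf_morphism_def
    proof (intro conjI allI impI ballI; (elim conjE)?)
      fix U assume U: "openin T U"
      show "(\<lambda>s. r' U (enc U s)) \<in> hom (Sec ?D U) (Sec I U)"
        using hom_compose[OF sheaf_morphismD(1)[OF B(2) U] sheaf_morphismD(1)[OF r'(1) U]]
        by (simp add: comp_def)
    next
      fix U V s assume "openin T U" "openin T V" "V \<subseteq> U" "s \<in> carrier (Sec ?D U)"
      then show "r' V (enc V (Res ?D U V s)) = Res I U V (r' U (enc U s))"
        using sheaf_morphismD(4)[OF B(2)] sheaf_morphismD(4)[OF r'(1)] sheaf_morphismD(2)[OF B(2)] by simp
    qed
  qed (use r'(2) in \<open>simp add: \<gamma>_def\<close>)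
qed

section \<open>Cech cochains in multiplicative notation\<close>

definition cech1_cocycle :: "('x, 'a) group_presheaf \<Rightarrow> 'k set \<Rightarrow> ('k \<Rightarrow> 'x set) \<Rightarrow>
    ('k \<Rightarrow> 'k \<Rightarrow> 'a) \<Rightarrow> bool" where
  "cech1_cocycle F K W c \<longleftrightarrow>
     (\<forall>k\<in>K. \<forall>l\<in>K. c k l \<in> carrier (Sec F (W k \<inter> W l))) \<and>
     (\<forall>k\<in>K. \<forall>l\<in>K. \<forall>m\<in>K.
        Res F (W k \<inter> W l) (W k \<inter> W l \<inter> W m) (c k l)
          \<otimes>\<^bsub>Sec F (W k \<inter> W l \<inter> W m)\<^esub> Res F (W l \<inter> W m) (W k \<inter> W l \<inter> W m) (c l m) =
        Res F (W k \<inter> W m) (W k \<inter> W l \<inter> W m) (c k m))"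

definition cech1_bounds :: "('x, 'a) group_presheaf \<Rightarrow> 'k set \<Rightarrow> ('k \<Rightarrow> 'x set) \<Rightarrow>
    ('k \<Rightarrow> 'k \<Rightarrow> 'a) \<Rightarrow> ('k \<Rightarrow> 'a) \<Rightarrow> bool" where
  "cech1_bounds F K W c b \<longleftrightarrow>
     (\<forall>k\<in>K. b k \<in> carrier (Sec F (W k))) \<and>
     (\<forall>k\<in>K. \<forall>l\<in>K. Res F (W k) (W k \<inter> W l) (b k) \<otimes>\<^bsub>Sec F (W k \<inter> W l)\<^esub> c k l =
        Res F (W l) (W k \<inter> W l) (b l))"

text \<open>The alternating sum is split by sign between the two sides, so that no inverses occur.
  The order of the factors is the one in which the defects of arrows are composed in
  \<open>defect_improve\<close>.\<close>

definition cech2_cocycle :: "('x, 'a) group_presheaf \<Rightarrow> 'k set \<Rightarrow> ('k \<Rightarrow> 'x set) \<Rightarrow>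
    ('k \<Rightarrow> 'k \<Rightarrow> 'k \<Rightarrow> 'a) \<Rightarrow> bool" where
  "cech2_cocycle F K W c \<longleftrightarrow>
     (\<forall>k\<in>K. \<forall>l\<in>K. \<forall>m\<in>K. c k l m \<in> carrier (Sec F (W k \<inter> W l \<inter> W m))) \<and>
     (\<forall>k\<in>K. \<forall>l\<in>K. \<forall>m\<in>K. \<forall>n\<in>K. let Q = W k \<inter> W l \<inter> W m \<inter> W n in
        Res F (W k \<inter> W m \<inter> W n) Q (c k m n) \<otimes>\<^bsub>Sec F Q\<^esub> Res F (W k \<inter> W l \<inter> W m) Q (c k l m) =
        Res F (W k \<inter> W l \<inter> W n) Q (c k l n) \<otimes>\<^bsub>Sec F Q\<^esub> Res F (W l \<inter> W m \<inter> W n) Q (c l m n))"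

definition cech2_bounds :: "('x, 'a) group_presheaf \<Rightarrow> 'k set \<Rightarrow> ('k \<Rightarrow> 'x set) \<Rightarrow>
    ('k \<Rightarrow> 'k \<Rightarrow> 'k \<Rightarrow> 'a) \<Rightarrow> ('k \<Rightarrow> 'k \<Rightarrow> 'a) \<Rightarrow> bool" where
  "cech2_bounds F K W c b \<longleftrightarrow>
     (\<forall>k\<in>K. \<forall>l\<in>K. b k l \<in> carrier (Sec F (W k \<inter> W l))) \<and>
     (\<forall>k\<in>K. \<forall>l\<in>K. \<forall>m\<in>K. let Q = W k \<inter> W l \<inter> W m in
        c k l m \<otimes>\<^bsub>Sec F Q\<^esub> Res F (W k \<inter> W m) Q (b k m) =
        Res F (W k \<inter> W l) Q (b k l) \<otimes>\<^bsub>Sec F Q\<^esub> Res F (W l \<inter> W m) Q (b l m))"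

text \<open>Coverings are indexed by the points of \<open>U\<close>, with \<open>x\<close> in
  \<open>W x\<close>. Such coverings come from choices near each point, and the fixed index type
  keeps the predicate free of a further type variable.\<close>

definition cech1_trivial :: "'x topology \<Rightarrow> 'x set \<Rightarrow> ('x, 'a) group_presheaf \<Rightarrow> bool" where
  "cech1_trivial T U F \<longleftrightarrow>
     (\<forall>W c. (\<forall>x\<in>U. openin T (W x) \<and> x \<in> W x \<and> W x \<subseteq> U) \<and> cech1_cocycle F U W c \<longrightarrow>
        (\<exists>b. cech1_bounds F U W c b))"

text \<open>The Cech complex of the Godement sheaf is contracted by choosing a member of the covering
  around each point; the retraction carries the contraction over to the injective sheaf.\<close>

lemma injective_sheaf_cech1:
  fixes I :: "('x, ('x, 'a) resolution_type) group_presheaf"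
  assumes I: "injective_sheaf T I" and W: "\<And>k. k \<in> K \<Longrightarrow> openin T (W k)"
    and c: "cech1_cocycle I K W c"
  shows "\<exists>b. cech1_bounds I K W c b"
proof -
  interpret presheaf_of_groups T I
    using I abelian_sheafD(2) unfolding injective_sheaf_def by blast
  obtain r where r: "sheaf_morphism T (godement T I) I r"
    "\<And>U s. \<lbrakk>openin T U; s \<in> carrier (Sec I U)\<rbrakk> \<Longrightarrow> r U (\<lambda>x\<in>U. germ T I U s x) = s"
    by (rule injective_sheaf_retract_godement[OF I]) (rule that; assumption)
  obtain i where i: "\<And>w k. k \<in> K \<Longrightarrow> w \<in> W k \<Longrightarrow> i w \<in> K \<and> w \<in> W (i w)"
    by (rule that[of "\<lambda>w. SOME k. k \<in> K \<and> w \<in> W k"]) (metis (mono_tags, lifting) someI_ex)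
  have c_cl: "c k l \<in> carrier (Sec I (W k \<inter> W l))" if "k \<in> K" "l \<in> K" for k l
    using c that unfolding cech1_cocycle_def by blast
  \<comment> \<open>At the point \<open>w\<close> the contraction inserts the index
    \<open>i w\<close>. The cocycle condition for \<open>i w, k, l\<close> then is the bounding
    condition at \<open>w\<close>.\<close>
  define b where "b k = (\<lambda>w\<in>W k. germ T I (W (i w) \<inter> W k) (c (i w) k) w)" for k
  have b_cl: "b k \<in> carrier (Sec (godement T I) (W k))" if "k \<in> K" for k
    using i[OF that] W that c_cl by (auto simp: b_def godement_def intro!: germ_in_stalk)
  have b_eq: "germ_mult T I w (b k w) (germ T I (W k \<inter> W l) (c k l) w) = b l w"
    if kl: "k \<in> K" "l \<in> K" and w: "w \<in> W k" "w \<in> W l" for k l w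
  proof -
    let ?i = "i w" and ?Q = "W (i w) \<inter> W k \<inter> W l"
    have iw: "?i \<in> K" "w \<in> W ?i" using i kl w by auto
    have o: "openin T ?Q" "openin T (W ?i \<inter> W k)" "openin T (W k \<inter> W l)" "openin T (W ?i \<inter> W l)"
      using W iw kl by auto
    have g: "germ T I ?Q (Res I (W ?i \<inter> W k) ?Q (c ?i k)) w = germ T I (W ?i \<inter> W k) (c ?i k) w"
      "germ T I ?Q (Res I (W k \<inter> W l) ?Q (c k l)) w = germ T I (W k \<inter> W l) (c k l) w"
      "germ T I ?Q (Res I (W ?i \<inter> W l) ?Q (c ?i l)) w = germ T I (W ?i \<inter> W l) (c ?i l) w"
      by (rule germ_Res; use w iw kl o c_cl in auto)+
    have "germ_mult T I w (b k w) (germ T I (W k \<inter> W l) (c k l) w) =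
      germ_mult T I w (germ T I ?Q (Res I (W ?i \<inter> W k) ?Q (c ?i k)) w)
        (germ T I ?Q (Res I (W k \<inter> W l) ?Q (c k l)) w)"
      using w by (simp add: b_def g)
    also have "\<dots> = germ T I ?Q (Res I (W ?i \<inter> W k) ?Q (c ?i k) \<otimes>\<^bsub>Sec I ?Q\<^esub> Res I (W k \<inter> W l) ?Q (c k l)) w"
      using w iw kl o c_cl by (intro germ_mult_germ) (auto intro!: Res_closed)
    also have "\<dots> = germ T I ?Q (Res I (W ?i \<inter> W l) ?Q (c ?i l)) w"
      using c iw kl unfolding cech1_cocycle_def by simp
    also have "\<dots> = b l w"
      using w by (simp add: b_def g)
    finally show ?thesis .
  qed
  have "cech1_bounds I K W c (\<lambda>k. r (W k) (b k))"
    unfolding cech1_bounds_def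
  proof (intro conjI ballI)
    fix k assume "k \<in> K"
    then show "r (W k) (b k) \<in> carrier (Sec I (W k))"
      using sheaf_morphismD(2)[OF r(1) W b_cl] by simp
  next
    fix k l assume kl: "k \<in> K" "l \<in> K"
    let ?Q = "W k \<inter> W l"
    let ?c = "\<lambda>w\<in>?Q. germ T I ?Q (c k l) w"
    have o: "openin T (W k)" "openin T (W l)" "openin T ?Q" using W kl by auto
    have R: "Res (godement T I) (W k) ?Q (b k) \<in> carrier (Sec (godement T I) ?Q)"
      using b_cl[OF kl(1)] by (auto simp: godement_def PiE_iff)
    have "Res I (W k) ?Q (r (W k) (b k)) \<otimes>\<^bsub>Sec I ?Q\<^esub> c k l =
      r ?Q (Res (godement T I) (W k) ?Q (b k)) \<otimes>\<^bsub>Sec I ?Q\<^esub> r ?Q ?c"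
      using sheaf_morphismD(4)[OF r(1) o(1,3) _ b_cl[OF kl(1)]] r(2)[OF o(3) c_cl[OF kl]] by simp
    also have "\<dots> = r ?Q (Res (godement T I) (W k) ?Q (b k) \<otimes>\<^bsub>Sec (godement T I) ?Q\<^esub> ?c)"
      using sheaf_morphismD(3)[OF r(1) o(3) R germs_in_godement[OF o(3) c_cl[OF kl]]] by simp
    also have "Res (godement T I) (W k) ?Q (b k) \<otimes>\<^bsub>Sec (godement T I) ?Q\<^esub> ?c =
      Res (godement T I) (W l) ?Q (b l)"
      using b_eq[OF kl] by (auto simp: godement_def fun_eq_iff restrict_def)
    also have "r ?Q \<dots> = Res I (W l) ?Q (r (W l) (b l))"
      using sheaf_morphismD(4)[OF r(1) o(2,3) _ b_cl[OF kl(2)]] by simp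
    finally show "Res I (W k) ?Q (r (W k) (b k)) \<otimes>\<^bsub>Sec I ?Q\<^esub> c k l = Res I (W l) ?Q (r (W l) (b l))" .
  qed
  then show ?thesis by blast
qed

text \<open>The contraction of \<open>injective_sheaf_cech1\<close> with one more index:
  \<open>b k l\<close> takes at \<open>w\<close> the germ of \<open>c (i w) k l\<close>, and the
  cocycle condition for \<open>i w, k, l, m\<close> becomes the bounding condition once factors are
  commuted.\<close>

lemma injective_sheaf_cech2:
  fixes I :: "('x, ('x, 'a) resolution_type) group_presheaf"
  assumes I: "injective_sheaf T I" and W: "\<And>k. k \<in> K \<Longrightarrow> openin T (W k)"
    and c: "cech2_cocycle I K W c"
  shows "\<exists>b. cech2_bounds I K W c b"
proof -
  have ab: "abelian_sheaf T I" using I unfolding injective_sheaf_def by simp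
  interpret presheaf_of_groups T I using abelian_sheafD(2)[OF ab] .
  obtain r where r: "sheaf_morphism T (godement T I) I r"
    "\<And>U s. \<lbrakk>openin T U; s \<in> carrier (Sec I U)\<rbrakk> \<Longrightarrow> r U (\<lambda>x\<in>U. germ T I U s x) = s"
    by (rule injective_sheaf_retract_godement[OF I]) (rule that; assumption)
  obtain i where i: "\<And>w k. k \<in> K \<Longrightarrow> w \<in> W k \<Longrightarrow> i w \<in> K \<and> w \<in> W (i w)"
    by (rule that[of "\<lambda>w. SOME k. k \<in> K \<and> w \<in> W k"]) (metis (mono_tags, lifting) someI_ex)
  have c_cl: "c k l m \<in> carrier (Sec I (W k \<inter> W l \<inter> W m))" if "k \<in> K" "l \<in> K" "m \<in> K" for k l m
    using c that unfolding cech2_cocycle_def by blast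
  define b where "b k l = (\<lambda>w\<in>W k \<inter> W l. germ T I (W (i w) \<inter> W k \<inter> W l) (c (i w) k l) w)" for k l
  have b_cl: "b k l \<in> carrier (Sec (godement T I) (W k \<inter> W l))" if "k \<in> K" "l \<in> K" for k l
    using i[OF that(1)] W that c_cl by (auto simp: b_def godement_def intro!: germ_in_stalk)
  have b_eq: "germ_mult T I w (germ T I (W k \<inter> W l \<inter> W m) (c k l m) w) (b k m w) =
      germ_mult T I w (b k l w) (b l m w)"
    if klm: "k \<in> K" "l \<in> K" "m \<in> K" and w: "w \<in> W k" "w \<in> W l" "w \<in> W m" for k l m w
  proof -
    let ?i = "i w" and ?Q = "W (i w) \<inter> W k \<inter> W l \<inter> W m"
    have iw: "?i \<in> K" "w \<in> W ?i" using i klm w by auto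
    have o: "openin T (W k)" "openin T (W l)" "openin T (W m)" "openin T (W ?i)"
      using W iw klm by auto
    have g: "germ T I (W k' \<inter> W l' \<inter> W m') (c k' l' m') w =
        germ T I ?Q (Res I (W k' \<inter> W l' \<inter> W m') ?Q (c k' l' m')) w"
      and cl: "Res I (W k' \<inter> W l' \<inter> W m') ?Q (c k' l' m') \<in> carrier (Sec I ?Q)"
      if "k' \<in> {?i, k, l, m}" "l' \<in> {?i, k, l, m}" "m' \<in> {?i, k, l, m}" for k' l' m'
    proof -
      have m: "k' \<in> K" "l' \<in> K" "m' \<in> K" "?Q \<subseteq> W k' \<inter> W l' \<inter> W m'" "w \<in> ?Q"
        using that klm iw w by auto
      have o': "openin T (W k' \<inter> W l' \<inter> W m')" "openin T ?Q"
        using W m o by auto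
      show "germ T I (W k' \<inter> W l' \<inter> W m') (c k' l' m') w =
        germ T I ?Q (Res I (W k' \<inter> W l' \<inter> W m') ?Q (c k' l' m')) w"
        using germ_Res[OF o' m(4,5) c_cl[OF m(1-3)]] by simp
      show "Res I (W k' \<inter> W l' \<inter> W m') ?Q (c k' l' m') \<in> carrier (Sec I ?Q)"
        using Res_closed[OF o' m(4) c_cl[OF m(1-3)]] .
    qed
    have oQ: "openin T ?Q" "w \<in> ?Q" using o w iw by auto
    interpret Q: comm_group "Sec I ?Q" using abelian_sheafD(4)[OF ab oQ(1)] .
    have "Res I (W ?i \<inter> W l \<inter> W m) ?Q (c ?i l m) \<otimes>\<^bsub>Sec I ?Q\<^esub> Res I (W ?i \<inter> W k \<inter> W l) ?Q (c ?i k l) =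
        Res I (W ?i \<inter> W k \<inter> W m) ?Q (c ?i k m) \<otimes>\<^bsub>Sec I ?Q\<^esub> Res I (W k \<inter> W l \<inter> W m) ?Q (c k l m)"
      using c iw klm unfolding cech2_cocycle_def by (simp add: Let_def)
    moreover have "Res I (W ?i \<inter> W l \<inter> W m) ?Q (c ?i l m) \<otimes>\<^bsub>Sec I ?Q\<^esub> Res I (W ?i \<inter> W k \<inter> W l) ?Q (c ?i k l) =
        Res I (W ?i \<inter> W k \<inter> W l) ?Q (c ?i k l) \<otimes>\<^bsub>Sec I ?Q\<^esub> Res I (W ?i \<inter> W l \<inter> W m) ?Q (c ?i l m)"
      "Res I (W ?i \<inter> W k \<inter> W m) ?Q (c ?i k m) \<otimes>\<^bsub>Sec I ?Q\<^esub> Res I (W k \<inter> W l \<inter> W m) ?Q (c k l m) =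
        Res I (W k \<inter> W l \<inter> W m) ?Q (c k l m) \<otimes>\<^bsub>Sec I ?Q\<^esub> Res I (W ?i \<inter> W k \<inter> W m) ?Q (c ?i k m)"
      by (intro Q.m_comm cl; simp)+
    ultimately show ?thesis
      using w by (simp add: b_def g germ_mult_germ[OF oQ] cl)
  qed
  have "cech2_bounds I K W c (\<lambda>k l. r (W k \<inter> W l) (b k l))"
    unfolding cech2_bounds_def Let_def
  proof (intro conjI ballI)
    fix k l assume "k \<in> K" "l \<in> K"
    then show "r (W k \<inter> W l) (b k l) \<in> carrier (Sec I (W k \<inter> W l))"
      using sheaf_morphismD(2)[OF r(1) openin_Int b_cl] W by blast
  next
    fix k l m assume klm: "k \<in> K" "l \<in> K" "m \<in> K"
    let ?Q = "W k \<inter> W l \<inter> W m" and ?D = "godement T I"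
    let ?c = "\<lambda>w\<in>?Q. germ T I ?Q (c k l m) w"
    have o: "openin T (W k \<inter> W l)" "openin T (W l \<inter> W m)" "openin T (W k \<inter> W m)" "openin T ?Q"
      using W klm by auto
    have sub: "?Q \<subseteq> W k \<inter> W l" "?Q \<subseteq> W l \<inter> W m" "?Q \<subseteq> W k \<inter> W m" by auto
    have R: "Res ?D (W k \<inter> W l) ?Q (b k l) \<in> carrier (Sec ?D ?Q)"
      "Res ?D (W l \<inter> W m) ?Q (b l m) \<in> carrier (Sec ?D ?Q)"
      "Res ?D (W k \<inter> W m) ?Q (b k m) \<in> carrier (Sec ?D ?Q)"
      using b_cl[OF klm(1,2)] b_cl[OF klm(2,3)] b_cl[OF klm(1,3)] by (auto simp: godement_def PiE_iff)
    have rR: "Res I (W k \<inter> W l) ?Q (r (W k \<inter> W l) (b k l)) = r ?Q (Res ?D (W k \<inter> W l) ?Q (b k l))"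
      "Res I (W l \<inter> W m) ?Q (r (W l \<inter> W m) (b l m)) = r ?Q (Res ?D (W l \<inter> W m) ?Q (b l m))"
      "Res I (W k \<inter> W m) ?Q (r (W k \<inter> W m) (b k m)) = r ?Q (Res ?D (W k \<inter> W m) ?Q (b k m))"
      using sheaf_morphismD(4)[OF r(1) o(1,4) sub(1) b_cl[OF klm(1,2)]]
        sheaf_morphismD(4)[OF r(1) o(2,4) sub(2) b_cl[OF klm(2,3)]]
        sheaf_morphismD(4)[OF r(1) o(3,4) sub(3) b_cl[OF klm(1,3)]] by simp_all
    have "?c \<otimes>\<^bsub>Sec ?D ?Q\<^esub> Res ?D (W k \<inter> W m) ?Q (b k m) =
        Res ?D (W k \<inter> W l) ?Q (b k l) \<otimes>\<^bsub>Sec ?D ?Q\<^esub> Res ?D (W l \<inter> W m) ?Q (b l m)"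
      using b_eq[OF klm] by (auto simp: godement_def fun_eq_iff restrict_def)
    then have "r ?Q (?c \<otimes>\<^bsub>Sec ?D ?Q\<^esub> Res ?D (W k \<inter> W m) ?Q (b k m)) =
        r ?Q (Res ?D (W k \<inter> W l) ?Q (b k l) \<otimes>\<^bsub>Sec ?D ?Q\<^esub> Res ?D (W l \<inter> W m) ?Q (b l m))"
      by simp
    then show "c k l m \<otimes>\<^bsub>Sec I ?Q\<^esub> Res I (W k \<inter> W m) ?Q (r (W k \<inter> W m) (b k m)) =
        Res I (W k \<inter> W l) ?Q (r (W k \<inter> W l) (b k l)) \<otimes>\<^bsub>Sec I ?Q\<^esub>
          Res I (W l \<inter> W m) ?Q (r (W l \<inter> W m) (b l m))"
      using sheaf_morphismD(3)[OF r(1) o(4)] R germs_in_godement[OF o(4) c_cl[OF klm]]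
        r(2)[OF o(4) c_cl[OF klm]] rR by simp
  qed
  then show ?thesis by blast
qed

section \<open>Vanishing of derived functor cohomology implies vanishing of Cech cohomology\<close>

text \<open>The resolution lives in the type belonging to \<open>'a\<close>, which may differ from
  the type \<open>'b\<close> of the sections of \<open>F\<close>. This leaves room for a resolution
  borrowed from an isomorphic sheaf with sections of another type.\<close>

locale resolved_sheaf =
  fixes T :: "'x topology" and F :: "('x, 'b) group_presheaf" and \<epsilon>
    and I :: "nat \<Rightarrow> ('x, ('x, 'a) resolution_type) group_presheaf" and d
  assumes abelian: "abelian_sheaf T F" and resolution: "injective_resolution T F \<epsilon> I d"
begin

lemma injective: "injective_sheaf T (I n)"
  and \<epsilon>_mor: "sheaf_morphism T F (I 0) \<epsilon>"
  and d_mor: "sheaf_morphism T (I n) (I (Suc n)) (d n)"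
  and \<epsilon>_inj: "openin T U \<Longrightarrow> inj_on (\<epsilon> U) (carrier (Sec F U))"
  and exact_0: "exact_at T F (I 0) (I (Suc 0)) \<epsilon> (d 0)"
  and exact_Suc: "exact_at T (I n) (I (Suc n)) (I (Suc (Suc n))) (d n) (d (Suc n))"
  using resolution unfolding injective_resolution_def by simp_all

lemma abelian_I: "abelian_sheaf T (I n)"
  using injective unfolding injective_sheaf_def by blast

sublocale F: presheaf_of_groups T F using abelian_sheafD(2)[OF abelian] .
sublocale I: presheaf_of_groups T "I n" for n using abelian_sheafD(2)[OF abelian_I] .

lemmas \<epsilon>_closed = sheaf_morphismD(2)[OF \<epsilon>_mor] and d_closed = sheaf_morphismD(2)[OF d_mor]
  and \<epsilon>_mult = sheaf_morphismD(3)[OF \<epsilon>_mor] and d_mult = sheaf_morphismD(3)[OF d_mor]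
  and \<epsilon>_Res = sheaf_morphismD(4)[OF \<epsilon>_mor] and d_Res = sheaf_morphismD(4)[OF d_mor]
  and comm_F = abelian_sheafD(4)[OF abelian] and comm_I = abelian_sheafD(4)[OF abelian_I]

lemma d_inv:
  assumes "openin T U" "s \<in> carrier (Sec (I n) U)"
  shows "d n U (inv\<^bsub>Sec (I n) U\<^esub> s) = inv\<^bsub>Sec (I (Suc n)) U\<^esub> (d n U s)"
  using assms sheaf_morphismD(1)[OF d_mor] I.group_Sec
  by (simp add: group_hom.hom_inv group_hom.intro group_hom_axioms.intro)

lemma d_\<epsilon>:
  assumes U: "openin T U" "s \<in> carrier (Sec F U)"
  shows "d 0 U (\<epsilon> U s) = \<one>\<^bsub>Sec (I (Suc 0)) U\<^esub>"
proof -
  have "\<epsilon> U s \<in> kernel (Sec (I 0) U) (Sec (I (Suc 0)) U) (d 0 U)"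
    unfolding exact_0[unfolded exact_at_def, rule_format, OF U(1)]
    using U \<epsilon>_closed[OF U] I.Res_self[OF U(1) \<epsilon>_closed[OF U]] by (auto intro!: exI[of _ U])
  then show ?thesis by (simp add: kernel_def)
qed

lemma d_d:
  assumes U: "openin T U" "s \<in> carrier (Sec (I n) U)"
  shows "d (Suc n) U (d n U s) = \<one>\<^bsub>Sec (I (Suc (Suc n))) U\<^esub>"
proof -
  have "d n U s \<in> kernel (Sec (I (Suc n)) U) (Sec (I (Suc (Suc n))) U) (d (Suc n) U)"
    unfolding exact_Suc[unfolded exact_at_def, rule_format, OF U(1)]
    using U d_closed[OF U] I.Res_self[OF U(1) d_closed[OF U]] by (auto intro!: exI[of _ U])
  then show ?thesis by (simp add: kernel_def)
qed

lemma d_kernel_local: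
  assumes U: "openin T U" "s \<in> carrier (Sec (I (Suc n)) U)" "d (Suc n) U s = \<one>\<^bsub>Sec (I (Suc (Suc n))) U\<^esub>"
    and x: "x \<in> U"
  shows "\<exists>V t. openin T V \<and> x \<in> V \<and> V \<subseteq> U \<and> t \<in> carrier (Sec (I n) V) \<and> d n V t = Res (I (Suc n)) U V s"
proof -
  have "s \<in> kernel (Sec (I (Suc n)) U) (Sec (I (Suc (Suc n))) U) (d (Suc n) U)"
    using U by (simp add: kernel_def)
  then show ?thesis
    unfolding exact_Suc[unfolded exact_at_def, rule_format, OF U(1)] using x by fastforce
qed

text \<open>Left exactness of taking sections: local preimages under \<open>\<epsilon>\<close> agree
  on overlaps because \<open>\<epsilon>\<close> is injective, hence they glue.\<close>

lemma d_kernel_0: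
  assumes U: "openin T U" "s \<in> carrier (Sec (I 0) U)" "d 0 U s = \<one>\<^bsub>Sec (I (Suc 0)) U\<^esub>"
  shows "\<exists>t\<in>carrier (Sec F U). \<epsilon> U t = s"
proof -
  have "s \<in> kernel (Sec (I 0) U) (Sec (I (Suc 0)) U) (d 0 U)"
    using U by (simp add: kernel_def)
  then have "\<forall>x\<in>U. \<exists>V t. openin T V \<and> x \<in> V \<and> V \<subseteq> U \<and> t \<in> carrier (Sec F V) \<and> Res (I 0) U V s = \<epsilon> V t"
    unfolding exact_0[unfolded exact_at_def, rule_format, OF U(1)] by fastforce
  then obtain W f where W: "\<And>x. x \<in> U \<Longrightarrow> openin T (W x)" "\<And>x. x \<in> U \<Longrightarrow> x \<in> W x"
      "\<And>x. x \<in> U \<Longrightarrow> W x \<subseteq> U"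
    and f: "\<And>x. x \<in> U \<Longrightarrow> f x \<in> carrier (Sec F (W x))"
      "\<And>x. x \<in> U \<Longrightarrow> Res (I 0) U (W x) s = \<epsilon> (W x) (f x)"
    by metis
  have UW: "U = (\<Union>x\<in>U. W x)" using W by blast
  have "Res F (W x) (W x \<inter> W y) (f x) = Res F (W y) (W x \<inter> W y) (f y)" if "x \<in> U" "y \<in> U" for x y
  proof -
    have o: "openin T (W x)" "openin T (W y)" "openin T (W x \<inter> W y)" "W x \<subseteq> U" "W y \<subseteq> U" using W that by auto
    have "\<epsilon> (W x \<inter> W y) (Res F (W x) (W x \<inter> W y) (f x)) = \<epsilon> (W x \<inter> W y) (Res F (W y) (W x \<inter> W y) (f y))"
      using \<epsilon>_Res[OF o(1,3) _ f(1)[OF that(1)]] \<epsilon>_Res[OF o(2,3) _ f(1)[OF that(2)]]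
        f(2)[OF that(1), symmetric] f(2)[OF that(2), symmetric] U o I.Res_Res[of U "W x" "W x \<inter> W y" s 0]
        I.Res_Res[of U "W y" "W x \<inter> W y" s 0] by simp
    then show ?thesis
      using inj_onD[OF \<epsilon>_inj[OF o(3)]] F.Res_closed o f that by simp
  qed
  then obtain t where t: "t \<in> carrier (Sec F U)" "\<And>x. x \<in> U \<Longrightarrow> Res F U (W x) t = f x"
    using sheaf_of_sets_glue[OF abelian_sheafD(3)[OF abelian], of U W U f] W(1) UW f(1) by blast
  have "\<epsilon> U t = s"
  proof (rule sheaf_of_sets_eqI[OF abelian_sheafD(3)[OF abelian_I] U(1) _ U(2)])
    show "\<exists>V. openin T V \<and> x \<in> V \<and> V \<subseteq> U \<and> Res (I 0) U V (\<epsilon> U t) = Res (I 0) U V s" if "x \<in> U" for x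
      using W[OF that] \<epsilon>_Res[OF U(1) W(1,3)[OF that] t(1)] t(2)[OF that] f(2)[OF that] by auto
  qed (use \<epsilon>_closed U t in auto)
  then show ?thesis using t by blast
qed

text \<open>A trivial factor group has the subgroup \<open>?B\<close> of boundaries as its only
  coset, and the coset of \<open>s\<close> contains \<open>s\<close> because \<open>?B\<close>
  contains the unit.\<close>

lemma trivial_cohomologyD:
  assumes H: "trivial_group (section_cohomology I d U (Suc n))" and U: "openin T U"
    and s: "s \<in> carrier (Sec (I (Suc n)) U)" "d (Suc n) U s = \<one>\<^bsub>Sec (I (Suc (Suc n))) U\<^esub>"
  shows "\<exists>t\<in>carrier (Sec (I n) U). d n U t = s"
proof -
  let ?B = "d n U ` carrier (Sec (I n) U)"
  let ?Z = "(Sec (I (Suc n)) U)\<lparr>carrier := kernel (Sec (I (Suc n)) U) (Sec (I (Suc (Suc n))) U) (d (Suc n) U)\<rparr>"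
  have "carrier (?Z Mod ?B) = {?B}"
    using H unfolding trivial_group_def section_cohomology_def by simp
  moreover have "?B #>\<^bsub>?Z\<^esub> s \<in> carrier (?Z Mod ?B)"
    unfolding carrier_FactGroup using s by (auto simp: kernel_def)
  ultimately have "?B #>\<^bsub>?Z\<^esub> s = ?B" by blast
  moreover interpret group "Sec (I n) U" using I.group_Sec[OF U] .
  interpret J: group "Sec (I (Suc n)) U" using I.group_Sec[OF U] .
  have "d n U \<one>\<^bsub>Sec (I n) U\<^esub> = \<one>\<^bsub>Sec (I (Suc n)) U\<^esub>"
    using hom_one[OF sheaf_morphismD(1)[OF d_mor U]] is_group J.is_group by simp
  then have "\<one>\<^bsub>Sec (I (Suc n)) U\<^esub> \<in> ?B" by (metis one_closed imageI)
  then have "s \<in> ?B #>\<^bsub>?Z\<^esub> s"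
    unfolding r_coset_def by (rule UN_I) (use s in simp)
  ultimately show ?thesis by auto
qed

end

lemma (in group) m_inv_cancel_left:
  "\<lbrakk>x \<in> carrier G; y \<in> carrier G\<rbrakk> \<Longrightarrow> x \<otimes> (inv x \<otimes> y) = y"
  "\<lbrakk>x \<in> carrier G; y \<in> carrier G\<rbrakk> \<Longrightarrow> inv x \<otimes> (x \<otimes> y) = y"
  by (simp_all flip: m_assoc)

section \<open>Dimension shifting along an injective resolution\<close>

context resolved_sheaf
begin

text \<open>In \<open>I 0\<close> the cocycle is bounded by some \<open>b\<close>. The sections
  \<open>d 0 (b k)\<close> glue to a closed global section \<open>z\<close>, which is
  \<open>d 0 w\<close> for a global \<open>w\<close> since H^1 vanishes. Dividing every
  \<open>b k\<close> by \<open>w\<close> makes it closed, so that it comes from \<open>F\<close>,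
  and does not change the coboundary.\<close>

lemma cech1_of_cohomology:
  assumes H: "trivial_group (section_cohomology I d U 1)" and U: "openin T U"
    and W: "\<And>k. k \<in> K \<Longrightarrow> openin T (W k)" "U = (\<Union>k\<in>K. W k)" and c: "cech1_cocycle F K W c"
  shows "\<exists>b. cech1_bounds F K W c b"
proof -
  have sub: "W k \<subseteq> U" if "k \<in> K" for k using that W(2) by auto
  have c_cl: "c k l \<in> carrier (Sec F (W k \<inter> W l))" if "k \<in> K" "l \<in> K" for k l
    using c that unfolding cech1_cocycle_def by blast
  have oW: "openin T (W k \<inter> W l)" if "k \<in> K" "l \<in> K" for k l using W that by auto
  have "cech1_cocycle (I 0) K W (\<lambda>k l. \<epsilon> (W k \<inter> W l) (c k l))"
    unfolding cech1_cocycle_def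
  proof (intro conjI ballI)
    fix k l assume "k \<in> K" "l \<in> K"
    then show "\<epsilon> (W k \<inter> W l) (c k l) \<in> carrier (Sec (I 0) (W k \<inter> W l))"
      using \<epsilon>_closed[OF oW] c_cl by blast
  next
    fix k l m assume klm: "k \<in> K" "l \<in> K" "m \<in> K"
    let ?Q = "W k \<inter> W l \<inter> W m"
    have s: "?Q \<subseteq> W k \<inter> W l" "?Q \<subseteq> W l \<inter> W m" "?Q \<subseteq> W k \<inter> W m" and oQ: "openin T ?Q"
      using W klm by auto
    note R = F.Res_closed[OF oW oQ]
    have "\<epsilon> ?Q (Res F (W k \<inter> W l) ?Q (c k l) \<otimes>\<^bsub>Sec F ?Q\<^esub> Res F (W l \<inter> W m) ?Q (c l m)) =
        \<epsilon> ?Q (Res F (W k \<inter> W m) ?Q (c k m))"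
      using c klm unfolding cech1_cocycle_def by simp
    then show "Res (I 0) (W k \<inter> W l) ?Q (\<epsilon> (W k \<inter> W l) (c k l)) \<otimes>\<^bsub>Sec (I 0) ?Q\<^esub>
          Res (I 0) (W l \<inter> W m) ?Q (\<epsilon> (W l \<inter> W m) (c l m)) =
        Res (I 0) (W k \<inter> W m) ?Q (\<epsilon> (W k \<inter> W m) (c k m))"
      using \<epsilon>_mult[OF oQ R[OF klm(1,2) s(1) c_cl[OF klm(1,2)]] R[OF klm(2,3) s(2) c_cl[OF klm(2,3)]]]
        \<epsilon>_Res[OF oW oQ s(1) c_cl, OF klm(1,2) klm(1,2)] \<epsilon>_Res[OF oW oQ s(2) c_cl, OF klm(2,3) klm(2,3)]
        \<epsilon>_Res[OF oW oQ s(3) c_cl, OF klm(1,3) klm(1,3)]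
      by simp
  qed
  from injective_sheaf_cech1[OF injective W(1) this] obtain b
    where b: "\<And>k. k \<in> K \<Longrightarrow> b k \<in> carrier (Sec (I 0) (W k))"
      "\<And>k l. k \<in> K \<Longrightarrow> l \<in> K \<Longrightarrow> Res (I 0) (W k) (W k \<inter> W l) (b k) \<otimes>\<^bsub>Sec (I 0) (W k \<inter> W l)\<^esub>
        \<epsilon> (W k \<inter> W l) (c k l) = Res (I 0) (W l) (W k \<inter> W l) (b l)"
    unfolding cech1_bounds_def by blast
  have Rb: "Res (I 0) (W k) (W k \<inter> W l) (b k) \<in> carrier (Sec (I 0) (W k \<inter> W l))"
    "Res (I 0) (W l) (W k \<inter> W l) (b l) \<in> carrier (Sec (I 0) (W k \<inter> W l))" if "k \<in> K" "l \<in> K" for k l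
    using I.Res_closed[OF W(1) oW _ b(1)] that by auto
  \<comment> \<open>Over an overlap \<open>b k\<close> and \<open>b l\<close> differ by a section
    from \<open>F\<close>, which \<open>d 0\<close> kills.\<close>
  have "Res (I 1) (W k) (W k \<inter> W l) (d 0 (W k) (b k)) = Res (I 1) (W l) (W k \<inter> W l) (d 0 (W l) (b l))"
    if kl: "k \<in> K" "l \<in> K" for k l
  proof -
    let ?Q = "W k \<inter> W l"
    have oQ: "openin T ?Q" using oW kl .
    interpret Q: comm_group "Sec (I (Suc 0)) ?Q" using comm_I[OF oQ] .
    have "d 0 ?Q (Res (I 0) (W l) ?Q (b l)) =
        d 0 ?Q (Res (I 0) (W k) ?Q (b k)) \<otimes>\<^bsub>Sec (I 1) ?Q\<^esub> d 0 ?Q (\<epsilon> ?Q (c k l))"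
      using b(2)[OF kl, symmetric] d_mult[OF oQ Rb(1)[OF kl] \<epsilon>_closed[OF oQ c_cl[OF kl]]] by simp
    also have "\<dots> = d 0 ?Q (Res (I 0) (W k) ?Q (b k))"
      using d_\<epsilon>[OF oQ c_cl[OF kl]] d_closed[OF oQ Rb(1)[OF kl]] by simp
    finally show ?thesis
      using d_Res[OF W(1) oQ _ b(1)] kl by simp
  qed
  then obtain z where z: "z \<in> carrier (Sec (I 1) U)" "\<And>k. k \<in> K \<Longrightarrow> Res (I 1) U (W k) z = d 0 (W k) (b k)"
    using sheaf_of_sets_glue[OF abelian_sheafD(3)[OF abelian_I[of 1]] W(1) W(2), of "\<lambda>k. d 0 (W k) (b k)"]
      d_closed[OF W(1) b(1)] by auto
  have "d 1 U z = \<one>\<^bsub>Sec (I 2) U\<^esub>"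
  proof (rule sheaf_of_sets_eqI[OF abelian_sheafD(3)[OF abelian_I[of 2]] U])
    show "d 1 U z \<in> carrier (Sec (I 2) U)" using d_closed[OF U, of z 1] z(1) by (simp add: numeral_2_eq_2)
    show "\<one>\<^bsub>Sec (I 2) U\<^esub> \<in> carrier (Sec (I 2) U)" using I.group_Sec[OF U] by (simp add: group.is_monoid)
    fix x assume "x \<in> U"
    then obtain k where k: "k \<in> K" "x \<in> W k" using W(2) by auto
    have "Res (I 2) U (W k) (d 1 U z) = \<one>\<^bsub>Sec (I 2) (W k)\<^esub>"
      using d_Res[OF U W(1)[OF k(1)] sub[OF k(1)], of z 1] z d_d[OF W(1) b(1)] k by (simp add: numeral_2_eq_2)
    then show "\<exists>V. openin T V \<and> x \<in> V \<and> V \<subseteq> U \<and> Res (I 2) U V (d 1 U z) = Res (I 2) U V \<one>\<^bsub>Sec (I 2) U\<^esub>"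
      using k W(1) sub I.Res_one[OF U W(1)[OF k(1)] sub[OF k(1)]] by (intro exI[of _ "W k"]) simp
  qed
  with trivial_cohomologyD[of U 0 z] H U z obtain w where w: "w \<in> carrier (Sec (I 0) U)" "d 0 U w = z"
    by (auto simp: numeral_2_eq_2)
  have Rw: "Res (I 0) U (W k) w \<in> carrier (Sec (I 0) (W k))" if "k \<in> K" for k
    using I.Res_closed[OF U W(1)[OF that] sub[OF that] w(1)] .
  \<comment> \<open>The same global section \<open>w\<close> is divided out for all
    \<open>k\<close>, hence cancels between \<open>e k\<close> and \<open>e l\<close>.\<close>
  define e where "e k = b k \<otimes>\<^bsub>Sec (I 0) (W k)\<^esub> inv\<^bsub>Sec (I 0) (W k)\<^esub> Res (I 0) U (W k) w" for k
  have "\<exists>f\<in>carrier (Sec F (W k)). \<epsilon> (W k) f = e k" if k: "k \<in> K" for k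
  proof (rule d_kernel_0[OF W(1)[OF k]])
    interpret J: comm_group "Sec (I 0) (W k)" using comm_I[OF W(1)[OF k]] .
    interpret J1: comm_group "Sec (I (Suc 0)) (W k)" using comm_I[OF W(1)[OF k]] .
    show "e k \<in> carrier (Sec (I 0) (W k))" unfolding e_def using b(1)[OF k] Rw[OF k] by simp
    have "d 0 (W k) (Res (I 0) U (W k) w) = d 0 (W k) (b k)"
      using d_Res[OF U W(1)[OF k] sub[OF k] w(1)] w(2) z(2)[OF k] by simp
    then show "d 0 (W k) (e k) = \<one>\<^bsub>Sec (I (Suc 0)) (W k)\<^esub>"
      unfolding e_def using d_mult[OF W(1)[OF k] b(1)[OF k], of "inv\<^bsub>Sec (I 0) (W k)\<^esub> Res (I 0) U (W k) w"]
        d_inv[OF W(1)[OF k] Rw[OF k]] d_closed[OF W(1)[OF k] b(1)[OF k]] Rw[OF k]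
      by simp
  qed
  then obtain f where f: "\<And>k. k \<in> K \<Longrightarrow> f k \<in> carrier (Sec F (W k))" "\<And>k. k \<in> K \<Longrightarrow> \<epsilon> (W k) (f k) = e k"
    by metis
  have "cech1_bounds F K W c f"
    unfolding cech1_bounds_def
  proof (intro conjI ballI)
    fix k l assume kl: "k \<in> K" "l \<in> K"
    let ?Q = "W k \<inter> W l"
    have oQ: "openin T ?Q" and s: "?Q \<subseteq> W k" "?Q \<subseteq> W l" using oW kl by auto
    interpret Q: comm_group "Sec (I 0) ?Q" using comm_I[OF oQ] .
    interpret FQ: comm_group "Sec F ?Q" using comm_F[OF oQ] .
    have w': "Res (I 0) U ?Q w \<in> carrier (Sec (I 0) ?Q)"
      using I.Res_closed[OF U oQ _ w(1)] s sub[OF kl(1)] by auto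
    have e: "\<epsilon> ?Q (Res F (W n) ?Q (f n)) = Res (I 0) (W n) ?Q (b n) \<otimes>\<^bsub>Sec (I 0) ?Q\<^esub> inv\<^bsub>Sec (I 0) ?Q\<^esub> Res (I 0) U ?Q w"
      if n: "n \<in> K" "?Q \<subseteq> W n" for n
    proof -
      interpret N: comm_group "Sec (I 0) (W n)" using comm_I[OF W(1)[OF n(1)]] .
      show ?thesis
        using \<epsilon>_Res[OF W(1)[OF n(1)] oQ n(2) f(1)[OF n(1)]] f(2)[OF n(1)]
          I.Res_mult[OF W(1)[OF n(1)] oQ n(2) b(1)[OF n(1)] N.inv_closed[OF Rw[OF n(1)]]]
          I.Res_inv[OF W(1)[OF n(1)] oQ n(2) Rw[OF n(1)]]
          I.Res_Res[OF U W(1)[OF n(1)] oQ sub[OF n(1)] n(2) w(1)]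
        by (simp add: e_def)
    qed
    have Rf: "Res F (W k) ?Q (f k) \<in> carrier (Sec F ?Q)" "Res F (W l) ?Q (f l) \<in> carrier (Sec F ?Q)"
      using F.Res_closed[OF W(1) oQ _ f(1)] kl by auto
    have "\<epsilon> ?Q (Res F (W k) ?Q (f k) \<otimes>\<^bsub>Sec F ?Q\<^esub> c k l) =
        (Res (I 0) (W k) ?Q (b k) \<otimes>\<^bsub>Sec (I 0) ?Q\<^esub> inv\<^bsub>Sec (I 0) ?Q\<^esub> Res (I 0) U ?Q w) \<otimes>\<^bsub>Sec (I 0) ?Q\<^esub> \<epsilon> ?Q (c k l)"
      using \<epsilon>_mult[OF oQ Rf(1) c_cl[OF kl]] e[OF kl(1) s(1)] by simp
    also have "\<dots> = (Res (I 0) (W k) ?Q (b k) \<otimes>\<^bsub>Sec (I 0) ?Q\<^esub> \<epsilon> ?Q (c k l)) \<otimes>\<^bsub>Sec (I 0) ?Q\<^esub> inv\<^bsub>Sec (I 0) ?Q\<^esub> Res (I 0) U ?Q w"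
      using Rb(1)[OF kl] w' \<epsilon>_closed[OF oQ c_cl[OF kl]] by (simp add: Q.m_ac)
    also have "\<dots> = \<epsilon> ?Q (Res F (W l) ?Q (f l))"
      using e[OF kl(2) s(2)] b(2)[OF kl] by simp
    finally show "Res F (W k) ?Q (f k) \<otimes>\<^bsub>Sec F ?Q\<^esub> c k l = Res F (W l) ?Q (f l)"
      using inj_onD[OF \<epsilon>_inj[OF oQ]] Rf c_cl[OF kl] by simp
  qed (use f in blast)
  then show ?thesis by blast
qed

text \<open>Local lifts of \<open>s\<close> to \<open>I 0\<close> exist by exactness, and their
  quotients form a Cech 1-cocycle of \<open>F\<close>. The sections bounding it correct the lifts so
  that they glue; a correction from \<open>F\<close> does not affect the image under
  \<open>d 0\<close>.\<close>

lemma d_kernel_1_lift: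
  assumes triv: "cech1_trivial T U F" and U: "openin T U"
    and s: "s \<in> carrier (Sec (I 1) U)" "d 1 U s = \<one>\<^bsub>Sec (I 2) U\<^esub>"
  shows "\<exists>t\<in>carrier (Sec (I 0) U). d 0 U t = s"
proof -
  have "\<exists>V t. openin T V \<and> x \<in> V \<and> V \<subseteq> U \<and> t \<in> carrier (Sec (I 0) V) \<and> d 0 V t = Res (I 1) U V s"
    if "x \<in> U" for x
    using d_kernel_local[of U s 0 x] U s that by (simp add: numeral_2_eq_2)
  then obtain W e where W: "\<And>x. x \<in> U \<Longrightarrow> openin T (W x)" "\<And>x. x \<in> U \<Longrightarrow> x \<in> W x" "\<And>x. x \<in> U \<Longrightarrow> W x \<subseteq> U"
    and e: "\<And>x. x \<in> U \<Longrightarrow> e x \<in> carrier (Sec (I 0) (W x))" "\<And>x. x \<in> U \<Longrightarrow> d 0 (W x) (e x) = Res (I 1) U (W x) s"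
    by metis
  have UW: "U = (\<Union>x\<in>U. W x)" using W by blast
  have Re: "Res (I 0) (W x) Q (e x) \<in> carrier (Sec (I 0) Q)" if "x \<in> U" "openin T Q" "Q \<subseteq> W x" for x Q
    using I.Res_closed[OF W(1) that(2,3) e(1)] that by simp
  have dRe: "d 0 Q (Res (I 0) (W x) Q (e x)) = Res (I 1) U Q s" if "x \<in> U" "openin T Q" "Q \<subseteq> W x" for x Q
    using d_Res[OF W(1)[OF that(1)] that(2,3) e(1)[OF that(1)]] e(2)[OF that(1)]
      I.Res_Res[OF U W(1)[OF that(1)] that(2) W(3)[OF that(1)] that(3) s(1)] by simp
  have "\<exists>f\<in>carrier (Sec F (W x \<inter> W y)). \<epsilon> (W x \<inter> W y) f =
      inv\<^bsub>Sec (I 0) (W x \<inter> W y)\<^esub> Res (I 0) (W x) (W x \<inter> W y) (e x) \<otimes>\<^bsub>Sec (I 0) (W x \<inter> W y)\<^esub>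
        Res (I 0) (W y) (W x \<inter> W y) (e y)" if xy: "x \<in> U" "y \<in> U" for x y
  proof (rule d_kernel_0)
    let ?Q = "W x \<inter> W y"
    show oQ: "openin T ?Q" using W xy by auto
    interpret J: comm_group "Sec (I 0) ?Q" using comm_I[OF oQ] .
    interpret J1: comm_group "Sec (I (Suc 0)) ?Q" using comm_I[OF oQ] .
    have R: "Res (I 0) (W x) ?Q (e x) \<in> carrier (Sec (I 0) ?Q)" "Res (I 0) (W y) ?Q (e y) \<in> carrier (Sec (I 0) ?Q)"
      using Re xy oQ by auto
    show "inv\<^bsub>Sec (I 0) ?Q\<^esub> Res (I 0) (W x) ?Q (e x) \<otimes>\<^bsub>Sec (I 0) ?Q\<^esub> Res (I 0) (W y) ?Q (e y) \<in> carrier (Sec (I 0) ?Q)"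
      using R by simp
    have "d 0 ?Q (Res (I 0) (W x) ?Q (e x)) = d 0 ?Q (Res (I 0) (W y) ?Q (e y))"
      using dRe[OF xy(1) oQ] dRe[OF xy(2) oQ] by simp
    then show "d 0 ?Q (inv\<^bsub>Sec (I 0) ?Q\<^esub> Res (I 0) (W x) ?Q (e x) \<otimes>\<^bsub>Sec (I 0) ?Q\<^esub> Res (I 0) (W y) ?Q (e y))
        = \<one>\<^bsub>Sec (I (Suc 0)) ?Q\<^esub>"
      using d_mult[OF oQ J.inv_closed[OF R(1)] R(2)] d_inv[OF oQ R(1)] d_closed[OF oQ R(2)] by simp
  qed
  then obtain c where c: "\<And>x y. x \<in> U \<Longrightarrow> y \<in> U \<Longrightarrow> c x y \<in> carrier (Sec F (W x \<inter> W y))"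
    "\<And>x y. x \<in> U \<Longrightarrow> y \<in> U \<Longrightarrow> \<epsilon> (W x \<inter> W y) (c x y) =
      inv\<^bsub>Sec (I 0) (W x \<inter> W y)\<^esub> Res (I 0) (W x) (W x \<inter> W y) (e x) \<otimes>\<^bsub>Sec (I 0) (W x \<inter> W y)\<^esub>
        Res (I 0) (W y) (W x \<inter> W y) (e y)"
    by metis
  have oW: "openin T (W x \<inter> W y)" if "x \<in> U" "y \<in> U" for x y using W that by auto
  have \<epsilon>Rc: "\<epsilon> Q (Res F (W x \<inter> W y) Q (c x y)) =
      inv\<^bsub>Sec (I 0) Q\<^esub> Res (I 0) (W x) Q (e x) \<otimes>\<^bsub>Sec (I 0) Q\<^esub> Res (I 0) (W y) Q (e y)"
    if xy: "x \<in> U" "y \<in> U" and Q: "openin T Q" "Q \<subseteq> W x \<inter> W y" for x y Q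
  proof -
    let ?Q = "W x \<inter> W y"
    interpret J: comm_group "Sec (I 0) ?Q" using comm_I[OF oW[OF xy]] .
    have s: "?Q \<subseteq> W x" "?Q \<subseteq> W y" by auto
    have R: "Res (I 0) (W x) ?Q (e x) \<in> carrier (Sec (I 0) ?Q)" "Res (I 0) (W y) ?Q (e y) \<in> carrier (Sec (I 0) ?Q)"
      using Re xy oW by auto
    show ?thesis
      using \<epsilon>_Res[OF oW[OF xy] Q c(1)[OF xy]] c(2)[OF xy] I.Res_mult[OF oW[OF xy] Q J.inv_closed[OF R(1)] R(2)]
        I.Res_inv[OF oW[OF xy] Q R(1)] I.Res_Res[OF W(1)[OF xy(1)] oW[OF xy] Q(1) s(1) Q(2) e(1)[OF xy(1)]]
        I.Res_Res[OF W(1)[OF xy(2)] oW[OF xy] Q(1) s(2) Q(2) e(1)[OF xy(2)]]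
      by simp
  qed
  have "cech1_cocycle F U W c"
    unfolding cech1_cocycle_def
  proof (intro conjI ballI)
    fix x y z assume xyz: "x \<in> U" "y \<in> U" "z \<in> U"
    let ?Q = "W x \<inter> W y \<inter> W z"
    have s: "?Q \<subseteq> W x \<inter> W y" "?Q \<subseteq> W y \<inter> W z" "?Q \<subseteq> W x \<inter> W z" and oQ: "openin T ?Q"
      using W xyz by auto
    interpret J: comm_group "Sec (I 0) ?Q" using comm_I[OF oQ] .
    interpret FQ: comm_group "Sec F ?Q" using comm_F[OF oQ] .
    have R: "Res (I 0) (W x) ?Q (e x) \<in> carrier (Sec (I 0) ?Q)" "Res (I 0) (W y) ?Q (e y) \<in> carrier (Sec (I 0) ?Q)"
      "Res (I 0) (W z) ?Q (e z) \<in> carrier (Sec (I 0) ?Q)"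
      using Re xyz oQ by auto
    have Rc: "Res F (W x \<inter> W y) ?Q (c x y) \<in> carrier (Sec F ?Q)" "Res F (W y \<inter> W z) ?Q (c y z) \<in> carrier (Sec F ?Q)"
      "Res F (W x \<inter> W z) ?Q (c x z) \<in> carrier (Sec F ?Q)"
      using F.Res_closed[OF oW oQ _ c(1)] s xyz by auto
    have "\<epsilon> ?Q (Res F (W x \<inter> W y) ?Q (c x y) \<otimes>\<^bsub>Sec F ?Q\<^esub> Res F (W y \<inter> W z) ?Q (c y z)) =
        \<epsilon> ?Q (Res F (W x \<inter> W z) ?Q (c x z))"
      using \<epsilon>_mult[OF oQ Rc(1,2)] \<epsilon>Rc[OF xyz(1,2) oQ s(1)] \<epsilon>Rc[OF xyz(2,3) oQ s(2)]
        \<epsilon>Rc[OF xyz(1,3) oQ s(3)] R by (simp add: J.m_assoc J.m_inv_cancel_left)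
    then show "Res F (W x \<inter> W y) ?Q (c x y) \<otimes>\<^bsub>Sec F ?Q\<^esub> Res F (W y \<inter> W z) ?Q (c y z) = Res F (W x \<inter> W z) ?Q (c x z)"
      using inj_onD[OF \<epsilon>_inj[OF oQ]] Rc by simp
  qed (use c in blast)
  moreover have "\<forall>x\<in>U. openin T (W x) \<and> x \<in> W x \<and> W x \<subseteq> U" using W by blast
  ultimately obtain b where b: "\<And>x. x \<in> U \<Longrightarrow> b x \<in> carrier (Sec F (W x))"
    "\<And>x y. x \<in> U \<Longrightarrow> y \<in> U \<Longrightarrow> Res F (W x) (W x \<inter> W y) (b x) \<otimes>\<^bsub>Sec F (W x \<inter> W y)\<^esub> c x y =
        Res F (W y) (W x \<inter> W y) (b y)"
    using triv unfolding cech1_trivial_def cech1_bounds_def by metis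
  \<comment> \<open>Since \<open>b y = b x * (inverse of e x) * e y\<close> over an overlap, the
    quotients of \<open>e\<close> by \<open>b\<close> agree there.\<close>
  define e' where "e' x = e x \<otimes>\<^bsub>Sec (I 0) (W x)\<^esub> inv\<^bsub>Sec (I 0) (W x)\<^esub> \<epsilon> (W x) (b x)" for x
  have e'_cl: "e' x \<in> carrier (Sec (I 0) (W x))" if x: "x \<in> U" for x
  proof -
    interpret J: comm_group "Sec (I 0) (W x)" using comm_I[OF W(1)[OF x]] .
    show ?thesis unfolding e'_def using e(1)[OF x] \<epsilon>_closed[OF W(1)[OF x] b(1)[OF x]] by simp
  qed
  have Re': "Res (I 0) (W x) Q (e' x) =
      Res (I 0) (W x) Q (e x) \<otimes>\<^bsub>Sec (I 0) Q\<^esub> inv\<^bsub>Sec (I 0) Q\<^esub> \<epsilon> Q (Res F (W x) Q (b x))"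
    if x: "x \<in> U" and Q: "openin T Q" "Q \<subseteq> W x" for x Q
  proof -
    interpret J: comm_group "Sec (I 0) (W x)" using comm_I[OF W(1)[OF x]] .
    show ?thesis
      unfolding e'_def
      using I.Res_mult[OF W(1)[OF x] Q e(1)[OF x] J.inv_closed[OF \<epsilon>_closed[OF W(1)[OF x] b(1)[OF x]]]]
        I.Res_inv[OF W(1)[OF x] Q \<epsilon>_closed[OF W(1)[OF x] b(1)[OF x]]] \<epsilon>_Res[OF W(1)[OF x] Q b(1)[OF x]]
      by simp
  qed
  have "Res (I 0) (W x) (W x \<inter> W y) (e' x) = Res (I 0) (W y) (W x \<inter> W y) (e' y)" if xy: "x \<in> U" "y \<in> U" for x y
  proof -
    let ?Q = "W x \<inter> W y"
    have oQ: "openin T ?Q" and s: "?Q \<subseteq> W x" "?Q \<subseteq> W y" using oW xy by auto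
    interpret J: comm_group "Sec (I 0) ?Q" using comm_I[OF oQ] .
    have R: "Res (I 0) (W x) ?Q (e x) \<in> carrier (Sec (I 0) ?Q)" "Res (I 0) (W y) ?Q (e y) \<in> carrier (Sec (I 0) ?Q)"
      using Re xy oQ by auto
    have Rb: "Res F (W x) ?Q (b x) \<in> carrier (Sec F ?Q)" "Res F (W y) ?Q (b y) \<in> carrier (Sec F ?Q)"
      using F.Res_closed[OF W(1) oQ _ b(1)] xy by auto
    have B: "\<epsilon> ?Q (Res F (W x) ?Q (b x)) \<in> carrier (Sec (I 0) ?Q)" "\<epsilon> ?Q (Res F (W y) ?Q (b y)) \<in> carrier (Sec (I 0) ?Q)"
      using \<epsilon>_closed[OF oQ] Rb by auto
    have eq: "\<epsilon> ?Q (Res F (W y) ?Q (b y)) = \<epsilon> ?Q (Res F (W x) ?Q (b x)) \<otimes>\<^bsub>Sec (I 0) ?Q\<^esub>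
        (inv\<^bsub>Sec (I 0) ?Q\<^esub> Res (I 0) (W x) ?Q (e x) \<otimes>\<^bsub>Sec (I 0) ?Q\<^esub> Res (I 0) (W y) ?Q (e y))"
      using b(2)[OF xy, symmetric] \<epsilon>_mult[OF oQ Rb(1) c(1)[OF xy]] c(2)[OF xy] by simp
    have alg: "A \<otimes>\<^bsub>Sec (I 0) ?Q\<^esub> inv\<^bsub>Sec (I 0) ?Q\<^esub> Z = B \<otimes>\<^bsub>Sec (I 0) ?Q\<^esub>
        inv\<^bsub>Sec (I 0) ?Q\<^esub> (Z \<otimes>\<^bsub>Sec (I 0) ?Q\<^esub> (inv\<^bsub>Sec (I 0) ?Q\<^esub> A \<otimes>\<^bsub>Sec (I 0) ?Q\<^esub> B))"
      if cl: "A \<in> carrier (Sec (I 0) ?Q)" "B \<in> carrier (Sec (I 0) ?Q)" "Z \<in> carrier (Sec (I 0) ?Q)" for A B Z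
    proof -
      have "A \<otimes>\<^bsub>Sec (I 0) ?Q\<^esub> inv\<^bsub>Sec (I 0) ?Q\<^esub> Z = A \<otimes>\<^bsub>Sec (I 0) ?Q\<^esub> inv\<^bsub>Sec (I 0) ?Q\<^esub> Z \<otimes>\<^bsub>Sec (I 0) ?Q\<^esub>
          (B \<otimes>\<^bsub>Sec (I 0) ?Q\<^esub> inv\<^bsub>Sec (I 0) ?Q\<^esub> B)"
        using cl by simp
      also have "\<dots> = B \<otimes>\<^bsub>Sec (I 0) ?Q\<^esub>
          inv\<^bsub>Sec (I 0) ?Q\<^esub> (Z \<otimes>\<^bsub>Sec (I 0) ?Q\<^esub> (inv\<^bsub>Sec (I 0) ?Q\<^esub> A \<otimes>\<^bsub>Sec (I 0) ?Q\<^esub> B))"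
        using cl by (simp add: J.inv_mult J.m_ac J.m_inv_cancel_left)
      finally show ?thesis .
    qed
    from alg[OF R B(1)] eq have "Res (I 0) (W x) ?Q (e x) \<otimes>\<^bsub>Sec (I 0) ?Q\<^esub> inv\<^bsub>Sec (I 0) ?Q\<^esub> \<epsilon> ?Q (Res F (W x) ?Q (b x)) =
        Res (I 0) (W y) ?Q (e y) \<otimes>\<^bsub>Sec (I 0) ?Q\<^esub> inv\<^bsub>Sec (I 0) ?Q\<^esub> \<epsilon> ?Q (Res F (W y) ?Q (b y))"
      by simp
    then show ?thesis using Re'[OF xy(1) oQ s(1)] Re'[OF xy(2) oQ s(2)] by simp
  qed
  then obtain t where t: "t \<in> carrier (Sec (I 0) U)" "\<And>x. x \<in> U \<Longrightarrow> Res (I 0) U (W x) t = e' x"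
    using sheaf_of_sets_glue[OF abelian_sheafD(3)[OF abelian_I[of 0]] W(1) UW, of e'] e'_cl by blast
  have "d 0 U t = s"
  proof (rule sheaf_of_sets_eqI[OF abelian_sheafD(3)[OF abelian_I[of 1]] U _ s(1)])
    show "d 0 U t \<in> carrier (Sec (I 1) U)" using d_closed[OF U t(1)] by simp
    fix x assume x: "x \<in> U"
    interpret J: comm_group "Sec (I 0) (W x)" using comm_I[OF W(1)[OF x]] .
    interpret J1: comm_group "Sec (I (Suc 0)) (W x)" using comm_I[OF W(1)[OF x]] .
    have B: "\<epsilon> (W x) (b x) \<in> carrier (Sec (I 0) (W x))" using \<epsilon>_closed[OF W(1)[OF x] b(1)[OF x]] .
    have "Res (I 1) U (W x) (d 0 U t) = d 0 (W x) (e' x)"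
      using d_Res[OF U W(1)[OF x] W(3)[OF x] t(1)] t(2)[OF x] by simp
    also have "\<dots> = Res (I 1) U (W x) s"
      unfolding e'_def using d_mult[OF W(1)[OF x] e(1)[OF x] J.inv_closed[OF B]] d_inv[OF W(1)[OF x] B]
        d_\<epsilon>[OF W(1)[OF x] b(1)[OF x]] e(2)[OF x] d_closed[OF W(1)[OF x] e(1)[OF x]] by simp
    finally show "\<exists>V. openin T V \<and> x \<in> V \<and> V \<subseteq> U \<and> Res (I 1) U V (d 0 U t) = Res (I 1) U V s"
      using W[OF x] by (intro exI[of _ "W x"]) simp
  qed
  then show ?thesis using t by blast
qed


text \<open>The shift is made twice. In \<open>I 0\<close> the cocycle is bounded by
  \<open>b\<close>; then \<open>d 0 b\<close> is a 1-cocycle in \<open>I 1\<close>, bounded by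
  \<open>a\<close>; then \<open>d 1 (a k)\<close> glue to a closed global section, which is a
  boundary of some \<open>w\<close> since H^2 vanishes. On each member \<open>a k\<close> divided by
  \<open>w\<close> is closed and lifts to some \<open>e k\<close> in \<open>I 0\<close>. Dividing
  \<open>b\<close> by the coboundary of \<open>e\<close> brings it into \<open>F\<close>.\<close>

lemma cech2_of_cohomology:
  assumes H: "trivial_group (section_cohomology I d U 2)" and U: "openin T U"
    and W: "\<And>k. k \<in> K \<Longrightarrow> openin T (W k)" "U = (\<Union>k\<in>K. W k)"
    and triv: "\<And>k. k \<in> K \<Longrightarrow> cech1_trivial T (W k) F" and c: "cech2_cocycle F K W c"
  shows "\<exists>b. cech2_bounds F K W c b"
proof -
  have sub: "W k \<subseteq> U" if "k \<in> K" for k using that W(2) by auto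
  have c_cl: "c k l m \<in> carrier (Sec F (W k \<inter> W l \<inter> W m))" if "k \<in> K" "l \<in> K" "m \<in> K" for k l m
    using c that unfolding cech2_cocycle_def by blast
  have oW: "openin T (W k \<inter> W l)" if "k \<in> K" "l \<in> K" for k l using W that by auto
  have oW3: "openin T (W k \<inter> W l \<inter> W m)" if "k \<in> K" "l \<in> K" "m \<in> K" for k l m using W that by auto
  have "cech2_cocycle (I 0) K W (\<lambda>k l m. \<epsilon> (W k \<inter> W l \<inter> W m) (c k l m))"
    unfolding cech2_cocycle_def Let_def
  proof (intro conjI ballI)
    fix k l m n assume klmn: "k \<in> K" "l \<in> K" "m \<in> K" "n \<in> K"
    let ?Q = "W k \<inter> W l \<inter> W m \<inter> W n"
    have oQ: "openin T ?Q" using W klmn by auto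
    have e: "Res (I 0) (W k' \<inter> W l' \<inter> W m') ?Q (\<epsilon> (W k' \<inter> W l' \<inter> W m') (c k' l' m')) =
        \<epsilon> ?Q (Res F (W k' \<inter> W l' \<inter> W m') ?Q (c k' l' m'))"
      and cl: "Res F (W k' \<inter> W l' \<inter> W m') ?Q (c k' l' m') \<in> carrier (Sec F ?Q)"
      if t: "k' \<in> {k, l, m, n}" "l' \<in> {k, l, m, n}" "m' \<in> {k, l, m, n}" for k' l' m'
    proof -
      have k': "k' \<in> K" "l' \<in> K" "m' \<in> K" and s: "?Q \<subseteq> W k' \<inter> W l' \<inter> W m'" using t klmn by auto
      show "Res (I 0) (W k' \<inter> W l' \<inter> W m') ?Q (\<epsilon> (W k' \<inter> W l' \<inter> W m') (c k' l' m')) =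
        \<epsilon> ?Q (Res F (W k' \<inter> W l' \<inter> W m') ?Q (c k' l' m'))"
        using \<epsilon>_Res[OF oW3[OF k'] oQ s c_cl[OF k']] by simp
      show "Res F (W k' \<inter> W l' \<inter> W m') ?Q (c k' l' m') \<in> carrier (Sec F ?Q)"
        using F.Res_closed[OF oW3[OF k'] oQ s c_cl[OF k']] .
    qed
    have "\<epsilon> ?Q (Res F (W k \<inter> W m \<inter> W n) ?Q (c k m n) \<otimes>\<^bsub>Sec F ?Q\<^esub> Res F (W k \<inter> W l \<inter> W m) ?Q (c k l m)) =
        \<epsilon> ?Q (Res F (W k \<inter> W l \<inter> W n) ?Q (c k l n) \<otimes>\<^bsub>Sec F ?Q\<^esub> Res F (W l \<inter> W m \<inter> W n) ?Q (c l m n))"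
      using c klmn unfolding cech2_cocycle_def Let_def by simp
    then show "Res (I 0) (W k \<inter> W m \<inter> W n) ?Q (\<epsilon> (W k \<inter> W m \<inter> W n) (c k m n)) \<otimes>\<^bsub>Sec (I 0) ?Q\<^esub>
          Res (I 0) (W k \<inter> W l \<inter> W m) ?Q (\<epsilon> (W k \<inter> W l \<inter> W m) (c k l m)) =
        Res (I 0) (W k \<inter> W l \<inter> W n) ?Q (\<epsilon> (W k \<inter> W l \<inter> W n) (c k l n)) \<otimes>\<^bsub>Sec (I 0) ?Q\<^esub>
          Res (I 0) (W l \<inter> W m \<inter> W n) ?Q (\<epsilon> (W l \<inter> W m \<inter> W n) (c l m n))"
      by (simp add: e \<epsilon>_mult[OF oQ] cl)
  qed (use \<epsilon>_closed[OF oW3] c_cl in blast)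
  from injective_sheaf_cech2[OF injective W(1) this] obtain b where
    b: "\<And>k l. k \<in> K \<Longrightarrow> l \<in> K \<Longrightarrow> b k l \<in> carrier (Sec (I 0) (W k \<inter> W l))" and
    cb: "\<And>k l m. k \<in> K \<Longrightarrow> l \<in> K \<Longrightarrow> m \<in> K \<Longrightarrow>
      \<epsilon> (W k \<inter> W l \<inter> W m) (c k l m) \<otimes>\<^bsub>Sec (I 0) (W k \<inter> W l \<inter> W m)\<^esub>
        Res (I 0) (W k \<inter> W m) (W k \<inter> W l \<inter> W m) (b k m) =
      Res (I 0) (W k \<inter> W l) (W k \<inter> W l \<inter> W m) (b k l) \<otimes>\<^bsub>Sec (I 0) (W k \<inter> W l \<inter> W m)\<^esub>
        Res (I 0) (W l \<inter> W m) (W k \<inter> W l \<inter> W m) (b l m)"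
    unfolding cech2_bounds_def Let_def by blast
  have Rb: "Res (I 0) (W k \<inter> W l) Q (b k l) \<in> carrier (Sec (I 0) Q)"
    if "k \<in> K" "l \<in> K" "openin T Q" "Q \<subseteq> W k \<inter> W l" for k l Q
    using I.Res_closed[OF oW[OF that(1,2)] that(3,4) b[OF that(1,2)]] .
  have dRb: "Res (I (Suc 0)) (W k \<inter> W l) Q (d 0 (W k \<inter> W l) (b k l)) = d 0 Q (Res (I 0) (W k \<inter> W l) Q (b k l))"
    if "k \<in> K" "l \<in> K" "openin T Q" "Q \<subseteq> W k \<inter> W l" for k l Q
    using d_Res[OF oW[OF that(1,2)] that(3,4) b[OF that(1,2)]] by simp
  have "cech1_cocycle (I (Suc 0)) K W (\<lambda>k l. d 0 (W k \<inter> W l) (b k l))"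
    unfolding cech1_cocycle_def
  proof (intro conjI ballI)
    fix k l m assume klm: "k \<in> K" "l \<in> K" "m \<in> K"
    let ?Q = "W k \<inter> W l \<inter> W m"
    have s: "?Q \<subseteq> W k \<inter> W l" "?Q \<subseteq> W l \<inter> W m" "?Q \<subseteq> W k \<inter> W m" and oQ: "openin T ?Q"
      using W klm by auto
    interpret J1: comm_group "Sec (I (Suc 0)) ?Q" using comm_I[OF oQ] .
    note R = Rb[OF klm(1,2) oQ s(1)] Rb[OF klm(2,3) oQ s(2)] Rb[OF klm(1,3) oQ s(3)]
    have "d 0 ?Q (Res (I 0) (W k \<inter> W l) ?Q (b k l)) \<otimes>\<^bsub>Sec (I (Suc 0)) ?Q\<^esub>
          d 0 ?Q (Res (I 0) (W l \<inter> W m) ?Q (b l m)) =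
        d 0 ?Q (\<epsilon> ?Q (c k l m)) \<otimes>\<^bsub>Sec (I (Suc 0)) ?Q\<^esub> d 0 ?Q (Res (I 0) (W k \<inter> W m) ?Q (b k m))"
      using arg_cong[OF cb[OF klm], of "d 0 ?Q"] d_mult[OF oQ R(1,2)]
        d_mult[OF oQ \<epsilon>_closed[OF oQ c_cl[OF klm]] R(3)] by simp
    also have "\<dots> = d 0 ?Q (Res (I 0) (W k \<inter> W m) ?Q (b k m))"
      using d_\<epsilon>[OF oQ c_cl[OF klm]] d_closed[OF oQ R(3)] by simp
    finally show "Res (I (Suc 0)) (W k \<inter> W l) ?Q (d 0 (W k \<inter> W l) (b k l)) \<otimes>\<^bsub>Sec (I (Suc 0)) ?Q\<^esub>
          Res (I (Suc 0)) (W l \<inter> W m) ?Q (d 0 (W l \<inter> W m) (b l m)) =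
        Res (I (Suc 0)) (W k \<inter> W m) ?Q (d 0 (W k \<inter> W m) (b k m))"
      using dRb[OF klm(1,2) oQ s(1)] dRb[OF klm(2,3) oQ s(2)] dRb[OF klm(1,3) oQ s(3)] by simp
  qed (use d_closed[OF oW] b in blast)
  from injective_sheaf_cech1[OF injective W(1) this] obtain a where
    a: "\<And>k. k \<in> K \<Longrightarrow> a k \<in> carrier (Sec (I (Suc 0)) (W k))" and
    ab: "\<And>k l. k \<in> K \<Longrightarrow> l \<in> K \<Longrightarrow>
      Res (I (Suc 0)) (W k) (W k \<inter> W l) (a k) \<otimes>\<^bsub>Sec (I (Suc 0)) (W k \<inter> W l)\<^esub> d 0 (W k \<inter> W l) (b k l) =
      Res (I (Suc 0)) (W l) (W k \<inter> W l) (a l)"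
    unfolding cech1_bounds_def by blast
  have Ra: "Res (I (Suc 0)) (W k) Q (a k) \<in> carrier (Sec (I (Suc 0)) Q)"
    if "k \<in> K" "openin T Q" "Q \<subseteq> W k" for k Q
    using I.Res_closed[OF W(1)[OF that(1)] that(2,3) a[OF that(1)]] .
  have "Res (I 2) (W k) (W k \<inter> W l) (d 1 (W k) (a k)) = Res (I 2) (W l) (W k \<inter> W l) (d 1 (W l) (a l))"
    if kl: "k \<in> K" "l \<in> K" for k l
  proof -
    let ?Q = "W k \<inter> W l"
    have oQ: "openin T ?Q" and s: "?Q \<subseteq> W k" "?Q \<subseteq> W l" using oW kl by auto
    interpret J2: comm_group "Sec (I (Suc (Suc 0))) ?Q" using comm_I[OF oQ] .
    have "d (Suc 0) ?Q (Res (I (Suc 0)) (W l) ?Q (a l)) = d (Suc 0) ?Q (Res (I (Suc 0)) (W k) ?Q (a k))"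
      using arg_cong[OF ab[OF kl], of "d (Suc 0) ?Q"] d_d[OF oQ b[OF kl]]
        d_mult[OF oQ Ra[OF kl(1) oQ s(1)] d_closed[OF oQ b[OF kl]]] d_closed[OF oQ Ra[OF kl(1) oQ s(1)]]
      by simp
    then show ?thesis
      using d_Res[OF W(1)[OF kl(1)] oQ s(1) a[OF kl(1)]] d_Res[OF W(1)[OF kl(2)] oQ s(2) a[OF kl(2)]]
      by (simp add: numeral_2_eq_2)
  qed
  then obtain z where z: "z \<in> carrier (Sec (I 2) U)" "\<And>k. k \<in> K \<Longrightarrow> Res (I 2) U (W k) z = d 1 (W k) (a k)"
    using sheaf_of_sets_glue[OF abelian_sheafD(3)[OF abelian_I[of 2]] W(1) W(2), of "\<lambda>k. d 1 (W k) (a k)"]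
      d_closed[OF W(1) a] by (auto simp: numeral_2_eq_2)
  have "d 2 U z = \<one>\<^bsub>Sec (I 3) U\<^esub>"
  proof (rule sheaf_of_sets_eqI[OF abelian_sheafD(3)[OF abelian_I[of 3]] U])
    show "d 2 U z \<in> carrier (Sec (I 3) U)" using d_closed[OF U, of z 2] z(1) by simp
    show "\<one>\<^bsub>Sec (I 3) U\<^esub> \<in> carrier (Sec (I 3) U)" using I.group_Sec[OF U] by (simp add: group.is_monoid)
    fix x assume "x \<in> U"
    then obtain k where k: "k \<in> K" "x \<in> W k" using W(2) by auto
    have "Res (I 3) U (W k) (d 2 U z) = \<one>\<^bsub>Sec (I 3) (W k)\<^esub>"
      using d_Res[OF U W(1)[OF k(1)] sub[OF k(1)], of z 2] z d_d[OF W(1) a] k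
      by (simp add: numeral_2_eq_2 numeral_3_eq_3)
    then show "\<exists>V. openin T V \<and> x \<in> V \<and> V \<subseteq> U \<and> Res (I 3) U V (d 2 U z) = Res (I 3) U V \<one>\<^bsub>Sec (I 3) U\<^esub>"
      using k W(1) sub I.Res_one[OF U W(1)[OF k(1)] sub[OF k(1)]] by (intro exI[of _ "W k"]) simp
  qed
  with trivial_cohomologyD[of U "Suc 0" z] H U z
  obtain w where w: "w \<in> carrier (Sec (I (Suc 0)) U)" "d (Suc 0) U w = z"
    by (auto simp: numeral_2_eq_2 numeral_3_eq_3)
  have Rw: "Res (I (Suc 0)) U Q w \<in> carrier (Sec (I (Suc 0)) Q)" if "openin T Q" "Q \<subseteq> U" for Q
    using I.Res_closed[OF U that w(1)] .
  \<comment> \<open>A closed section is a priori only locally in the image of \<open>d 0\<close>.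
    The vanishing of Cech H^1 of \<open>F\<close> on the member \<open>W k\<close> makes it an image
    over all of \<open>W k\<close>.\<close>
  have "\<exists>e\<in>carrier (Sec (I 0) (W k)). d 0 (W k) e =
      a k \<otimes>\<^bsub>Sec (I (Suc 0)) (W k)\<^esub> inv\<^bsub>Sec (I (Suc 0)) (W k)\<^esub> Res (I (Suc 0)) U (W k) w" if k: "k \<in> K" for k
  proof -
    note o = W(1)[OF k] and s = sub[OF k] and cl = a[OF k] Rw[OF W(1)[OF k] sub[OF k]]
    interpret J1: comm_group "Sec (I (Suc 0)) (W k)" using comm_I[OF o] .
    interpret J2: comm_group "Sec (I (Suc (Suc 0))) (W k)" using comm_I[OF o] .
    have "d (Suc 0) (W k) (Res (I (Suc 0)) U (W k) w) = d (Suc 0) (W k) (a k)"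
      using d_Res[OF U o s w(1)] w(2) z(2)[OF k] by (simp add: numeral_2_eq_2)
    then have "d (Suc 0) (W k) (a k \<otimes>\<^bsub>Sec (I (Suc 0)) (W k)\<^esub> inv\<^bsub>Sec (I (Suc 0)) (W k)\<^esub> Res (I (Suc 0)) U (W k) w)
        = \<one>\<^bsub>Sec (I (Suc (Suc 0))) (W k)\<^esub>"
      using d_mult[OF o cl(1) J1.inv_closed[OF cl(2)]] d_inv[OF o cl(2)] d_closed[OF o cl(1)] by simp
    then show ?thesis
      using d_kernel_1_lift[OF triv[OF k] o] cl by (simp add: numeral_2_eq_2)
  qed
  then obtain e where e: "\<And>k. k \<in> K \<Longrightarrow> e k \<in> carrier (Sec (I 0) (W k))"
    "\<And>k. k \<in> K \<Longrightarrow> d 0 (W k) (e k) =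
      a k \<otimes>\<^bsub>Sec (I (Suc 0)) (W k)\<^esub> inv\<^bsub>Sec (I (Suc 0)) (W k)\<^esub> Res (I (Suc 0)) U (W k) w"
    by metis
  have Re: "Res (I 0) (W k) Q (e k) \<in> carrier (Sec (I 0) Q)" if "k \<in> K" "openin T Q" "Q \<subseteq> W k" for k Q
    using I.Res_closed[OF W(1)[OF that(1)] that(2,3) e(1)[OF that(1)]] .
  have dRe: "d 0 Q (Res (I 0) (W k) Q (e k)) = Res (I (Suc 0)) (W k) Q (a k) \<otimes>\<^bsub>Sec (I (Suc 0)) Q\<^esub>
      inv\<^bsub>Sec (I (Suc 0)) Q\<^esub> Res (I (Suc 0)) U Q w" if k: "k \<in> K" and Q: "openin T Q" "Q \<subseteq> W k" for k Q
  proof -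
    note o = W(1)[OF k] and s = sub[OF k] and cl = a[OF k] Rw[OF W(1)[OF k] sub[OF k]]
    interpret J1: comm_group "Sec (I (Suc 0)) (W k)" using comm_I[OF o] .
    show ?thesis
      using d_Res[OF o Q e(1)[OF k]] e(2)[OF k] I.Res_mult[OF o Q cl(1) J1.inv_closed[OF cl(2)]]
        I.Res_inv[OF o Q cl(2)] I.Res_Res[OF U o Q(1) s Q(2) w(1)] by simp
  qed
  \<comment> \<open>The coboundary of \<open>e\<close>. Both \<open>g k l\<close> and
    \<open>b k l\<close> are mapped by \<open>d 0\<close> to the quotient of \<open>a l\<close> by
    \<open>a k\<close>, as \<open>w\<close> cancels; their quotient is therefore closed.\<close>
  define g where "g k l = Res (I 0) (W l) (W k \<inter> W l) (e l) \<otimes>\<^bsub>Sec (I 0) (W k \<inter> W l)\<^esub>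
      inv\<^bsub>Sec (I 0) (W k \<inter> W l)\<^esub> Res (I 0) (W k) (W k \<inter> W l) (e k)" for k l
  have g: "g k l \<in> carrier (Sec (I 0) (W k \<inter> W l))" if kl: "k \<in> K" "l \<in> K" for k l
  proof -
    interpret J: comm_group "Sec (I 0) (W k \<inter> W l)" using comm_I[OF oW[OF kl]] .
    show ?thesis unfolding g_def using Re kl oW[OF kl] by simp
  qed
  have Rg: "Res (I 0) (W k \<inter> W l) Q (g k l) = Res (I 0) (W l) Q (e l) \<otimes>\<^bsub>Sec (I 0) Q\<^esub>
      inv\<^bsub>Sec (I 0) Q\<^esub> Res (I 0) (W k) Q (e k)"
    if kl: "k \<in> K" "l \<in> K" and Q: "openin T Q" "Q \<subseteq> W k \<inter> W l" for k l Q
  proof -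
    let ?P = "W k \<inter> W l"
    interpret J: comm_group "Sec (I 0) ?P" using comm_I[OF oW[OF kl]] .
    have s: "?P \<subseteq> W k" "?P \<subseteq> W l" by auto
    note cl = Re[OF kl(2) oW[OF kl] s(2)] Re[OF kl(1) oW[OF kl] s(1)]
    show ?thesis
      unfolding g_def
      using I.Res_mult[OF oW[OF kl] Q cl(1) J.inv_closed[OF cl(2)]] I.Res_inv[OF oW[OF kl] Q cl(2)]
        I.Res_Res[OF W(1)[OF kl(1)] oW[OF kl] Q(1) s(1) Q(2) e(1)[OF kl(1)]]
        I.Res_Res[OF W(1)[OF kl(2)] oW[OF kl] Q(1) s(2) Q(2) e(1)[OF kl(2)]] by simp
  qed
  have "\<exists>f\<in>carrier (Sec F (W k \<inter> W l)). \<epsilon> (W k \<inter> W l) f =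
      b k l \<otimes>\<^bsub>Sec (I 0) (W k \<inter> W l)\<^esub> inv\<^bsub>Sec (I 0) (W k \<inter> W l)\<^esub> g k l" if kl: "k \<in> K" "l \<in> K" for k l
  proof (rule d_kernel_0[OF oW[OF kl]])
    let ?Q = "W k \<inter> W l"
    note o = oW[OF kl]
    have s: "?Q \<subseteq> W k" "?Q \<subseteq> W l" by auto
    interpret J: comm_group "Sec (I 0) ?Q" using comm_I[OF o] .
    interpret J1: comm_group "Sec (I (Suc 0)) ?Q" using comm_I[OF o] .
    show "b k l \<otimes>\<^bsub>Sec (I 0) ?Q\<^esub> inv\<^bsub>Sec (I 0) ?Q\<^esub> g k l \<in> carrier (Sec (I 0) ?Q)"
      using b[OF kl] g[OF kl] by simp
    note cl = Re[OF kl(2) o s(2)] Re[OF kl(1) o s(1)]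
    note al = Ra[OF kl(1) o s(1)] Ra[OF kl(2) o s(2)] and wl = Rw[OF o subset_trans[OF s(1) sub[OF kl(1)]]]
      and db = d_closed[OF o b[OF kl]]
    have "d 0 ?Q (g k l) = (Res (I (Suc 0)) (W l) ?Q (a l) \<otimes>\<^bsub>Sec (I (Suc 0)) ?Q\<^esub>
        inv\<^bsub>Sec (I (Suc 0)) ?Q\<^esub> Res (I (Suc 0)) U ?Q w) \<otimes>\<^bsub>Sec (I (Suc 0)) ?Q\<^esub>
      inv\<^bsub>Sec (I (Suc 0)) ?Q\<^esub> (Res (I (Suc 0)) (W k) ?Q (a k) \<otimes>\<^bsub>Sec (I (Suc 0)) ?Q\<^esub>
        inv\<^bsub>Sec (I (Suc 0)) ?Q\<^esub> Res (I (Suc 0)) U ?Q w)"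
      unfolding g_def
      using d_mult[OF o cl(1) J.inv_closed[OF cl(2)]] d_inv[OF o cl(2)] dRe[OF kl(1) o s(1)] dRe[OF kl(2) o s(2)]
      by simp
    also have "\<dots> = Res (I (Suc 0)) (W l) ?Q (a l) \<otimes>\<^bsub>Sec (I (Suc 0)) ?Q\<^esub>
        inv\<^bsub>Sec (I (Suc 0)) ?Q\<^esub> Res (I (Suc 0)) (W k) ?Q (a k)"
      using al wl by (simp add: J1.inv_mult J1.m_ac J1.m_inv_cancel_left)
    also have "\<dots> = d 0 ?Q (b k l)"
      unfolding ab[OF kl, symmetric] using al db by (simp add: J1.m_ac J1.m_inv_cancel_left)
    finally show "d 0 ?Q (b k l \<otimes>\<^bsub>Sec (I 0) ?Q\<^esub> inv\<^bsub>Sec (I 0) ?Q\<^esub> g k l) = \<one>\<^bsub>Sec (I (Suc 0)) ?Q\<^esub>"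
      using d_mult[OF o b[OF kl] J.inv_closed[OF g[OF kl]]] d_inv[OF o g[OF kl]] db by simp
  qed
  then obtain f where f: "\<And>k l. k \<in> K \<Longrightarrow> l \<in> K \<Longrightarrow> f k l \<in> carrier (Sec F (W k \<inter> W l))"
    "\<And>k l. k \<in> K \<Longrightarrow> l \<in> K \<Longrightarrow> \<epsilon> (W k \<inter> W l) (f k l) =
      b k l \<otimes>\<^bsub>Sec (I 0) (W k \<inter> W l)\<^esub> inv\<^bsub>Sec (I 0) (W k \<inter> W l)\<^esub> g k l"
    by metis
  have "cech2_bounds F K W c f"
    unfolding cech2_bounds_def Let_def
  proof (intro conjI ballI)
    fix k l m assume klm: "k \<in> K" "l \<in> K" "m \<in> K"
    let ?Q = "W k \<inter> W l \<inter> W m"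
    have s: "?Q \<subseteq> W k \<inter> W l" "?Q \<subseteq> W l \<inter> W m" "?Q \<subseteq> W k \<inter> W m" and s1: "?Q \<subseteq> W k" "?Q \<subseteq> W l" "?Q \<subseteq> W m"
      and oQ: "openin T ?Q"
      using W klm by auto
    interpret J: comm_group "Sec (I 0) ?Q" using comm_I[OF oQ] .
    interpret FQ: comm_group "Sec F ?Q" using comm_F[OF oQ] .
    have Rf: "Res F (W k' \<inter> W l') ?Q (f k' l') \<in> carrier (Sec F ?Q)"
      and \<epsilon>f: "\<epsilon> ?Q (Res F (W k' \<inter> W l') ?Q (f k' l')) = Res (I 0) (W k' \<inter> W l') ?Q (b k' l') \<otimes>\<^bsub>Sec (I 0) ?Q\<^esub>
        inv\<^bsub>Sec (I 0) ?Q\<^esub> (Res (I 0) (W l') ?Q (e l') \<otimes>\<^bsub>Sec (I 0) ?Q\<^esub> inv\<^bsub>Sec (I 0) ?Q\<^esub> Res (I 0) (W k') ?Q (e k'))"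
      if kl: "k' \<in> K" "l' \<in> K" and Q: "?Q \<subseteq> W k' \<inter> W l'" for k' l'
    proof -
      note o = oW[OF kl]
      interpret P: comm_group "Sec (I 0) (W k' \<inter> W l')" using comm_I[OF o] .
      show "Res F (W k' \<inter> W l') ?Q (f k' l') \<in> carrier (Sec F ?Q)"
        using F.Res_closed[OF o oQ Q f(1)[OF kl]] .
      show "\<epsilon> ?Q (Res F (W k' \<inter> W l') ?Q (f k' l')) = Res (I 0) (W k' \<inter> W l') ?Q (b k' l') \<otimes>\<^bsub>Sec (I 0) ?Q\<^esub>
        inv\<^bsub>Sec (I 0) ?Q\<^esub> (Res (I 0) (W l') ?Q (e l') \<otimes>\<^bsub>Sec (I 0) ?Q\<^esub> inv\<^bsub>Sec (I 0) ?Q\<^esub> Res (I 0) (W k') ?Q (e k'))"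
        using \<epsilon>_Res[OF o oQ Q f(1)[OF kl]] f(2)[OF kl] I.Res_mult[OF o oQ Q b[OF kl] P.inv_closed[OF g[OF kl]]]
          I.Res_inv[OF o oQ Q g[OF kl]] Rg[OF kl oQ Q] by simp
    qed
    note R = Rf[OF klm(1,2) s(1)] Rf[OF klm(2,3) s(2)] Rf[OF klm(1,3) s(3)]
      and B = Rb[OF klm(1,2) oQ s(1)] Rb[OF klm(2,3) oQ s(2)] Rb[OF klm(1,3) oQ s(3)]
      and E = Re[OF klm(1) oQ s1(1)] Re[OF klm(2) oQ s1(2)] Re[OF klm(3) oQ s1(3)]
      and C = \<epsilon>_closed[OF oQ c_cl[OF klm]]
    \<comment> \<open>Replacing \<open>b\<close> by its quotient with a coboundary preserves the
      bounding condition: the terms in \<open>E2\<close> cancel, and \<open>E1\<close>,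
      \<open>E3\<close> occur alike on both sides.\<close>
    have alg: "C \<otimes>\<^bsub>Sec (I 0) ?Q\<^esub> (B3 \<otimes>\<^bsub>Sec (I 0) ?Q\<^esub> inv\<^bsub>Sec (I 0) ?Q\<^esub> (E3 \<otimes>\<^bsub>Sec (I 0) ?Q\<^esub> inv\<^bsub>Sec (I 0) ?Q\<^esub> E1)) =
        (B1 \<otimes>\<^bsub>Sec (I 0) ?Q\<^esub> inv\<^bsub>Sec (I 0) ?Q\<^esub> (E2 \<otimes>\<^bsub>Sec (I 0) ?Q\<^esub> inv\<^bsub>Sec (I 0) ?Q\<^esub> E1)) \<otimes>\<^bsub>Sec (I 0) ?Q\<^esub>
        (B2 \<otimes>\<^bsub>Sec (I 0) ?Q\<^esub> inv\<^bsub>Sec (I 0) ?Q\<^esub> (E3 \<otimes>\<^bsub>Sec (I 0) ?Q\<^esub> inv\<^bsub>Sec (I 0) ?Q\<^esub> E2))"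
      if "C \<otimes>\<^bsub>Sec (I 0) ?Q\<^esub> B3 = B1 \<otimes>\<^bsub>Sec (I 0) ?Q\<^esub> B2" and
        cl: "{C, B1, B2, B3, E1, E2, E3} \<subseteq> carrier (Sec (I 0) ?Q)" for C B1 B2 B3 E1 E2 E3
    proof -
      have "C \<otimes>\<^bsub>Sec (I 0) ?Q\<^esub> (B3 \<otimes>\<^bsub>Sec (I 0) ?Q\<^esub> inv\<^bsub>Sec (I 0) ?Q\<^esub> (E3 \<otimes>\<^bsub>Sec (I 0) ?Q\<^esub> inv\<^bsub>Sec (I 0) ?Q\<^esub> E1)) =
          (B1 \<otimes>\<^bsub>Sec (I 0) ?Q\<^esub> B2) \<otimes>\<^bsub>Sec (I 0) ?Q\<^esub> (E1 \<otimes>\<^bsub>Sec (I 0) ?Q\<^esub> inv\<^bsub>Sec (I 0) ?Q\<^esub> E3)"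
        using that(1)[symmetric] cl by (simp add: J.inv_mult J.m_ac)
      also have "\<dots> = (B1 \<otimes>\<^bsub>Sec (I 0) ?Q\<^esub> B2) \<otimes>\<^bsub>Sec (I 0) ?Q\<^esub>
          (E1 \<otimes>\<^bsub>Sec (I 0) ?Q\<^esub> (E2 \<otimes>\<^bsub>Sec (I 0) ?Q\<^esub> (inv\<^bsub>Sec (I 0) ?Q\<^esub> E2 \<otimes>\<^bsub>Sec (I 0) ?Q\<^esub> inv\<^bsub>Sec (I 0) ?Q\<^esub> E3)))"
        using cl by (simp add: J.m_inv_cancel_left)
      also have "\<dots> = (B1 \<otimes>\<^bsub>Sec (I 0) ?Q\<^esub> inv\<^bsub>Sec (I 0) ?Q\<^esub> (E2 \<otimes>\<^bsub>Sec (I 0) ?Q\<^esub> inv\<^bsub>Sec (I 0) ?Q\<^esub> E1)) \<otimes>\<^bsub>Sec (I 0) ?Q\<^esub>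
        (B2 \<otimes>\<^bsub>Sec (I 0) ?Q\<^esub> inv\<^bsub>Sec (I 0) ?Q\<^esub> (E3 \<otimes>\<^bsub>Sec (I 0) ?Q\<^esub> inv\<^bsub>Sec (I 0) ?Q\<^esub> E2))"
        using cl by (simp add: J.inv_mult J.m_ac)
      finally show ?thesis .
    qed
    have "\<epsilon> ?Q (c k l m \<otimes>\<^bsub>Sec F ?Q\<^esub> Res F (W k \<inter> W m) ?Q (f k m)) =
        \<epsilon> ?Q (Res F (W k \<inter> W l) ?Q (f k l) \<otimes>\<^bsub>Sec F ?Q\<^esub> Res F (W l \<inter> W m) ?Q (f l m))"
      unfolding \<epsilon>_mult[OF oQ c_cl[OF klm] R(3)] \<epsilon>_mult[OF oQ R(1,2)]
        \<epsilon>f[OF klm(1,2) s(1)] \<epsilon>f[OF klm(2,3) s(2)] \<epsilon>f[OF klm(1,3) s(3)]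
      by (rule alg[OF cb[OF klm]]) (use B E C in blast)
    then show "c k l m \<otimes>\<^bsub>Sec F ?Q\<^esub> Res F (W k \<inter> W m) ?Q (f k m) =
        Res F (W k \<inter> W l) ?Q (f k l) \<otimes>\<^bsub>Sec F ?Q\<^esub> Res F (W l \<inter> W m) ?Q (f l m)"
      using inj_onD[OF \<epsilon>_inj[OF oQ]] R c_cl[OF klm] by simp
  qed (use f in blast)
  then show ?thesis by blast
qed

end

section \<open>From the cohomological hypotheses to Cech statements\<close>

lemma cech2_bounds_of_cohomology:
  fixes F :: "('x, 'b) group_presheaf"
  assumes F: "abelian_sheaf T F" and U: "openin T U" and H: "cohomology_trivial T U F 2"
    and W: "\<And>k. k \<in> K \<Longrightarrow> openin T (W k)" "U = (\<Union>k\<in>K. W k)"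
    and triv: "\<And>k. k \<in> K \<Longrightarrow> cech1_trivial T (W k) F" and c: "cech2_cocycle F K W c"
  shows "\<exists>b. cech2_bounds F K W c b"
proof -
  obtain \<epsilon> d and I :: "nat \<Rightarrow> ('x, ('x, 'b) resolution_type) group_presheaf" where r: "injective_resolution T F \<epsilon> I d" "trivial_group (section_cohomology I d U 2)"
    using H unfolding cohomology_trivial_def is_sheaf_cohomology_def by blast
  interpret resolved_sheaf T F \<epsilon> I d using F r(1) by unfold_locales
  show ?thesis using cech2_of_cohomology[OF r(2) U W triv c] .
qed

text \<open>An isomorphism of sheaves carries an injective resolution of its target to one of its source,
  whose members keep the type of the target.\<close>

lemma cech1_trivial_of_iso:
  fixes F' :: "('x, 'b) group_presheaf"
  assumes F: "abelian_sheaf T F" and U: "openin T U" and iso: "sheaf_iso T F F' \<phi>"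
    and H: "cohomology_trivial T U F' 1"
  shows "cech1_trivial T U F"
proof -
  obtain \<epsilon> d and I :: "nat \<Rightarrow> ('x, ('x, 'b) resolution_type) group_presheaf" where r: "injective_resolution T F' \<epsilon> I d" "trivial_group (section_cohomology I d U 1)"
    using H unfolding cohomology_trivial_def is_sheaf_cohomology_def by blast
  have \<phi>: "sheaf_morphism T F F' \<phi>" "\<And>U. openin T U \<Longrightarrow> bij_betw (\<phi> U) (carrier (Sec F U)) (carrier (Sec F' U))"
    using iso unfolding sheaf_iso_def iso_def by auto
  have \<epsilon>: "sheaf_morphism T F' (I 0) \<epsilon>" using r(1) unfolding injective_resolution_def by blast
  have mor: "sheaf_morphism T F (I 0) (\<lambda>U s. \<epsilon> U (\<phi> U s))"
    unfolding sheaf_morphism_def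
  proof (intro conjI allI impI ballI; (elim conjE)?)
    fix U assume U: "openin T U"
    show "(\<lambda>s. \<epsilon> U (\<phi> U s)) \<in> hom (Sec F U) (Sec (I 0) U)"
      using hom_compose[OF sheaf_morphismD(1)[OF \<phi>(1) U] sheaf_morphismD(1)[OF \<epsilon> U]]
      by (simp add: comp_def)
  next
    fix U V s assume "openin T U" "openin T V" "V \<subseteq> U" "s \<in> carrier (Sec F U)"
    then show "\<epsilon> V (\<phi> V (Res F U V s)) = Res (I 0) U V (\<epsilon> U (\<phi> U s))"
      using sheaf_morphismD(4)[OF \<phi>(1)] sheaf_morphismD(4)[OF \<epsilon>] sheaf_morphismD(2)[OF \<phi>(1)] by simp
  qed
  have inj: "inj_on (\<lambda>s. \<epsilon> U (\<phi> U s)) (carrier (Sec F U))" if U: "openin T U" for U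
  proof -
    have "inj_on (\<epsilon> U) (carrier (Sec F' U))" using r(1) U unfolding injective_resolution_def by blast
    then show ?thesis
      using \<phi>(2)[OF U] comp_inj_on[of "\<phi> U" "carrier (Sec F U)" "\<epsilon> U"] by (simp add: bij_betw_def comp_def)
  qed
  \<comment> \<open>Exactness at \<open>I 0\<close> involves the sheaf only through the image of the
    augmentation, and this image is unchanged.\<close>
  have img: "(\<lambda>s. \<epsilon> V (\<phi> V s)) ` carrier (Sec F V) = \<epsilon> V ` carrier (Sec F' V)" if "openin T V" for V
    using \<phi>(2)[OF that] by (simp add: bij_betw_def flip: image_image)
  have "exact_at T F (I 0) (I 1) (\<lambda>U s. \<epsilon> U (\<phi> U s)) (d 0)"
    unfolding exact_at_def
  proof (intro allI impI)
    fix U assume "openin T U"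
    then have "kernel (Sec (I 0) U) (Sec (I 1) U) (d 0 U) = {s \<in> carrier (Sec (I 0) U). \<forall>x\<in>U. \<exists>V. openin T V \<and>
        x \<in> V \<and> V \<subseteq> U \<and> Res (I 0) U V s \<in> \<epsilon> V ` carrier (Sec F' V)}"
      using r(1) unfolding injective_resolution_def exact_at_def by blast
    then show "kernel (Sec (I 0) U) (Sec (I 1) U) (d 0 U) = {s \<in> carrier (Sec (I 0) U). \<forall>x\<in>U. \<exists>V. openin T V \<and>
        x \<in> V \<and> V \<subseteq> U \<and> Res (I 0) U V s \<in> (\<lambda>s. \<epsilon> V (\<phi> V s)) ` carrier (Sec F V)}"
      using img by (simp cong: conj_cong)
  qed
  with r(1) mor inj have "injective_resolution T F (\<lambda>U s. \<epsilon> U (\<phi> U s)) I d"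
    unfolding injective_resolution_def by blast
  then interpret resolved_sheaf T F "\<lambda>U s. \<epsilon> U (\<phi> U s)" I d using F by unfold_locales
  show ?thesis
    unfolding cech1_trivial_def
  proof (intro allI impI; elim conjE)
    fix W c assume "\<forall>x\<in>U. openin T (W x) \<and> x \<in> W x \<and> W x \<subseteq> U" "cech1_cocycle F U W c"
    moreover from this have "U = (\<Union>x\<in>U. W x)" by blast
    ultimately show "\<exists>b. cech1_bounds F U W c b"
      using cech1_of_cohomology[OF r(2) U, of U W c] by blast
  qed
qed

lemma cech1_trivial_of_cohomology:
  assumes "abelian_sheaf T F" "openin T U" "cohomology_trivial T U F 1"
  shows "cech1_trivial T U F"
proof (rule cech1_trivial_of_iso[OF assms(1,2) _ assms(3)])
  show "sheaf_iso T F F (\<lambda>U s. s)"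
    unfolding sheaf_iso_def sheaf_morphism_def by (simp add: iso_def hom_def bij_betw_def)
qed

lemma cech1_trivial_subtopology:
  assumes "openin T U" "V \<subseteq> U" "cech1_trivial (subtopology T U) V F"
  shows "cech1_trivial T V F"
  using assms unfolding cech1_trivial_def by (meson openin_open_subtopology subset_trans)

lemma abelian_sheaf_subtopology:
  assumes F: "abelian_sheaf T F" and U: "openin T U"
  shows "abelian_sheaf (subtopology T U) F"
proof -
  have o: "openin (subtopology T U) V \<longleftrightarrow> openin T V \<and> V \<subseteq> U" for V
    using openin_open_subtopology[OF U] .
  have "sheaf_of_sets (subtopology T U) (\<lambda>U. carrier (Sec F U)) (Res F)"
    unfolding sheaf_of_sets_def
  proof (intro conjI allI impI)
    show "presheaf_of_sets (subtopology T U) (\<lambda>U. carrier (Sec F U)) (Res F)"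
      using abelian_sheafD(3)[OF F] unfolding sheaf_of_sets_def presheaf_of_sets_def o by simp
  next
    fix V \<V> s
    assume "openin (subtopology T U) V \<and> open_cover (subtopology T U) V \<V> \<and>
      (\<forall>W\<in>\<V>. s W \<in> carrier (Sec F W)) \<and>
      (\<forall>W\<in>\<V>. \<forall>W'\<in>\<V>. Res F W (W \<inter> W') (s W) = Res F W' (W \<inter> W') (s W'))"
    then have "openin T V \<and> open_cover T V \<V> \<and> (\<forall>W\<in>\<V>. s W \<in> carrier (Sec F W)) \<and>
      (\<forall>W\<in>\<V>. \<forall>W'\<in>\<V>. Res F W (W \<inter> W') (s W) = Res F W' (W \<inter> W') (s W'))"
      unfolding open_cover_def o by (elim conjE, intro conjI) (assumption | blast)+
    with abelian_sheafD(3)[OF F, unfolded sheaf_of_sets_def, THEN conjunct2, THEN spec, THEN spec, THEN spec]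
    show "\<exists>!t. t \<in> carrier (Sec F V) \<and> (\<forall>W\<in>\<V>. Res F V W t = s W)" by (rule mp)
  qed
  then show ?thesis
    using F unfolding abelian_sheaf_def sheaf_of_groups_def o by simp
qed

section \<open>Filtered gerbes in a strict form\<close>

text \<open>An arrow remembers the open set over which it lives and its end points, and an object over an
  open set is at the same time an object over all smaller ones. In this form restriction is strictly
  functorial, and no coherence isomorphisms occur.\<close>

locale strict_groupoid_prestack =
  fixes X :: "'x topology" and Ob :: "'o set" and base :: "'o \<Rightarrow> 'x set"
    and Arr :: "'r set" and supp :: "'r \<Rightarrow> 'x set" and src tgt :: "'r \<Rightarrow> 'o"
    and idn :: "'x set \<Rightarrow> 'o \<Rightarrow> 'r" and cmp :: "'r \<Rightarrow> 'r \<Rightarrow> 'r" (infixl \<open>\<cdot>\<close> 70)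
    and inve :: "'r \<Rightarrow> 'r" and res :: "'x set \<Rightarrow> 'r \<Rightarrow> 'r"
  assumes arr: "f \<in> Arr \<Longrightarrow> openin X (supp f)" "f \<in> Arr \<Longrightarrow> src f \<in> Ob" "f \<in> Arr \<Longrightarrow> tgt f \<in> Ob"
      "f \<in> Arr \<Longrightarrow> supp f \<subseteq> base (src f)" "f \<in> Arr \<Longrightarrow> supp f \<subseteq> base (tgt f)"
    and idn: "\<lbrakk>a \<in> Ob; openin X V; V \<subseteq> base a\<rbrakk> \<Longrightarrow> idn V a \<in> Arr"
      "\<lbrakk>a \<in> Ob; openin X V; V \<subseteq> base a\<rbrakk> \<Longrightarrow> supp (idn V a) = V"
      "\<lbrakk>a \<in> Ob; openin X V; V \<subseteq> base a\<rbrakk> \<Longrightarrow> src (idn V a) = a"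
      "\<lbrakk>a \<in> Ob; openin X V; V \<subseteq> base a\<rbrakk> \<Longrightarrow> tgt (idn V a) = a"
    and cmp: "\<lbrakk>f \<in> Arr; g \<in> Arr; supp g = supp f; src g = tgt f\<rbrakk> \<Longrightarrow> g \<cdot> f \<in> Arr"
      "\<lbrakk>f \<in> Arr; g \<in> Arr; supp g = supp f; src g = tgt f\<rbrakk> \<Longrightarrow> supp (g \<cdot> f) = supp f"
      "\<lbrakk>f \<in> Arr; g \<in> Arr; supp g = supp f; src g = tgt f\<rbrakk> \<Longrightarrow> src (g \<cdot> f) = src f"
      "\<lbrakk>f \<in> Arr; g \<in> Arr; supp g = supp f; src g = tgt f\<rbrakk> \<Longrightarrow> tgt (g \<cdot> f) = tgt g"
    and assoc: "\<lbrakk>f \<in> Arr; g \<in> Arr; h \<in> Arr; supp g = supp f; supp h = supp g; src g = tgt f; src h = tgt g\<rbrakk>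
      \<Longrightarrow> h \<cdot> g \<cdot> f = h \<cdot> (g \<cdot> f)"
    and cmp_idn: "f \<in> Arr \<Longrightarrow> f \<cdot> idn (supp f) (src f) = f"
    and idn_cmp: "f \<in> Arr \<Longrightarrow> idn (supp f) (tgt f) \<cdot> f = f"
    and inve: "f \<in> Arr \<Longrightarrow> inve f \<in> Arr" "f \<in> Arr \<Longrightarrow> supp (inve f) = supp f"
      "f \<in> Arr \<Longrightarrow> src (inve f) = tgt f" "f \<in> Arr \<Longrightarrow> tgt (inve f) = src f"
    and inve_cmp: "f \<in> Arr \<Longrightarrow> inve f \<cdot> f = idn (supp f) (src f)"
    and cmp_inve: "f \<in> Arr \<Longrightarrow> f \<cdot> inve f = idn (supp f) (tgt f)"
    and res: "\<lbrakk>f \<in> Arr; openin X V; V \<subseteq> supp f\<rbrakk> \<Longrightarrow> res V f \<in> Arr"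
      "\<lbrakk>f \<in> Arr; openin X V; V \<subseteq> supp f\<rbrakk> \<Longrightarrow> supp (res V f) = V"
      "\<lbrakk>f \<in> Arr; openin X V; V \<subseteq> supp f\<rbrakk> \<Longrightarrow> src (res V f) = src f"
      "\<lbrakk>f \<in> Arr; openin X V; V \<subseteq> supp f\<rbrakk> \<Longrightarrow> tgt (res V f) = tgt f"
    and res_self: "f \<in> Arr \<Longrightarrow> res (supp f) f = f"
    and res_res: "\<lbrakk>f \<in> Arr; openin X V; openin X W; V \<subseteq> supp f; W \<subseteq> V\<rbrakk> \<Longrightarrow> res W (res V f) = res W f"
    and res_cmp: "\<lbrakk>f \<in> Arr; g \<in> Arr; supp g = supp f; src g = tgt f; openin X V; V \<subseteq> supp f\<rbrakk>
      \<Longrightarrow> res V (g \<cdot> f) = res V g \<cdot> res V f"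
begin

section \<open>The calculus of strict arrows\<close>

lemma cmp_idn': "\<lbrakk>f \<in> Arr; supp f = V; src f = a\<rbrakk> \<Longrightarrow> f \<cdot> idn V a = f"
  and idn_cmp': "\<lbrakk>f \<in> Arr; supp f = V; tgt f = a\<rbrakk> \<Longrightarrow> idn V a \<cdot> f = f"
  and res_self': "\<lbrakk>f \<in> Arr; supp f = V\<rbrakk> \<Longrightarrow> res V f = f"
  using cmp_idn idn_cmp res_self by auto

lemma cancel:
  assumes "f \<in> Arr" "g \<in> Arr" "supp g = supp f"
  shows "tgt g = src f \<Longrightarrow> inve f \<cdot> (f \<cdot> g) = g"
    and "tgt g = tgt f \<Longrightarrow> f \<cdot> (inve f \<cdot> g) = g"
  using assms by (simp_all add: inve inve_cmp cmp_inve idn_cmp' flip: assoc)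

lemma inve_eqI:
  assumes "f \<in> Arr" "g \<in> Arr" "supp g = supp f" "src g = tgt f" "g \<cdot> f = idn (supp f) (src f)"
  shows "inve f = g"
proof -
  have tgt: "tgt g = src f"
    using assms cmp(4)[of f g] idn(4)[of "src f" "supp f"] arr[of f] by simp
  have "inve f = g \<cdot> f \<cdot> inve f" using assms by (simp add: inve idn_cmp')
  also have "\<dots> = g" using assms(1-4) by (simp add: assoc inve cmp_inve cmp_idn')
  finally show ?thesis .
qed

lemma inve_inve: "f \<in> Arr \<Longrightarrow> inve (inve f) = f"
  by (rule inve_eqI) (auto simp: inve cmp_inve)

lemma inve_comp:
  "\<lbrakk>f \<in> Arr; g \<in> Arr; supp g = supp f; src g = tgt f\<rbrakk> \<Longrightarrow> inve (g \<cdot> f) = inve f \<cdot> inve g"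
  by (rule inve_eqI) (simp_all add: inve cmp assoc cancel inve_cmp)

lemma inve_idn: "\<lbrakk>a \<in> Ob; openin X V; V \<subseteq> base a\<rbrakk> \<Longrightarrow> inve (idn V a) = idn V a"
  by (rule inve_eqI) (simp_all add: idn cmp_idn')

text \<open>The restriction of an identity is idempotent because restriction respects composition,
  and in a groupoid an idempotent is an identity.\<close>

lemma res_idn:
  assumes "a \<in> Ob" "openin X V" "V \<subseteq> base a" "openin X W" "W \<subseteq> V"
  shows "res W (idn V a) = idn W a"
proof -
  let ?i = "res W (idn V a)"
  have i: "?i \<in> Arr" "supp ?i = W" "src ?i = a" "tgt ?i = a"
    using assms by (simp_all add: idn res)
  have "?i \<cdot> ?i = ?i" using assms by (simp add: idn cmp_idn' flip: res_cmp)
  then have "inve ?i \<cdot> (?i \<cdot> ?i) = inve ?i \<cdot> ?i" by simp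
  then show ?thesis using i by (simp add: cancel inve_cmp)
qed

lemma res_inve:
  assumes "f \<in> Arr" "openin X V" "V \<subseteq> supp f"
  shows "res V (inve f) = inve (res V f)"
proof (rule inve_eqI[symmetric])
  have "res V (inve f) \<cdot> res V f = res V (idn (supp f) (src f))"
    using assms by (simp add: inve inve_cmp flip: res_cmp)
  then show "res V (inve f) \<cdot> res V f = idn (supp (res V f)) (src (res V f))"
    using assms arr[of f] by (simp add: res_idn res)
qed (use assms in \<open>simp_all add: res inve\<close>)

lemmas arrow_simps = arr idn cmp assoc cmp_idn' idn_cmp' inve inve_cmp cmp_inve res res_self' res_res
  res_cmp cancel inve_inve inve_comp inve_idn res_idn res_inve

end

text \<open>\<open>N p\<close> collects the loops of the p-th subgroupoid at all objects and over
  all open sets, and \<open>\<kappa> p\<close> is the class map into the single sheaf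
  \<open>A p\<close> that stands for the quotient of \<open>N p\<close> by \<open>N (Suc p)\<close>.
  The conjugation laws allow arrows between different objects, which is what makes one sheaf
  suffice. The condition \<open>complete\<close> concerns families whose supports may shrink as
  \<open>p\<close> grows, in the form in which approximations arise.\<close>

locale filtered_gerbe = strict_groupoid_prestack +
  fixes N :: "nat \<Rightarrow> 'c set" and A :: "nat \<Rightarrow> ('a, 'd) group_presheaf" and \<kappa> :: "nat \<Rightarrow> 'c \<Rightarrow> 'd"
  assumes glue: "\<lbrakk>a \<in> Ob; b \<in> Ob; base a = base b;
      \<And>x. x \<in> base a \<Longrightarrow> k x \<in> Arr \<and> x \<in> supp (k x) \<and> src (k x) = a \<and> tgt (k x) = b;
      \<And>x y. x \<in> base a \<Longrightarrow> y \<in> base a \<Longrightarrow>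
        res (supp (k x) \<inter> supp (k y)) (k x) = res (supp (k x) \<inter> supp (k y)) (k y)\<rbrakk>
      \<Longrightarrow> \<exists>h\<in>Arr. supp h = base a \<and> src h = a \<and> tgt h = b"
    and locally_connected: "\<lbrakk>a \<in> Ob; b \<in> Ob; base a = base b; x \<in> base a\<rbrakk>
      \<Longrightarrow> \<exists>f\<in>Arr. x \<in> supp f \<and> src f = a \<and> tgt f = b"
    and restrict_object: "\<lbrakk>a \<in> Ob; openin X V; V \<subseteq> base a\<rbrakk>
      \<Longrightarrow> \<exists>f\<in>Arr. supp f = V \<and> tgt f = a \<and> base (src f) = V"
    and N_loop: "f \<in> N p \<Longrightarrow> f \<in> Arr" "f \<in> N p \<Longrightarrow> tgt f = src f"
    and N_0: "\<lbrakk>f \<in> Arr; src f = tgt f\<rbrakk> \<Longrightarrow> f \<in> N 0"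
    and N_Suc: "f \<in> N (Suc p) \<Longrightarrow> f \<in> N p"
    and N_separated: "\<lbrakk>f \<in> Arr; \<And>p. f \<in> N p\<rbrakk> \<Longrightarrow> f = idn (supp f) (src f)"
    and N_idn: "\<lbrakk>a \<in> Ob; openin X V; V \<subseteq> base a\<rbrakk> \<Longrightarrow> idn V a \<in> N p"
    and N_cmp: "\<lbrakk>f \<in> N p; g \<in> N p; supp g = supp f; src g = src f\<rbrakk> \<Longrightarrow> g \<cdot> f \<in> N p"
    and N_inve: "f \<in> N p \<Longrightarrow> inve f \<in> N p"
    and N_conj: "\<lbrakk>f \<in> N p; g \<in> Arr; supp g = supp f; src g = src f\<rbrakk> \<Longrightarrow> g \<cdot> (f \<cdot> inve g) \<in> N p"
    and N_res: "\<lbrakk>f \<in> N p; openin X V; V \<subseteq> supp f\<rbrakk> \<Longrightarrow> res V f \<in> N p"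
    and N_local: "\<lbrakk>f \<in> Arr; src f = tgt f;
      \<And>x. x \<in> supp f \<Longrightarrow> \<exists>V. openin X V \<and> x \<in> V \<and> V \<subseteq> supp f \<and> res V f \<in> N p\<rbrakk> \<Longrightarrow> f \<in> N p"
    and abelian: "abelian_sheaf X (A p)"
    and \<kappa>_closed: "f \<in> N p \<Longrightarrow> \<kappa> p f \<in> carrier (Sec (A p) (supp f))"
    and \<kappa>_cmp: "\<lbrakk>f \<in> N p; g \<in> N p; supp g = supp f; src g = src f\<rbrakk>
      \<Longrightarrow> \<kappa> p (g \<cdot> f) = \<kappa> p g \<otimes>\<^bsub>Sec (A p) (supp f)\<^esub> \<kappa> p f"
    and \<kappa>_res: "\<lbrakk>f \<in> N p; openin X V; V \<subseteq> supp f\<rbrakk> \<Longrightarrow> \<kappa> p (res V f) = Res (A p) (supp f) V (\<kappa> p f)"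
    and \<kappa>_kernel: "\<lbrakk>f \<in> N p; \<kappa> p f = \<one>\<^bsub>Sec (A p) (supp f)\<^esub>\<rbrakk> \<Longrightarrow> f \<in> N (Suc p)"
    and \<kappa>_conj: "\<lbrakk>f \<in> N p; g \<in> Arr; supp g = supp f; src g = src f\<rbrakk> \<Longrightarrow> \<kappa> p (g \<cdot> (f \<cdot> inve g)) = \<kappa> p f"
    and \<kappa>_locally_surjective: "\<lbrakk>a \<in> Ob; openin X V; V \<subseteq> base a; e \<in> carrier (Sec (A p) V); x \<in> V\<rbrakk>
      \<Longrightarrow> \<exists>m\<in>N p. x \<in> supp m \<and> supp m \<subseteq> V \<and> src m = a \<and> \<kappa> p m = Res (A p) V (supp m) e"
    and complete: "\<lbrakk>a \<in> Ob; openin X V; V \<subseteq> base a;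
      \<And>p x. x \<in> V \<Longrightarrow> \<phi> p x \<in> Arr \<and> x \<in> supp (\<phi> p x) \<and> supp (\<phi> p x) \<subseteq> V \<and> src (\<phi> p x) = a \<and> tgt (\<phi> p x) = a;
      \<And>p q x y. \<lbrakk>p \<le> q; x \<in> V; y \<in> V\<rbrakk> \<Longrightarrow> res (supp (\<phi> p x) \<inter> supp (\<phi> q y)) (\<phi> q y) \<cdot>
        inve (res (supp (\<phi> p x) \<inter> supp (\<phi> q y)) (\<phi> p x)) \<in> N p\<rbrakk>
      \<Longrightarrow> \<exists>h\<in>Arr. supp h = V \<and> src h = a \<and> tgt h = a \<and>
        (\<forall>p. \<forall>x\<in>V. \<phi> p x \<cdot> inve (res (supp (\<phi> p x)) h) \<in> N p)"
begin

section \<open>Congruence of arrows modulo \<open>N p\<close>\<close>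

definition cong :: "nat \<Rightarrow> 'c \<Rightarrow> 'c \<Rightarrow> bool" where
  "cong p f g \<longleftrightarrow> f \<in> Arr \<and> g \<in> Arr \<and> supp f = supp g \<and> src f = src g \<and> tgt f = tgt g \<and> f \<cdot> inve g \<in> N p"

lemma congD:
  assumes "cong p f g"
  shows "f \<in> Arr" "g \<in> Arr" "supp f = supp g" "src f = src g" "tgt f = tgt g" "f \<cdot> inve g \<in> N p"
  using assms unfolding cong_def by auto

lemma cong_refl: "f \<in> Arr \<Longrightarrow> cong p f f"
  unfolding cong_def by (simp add: arrow_simps N_idn)

lemma cong_sym: "cong p f g \<Longrightarrow> cong p g f"
  using N_inve[of "f \<cdot> inve g" p] unfolding cong_def by (simp add: arrow_simps)

lemma cong_trans: assumes fg: "cong p f g" and gh: "cong p g h" shows "cong p f h"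
proof -
  note f = congD[OF fg] and h = congD[OF gh]
  have "f \<cdot> inve g \<cdot> (g \<cdot> inve h) \<in> N p"
    by (rule N_cmp[OF h(6) f(6)]) (use f h in \<open>simp_all add: arrow_simps\<close>)
  then show ?thesis unfolding cong_def using f h by (simp add: arrow_simps)
qed

lemma N_mono: "f \<in> N q \<Longrightarrow> p \<le> q \<Longrightarrow> f \<in> N p"
  by (induction q) (auto simp: le_Suc_eq N_Suc)

lemma cong_mono: "cong q f g \<Longrightarrow> p \<le> q \<Longrightarrow> cong p f g"
  unfolding cong_def using N_mono by blast

lemma cong_res: "cong p f g \<Longrightarrow> openin X V \<Longrightarrow> V \<subseteq> supp f \<Longrightarrow> cong p (res V f) (res V g)"
  using N_res[of "f \<cdot> inve g" p V] unfolding cong_def by (simp add: arrow_simps)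

text \<open>The quotient of the composites is the conjugate of \<open>f \<cdot> inve g\<close> by
  \<open>h\<close>, so normality enters here. Composition on the right leaves the quotient
  unchanged.\<close>

lemma cong_cmp_left:
  assumes "cong p f g" "h \<in> Arr" "supp h = supp f" "src h = tgt f"
  shows "cong p (h \<cdot> f) (h \<cdot> g)"
  using assms N_conj[of "f \<cdot> inve g" p h] unfolding cong_def by (simp add: arrow_simps)

lemma cong_cmp_right:
  assumes "cong p f g" "h \<in> Arr" "supp h = supp f" "src f = tgt h"
  shows "cong p (f \<cdot> h) (g \<cdot> h)"
  using assms unfolding cong_def by (simp add: arrow_simps)

text \<open>Conjugating \<open>f \<cdot> inve g\<close> by \<open>inve f\<close> gives
  \<open>inve g \<cdot> f\<close>, and the inverse of this loop is the quotient of
  \<open>inve f\<close> by \<open>inve g\<close>.\<close>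

lemma cong_inve:
  assumes "cong p f g" shows "cong p (inve f) (inve g)"
proof -
  note f = congD[OF assms]
  have "inve f \<cdot> (f \<cdot> inve g \<cdot> inve (inve f)) \<in> N p"
    by (rule N_conj) (use f in \<open>simp_all add: arrow_simps\<close>)
  then have "inve g \<cdot> f \<in> N p" using f by (simp add: arrow_simps)
  from N_inve[OF this] show ?thesis unfolding cong_def using f by (simp add: arrow_simps)
qed

lemma cong_loop_iff: "\<lbrakk>f \<in> Arr; src f = tgt f\<rbrakk> \<Longrightarrow> cong p f (idn (supp f) (src f)) \<longleftrightarrow> f \<in> N p"
  unfolding cong_def by (simp add: arrow_simps)

lemma cong_local:
  assumes f: "f \<in> Arr" "g \<in> Arr" "supp f = supp g" "src f = src g" "tgt f = tgt g"
    and loc: "\<And>x. x \<in> supp f \<Longrightarrow> \<exists>V. openin X V \<and> x \<in> V \<and> V \<subseteq> supp f \<and> cong p (res V f) (res V g)"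
  shows "cong p f g"
proof -
  have "f \<cdot> inve g \<in> N p"
  proof (rule N_local)
    fix x assume "x \<in> supp (f \<cdot> inve g)"
    then have "x \<in> supp f" using f by (simp add: arrow_simps)
    from loc[OF this] obtain V where V: "openin X V" "x \<in> V" "V \<subseteq> supp f" "cong p (res V f) (res V g)"
      by blast
    then show "\<exists>V. openin X V \<and> x \<in> V \<and> V \<subseteq> supp (f \<cdot> inve g) \<and> res V (f \<cdot> inve g) \<in> N p"
      using congD(6)[OF V(4)] f by (intro exI[of _ V]) (simp add: arrow_simps)
  qed (use f in \<open>simp_all add: arrow_simps\<close>)
  then show ?thesis unfolding cong_def using f by simp
qed

lemma cong_all_eq:
  assumes "\<And>p. cong p f g" shows "f = g"
proof -
  note f = congD[OF assms]
  have "f \<cdot> inve g = idn (supp g) (tgt g)"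
    using N_separated[of "f \<cdot> inve g"] f by (simp add: arrow_simps)
  then have "f \<cdot> inve g \<cdot> g = idn (supp g) (tgt g) \<cdot> g" by simp
  then show ?thesis using f by (simp add: arrow_simps)
qed

lemma cong_0: "\<lbrakk>f \<in> Arr; g \<in> Arr; supp f = supp g; src f = src g; tgt f = tgt g\<rbrakk> \<Longrightarrow> cong 0 f g"
  unfolding cong_def by (simp add: N_0 arrow_simps)

lemma \<kappa>_idn: assumes "a \<in> Ob" "openin X V" "V \<subseteq> base a" shows "\<kappa> p (idn V a) = \<one>\<^bsub>Sec (A p) V\<^esub>"
proof -
  interpret comm_group "Sec (A p) V" using abelian_sheafD(4)[OF abelian assms(2)] .
  show ?thesis
    using \<kappa>_cmp[of "idn V a" p "idn V a"] \<kappa>_closed[OF N_idn[OF assms], of p] assms N_idn[OF assms, of p]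
    by (simp add: arrow_simps)
qed

lemma \<kappa>_inve: assumes f: "f \<in> N p" shows "\<kappa> p (inve f) = inv\<^bsub>Sec (A p) (supp f)\<^esub> (\<kappa> p f)"
proof -
  have f': "f \<in> Arr" "tgt f = src f" using N_loop f by auto
  interpret comm_group "Sec (A p) (supp f)" using abelian_sheafD(4)[OF abelian] f' arr by blast
  have "\<kappa> p (inve f) \<otimes>\<^bsub>Sec (A p) (supp f)\<^esub> \<kappa> p f = \<one>\<^bsub>Sec (A p) (supp f)\<^esub>"
    using \<kappa>_cmp[OF f N_inve[OF f]] f' by (simp add: arrow_simps \<kappa>_idn)
  then show ?thesis
    using \<kappa>_closed[OF f] \<kappa>_closed[OF N_inve[OF f]] f' by (metis inv_equality inve(2))
qed

end

section \<open>Local objects over a common open set are isomorphic\<close>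

text \<open>Choice in the shape of the bounded existence statements below. It is applied by
  resolution, where the instances of \<open>P\<close> are long conjunctions.\<close>

lemma Bex_choice: "(\<And>x. x \<in> K \<Longrightarrow> \<exists>y\<in>B. P x y) \<Longrightarrow> \<exists>f. \<forall>x\<in>K. f x \<in> B \<and> P x (f x)"
  by metis

lemma Bex_choice2:
  "(\<And>k l. k \<in> K \<Longrightarrow> l \<in> K \<Longrightarrow> \<exists>y\<in>B. P k l y) \<Longrightarrow> \<exists>f. \<forall>k\<in>K. \<forall>l\<in>K. f k l \<in> B \<and> P k l (f k l)"
  by metis

context filtered_gerbe
begin

text \<open>Such a family presents an isomorphism of \<open>a\<close> and \<open>b\<close> over
  \<open>base a\<close> in the quotient of the gerbe by \<open>N p\<close>.\<close>

definition approx_arrow :: "'b \<Rightarrow> 'b \<Rightarrow> nat \<Rightarrow> ('a \<Rightarrow> 'c) \<Rightarrow> bool" where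
  "approx_arrow a b p g \<longleftrightarrow>
     (\<forall>x\<in>base a. g x \<in> Arr \<and> x \<in> supp (g x) \<and> src (g x) = a \<and> tgt (g x) = b) \<and>
     (\<forall>x\<in>base a. \<forall>y\<in>base a. cong p (res (supp (g x) \<inter> supp (g y)) (g x)) (res (supp (g x) \<inter> supp (g y)) (g y)))"

text \<open>For \<open>g' x = g x \<cdot> inve (m x)\<close> the difference
  \<open>inve (g' x) \<cdot> g' y\<close> equals
  \<open>m x \<cdot> n x y \<cdot> inve (m y)\<close>. If the classes \<open>e x\<close> of the
  \<open>m x\<close> bound the cocycle of classes of \<open>n\<close>, this loop has trivial class
  and lies in \<open>N (Suc p)\<close>. The second conclusion is what makes the successive
  improvements converge.\<close>

lemma approx_arrow_improve:
  assumes ab: "a \<in> Ob" "b \<in> Ob" "base a = base b" and U: "openin X (base a)"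
    and triv: "cech1_trivial X (base a) (A p)" and g: "approx_arrow a b p g"
  shows "\<exists>g'. approx_arrow a b (Suc p) g' \<and>
    (\<forall>x\<in>base a. supp (g' x) \<subseteq> supp (g x) \<and> cong p (g' x) (res (supp (g' x)) (g x)))"
proof -
  let ?U = "base a"
  define W where "W x = supp (g x)" for x
  have g1: "g x \<in> Arr" "x \<in> W x" "supp (g x) = W x" "src (g x) = a" "tgt (g x) = b" "openin X (W x)" "W x \<subseteq> ?U"
    if "x \<in> ?U" for x
    using g that arr[of "g x"] unfolding approx_arrow_def W_def by auto
  have g2: "cong p (res (W x \<inter> W y) (g x)) (res (W x \<inter> W y) (g y))" if "x \<in> ?U" "y \<in> ?U" for x y
    using g that unfolding approx_arrow_def W_def by blast
  \<comment> \<open>Differences are formed on the side of the source, so all of them are loops at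
    the same object \<open>a\<close> and the cocycle identity holds exactly.\<close>
  define n where "n x y = inve (res (W x \<inter> W y) (g x)) \<cdot> res (W x \<inter> W y) (g y)" for x y
  have oW: "openin X (W x \<inter> W y)" if "x \<in> ?U" "y \<in> ?U" for x y using g1 that by auto
  have n_N: "n x y \<in> N p" if xy: "x \<in> ?U" "y \<in> ?U" for x y
  proof -
    have "cong p (n x y) (idn (W x \<inter> W y) a)"
      unfolding n_def using cong_cmp_left[OF cong_sym[OF g2[OF xy]], of "inve (res (W x \<inter> W y) (g x))"]
        g1[OF xy(1)] g1[OF xy(2)] oW[OF xy] by (simp add: arrow_simps)
    from congD[OF this] show ?thesis
      using cong_loop_iff[of "n x y" p] \<open>cong p (n x y) (idn (W x \<inter> W y) a)\<close> ab(1) oW[OF xy] g1[OF xy(1)]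
      by (simp add: idn le_infI1)
  qed
  have n_supp: "supp (n x y) = W x \<inter> W y" "src (n x y) = a" "tgt (n x y) = a" "n x y \<in> Arr"
    if "x \<in> ?U" "y \<in> ?U" for x y
    unfolding n_def using g1[OF that(1)] g1[OF that(2)] oW[OF that] by (simp_all add: arrow_simps)
  have res_n: "res Q (n x y) = inve (res Q (g x)) \<cdot> res Q (g y)"
    if "x \<in> ?U" "y \<in> ?U" "openin X Q" "Q \<subseteq> W x" "Q \<subseteq> W y" for x y Q
    unfolding n_def using g1[OF that(1)] g1[OF that(2)] oW[OF that(1,2)] that(3-) by (simp add: arrow_simps)
  have "cech1_cocycle (A p) ?U W (\<lambda>x y. \<kappa> p (n x y))"
    unfolding cech1_cocycle_def
  proof (intro conjI ballI)
    fix x y assume "x \<in> ?U" "y \<in> ?U"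
    then show "\<kappa> p (n x y) \<in> carrier (Sec (A p) (W x \<inter> W y))"
      using \<kappa>_closed[OF n_N] n_supp by metis
  next
    fix x y z assume xyz: "x \<in> ?U" "y \<in> ?U" "z \<in> ?U"
    let ?Q = "W x \<inter> W y \<inter> W z"
    have oQ: "openin X ?Q" and s: "?Q \<subseteq> W x" "?Q \<subseteq> W y" "?Q \<subseteq> W z"
      using g1(6)[OF xyz(1)] g1(6)[OF xyz(2)] g1(6)[OF xyz(3)] by auto
    have s2: "?Q \<subseteq> W x \<inter> W y" "?Q \<subseteq> W y \<inter> W z" "?Q \<subseteq> W x \<inter> W z" by auto
    have eq: "res ?Q (n y z) = inve (res ?Q (n x y)) \<cdot> res ?Q (n x z)"
      using res_n[OF xyz(1,2) oQ s(1,2)] res_n[OF xyz(2,3) oQ s(2,3)] res_n[OF xyz(1,3) oQ s(1,3)]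
        g1[OF xyz(1)] g1[OF xyz(2)] g1[OF xyz(3)] oQ s by (simp add: arrow_simps)
    have R: "Res (A p) (W v \<inter> W w) ?Q (\<kappa> p (n v w)) = \<kappa> p (res ?Q (n v w))"
      and RN: "res ?Q (n v w) \<in> N p" and Rs: "supp (res ?Q (n v w)) = ?Q" "src (res ?Q (n v w)) = a"
        "res ?Q (n v w) \<in> Arr" "tgt (res ?Q (n v w)) = a"
      if "v \<in> ?U" "w \<in> ?U" "?Q \<subseteq> W v \<inter> W w" for v w
      using \<kappa>_res[OF n_N[OF that(1,2)] oQ] N_res[OF n_N[OF that(1,2)] oQ] n_supp[OF that(1,2)] that(3) oQ
      by (simp_all add: arrow_simps)
    have "res ?Q (n x y) \<cdot> res ?Q (n y z) = res ?Q (n x z)"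
      unfolding eq using Rs[OF xyz(1,2) s2(1)] Rs[OF xyz(1,3) s2(3)] by (simp add: arrow_simps)
    then show "Res (A p) (W x \<inter> W y) ?Q (\<kappa> p (n x y)) \<otimes>\<^bsub>Sec (A p) ?Q\<^esub> Res (A p) (W y \<inter> W z) ?Q (\<kappa> p (n y z)) =
        Res (A p) (W x \<inter> W z) ?Q (\<kappa> p (n x z))"
      using \<kappa>_cmp[OF RN[OF xyz(2,3) s2(2)] RN[OF xyz(1,2) s2(1)]] Rs[OF xyz(1,2) s2(1)] Rs[OF xyz(2,3) s2(2)]
        R[OF xyz(1,2) s2(1)] R[OF xyz(2,3) s2(2)] R[OF xyz(1,3) s2(3)] by simp
  qed
  with triv g1 obtain e where e: "\<And>x. x \<in> ?U \<Longrightarrow> e x \<in> carrier (Sec (A p) (W x))"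
    "\<And>x y. x \<in> ?U \<Longrightarrow> y \<in> ?U \<Longrightarrow> Res (A p) (W x) (W x \<inter> W y) (e x) \<otimes>\<^bsub>Sec (A p) (W x \<inter> W y)\<^esub> \<kappa> p (n x y) =
      Res (A p) (W y) (W x \<inter> W y) (e y)"
    unfolding cech1_trivial_def cech1_bounds_def by metis
  \<comment> \<open>Classes lift to loops only locally, and this is why the supports shrink from
    \<open>W x\<close> to \<open>W' x\<close>.\<close>
  have "\<exists>m\<in>N p. x \<in> supp m \<and> supp m \<subseteq> W x \<and> src m = a \<and> \<kappa> p m = Res (A p) (W x) (supp m) (e x)" if "x \<in> ?U" for x
    using \<kappa>_locally_surjective[OF ab(1) g1(6,7)[OF that] e(1)[OF that] g1(2)[OF that]] .
  then obtain m where m: "\<And>x. x \<in> ?U \<Longrightarrow> m x \<in> N p" "\<And>x. x \<in> ?U \<Longrightarrow> x \<in> supp (m x)"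
    "\<And>x. x \<in> ?U \<Longrightarrow> supp (m x) \<subseteq> W x" "\<And>x. x \<in> ?U \<Longrightarrow> src (m x) = a"
    "\<And>x. x \<in> ?U \<Longrightarrow> \<kappa> p (m x) = Res (A p) (W x) (supp (m x)) (e x)"
    by metis
  define W' where "W' x = supp (m x)" for x
  have m': "m x \<in> Arr" "supp (m x) = W' x" "src (m x) = a" "tgt (m x) = a" "openin X (W' x)" "W' x \<subseteq> W x"
    if "x \<in> ?U" for x
    using N_loop[OF m(1)[OF that]] m(3,4)[OF that] arr(1) unfolding W'_def by auto
  define g' where "g' x = res (W' x) (g x) \<cdot> inve (m x)" for x
  have g': "g' x \<in> Arr" "supp (g' x) = W' x" "src (g' x) = a" "tgt (g' x) = b" if "x \<in> ?U" for x
    unfolding g'_def using g1[OF that] m'[OF that] by (simp_all add: arrow_simps)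
  have "cong (Suc p) (res (W' x \<inter> W' y) (g' x)) (res (W' x \<inter> W' y) (g' y))" if xy: "x \<in> ?U" "y \<in> ?U" for x y
  proof -
    let ?Q = "W' x \<inter> W' y"
    have oQ: "openin X ?Q" and s: "?Q \<subseteq> W' x" "?Q \<subseteq> W' y" "?Q \<subseteq> W x" "?Q \<subseteq> W y" "?Q \<subseteq> W x \<inter> W y"
      using m'(5,6)[OF xy(1)] m'(5,6)[OF xy(2)] by auto
    interpret comm_group "Sec (A p) ?Q" using abelian_sheafD(4)[OF abelian oQ] .
    interpret P: presheaf_of_groups X "A p" using abelian_sheafD(2)[OF abelian] .
    note mx = m'[OF xy(1)] and my = m'[OF xy(2)] and gx = g1[OF xy(1)] and gy = g1[OF xy(2)]
    let ?mx = "res ?Q (m x)" and ?my = "res ?Q (m y)" and ?n = "res ?Q (n x y)"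
    have N: "?mx \<in> N p" "?my \<in> N p" "?n \<in> N p"
      using N_res[OF m(1)[OF xy(1)] oQ] N_res[OF m(1)[OF xy(2)] oQ] N_res[OF n_N[OF xy] oQ] mx my n_supp[OF xy] s by simp_all
    have st: "?mx \<in> Arr" "supp ?mx = ?Q" "src ?mx = a" "tgt ?mx = a" "?my \<in> Arr" "supp ?my = ?Q" "src ?my = a" "tgt ?my = a"
      "?n \<in> Arr" "supp ?n = ?Q" "src ?n = a" "tgt ?n = a"
      using mx my n_supp[OF xy] oQ s by (simp_all add: res)
    have ex: "\<kappa> p ?mx = Res (A p) (W x) ?Q (e x)" "\<kappa> p ?my = Res (A p) (W y) ?Q (e y)"
      "\<kappa> p ?n = Res (A p) (W x \<inter> W y) ?Q (\<kappa> p (n x y))"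
      using \<kappa>_res[OF m(1)[OF xy(1)] oQ] \<kappa>_res[OF m(1)[OF xy(2)] oQ] \<kappa>_res[OF n_N[OF xy] oQ] mx my n_supp[OF xy] s
        m(5)[OF xy(1)] m(5)[OF xy(2)] P.Res_Res[OF gx(6) mx(5) oQ mx(6) s(1) e(1)[OF xy(1)]]
        P.Res_Res[OF gy(6) my(5) oQ my(6) s(2) e(1)[OF xy(2)]] by simp_all
    have cl: "\<kappa> p ?mx \<in> carrier (Sec (A p) ?Q)" "\<kappa> p ?my \<in> carrier (Sec (A p) ?Q)" "\<kappa> p ?n \<in> carrier (Sec (A p) ?Q)"
      using \<kappa>_closed[OF N(1)] \<kappa>_closed[OF N(2)] \<kappa>_closed[OF N(3)] st by simp_all
    have cn: "\<kappa> p (n x y) \<in> carrier (Sec (A p) (W x \<inter> W y))"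
      using \<kappa>_closed[OF n_N[OF xy]] n_supp[OF xy] by simp
    have Rex: "Res (A p) (W x) (W x \<inter> W y) (e x) \<in> carrier (Sec (A p) (W x \<inter> W y))"
      using P.Res_closed[OF gx(6) oW[OF xy] _ e(1)[OF xy(1)]] by simp
    \<comment> \<open>The bounding equation, known over \<open>W x \<inter> W y\<close>, is
      restricted to the overlap of the smaller supports.\<close>
    have "\<kappa> p ?mx \<otimes>\<^bsub>Sec (A p) ?Q\<^esub> \<kappa> p ?n = \<kappa> p ?my"
      using arg_cong[OF e(2)[OF xy], of "Res (A p) (W x \<inter> W y) ?Q"] P.Res_mult[OF oW[OF xy] oQ s(5) Rex cn]
        P.Res_Res[OF gx(6) oW[OF xy] oQ _ s(5) e(1)[OF xy(1)]] P.Res_Res[OF gy(6) oW[OF xy] oQ _ s(5) e(1)[OF xy(2)]] ex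
      by simp
    then have "\<kappa> p (?mx \<cdot> ?n \<cdot> inve ?my) = \<one>\<^bsub>Sec (A p) ?Q\<^esub>"
      using \<kappa>_cmp[OF N(3,1)] \<kappa>_cmp[OF N_inve[OF N(2)] N_cmp[OF N(3,1)]] \<kappa>_inve[OF N(2)] st cl
      by (simp add: arrow_simps)
    then have "?mx \<cdot> ?n \<cdot> inve ?my \<in> N (Suc p)"
      using \<kappa>_kernel[OF N_cmp[OF N_inve[OF N(2)] N_cmp[OF N(3,1)]]] st by (simp add: arrow_simps)
    moreover have eq: "?mx \<cdot> ?n \<cdot> inve ?my = inve (res ?Q (g' x)) \<cdot> res ?Q (g' y)"
      unfolding res_n[OF xy oQ s(3,4)] g'_def using gx gy mx my oQ s by (simp add: arrow_simps)
    ultimately have "inve (res ?Q (g' x)) \<cdot> res ?Q (g' y) \<in> N (Suc p)" by simp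
    then have "cong (Suc p) (inve (res ?Q (g' x)) \<cdot> res ?Q (g' y)) (idn ?Q a)"
      using cong_loop_iff[of "inve (res ?Q (g' x)) \<cdot> res ?Q (g' y)" "Suc p"] g'[OF xy(1)] g'[OF xy(2)] oQ s
      by (simp add: arrow_simps)
    from cong_cmp_left[OF this, of "res ?Q (g' x)"]
    have "cong (Suc p) (res ?Q (g' y)) (res ?Q (g' x))"
      using g'[OF xy(1)] g'[OF xy(2)] oQ s by (simp add: arrow_simps)
    then show ?thesis by (rule cong_sym)
  qed
  then have "approx_arrow a b (Suc p) g'"
    unfolding approx_arrow_def using g' m(2) by (simp add: W'_def)
  \<comment> \<open>The correcting factor lies in \<open>N p\<close>, hence is congruent to an
    identity.\<close>
  moreover have "supp (g' x) \<subseteq> supp (g x) \<and> cong p (g' x) (res (supp (g' x)) (g x))" if x: "x \<in> ?U" for x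
  proof -
    have "cong p (inve (m x)) (idn (W' x) a)"
      using cong_loop_iff[of "inve (m x)" p] N_inve[OF m(1)[OF x]] m'[OF x] by (simp add: arrow_simps)
    from cong_cmp_left[OF this, of "res (W' x) (g x)"] show ?thesis
      using g1[OF x] m'[OF x] g'[OF x] unfolding g'_def by (simp add: arrow_simps)
  qed
  ultimately show ?thesis by blast
qed

text \<open>Iterated improvement gives families \<open>g p\<close> on shrinking neighbourhoods.
  Relative to the fixed arrow \<open>g 0 z\<close> they become approximations to a loop over all of
  \<open>W 0 z\<close>, and completeness produces that loop. The resulting arrows \<open>k z\<close>
  are congruent to the \<open>g p\<close> for every \<open>p\<close>, which determines them and lets
  them glue.\<close>

lemma isomorphic_same_base:
  assumes ab: "a \<in> Ob" "b \<in> Ob" "base a = base b" and U: "openin X (base a)"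
    and triv: "\<And>p. cech1_trivial X (base a) (A p)"
  shows "\<exists>h\<in>Arr. supp h = base a \<and> src h = a \<and> tgt h = b"
proof -
  let ?U = "base a"
  \<comment> \<open>Modulo \<open>N 0\<close>, which contains every loop, parallel arrows over the
    same set agree; local connectedness is enough to start.\<close>
  have "\<exists>g. approx_arrow a b 0 g"
  proof -
    obtain g where g: "\<And>x. x \<in> ?U \<Longrightarrow> g x \<in> Arr \<and> x \<in> supp (g x) \<and> src (g x) = a \<and> tgt (g x) = b"
      using locally_connected[OF ab] by metis
    have "cong 0 (res (supp (g x) \<inter> supp (g y)) (g x)) (res (supp (g x) \<inter> supp (g y)) (g y))"
      if "x \<in> ?U" "y \<in> ?U" for x y
      using g[OF that(1)] g[OF that(2)] arr(1)[of "g x"] arr(1)[of "g y"] by (intro cong_0) (simp_all add: res openin_Int)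
    then have "approx_arrow a b 0 g" unfolding approx_arrow_def using g by blast
    then show ?thesis by blast
  qed
  then obtain g where g: "\<And>p. approx_arrow a b p (g p)"
    "\<And>p. \<forall>x\<in>?U. supp (g (Suc p) x) \<subseteq> supp (g p x) \<and> cong p (g (Suc p) x) (res (supp (g (Suc p) x)) (g p x))"
    using dependent_nat_choice[of "approx_arrow a b" "\<lambda>p g g'. \<forall>x\<in>?U. supp (g' x) \<subseteq> supp (g x) \<and>
      cong p (g' x) (res (supp (g' x)) (g x))"] approx_arrow_improve[OF ab U triv] by metis
  define W where "W p x = supp (g p x)" for p x
  have g1: "g p x \<in> Arr" "x \<in> W p x" "supp (g p x) = W p x" "src (g p x) = a" "tgt (g p x) = b"
      "openin X (W p x)" "W p x \<subseteq> ?U"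
    if "x \<in> ?U" for p x
    using g(1)[of p] that arr[of "g p x"] unfolding approx_arrow_def W_def by auto
  have g2: "cong p (res (W p x \<inter> W p y) (g p x)) (res (W p x \<inter> W p y) (g p y))" if "x \<in> ?U" "y \<in> ?U" for p x y
    using g(1)[of p] that unfolding approx_arrow_def W_def by blast
  have g3: "W q x \<subseteq> W p x \<and> cong p (g q x) (res (W q x) (g p x))" if "x \<in> ?U" "p \<le> q" for p q x
    using that(2)
  proof (induction q rule: dec_induct)
    case base
    show ?case using g1[OF that(1)] by (simp add: cong_refl res_self')
  next
    case (step q)
    have s: "W (Suc q) x \<subseteq> W q x" and c: "cong q (g (Suc q) x) (res (W (Suc q) x) (g q x))"
      using g(2)[of q] that(1) unfolding W_def by auto
    have "cong p (res (W (Suc q) x) (g q x)) (res (W (Suc q) x) (res (W q x) (g p x)))"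
      using cong_res[OF conjunct2[OF step.IH] g1(6)[OF that(1)]] s g1(3)[OF that(1)] by simp
    then have "cong p (res (W (Suc q) x) (g q x)) (res (W (Suc q) x) (g p x))"
      using g1[OF that(1)] s step.IH by (simp add: res_res)
    with cong_mono[OF c step.hyps(1)] show ?case using cong_trans s step.IH by blast
  qed
  \<comment> \<open>Different stages at different points are compared in two moves: from stage
    \<open>q\<close> down to stage \<open>p\<close> at the point \<open>x\<close>, then from
    \<open>x\<close> to \<open>y\<close> at stage \<open>p\<close>.\<close>
  have g4: "cong p (res Q (g q x)) (res Q (g p y))"
    if xy: "x \<in> ?U" "y \<in> ?U" and pq: "p \<le> q" and Q: "openin X Q" "Q \<subseteq> W q x" "Q \<subseteq> W p y" for p q x y Q
  proof -
    have s: "Q \<subseteq> W p x \<inter> W p y" "openin X (W p x \<inter> W p y)" using g3[OF xy(1) pq] Q g1(6) xy by auto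
    have "cong p (res Q (g q x)) (res Q (res (W q x) (g p x)))"
      using cong_res[OF conjunct2[OF g3[OF xy(1) pq]] Q(1)] Q(2) g1(3)[OF xy(1)] by simp
    then have 1: "cong p (res Q (g q x)) (res Q (g p x))"
      using g1[OF xy(1)] g3[OF xy(1) pq] Q by (simp add: res_res)
    have "cong p (res Q (res (W p x \<inter> W p y) (g p x))) (res Q (res (W p x \<inter> W p y) (g p y)))"
      by (rule cong_res[OF g2[OF xy] Q(1)]) (use g1[OF xy(1)] s in \<open>simp add: res\<close>)
    then have "cong p (res Q (g p x)) (res Q (g p y))"
      using g1[OF xy(1)] g1[OF xy(2)] s Q by (simp add: res_res)
    with 1 show ?thesis by (rule cong_trans)
  qed
  have ex_k: "\<exists>k\<in>Arr. supp k = W 0 z \<and> src k = a \<and> tgt k = b \<and>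
      (\<forall>p. \<forall>x\<in>W 0 z. cong p (res (W p x \<inter> W 0 z) k) (res (W p x \<inter> W 0 z) (g p x)))" if z: "z \<in> ?U" for z
  proof -
    let ?V = "W 0 z"
    note gz = g1[OF z, of 0]
    \<comment> \<open>Division by \<open>g 0 z\<close> turns arrows from \<open>a\<close> to
      \<open>b\<close> into loops at \<open>a\<close>, to which completeness applies.\<close>
    define \<phi> where "\<phi> p x = inve (res (W p x \<inter> ?V) (g 0 z)) \<cdot> res (W p x \<inter> ?V) (g p x)" for p x
    have \<phi>: "\<phi> p x \<in> Arr" "supp (\<phi> p x) = W p x \<inter> ?V" "src (\<phi> p x) = a" "tgt (\<phi> p x) = a"
      "openin X (W p x \<inter> ?V)" "x \<in> W p x" if "x \<in> ?V" for p x
    proof -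
      have x: "x \<in> ?U" using that gz by auto
      show o: "openin X (W p x \<inter> ?V)" "x \<in> W p x" using g1[OF x] gz by auto
      show "\<phi> p x \<in> Arr" "supp (\<phi> p x) = W p x \<inter> ?V" "src (\<phi> p x) = a" "tgt (\<phi> p x) = a"
        unfolding \<phi>_def using g1[OF x] gz o by (simp_all add: arrow_simps)
    qed
    have \<phi>_cong: "cong p (res Q (\<phi> q y)) (res Q (\<phi> p x))"
      if pq: "p \<le> q" and xy: "x \<in> ?V" "y \<in> ?V" and Q: "openin X Q" "Q \<subseteq> W p x" "Q \<subseteq> W q y" "Q \<subseteq> ?V" for p q x y Q
    proof -
      have x: "x \<in> ?U" and y: "y \<in> ?U" using xy gz by auto
      have r: "res Q (\<phi> r w) = inve (res Q (g 0 z)) \<cdot> res Q (g r w)" if "w \<in> ?V" "Q \<subseteq> W r w" for r w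
        unfolding \<phi>_def using g1[OF subsetD[OF gz(7) that(1)], of r] gz \<phi>(5)[OF that(1), of r] that Q
        by (simp add: arrow_simps)
      show ?thesis
        unfolding r[OF xy(1) Q(2)] r[OF xy(2) Q(3)]
        by (rule cong_cmp_left[OF g4[OF y x pq Q(1,3,2)]]) (use g1[OF y] gz Q in \<open>simp_all add: arrow_simps\<close>)
    qed
    have "\<exists>h\<in>Arr. supp h = ?V \<and> src h = a \<and> tgt h = a \<and>
        (\<forall>p. \<forall>x\<in>?V. \<phi> p x \<cdot> inve (res (supp (\<phi> p x)) h) \<in> N p)"
    proof (rule complete[OF ab(1) gz(6,7)])
      show "\<phi> p x \<in> Arr \<and> x \<in> supp (\<phi> p x) \<and> supp (\<phi> p x) \<subseteq> ?V \<and> src (\<phi> p x) = a \<and> tgt (\<phi> p x) = a"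
        if "x \<in> ?V" for p x
        using \<phi>[OF that] that by simp
      show "res (supp (\<phi> p x) \<inter> supp (\<phi> q y)) (\<phi> q y) \<cdot> inve (res (supp (\<phi> p x) \<inter> supp (\<phi> q y)) (\<phi> p x)) \<in> N p"
        if "p \<le> q" "x \<in> ?V" "y \<in> ?V" for p q x y
        using \<phi>(2,5)[OF that(2), of p] \<phi>(2,5)[OF that(3), of q] by (intro congD(6)[OF \<phi>_cong[OF that]]) auto
    qed
    then obtain h where h: "h \<in> Arr" "supp h = ?V" "src h = a" "tgt h = a"
      "\<And>p x. x \<in> ?V \<Longrightarrow> \<phi> p x \<cdot> inve (res (supp (\<phi> p x)) h) \<in> N p" by blast
    have "cong p (res (W p x \<inter> ?V) (g 0 z \<cdot> h)) (res (W p x \<inter> ?V) (g p x))" if x: "x \<in> ?V" for p x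
    proof -
      let ?Q = "W p x \<inter> ?V"
      have xU: "x \<in> ?U" using x gz by auto
      have "cong p (\<phi> p x) (res ?Q h)"
        unfolding cong_def using \<phi>[OF x] h(5)[OF x, of p] h(1-4) by (simp add: res)
      from cong_cmp_left[OF cong_sym[OF this], of "res ?Q (g 0 z)"]
      show ?thesis
        unfolding \<phi>_def using \<phi>(5)[OF x, of p] g1[OF xU, of p] gz h(1-4) by (simp add: arrow_simps)
    qed
    then show ?thesis
      using gz h(1-4) by (intro bexI[of _ "g 0 z \<cdot> h"]) (simp_all add: arrow_simps)
  qed
  obtain k where k': "\<forall>z\<in>?U. k z \<in> Arr \<and> supp (k z) = W 0 z \<and> src (k z) = a \<and> tgt (k z) = b \<and>
      (\<forall>p. \<forall>x\<in>W 0 z. cong p (res (W p x \<inter> W 0 z) (k z)) (res (W p x \<inter> W 0 z) (g p x)))"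
    by (rule exE[OF Bex_choice], erule ex_k, rule that, assumption)
  have k: "k z \<in> Arr" "supp (k z) = W 0 z" "src (k z) = a" "tgt (k z) = b"
      "x \<in> W 0 z \<Longrightarrow> cong p (res (W p x \<inter> W 0 z) (k z)) (res (W p x \<inter> W 0 z) (g p x))"
    if "z \<in> ?U" for z p x
    using bspec[OF k' that] by auto
  show ?thesis
  proof (rule glue[OF ab, of k])
    fix y z assume yz: "y \<in> ?U" "z \<in> ?U"
    let ?Q = "W 0 y \<inter> W 0 z"
    have oQ: "openin X ?Q" using g1(6) yz by auto
    \<comment> \<open>Near each \<open>x\<close>, both arrows are congruent to \<open>g p x\<close>
      modulo \<open>N p\<close>, on a neighbourhood depending on \<open>p\<close>. Congruence is
      local for each fixed \<open>p\<close>, and congruence for all \<open>p\<close> is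
      equality.\<close>
    have "res ?Q (k y) = res ?Q (k z)"
    proof (rule cong_all_eq, rule cong_local)
      fix p x assume "x \<in> supp (res ?Q (k y))"
      then have x: "x \<in> W 0 y" "x \<in> W 0 z" using k[OF yz(1)] oQ by (simp_all add: res)
      then have xU: "x \<in> ?U" using g1[OF yz(1), of 0] by auto
      let ?P = "W p x \<inter> ?Q"
      have oP: "openin X ?P" using g1[OF xU] oQ by auto
      have oV: "openin X (W p x \<inter> W 0 v)" if "v \<in> ?U" for v using g1[OF xU] g1[OF that] by auto
      have kv: "cong p (res ?P (k v)) (res ?P (g p x))" if v: "v \<in> ?U" "x \<in> W 0 v" "?P \<subseteq> W 0 v" for v
      proof -
        have "cong p (res ?P (res (W p x \<inter> W 0 v) (k v))) (res ?P (res (W p x \<inter> W 0 v) (g p x)))"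
          by (rule cong_res[OF k(5)[OF v(1,2)] oP]) (use k[OF v(1)] oV[OF v(1)] v(3) in \<open>simp add: res\<close>)
        then show ?thesis
          using k[OF v(1)] g1[OF xU, of p] oV[OF v(1)] oP v(3) by (simp add: res_res)
      qed
      have "cong p (res ?P (k y)) (res ?P (k z))"
        using cong_trans[OF kv[OF yz(1) x(1)] cong_sym[OF kv[OF yz(2) x(2)]]] by auto
      moreover have "res ?P (res ?Q (k v)) = res ?P (k v)" if "v \<in> ?U" "?Q \<subseteq> W 0 v" for v
        using res_res[OF k(1)[OF that(1)] oQ oP _ Int_lower2] k(2)[OF that(1)] that(2) by simp
      ultimately show "\<exists>V. openin X V \<and> x \<in> V \<and> V \<subseteq> supp (res ?Q (k y)) \<and> cong p (res V (res ?Q (k y))) (res V (res ?Q (k z)))"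
        using oP x g1(2)[OF xU, of p] k[OF yz(1)] oQ yz
        by (intro exI[of _ ?P]) (simp add: res le_infI2)
    qed (use k[OF yz(1)] k[OF yz(2)] oQ in \<open>simp_all add: res\<close>)
    then show "res (supp (k y) \<inter> supp (k z)) (k y) = res (supp (k y) \<inter> supp (k z)) (k z)"
      using k(2) yz by simp
  qed (use k g1 in simp)
qed

text \<open>Replacing both objects by restrictions to \<open>V\<close>, to which they are isomorphic
  over \<open>V\<close>, reduces to objects that live exactly over \<open>V\<close>.\<close>

lemma isomorphic:
  assumes ab: "a \<in> Ob" "b \<in> Ob" and V: "openin X V" "V \<subseteq> base a" "V \<subseteq> base b"
    and triv: "\<And>p. cech1_trivial X V (A p)"
  shows "\<exists>h\<in>Arr. supp h = V \<and> src h = a \<and> tgt h = b"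
proof -
  obtain f where f: "f \<in> Arr" "supp f = V" "tgt f = a" "base (src f) = V"
    using restrict_object[OF ab(1) V(1,2)] by blast
  obtain g where g: "g \<in> Arr" "supp g = V" "tgt g = b" "base (src g) = V"
    using restrict_object[OF ab(2) V(1,3)] by blast
  obtain h where h: "h \<in> Arr" "supp h = V" "src h = src f" "tgt h = src g"
    using isomorphic_same_base[of "src f" "src g"] f g V(1) triv arr by auto
  show ?thesis
    by (rule bexI[of _ "g \<cdot> (h \<cdot> inve f)"]) (use f g h in \<open>simp_all add: arrow_simps\<close>)
qed

lemma cong_cmp:
  assumes "cong p f f'" "cong p g g'" "supp g = supp f" "src g = tgt f"
  shows "cong p (g \<cdot> f) (g' \<cdot> f')"
proof (rule cong_trans)
  note f = congD[OF assms(1)] and g = congD[OF assms(2)]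
  show "cong p (g \<cdot> f) (g \<cdot> f')" by (rule cong_cmp_left[OF assms(1)]) (use g assms in auto)
  show "cong p (g \<cdot> f') (g' \<cdot> f')" by (rule cong_cmp_right[OF assms(2)]) (use f g assms in auto)
qed

section \<open>Correcting an approximate descent datum\<close>

definition frame :: "'k set \<Rightarrow> ('k \<Rightarrow> 'b) \<Rightarrow> ('k \<Rightarrow> 'k \<Rightarrow> 'c) \<Rightarrow> bool" where
  "frame K a g \<longleftrightarrow> (\<forall>k\<in>K. \<forall>l\<in>K. g k l \<in> Arr \<and> supp (g k l) = base (a k) \<inter> base (a l) \<and>
     src (g k l) = a k \<and> tgt (g k l) = a l)"

text \<open>The failure of the cocycle condition, expressed as a loop at the first object. Defects
  with different first indices have to be transported along some \<open>g k l\<close> before they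
  can be composed, and \<open>\<kappa>\<close> does not see this transport.\<close>

definition defect :: "('k \<Rightarrow> 'b) \<Rightarrow> ('k \<Rightarrow> 'k \<Rightarrow> 'c) \<Rightarrow> 'k \<Rightarrow> 'k \<Rightarrow> 'k \<Rightarrow> 'c" where
  "defect a g k l m = (let r = res (base (a k) \<inter> base (a l) \<inter> base (a m)) in
     inve (r (g k m)) \<cdot> (r (g l m) \<cdot> r (g k l)))"

lemma frameD:
  assumes "frame K a g" "k \<in> K" "l \<in> K"
  shows "g k l \<in> Arr" "supp (g k l) = base (a k) \<inter> base (a l)" "src (g k l) = a k" "tgt (g k l) = a l"
    "openin X (base (a k) \<inter> base (a l))"
  using assms arr(1)[of "g k l"] unfolding frame_def by auto

lemma frame_res:
  assumes g: "frame K a g" "k \<in> K" "l \<in> K" and Q: "openin X Q" "Q \<subseteq> base (a k)" "Q \<subseteq> base (a l)"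
  shows "res Q (g k l) \<in> Arr" "supp (res Q (g k l)) = Q" "src (res Q (g k l)) = a k" "tgt (res Q (g k l)) = a l"
  using frameD[OF g] Q by (simp_all add: res)

lemma defect_res:
  assumes g: "frame K a g" and klm: "k \<in> K" "l \<in> K" "m \<in> K"
    and o: "openin X (base (a k) \<inter> base (a l) \<inter> base (a m))"
    and Q: "openin X Q" "Q \<subseteq> base (a k)" "Q \<subseteq> base (a l)" "Q \<subseteq> base (a m)"
  shows "res Q (defect a g k l m) = inve (res Q (g k m)) \<cdot> (res Q (g l m) \<cdot> res Q (g k l))"
  unfolding defect_def Let_def
  using frameD[OF g klm(1,2)] frameD[OF g klm(2,3)] frameD[OF g klm(1,3)] o Q
  by (simp add: arrow_simps Int_assoc Int_lower2 le_infI1 le_infI2)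

lemma defect_arr:
  assumes g: "frame K a g" and klm: "k \<in> K" "l \<in> K" "m \<in> K"
    and o: "openin X (base (a k) \<inter> base (a l) \<inter> base (a m))"
  shows "defect a g k l m \<in> Arr" "supp (defect a g k l m) = base (a k) \<inter> base (a l) \<inter> base (a m)"
    "src (defect a g k l m) = a k" "tgt (defect a g k l m) = a k"
proof -
  let ?Q = "base (a k) \<inter> base (a l) \<inter> base (a m)"
  have s: "?Q \<subseteq> base (a k)" "?Q \<subseteq> base (a l)" "?Q \<subseteq> base (a m)" by auto
  note f = frame_res[OF g klm(1,2) o s(1,2)] frame_res[OF g klm(2,3) o s(2,3)] frame_res[OF g klm(1,3) o s(1,3)]
  show "defect a g k l m \<in> Arr" "supp (defect a g k l m) = ?Q"
    "src (defect a g k l m) = a k" "tgt (defect a g k l m) = a k"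
    unfolding defect_def Let_def using f by (simp_all add: arrow_simps)
qed

lemma cong_defect:
  assumes g: "frame K a g" "frame K a g'" and klm: "k \<in> K" "l \<in> K" "m \<in> K"
    and o: "openin X (base (a k) \<inter> base (a l) \<inter> base (a m))"
    and c: "\<And>k l. k \<in> K \<Longrightarrow> l \<in> K \<Longrightarrow> cong p (g k l) (g' k l)"
  shows "cong p (defect a g k l m) (defect a g' k l m)"
proof -
  let ?Q = "base (a k) \<inter> base (a l) \<inter> base (a m)"
  have s: "?Q \<subseteq> base (a k)" "?Q \<subseteq> base (a l)" "?Q \<subseteq> base (a m)" by auto
  note f = frame_res[OF g(1) klm(1,2) o s(1,2)] frame_res[OF g(1) klm(2,3) o s(2,3)] frame_res[OF g(1) klm(1,3) o s(1,3)]
  have c': "cong p (res ?Q (g i j)) (res ?Q (g' i j))" if "i \<in> {k, l, m}" "j \<in> {k, l, m}" for i j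
    by (rule cong_res[OF c o]) (use that klm frameD(2)[OF g(1), of i j] in auto)
  show ?thesis
    unfolding defect_def Let_def
    by (intro cong_cmp cong_inve c') (use f in \<open>simp_all add: arrow_simps\<close>)
qed

text \<open>What acyclicity contributes is condensed here: \<open>surj\<close> lifts classes over
  entire double overlaps, in contrast to the local lifting of
  \<open>\<kappa>_locally_surjective\<close>, so the covering can stay fixed through all
  corrections.\<close>

context
  fixes K :: "'k set" and a :: "'k \<Rightarrow> 'b"
  assumes objects: "\<And>k. k \<in> K \<Longrightarrow> a k \<in> Ob" and open_base: "\<And>k. k \<in> K \<Longrightarrow> openin X (base (a k))"
    and surj: "\<And>p k l e. \<lbrakk>k \<in> K; l \<in> K; e \<in> carrier (Sec (A p) (base (a k) \<inter> base (a l)))\<rbrakk>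
      \<Longrightarrow> \<exists>m\<in>N p. supp m = base (a k) \<inter> base (a l) \<and> src m = a k \<and> \<kappa> p m = e"
    and cech2: "\<And>p c. cech2_cocycle (A p) K (\<lambda>k. base (a k)) c \<Longrightarrow>
      \<exists>b. cech2_bounds (A p) K (\<lambda>k. base (a k)) c b"
begin

lemma open_Int: "k \<in> K \<Longrightarrow> l \<in> K \<Longrightarrow> openin X (base (a k) \<inter> base (a l))"
  "k \<in> K \<Longrightarrow> l \<in> K \<Longrightarrow> m \<in> K \<Longrightarrow> openin X (base (a k) \<inter> base (a l) \<inter> base (a m))"
  using open_base by auto

text \<open>With \<open>\<mu>\<close> lifting a bounding cochain and
  \<open>g' k l = g k l \<cdot> inve (\<mu> k l)\<close>, the new defect is the product of
  \<open>\<mu> k m\<close>, the old defect, a conjugate of \<open>inve (\<mu> l m)\<close>, and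
  \<open>inve (\<mu> k l)\<close>. Its class is that of the old defect times \<open>b k m\<close>,
  divided by \<open>b k l\<close> and \<open>b l m\<close>; the bounding condition makes it
  trivial.\<close>

lemma defect_improve:
  assumes g: "frame K a g" and defect: "\<And>k l m. k \<in> K \<Longrightarrow> l \<in> K \<Longrightarrow> m \<in> K \<Longrightarrow> defect a g k l m \<in> N p"
  shows "\<exists>g'. frame K a g' \<and> (\<forall>k\<in>K. \<forall>l\<in>K. \<forall>m\<in>K. defect a g' k l m \<in> N (Suc p)) \<and>
    (\<forall>k\<in>K. \<forall>l\<in>K. cong p (g' k l) (g k l))"
proof -
  have "cech2_cocycle (A p) K (\<lambda>k. base (a k)) (\<lambda>k l m. \<kappa> p (defect a g k l m))"
    unfolding cech2_cocycle_def Let_def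
  proof (intro conjI ballI)
    fix k l m assume klm: "k \<in> K" "l \<in> K" "m \<in> K"
    show "\<kappa> p (defect a g k l m) \<in> carrier (Sec (A p) (base (a k) \<inter> base (a l) \<inter> base (a m)))"
      using \<kappa>_closed[OF defect[OF klm]] defect_arr(2)[OF g klm open_Int(2)[OF klm]] by simp
  next
    fix k l m n assume klmn: "k \<in> K" "l \<in> K" "m \<in> K" "n \<in> K"
    let ?Q = "base (a k) \<inter> base (a l) \<inter> base (a m) \<inter> base (a n)"
    have oQ: "openin X ?Q" using open_base klmn by auto
    have s: "?Q \<subseteq> base (a k)" "?Q \<subseteq> base (a l)" "?Q \<subseteq> base (a m)" "?Q \<subseteq> base (a n)" by auto
    note kl = frame_res[OF g klmn(1,2) oQ s(1,2)] and km = frame_res[OF g klmn(1,3) oQ s(1,3)]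
      and kn = frame_res[OF g klmn(1,4) oQ s(1,4)] and lm = frame_res[OF g klmn(2,3) oQ s(2,3)]
      and ln = frame_res[OF g klmn(2,4) oQ s(2,4)] and mn = frame_res[OF g klmn(3,4) oQ s(3,4)]
    have D: "Res (A p) (base (a k') \<inter> base (a l') \<inter> base (a m')) ?Q (\<kappa> p (defect a g k' l' m')) =
        \<kappa> p (res ?Q (defect a g k' l' m'))"
      and DN: "res ?Q (defect a g k' l' m') \<in> N p"
      and D_eq: "res ?Q (defect a g k' l' m') = inve (res ?Q (g k' m')) \<cdot> (res ?Q (g l' m') \<cdot> res ?Q (g k' l'))"
      and Ds: "res ?Q (defect a g k' l' m') \<in> Arr" "supp (res ?Q (defect a g k' l' m')) = ?Q"
        "src (res ?Q (defect a g k' l' m')) = a k'" "tgt (res ?Q (defect a g k' l' m')) = a k'"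
      if t: "k' \<in> {k, l, m, n}" "l' \<in> {k, l, m, n}" "m' \<in> {k, l, m, n}" for k' l' m'
    proof -
      have K: "k' \<in> K" "l' \<in> K" "m' \<in> K" and s': "?Q \<subseteq> base (a k')" "?Q \<subseteq> base (a l')" "?Q \<subseteq> base (a m')"
        and s3: "?Q \<subseteq> base (a k') \<inter> base (a l') \<inter> base (a m')"
        using t klmn by auto
      note d = defect_arr[OF g K open_Int(2)[OF K]]
      show "Res (A p) (base (a k') \<inter> base (a l') \<inter> base (a m')) ?Q (\<kappa> p (defect a g k' l' m')) =
          \<kappa> p (res ?Q (defect a g k' l' m'))"
        using \<kappa>_res[OF defect[OF K] oQ] d(2) s3 by simp
      show "res ?Q (defect a g k' l' m') \<in> N p" using N_res[OF defect[OF K] oQ] d(2) s3 by simp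
      show "res ?Q (defect a g k' l' m') = inve (res ?Q (g k' m')) \<cdot> (res ?Q (g l' m') \<cdot> res ?Q (g k' l'))"
        by (rule defect_res[OF g K open_Int(2)[OF K] oQ s'])
      show "res ?Q (defect a g k' l' m') \<in> Arr" "supp (res ?Q (defect a g k' l' m')) = ?Q"
        "src (res ?Q (defect a g k' l' m')) = a k'" "tgt (res ?Q (defect a g k' l' m')) = a k'"
        using res[OF d(1) oQ] d s3 by simp_all
    qed
    let ?d = "\<lambda>k l m. res ?Q (defect a g k l m)" and ?g = "inve (res ?Q (g k l))"
    \<comment> \<open>both sides equal \<open>g\<^sub>k\<^sub>n\<inverse> g\<^sub>m\<^sub>n g\<^sub>l\<^sub>m g\<^sub>k\<^sub>l\<close>\<close>
    have "?d k m n \<cdot> ?d k l m = ?d k l n \<cdot> (?g \<cdot> (?d l m n \<cdot> inve ?g))"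
      using kl km kn lm ln mn by (simp add: D_eq arrow_simps)
    moreover have "\<kappa> p (?d k m n \<cdot> ?d k l m) = \<kappa> p (?d k m n) \<otimes>\<^bsub>Sec (A p) ?Q\<^esub> \<kappa> p (?d k l m)"
      using \<kappa>_cmp[OF DN[of k l m] DN[of k m n]] Ds by simp
    \<comment> \<open>The defect at \<open>a l\<close> is moved to \<open>a k\<close> by
      conjugation, which preserves its class; so the identity of arrows becomes the abelian cocycle
      condition.\<close>
    moreover have "\<kappa> p (?d k l n \<cdot> (?g \<cdot> (?d l m n \<cdot> inve ?g))) = \<kappa> p (?d k l n) \<otimes>\<^bsub>Sec (A p) ?Q\<^esub> \<kappa> p (?d l m n)"
    proof -
      have g': "?g \<in> Arr" "supp ?g = ?Q" "src ?g = a l" "tgt ?g = a k" using kl by (simp_all add: inve)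
      have st: "supp (?g \<cdot> (?d l m n \<cdot> inve ?g)) = ?Q" "src (?g \<cdot> (?d l m n \<cdot> inve ?g)) = a k"
        using g' Ds[of l m n] by (simp_all add: cmp inve)
      have "\<kappa> p (?g \<cdot> (?d l m n \<cdot> inve ?g)) = \<kappa> p (?d l m n)" "?g \<cdot> (?d l m n \<cdot> inve ?g) \<in> N p"
        using \<kappa>_conj[OF DN[of l m n] g'(1)] N_conj[OF DN[of l m n] g'(1)] Ds[of l m n] g' by simp_all
      then show ?thesis
        using \<kappa>_cmp[OF _ DN[of k l n], of "?g \<cdot> (?d l m n \<cdot> inve ?g)"] Ds[of k l n] st by simp
    qed
    ultimately show "Res (A p) (base (a k) \<inter> base (a m) \<inter> base (a n)) ?Q (\<kappa> p (defect a g k m n)) \<otimes>\<^bsub>Sec (A p) ?Q\<^esub>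
          Res (A p) (base (a k) \<inter> base (a l) \<inter> base (a m)) ?Q (\<kappa> p (defect a g k l m)) =
        Res (A p) (base (a k) \<inter> base (a l) \<inter> base (a n)) ?Q (\<kappa> p (defect a g k l n)) \<otimes>\<^bsub>Sec (A p) ?Q\<^esub>
          Res (A p) (base (a l) \<inter> base (a m) \<inter> base (a n)) ?Q (\<kappa> p (defect a g l m n))"
      using D[of k m n] D[of k l m] D[of k l n] D[of l m n] by simp
  qed
  from cech2[OF this] obtain b where
    b: "\<And>k l. k \<in> K \<Longrightarrow> l \<in> K \<Longrightarrow> b k l \<in> carrier (Sec (A p) (base (a k) \<inter> base (a l)))" and
    bb: "\<And>k l m. k \<in> K \<Longrightarrow> l \<in> K \<Longrightarrow> m \<in> K \<Longrightarrow> \<kappa> p (defect a g k l m) \<otimes>\<^bsub>Sec (A p) (base (a k) \<inter> base (a l) \<inter> base (a m))\<^esub>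
        Res (A p) (base (a k) \<inter> base (a m)) (base (a k) \<inter> base (a l) \<inter> base (a m)) (b k m) =
      Res (A p) (base (a k) \<inter> base (a l)) (base (a k) \<inter> base (a l) \<inter> base (a m)) (b k l) \<otimes>\<^bsub>Sec (A p) (base (a k) \<inter> base (a l) \<inter> base (a m))\<^esub>
        Res (A p) (base (a l) \<inter> base (a m)) (base (a k) \<inter> base (a l) \<inter> base (a m)) (b l m)"
    unfolding cech2_bounds_def Let_def by metis
  have ex_\<mu>: "\<exists>m\<in>N p. supp m = base (a k) \<inter> base (a l) \<and> src m = a k \<and> \<kappa> p m = b k l"
    if "k \<in> K" "l \<in> K" for k l
    using surj[OF that b[OF that]] .
  obtain \<mu> where m: "\<forall>k\<in>K. \<forall>l\<in>K. \<mu> k l \<in> N p \<and>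
      supp (\<mu> k l) = base (a k) \<inter> base (a l) \<and> src (\<mu> k l) = a k \<and> \<kappa> p (\<mu> k l) = b k l"
    by (rule exE[OF Bex_choice2], rule ex_\<mu>, assumption, assumption, rule that, assumption)
  have \<mu>: "\<mu> k l \<in> N p" "supp (\<mu> k l) = base (a k) \<inter> base (a l)" "src (\<mu> k l) = a k" "\<kappa> p (\<mu> k l) = b k l"
    if "k \<in> K" "l \<in> K" for k l
    using bspec[OF bspec[OF m that(1)] that(2)] by auto
  have \<mu>': "\<mu> k l \<in> Arr" "tgt (\<mu> k l) = a k" if "k \<in> K" "l \<in> K" for k l
    using N_loop[OF \<mu>(1)[OF that]] \<mu>(3)[OF that] by auto
  define g' where "g' k l = g k l \<cdot> inve (\<mu> k l)" for k l
  have fr: "frame K a g'"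
    unfolding frame_def
  proof (intro ballI)
    fix k l assume "k \<in> K" "l \<in> K"
    then show "g' k l \<in> Arr \<and> supp (g' k l) = base (a k) \<inter> base (a l) \<and> src (g' k l) = a k \<and> tgt (g' k l) = a l"
      unfolding g'_def using frameD[OF g] \<mu> \<mu>' by (simp add: arrow_simps)
  qed
  have "defect a g' k l m \<in> N (Suc p)" if klm: "k \<in> K" "l \<in> K" "m \<in> K" for k l m
  proof -
    let ?Q = "base (a k) \<inter> base (a l) \<inter> base (a m)"
    have oQ: "openin X ?Q" using open_Int(2)[OF klm] .
    have s: "?Q \<subseteq> base (a k)" "?Q \<subseteq> base (a l)" "?Q \<subseteq> base (a m)"
      "?Q \<subseteq> base (a k) \<inter> base (a l)" "?Q \<subseteq> base (a l) \<inter> base (a m)" "?Q \<subseteq> base (a k) \<inter> base (a m)" by auto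
    note kl = frame_res[OF g klm(1,2) oQ s(1,2)] and lm = frame_res[OF g klm(2,3) oQ s(2,3)]
      and km = frame_res[OF g klm(1,3) oQ s(1,3)]
    have M: "res ?Q (\<mu> i j) \<in> Arr" "supp (res ?Q (\<mu> i j)) = ?Q" "src (res ?Q (\<mu> i j)) = a i" "tgt (res ?Q (\<mu> i j)) = a i"
      "res ?Q (\<mu> i j) \<in> N p" "\<kappa> p (res ?Q (\<mu> i j)) = Res (A p) (base (a i) \<inter> base (a j)) ?Q (b i j)"
      and G': "res ?Q (g' i j) = res ?Q (g i j) \<cdot> inve (res ?Q (\<mu> i j))"
      if ij: "i \<in> K" "j \<in> K" "?Q \<subseteq> base (a i) \<inter> base (a j)" for i j
      unfolding g'_def
      using res[OF \<mu>'(1)[OF ij(1,2)] oQ] \<mu>(2,3)[OF ij(1,2)] \<mu>'[OF ij(1,2)] ij(3) N_res[OF \<mu>(1)[OF ij(1,2)] oQ]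
        \<kappa>_res[OF \<mu>(1)[OF ij(1,2)] oQ] \<mu>(4)[OF ij(1,2)] frameD[OF g ij(1,2)] oQ
      by (simp_all add: arrow_simps)
    note Mkl = M[OF klm(1,2) s(4)] and Mlm = M[OF klm(2,3) s(5)] and Mkm = M[OF klm(1,3) s(6)]
    let ?kl = "res ?Q (\<mu> k l)" and ?lm = "res ?Q (\<mu> l m)" and ?km = "res ?Q (\<mu> k m)" and ?g = "inve (res ?Q (g k l))"
    let ?c = "?g \<cdot> (inve ?lm \<cdot> inve ?g)"
    have g1: "?g \<in> Arr" "supp ?g = ?Q" "src ?g = a l" "tgt ?g = a k" using kl by (simp_all add: inve)
    note d = defect_arr[OF g klm oQ]
    \<comment> \<open>The factor \<open>?c\<close> is \<open>inve ?lm\<close> moved past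
      \<open>res ?Q (g k l)\<close>, so that all factors are loops at \<open>a k\<close>.\<close>
    have eq: "defect a g' k l m = ?km \<cdot> (defect a g k l m \<cdot> (?c \<cdot> inve ?kl))"
      unfolding defect_def Let_def G'[OF klm(1,2) s(4)] G'[OF klm(2,3) s(5)] G'[OF klm(1,3) s(6)]
      using kl lm km Mkl(1-4) Mlm(1-4) Mkm(1-4) by (simp add: arrow_simps)
    have c1: "?c \<in> N p" "\<kappa> p ?c = \<kappa> p (inve ?lm)"
      using N_conj[OF N_inve[OF Mlm(5)] g1(1)] \<kappa>_conj[OF N_inve[OF Mlm(5)] g1(1)] Mlm g1 by (simp_all add: inve)
    have c2: "supp ?c = ?Q" "src ?c = a k"
      using g1 Mlm by (simp_all add: cmp inve)
    have e1: "?c \<cdot> inve ?kl \<in> N p" "\<kappa> p (?c \<cdot> inve ?kl) = \<kappa> p ?c \<otimes>\<^bsub>Sec (A p) ?Q\<^esub> \<kappa> p (inve ?kl)"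
      using N_cmp[OF N_inve[OF Mkl(5)] c1(1)] \<kappa>_cmp[OF N_inve[OF Mkl(5)] c1(1)] c2 Mkl by (simp_all add: inve)
    have e2: "supp (?c \<cdot> inve ?kl) = ?Q" "src (?c \<cdot> inve ?kl) = a k"
      using c2 N_loop[OF c1(1)] Mkl by (simp_all add: cmp inve)
    have f1: "defect a g k l m \<cdot> (?c \<cdot> inve ?kl) \<in> N p" "\<kappa> p (defect a g k l m \<cdot> (?c \<cdot> inve ?kl)) =
        \<kappa> p (defect a g k l m) \<otimes>\<^bsub>Sec (A p) ?Q\<^esub> \<kappa> p (?c \<cdot> inve ?kl)"
      using N_cmp[OF e1(1) defect[OF klm]] \<kappa>_cmp[OF e1(1) defect[OF klm]] e2 d by simp_all
    have f2: "supp (defect a g k l m \<cdot> (?c \<cdot> inve ?kl)) = ?Q" "src (defect a g k l m \<cdot> (?c \<cdot> inve ?kl)) = a k"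
      using e2 N_loop[OF e1(1)] d by (simp_all add: cmp)
    have h1: "defect a g' k l m \<in> N p" "\<kappa> p (defect a g' k l m) =
        \<kappa> p ?km \<otimes>\<^bsub>Sec (A p) ?Q\<^esub> \<kappa> p (defect a g k l m \<cdot> (?c \<cdot> inve ?kl))"
      unfolding eq using N_cmp[OF f1(1) Mkm(5)] \<kappa>_cmp[OF f1(1) Mkm(5)] f2 Mkm by simp_all
    interpret comm_group "Sec (A p) ?Q" using abelian_sheafD(4)[OF abelian oQ] .
    have cl: "\<kappa> p ?kl \<in> carrier (Sec (A p) ?Q)" "\<kappa> p ?lm \<in> carrier (Sec (A p) ?Q)" "\<kappa> p ?km \<in> carrier (Sec (A p) ?Q)"
      "\<kappa> p (defect a g k l m) \<in> carrier (Sec (A p) ?Q)"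
      using \<kappa>_closed[OF Mkl(5)] \<kappa>_closed[OF Mlm(5)] \<kappa>_closed[OF Mkm(5)] \<kappa>_closed[OF defect[OF klm]] Mkl(2) Mlm(2) Mkm(2) d(2)
      by simp_all
    have i: "\<kappa> p (inve ?kl) = inv\<^bsub>Sec (A p) ?Q\<^esub> (\<kappa> p ?kl)" "\<kappa> p (inve ?lm) = inv\<^bsub>Sec (A p) ?Q\<^esub> (\<kappa> p ?lm)"
      using \<kappa>_inve[OF Mkl(5)] \<kappa>_inve[OF Mlm(5)] Mkl(2) Mlm(2) by simp_all
    have "\<kappa> p (defect a g' k l m) = (\<kappa> p (defect a g k l m) \<otimes>\<^bsub>Sec (A p) ?Q\<^esub> \<kappa> p ?km) \<otimes>\<^bsub>Sec (A p) ?Q\<^esub>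
        inv\<^bsub>Sec (A p) ?Q\<^esub> (\<kappa> p ?kl \<otimes>\<^bsub>Sec (A p) ?Q\<^esub> \<kappa> p ?lm)"
      unfolding h1(2) f1(2) e1(2) c1(2) i using cl by (simp add: inv_mult m_ac)
    also have "\<dots> = \<one>\<^bsub>Sec (A p) ?Q\<^esub>"
      using bb[OF klm] cl Mkl(6) Mlm(6) Mkm(6) by simp
    finally show ?thesis
      using \<kappa>_kernel[OF h1(1)] defect_arr(2)[OF fr klm oQ] by simp
  qed
  moreover have "cong p (g' k l) (g k l)" if kl: "k \<in> K" "l \<in> K" for k l
  proof -
    have "cong p (inve (\<mu> k l)) (idn (base (a k) \<inter> base (a l)) (a k))"
      using cong_loop_iff[of "inve (\<mu> k l)" p] N_inve[OF \<mu>(1)[OF kl]] \<mu>(2,3)[OF kl] \<mu>'[OF kl] by (simp add: arrow_simps)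
    from cong_cmp_left[OF this, of "g k l"] show ?thesis
      unfolding g'_def using frameD[OF g kl] \<mu>(2,3)[OF kl] \<mu>'[OF kl] by (simp add: arrow_simps)
  qed
  ultimately show ?thesis using fr by blast
qed

text \<open>The start is any choice of isomorphisms over the double overlaps. Each arrow is changed
  at stage \<open>p\<close> only by a factor in \<open>N p\<close>, so the sequences converge, and
  the defect of the limit is congruent to that of every stage. It therefore lies in all
  \<open>N p\<close>, which is the exact cocycle condition.\<close>

lemma ex_descent_datum:
  assumes triv: "\<And>p k l. k \<in> K \<Longrightarrow> l \<in> K \<Longrightarrow> cech1_trivial X (base (a k) \<inter> base (a l)) (A p)"
  shows "\<exists>g. frame K a g \<and> (\<forall>k\<in>K. \<forall>l\<in>K. \<forall>m\<in>K.
    res (base (a k) \<inter> base (a l) \<inter> base (a m)) (g l m) \<cdot> res (base (a k) \<inter> base (a l) \<inter> base (a m)) (g k l) =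
    res (base (a k) \<inter> base (a l) \<inter> base (a m)) (g k m))"
proof -
  let ?P = "\<lambda>p g. frame K a g \<and> (\<forall>k\<in>K. \<forall>l\<in>K. \<forall>m\<in>K. defect a g k l m \<in> N p)"
  have ex_g: "\<exists>h\<in>Arr. supp h = base (a k) \<inter> base (a l) \<and> src h = a k \<and> tgt h = a l" if kl: "k \<in> K" "l \<in> K" for k l
    by (rule isomorphic) (use objects open_Int(1) triv kl in auto)
  obtain g0 where "\<forall>k\<in>K. \<forall>l\<in>K. g0 k l \<in> Arr \<and> supp (g0 k l) = base (a k) \<inter> base (a l) \<and>
      src (g0 k l) = a k \<and> tgt (g0 k l) = a l"
    by (rule exE[OF Bex_choice2], rule ex_g, assumption, assumption, rule that, assumption)
  then have g0: "frame K a g0" unfolding frame_def .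
  have P0: "?P 0 g0"
    using g0 N_0 defect_arr[OF g0 _ _ _ open_Int(2)] by simp
  let ?R = "\<lambda>p g g'. \<forall>k\<in>K. \<forall>l\<in>K. cong p (g' k l) (g k l)"
  have step: "\<exists>g'. ?P (Suc p) g' \<and> ?R p g g'" if "?P p g" for p g
    unfolding conj_assoc by (rule defect_improve) (use that in auto)
  obtain g where "\<forall>p. ?P p (g p) \<and> ?R p (g p) (g (Suc p))"
    by (rule exE[OF dependent_nat_choice[of ?P ?R, OF exI[of "?P 0", OF P0]]], erule step, rule that, assumption)
  then have g: "\<And>p. ?P p (g p)" "\<And>p. ?R p (g p) (g (Suc p))" by simp_all
  have fr: "frame K a (g p)" for p using g(1) by blast
  have g_cong: "cong p (g q k l) (g p k l)" if kl: "k \<in> K" "l \<in> K" and pq: "p \<le> q" for p q k l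
    using pq
  proof (induction q rule: dec_induct)
    case base
    show ?case using cong_refl frameD(1)[OF fr kl] by blast
  next
    case (step q)
    then show ?case using cong_mono[of q "g (Suc q) k l" "g q k l" p] g(2) kl cong_trans by blast
  qed
  have ex_h: "\<exists>h\<in>Arr. supp h = base (a k) \<inter> base (a l) \<and> src h = a k \<and> tgt h = a l \<and> (\<forall>p. cong p h (g p k l))"
    if kl: "k \<in> K" "l \<in> K" for k l
  proof -
    let ?V = "base (a k) \<inter> base (a l)"
    note f = frameD[OF fr kl]
    define \<phi> where "\<phi> p = inve (g 0 k l) \<cdot> g p k l" for p
    have \<phi>: "\<phi> p \<in> Arr" "supp (\<phi> p) = ?V" "src (\<phi> p) = a k" "tgt (\<phi> p) = a k" for p
      unfolding \<phi>_def using f by (simp_all add: arrow_simps)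
    have \<phi>_cong: "cong p (\<phi> q) (\<phi> p)" if "p \<le> q" for p q
      unfolding \<phi>_def by (rule cong_cmp_left[OF g_cong[OF kl that]]) (use f in \<open>simp_all add: inve\<close>)
    \<comment> \<open>As supports do not shrink here, \<open>complete\<close> is applied to families
      that are constant in the point.\<close>
    have "\<exists>h\<in>Arr. supp h = ?V \<and> src h = a k \<and> tgt h = a k \<and> (\<forall>p. \<forall>x\<in>?V. \<phi> p \<cdot> inve (res (supp (\<phi> p)) h) \<in> N p)"
      by (rule complete[of "a k" ?V "\<lambda>p x. \<phi> p"])
        (use objects kl f(5) \<phi> congD(6)[OF \<phi>_cong] in \<open>auto simp: res_self'\<close>)
    then obtain h where h: "h \<in> Arr" "supp h = ?V" "src h = a k" "tgt h = a k"
      and hN: "\<forall>p. \<forall>x\<in>?V. \<phi> p \<cdot> inve (res (supp (\<phi> p)) h) \<in> N p"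
      by (elim bexE conjE)
    have hN: "\<phi> p \<cdot> inve h \<in> N p" if "x \<in> ?V" for p x
      using bspec[OF spec[OF hN] that, of p] \<phi>(2)[of p] h by (simp add: res_self')
    have "cong p (g 0 k l \<cdot> h) (g p k l)" for p
    proof -
      \<comment> \<open>\<open>complete\<close> makes its assertion at the points of the overlap
        only; arguing locally turns it into a congruence over the overlap, also when that is
        empty.\<close>
      have "cong p (\<phi> p) h"
      proof (rule cong_local)
        fix x assume "x \<in> supp (\<phi> p)"
        then show "\<exists>V. openin X V \<and> x \<in> V \<and> V \<subseteq> supp (\<phi> p) \<and> cong p (res V (\<phi> p)) (res V h)"
          using \<phi>[of p] h hN[of x p] f(5) by (intro exI[of _ ?V]) (simp add: res_self' cong_def)
      qed (use \<phi> h in simp_all)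
      from cong_cmp_left[OF cong_sym[OF this], of "g 0 k l"] show ?thesis
        unfolding \<phi>_def using f h by (simp add: arrow_simps)
    qed
    then show ?thesis
      using f h(1-4) by (intro bexI[of _ "g 0 k l \<cdot> h"]) (simp_all add: cmp)
  qed
  obtain h where h: "\<forall>k\<in>K. \<forall>l\<in>K. h k l \<in> Arr \<and>
      supp (h k l) = base (a k) \<inter> base (a l) \<and> src (h k l) = a k \<and> tgt (h k l) = a l \<and> (\<forall>p. cong p (h k l) (g p k l))"
    by (rule exE[OF Bex_choice2], rule ex_h, assumption, assumption, rule that, assumption)
  have fh: "frame K a h" unfolding frame_def using h by blast
  have h_cong: "cong p (h k l) (g p k l)" if "k \<in> K" "l \<in> K" for k l p
    using bspec[OF bspec[OF h that(1)] that(2)] by blast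
  have "res Q (h l m) \<cdot> res Q (h k l) = res Q (h k m)"
    if klm: "k \<in> K" "l \<in> K" "m \<in> K" and Q: "Q = base (a k) \<inter> base (a l) \<inter> base (a m)" for k l m Q
  proof -
    have oQ: "openin X Q" and s: "Q \<subseteq> base (a k)" "Q \<subseteq> base (a l)" "Q \<subseteq> base (a m)"
      using open_Int(2)[OF klm] unfolding Q by auto
    note kl = frame_res[OF fh klm(1,2) oQ s(1,2)] and lm = frame_res[OF fh klm(2,3) oQ s(2,3)]
      and km = frame_res[OF fh klm(1,3) oQ s(1,3)]
    note d = defect_arr[OF fh klm open_Int(2)[OF klm]]
    \<comment> \<open>The defect of \<open>h\<close> is congruent modulo \<open>N p\<close> to the
      defect of \<open>g p\<close>, which lies in \<open>N p\<close> by construction.\<close>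
    have "defect a h k l m \<in> N p" for p
    proof -
      have dp: "defect a (g p) k l m \<in> N p" using g(1) klm by blast
      note dg = defect_arr[OF fr klm open_Int(2)[OF klm], of p]
      have "cong p (defect a (g p) k l m) (idn Q (a k))"
        using cong_loop_iff[OF dg(1), of p] dp dg Q by simp
      with cong_defect[OF fh fr klm open_Int(2)[OF klm] h_cong] have "cong p (defect a h k l m) (idn Q (a k))"
        by (rule cong_trans)
      then show ?thesis using cong_loop_iff[OF d(1), of p] d Q by simp
    qed
    then have "defect a h k l m = idn Q (a k)"
      using N_separated[OF d(1)] d Q by simp
    then have "res Q (h k m) \<cdot> defect a h k l m = res Q (h k m)" using km by (simp add: cmp_idn')
    then show ?thesis
      unfolding defect_def Let_def Q[symmetric] using kl lm km by (simp add: arrow_simps)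
  qed
  then show ?thesis using fh by blast
qed

end

end

section \<open>Sections of quotient sheaves\<close>

text \<open>It is used with \<open>M\<close> a member of the filtration, for the successive
  quotients, and with \<open>M\<close> all of \<open>F\<close>, for the quotients that enter the
  limit sheaf.\<close>

locale subquotient_sheaf =
  fixes T :: "'x topology" and F :: "('x, 'a) group_presheaf" and M N :: "'x set \<Rightarrow> 'a set"
  assumes sheaf: "sheaf_of_groups T F"
    and subgroup_M: "openin T V \<Longrightarrow> subgroup (M V) (Sec F V)"
    and M_Res: "\<lbrakk>openin T U; openin T V; V \<subseteq> U; s \<in> M U\<rbrakk> \<Longrightarrow> Res F U V s \<in> M V"
    and normal_N: "openin T V \<Longrightarrow> N V \<lhd> Sec F V"
    and N_sub_M: "openin T V \<Longrightarrow> N V \<subseteq> M V"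
    and sheaf_N: "sheaf_of_sets T N (Res F)"
begin

sublocale F: presheaf_of_groups T F using presheaf_of_groups_sheaf[OF sheaf] .

abbreviation Q where "Q \<equiv> quot_presheaf F M N"
abbreviation coset where "coset V s \<equiv> N V #>\<^bsub>Sec F V\<^esub> s"

lemma M_sub: "openin T V \<Longrightarrow> s \<in> M V \<Longrightarrow> s \<in> carrier (Sec F V)"
  using subgroup.mem_carrier[OF subgroup_M] .

lemma N_Res: "\<lbrakk>openin T U; openin T V; V \<subseteq> U; s \<in> N U\<rbrakk> \<Longrightarrow> Res F U V s \<in> N V"
  using sheaf_N presheaf_of_setsD(1) unfolding sheaf_of_sets_def by metis

lemma coset_eq_iff:
  assumes V: "openin T V" and st: "s \<in> carrier (Sec F V)" "t \<in> carrier (Sec F V)"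
  shows "coset V s = coset V t \<longleftrightarrow> s \<otimes>\<^bsub>Sec F V\<^esub> inv\<^bsub>Sec F V\<^esub> t \<in> N V"
proof -
  interpret normal "N V" "Sec F V" using normal_N[OF V] .
  show ?thesis
  proof
    assume "coset V s = coset V t"
    then have "s \<in> coset V t" using rcos_self[OF st(1) is_subgroup] by simp
    then show "s \<otimes>\<^bsub>Sec F V\<^esub> inv\<^bsub>Sec F V\<^esub> t \<in> N V"
      using st subset by (auto simp: r_coset_def m_assoc)
  next
    assume n: "s \<otimes>\<^bsub>Sec F V\<^esub> inv\<^bsub>Sec F V\<^esub> t \<in> N V"
    have "s = (s \<otimes>\<^bsub>Sec F V\<^esub> inv\<^bsub>Sec F V\<^esub> t) \<otimes>\<^bsub>Sec F V\<^esub> t" using st by (simp add: m_assoc)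
    then have "s \<in> coset V t" using n unfolding r_coset_def by blast
    then show "coset V s = coset V t" using repr_independence[OF _ st(2) is_subgroup] by simp
  qed
qed

lemma carrier_Q: "carrier (Sec Q V) = coset V ` M V"
  by (simp add: quot_presheaf_def carrier_FactGroup r_coset_def)

text \<open>Restricting a coset elementwise may yield only a part of a coset; the factor
  \<open>N V\<close> in the definition fills it up. One inclusion uses that restriction maps
  \<open>N U\<close> into \<open>N V\<close>, the other that \<open>N U\<close> contains the
  unit.\<close>

lemma Res_Q_coset:
  assumes "openin T U" "openin T V" "V \<subseteq> U" and s: "s \<in> carrier (Sec F U)"
  shows "Res Q U V (coset U s) = coset V (Res F U V s)"
proof -
  interpret U: normal "N U" "Sec F U" using normal_N assms by blast
  interpret V: normal "N V" "Sec F V" using normal_N assms by blast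
  have Rs: "Res F U V s \<in> carrier (Sec F V)" using F.Res_closed assms by blast
  have R: "Res F U V (n \<otimes>\<^bsub>Sec F U\<^esub> s) = Res F U V n \<otimes>\<^bsub>Sec F V\<^esub> Res F U V s" if "n \<in> N U" for n
    using F.Res_mult[OF assms(1-3) U.mem_carrier[OF that] s] .
  have "Res Q U V (coset U s) = (\<Union>m\<in>N V. \<Union>n\<in>N U. {m \<otimes>\<^bsub>Sec F V\<^esub> (Res F U V n \<otimes>\<^bsub>Sec F V\<^esub> Res F U V s)})"
    by (auto simp: quot_presheaf_def set_mult_def r_coset_def R image_iff)
  also have "\<dots> = coset V (Res F U V s)"
  proof (intro equalityI subsetI)
    fix z assume "z \<in> (\<Union>m\<in>N V. \<Union>n\<in>N U. {m \<otimes>\<^bsub>Sec F V\<^esub> (Res F U V n \<otimes>\<^bsub>Sec F V\<^esub> Res F U V s)})"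
    then obtain m n where m: "m \<in> N V" "n \<in> N U" "z = m \<otimes>\<^bsub>Sec F V\<^esub> (Res F U V n \<otimes>\<^bsub>Sec F V\<^esub> Res F U V s)" by auto
    then have "z = (m \<otimes>\<^bsub>Sec F V\<^esub> Res F U V n) \<otimes>\<^bsub>Sec F V\<^esub> Res F U V s"
      using N_Res[OF assms(1-3)] Rs V.subset by (auto simp: V.m_assoc)
    moreover have "m \<otimes>\<^bsub>Sec F V\<^esub> Res F U V n \<in> N V" using m N_Res[OF assms(1-3)] by simp
    ultimately show "z \<in> coset V (Res F U V s)" unfolding r_coset_def by blast
  next
    fix z assume "z \<in> coset V (Res F U V s)"
    then obtain m where m: "m \<in> N V" "z = m \<otimes>\<^bsub>Sec F V\<^esub> Res F U V s" unfolding r_coset_def by auto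
    moreover have "Res F U V \<one>\<^bsub>Sec F U\<^esub> = \<one>\<^bsub>Sec F V\<^esub>" using F.Res_one assms by blast
    ultimately show "z \<in> (\<Union>m\<in>N V. \<Union>n\<in>N U. {m \<otimes>\<^bsub>Sec F V\<^esub> (Res F U V n \<otimes>\<^bsub>Sec F V\<^esub> Res F U V s)})"
      using Rs U.one_closed by (intro UN_I[of m] UN_I[of "\<one>\<^bsub>Sec F U\<^esub>"]) simp_all
  qed
  finally show ?thesis .
qed

lemma mult_Q_coset:
  assumes V: "openin T V" and "s \<in> carrier (Sec F V)" "t \<in> carrier (Sec F V)"
  shows "coset V s \<otimes>\<^bsub>Sec Q V\<^esub> coset V t = coset V (s \<otimes>\<^bsub>Sec F V\<^esub> t)"
proof -
  interpret normal "N V" "Sec F V" using normal_N[OF V] .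
  show ?thesis using rcos_sum[OF assms(2,3)] by (simp add: quot_presheaf_def set_mult_def)
qed

sublocale Q: presheaf_of_groups T Q
proof (rule presheaf_of_groups.intro)
  fix V assume V: "openin T V"
  interpret group "Sec F V" using F.group_Sec[OF V] .
  interpret H: normal "N V" "(Sec F V)\<lparr>carrier := M V\<rparr>"
    using normal_restrict_supergroup[OF subgroup_M[OF V] normal_N[OF V] N_sub_M[OF V]] .
  show "group (Sec Q V)" unfolding quot_presheaf_def using H.factorgroup_is_group by simp
next
  fix U V assume UV: "openin T U" "openin T V" "V \<subseteq> U"
  show "Res Q U V \<in> hom (Sec Q U) (Sec Q V)"
  proof (rule homI)
    fix c assume "c \<in> carrier (Sec Q U)"
    then show "Res Q U V c \<in> carrier (Sec Q V)"
      unfolding carrier_Q using Res_Q_coset[OF UV] M_sub[OF UV(1)] M_Res[OF UV] by auto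
  next
    fix c c' assume "c \<in> carrier (Sec Q U)" "c' \<in> carrier (Sec Q U)"
    then obtain s t where s: "s \<in> M U" "c = coset U s" and t: "t \<in> M U" "c' = coset U t"
      unfolding carrier_Q by auto
    have cl: "s \<in> carrier (Sec F U)" "t \<in> carrier (Sec F U)" using M_sub[OF UV(1)] s t by auto
    interpret group "Sec F U" using F.group_Sec[OF UV(1)] .
    show "Res Q U V (c \<otimes>\<^bsub>Sec Q U\<^esub> c') = Res Q U V c \<otimes>\<^bsub>Sec Q V\<^esub> Res Q U V c'"
      unfolding s t mult_Q_coset[OF UV(1) cl] Res_Q_coset[OF UV cl(1)] Res_Q_coset[OF UV cl(2)]
        Res_Q_coset[OF UV m_closed[OF cl]] F.Res_mult[OF UV cl]
      using mult_Q_coset[OF UV(2)] F.Res_closed[OF UV] cl by simp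
  qed
next
  fix U c assume "openin T U" "c \<in> carrier (Sec Q U)"
  then show "Res Q U U c = c"
    unfolding carrier_Q using Res_Q_coset[of U U] M_sub F.Res_self by auto
next
  fix U V W c assume *: "openin T U" "openin T V" "openin T W" "V \<subseteq> U" "W \<subseteq> V" "c \<in> carrier (Sec Q U)"
  then obtain s where "s \<in> M U" "c = coset U s" unfolding carrier_Q by auto
  then have s: "s \<in> carrier (Sec F U)" "c = coset U s" using M_sub * by auto
  then show "Res Q V W (Res Q U V c) = Res Q U W c"
    using * Res_Q_coset[of U V s] Res_Q_coset[of U W s] Res_Q_coset[of V W "Res F U V s"]
      F.Res_closed[of U V s] F.Res_Res[of U V W s] by auto
qed

section \<open>Germs and sections of the quotient sheaf in terms of representatives\<close>

lemma germ_coset_eqI: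
  assumes "openin T U" "openin T V" "openin T W" "x \<in> W" "W \<subseteq> U" "W \<subseteq> V" and s: "s \<in> M U" and t: "t \<in> M V"
    and n: "Res F U W s \<otimes>\<^bsub>Sec F W\<^esub> inv\<^bsub>Sec F W\<^esub> Res F V W t \<in> N W"
  shows "germ T Q U (coset U s) x = germ T Q V (coset V t) x"
proof (rule Q.germ_eqI[OF assms(1-4)])
  have cl: "s \<in> carrier (Sec F U)" "t \<in> carrier (Sec F V)" using M_sub assms by auto
  show "Res Q U W (coset U s) = Res Q V W (coset V t)"
    using Res_Q_coset[OF assms(1,3,5) cl(1)] Res_Q_coset[OF assms(2,3,6) cl(2)]
      coset_eq_iff[OF assms(3) F.Res_closed[OF assms(1,3,5) cl(1)] F.Res_closed[OF assms(2,3,6) cl(2)]] n by simp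
qed (use assms in \<open>auto simp: carrier_Q\<close>)

lemma germ_cosetE:
  assumes "(V, c) \<in> germ T Q U (coset U s) x" "openin T U" "s \<in> M U"
  obtains t W where "openin T V" "x \<in> V" "t \<in> M V" "c = coset V t"
    "openin T W" "x \<in> W" "W \<subseteq> U" "W \<subseteq> V" "Res F U W s \<otimes>\<^bsub>Sec F W\<^esub> inv\<^bsub>Sec F W\<^esub> Res F V W t \<in> N W"
proof -
  obtain W where W: "openin T V" "x \<in> V" "c \<in> carrier (Sec Q V)" "openin T W" "x \<in> W" "W \<subseteq> U" "W \<subseteq> V"
    and eq: "Res Q U W (coset U s) = Res Q V W c"
    using assms(1) unfolding Q.mem_germ_iff by auto
  from W(3) obtain t where t: "t \<in> M V" "c = coset V t" unfolding carrier_Q by auto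
  have cl: "s \<in> carrier (Sec F U)" "t \<in> carrier (Sec F V)" using M_sub assms W t by auto
  have "Res F U W s \<otimes>\<^bsub>Sec F W\<^esub> inv\<^bsub>Sec F W\<^esub> Res F V W t \<in> N W"
    using eq Res_Q_coset[OF assms(2) W(4,6) cl(1)] Res_Q_coset[OF W(1,4,7) cl(2)]
      coset_eq_iff[OF W(4) F.Res_closed[OF assms(2) W(4,6) cl(1)] F.Res_closed[OF W(1,4,7) cl(2)]] t by simp
  with that W t show thesis by blast
qed

lemma germ_coset_eqD:
  assumes "germ T Q U (coset U s) x = germ T Q V (coset V t) x" "openin T U" "openin T V" "x \<in> V" "s \<in> M U" "t \<in> M V"
  obtains W where "openin T W" "x \<in> W" "W \<subseteq> U" "W \<subseteq> V" "Res F U W s \<otimes>\<^bsub>Sec F W\<^esub> inv\<^bsub>Sec F W\<^esub> Res F V W t \<in> N W"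
proof -
  have "coset V t \<in> carrier (Sec Q V)" using assms by (auto simp: carrier_Q)
  obtain W where W: "openin T W" "x \<in> W" "W \<subseteq> U" "W \<subseteq> V"
    "Res Q U W (coset U s) = Res Q V W (coset V t)"
    by (rule Q.germ_eqD[OF assms(1,3,4) \<open>coset V t \<in> carrier (Sec Q V)\<close>])
      (rule that, assumption, assumption, blast, blast, assumption)
  have cl: "s \<in> carrier (Sec F U)" "t \<in> carrier (Sec F V)" using M_sub assms by auto
  have "Res F U W s \<otimes>\<^bsub>Sec F W\<^esub> inv\<^bsub>Sec F W\<^esub> Res F V W t \<in> N W"
    using W(5) Res_Q_coset[OF assms(2) W(1,3) cl(1)] Res_Q_coset[OF assms(3) W(1,4) cl(2)]
      coset_eq_iff[OF W(1) F.Res_closed[OF assms(2) W(1,3) cl(1)] F.Res_closed[OF assms(3) W(1,4) cl(2)]] by simp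
  with that W show thesis by blast
qed

text \<open>The restrictions in \<open>N\<close> glue to a section of the sheaf \<open>N\<close>,
  and this section equals \<open>s\<close> because \<open>F\<close> separates sections.\<close>

lemma N_local:
  assumes U: "openin T U" and s: "s \<in> carrier (Sec F U)"
    and loc: "\<And>x. x \<in> U \<Longrightarrow> \<exists>V. openin T V \<and> x \<in> V \<and> V \<subseteq> U \<and> Res F U V s \<in> N V"
  shows "s \<in> N U"
proof -
  obtain W where W: "\<And>x. x \<in> U \<Longrightarrow> openin T (W x) \<and> x \<in> W x \<and> W x \<subseteq> U \<and> Res F U (W x) s \<in> N (W x)"
    using loc by metis
  have UW: "U = (\<Union>x\<in>U. W x)" using W by blast
  have "Res F (W x) (W x \<inter> W y) (Res F U (W x) s) = Res F (W y) (W x \<inter> W y) (Res F U (W y) s)"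
    if xy: "x \<in> U" "y \<in> U" for x y
  proof -
    have o: "openin T (W x)" "openin T (W y)" "openin T (W x \<inter> W y)" "W x \<subseteq> U" "W y \<subseteq> U"
      using W[OF xy(1)] W[OF xy(2)] by auto
    show ?thesis
      using F.Res_Res[OF U o(1,3,4) Int_lower1 s] F.Res_Res[OF U o(2,3,5) Int_lower2 s] by simp
  qed
  then obtain t where t: "t \<in> N U" "\<And>x. x \<in> U \<Longrightarrow> Res F U (W x) t = Res F U (W x) s"
    using sheaf_of_sets_glue[OF sheaf_N _ UW, of "\<lambda>x. Res F U (W x) s"] W by blast
  have S: "sheaf_of_sets T (\<lambda>U. carrier (Sec F U)) (Res F)" using sheaf unfolding sheaf_of_groups_def by simp
  have "t = s"
  proof (rule sheaf_of_sets_eqI[OF S U])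
    show "t \<in> carrier (Sec F U)" using t(1) N_sub_M[OF U] M_sub[OF U] by blast
    show "\<exists>V. openin T V \<and> x \<in> V \<and> V \<subseteq> U \<and> Res F U V t = Res F U V s" if "x \<in> U" for x
      using W[OF that] t(2)[OF that] by (intro exI[of _ "W x"]) simp
  qed (rule s)
  then show ?thesis using t by simp
qed

text \<open>Sheafification identifies nothing beyond cosets here: equality of germs gives membership
  of the quotient in \<open>N\<close> near each point, and membership in the sheaf \<open>N\<close>
  is local.\<close>

lemma quot_proj_eq_iff:
  assumes U: "openin T U" and st: "s \<in> M U" "t \<in> M U"
  shows "quot_proj T F M N U s = quot_proj T F M N U t \<longleftrightarrow> s \<otimes>\<^bsub>Sec F U\<^esub> inv\<^bsub>Sec F U\<^esub> t \<in> N U"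
proof
  interpret group "Sec F U" using F.group_Sec[OF U] .
  have cl: "s \<in> carrier (Sec F U)" "t \<in> carrier (Sec F U)" using M_sub[OF U] st by auto
  have R: "Res F U W (s \<otimes>\<^bsub>Sec F U\<^esub> inv\<^bsub>Sec F U\<^esub> t) = Res F U W s \<otimes>\<^bsub>Sec F W\<^esub> inv\<^bsub>Sec F W\<^esub> Res F U W t"
    if "openin T W" "W \<subseteq> U" for W
    using F.Res_mult[OF U that cl(1) inv_closed[OF cl(2)]] F.Res_inv[OF U that cl(2)] by simp
  {
    assume eq: "quot_proj T F M N U s = quot_proj T F M N U t"
    show "s \<otimes>\<^bsub>Sec F U\<^esub> inv\<^bsub>Sec F U\<^esub> t \<in> N U"
    proof (rule N_local[OF U])
      fix x assume x: "x \<in> U"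
      have g: "germ T Q U (coset U s) x = germ T Q U (coset U t) x"
        using fun_cong[OF eq, of x] x by (simp add: quot_proj_def)
      obtain W where "openin T W" "x \<in> W" "W \<subseteq> U"
        "Res F U W s \<otimes>\<^bsub>Sec F W\<^esub> inv\<^bsub>Sec F W\<^esub> Res F U W t \<in> N W"
        by (rule germ_coset_eqD[OF g U U x st]) (rule that; assumption)
      then show "\<exists>V. openin T V \<and> x \<in> V \<and> V \<subseteq> U \<and> Res F U V (s \<otimes>\<^bsub>Sec F U\<^esub> inv\<^bsub>Sec F U\<^esub> t) \<in> N V"
        using R by (intro exI[of _ W]) simp
    qed (use cl in simp)
  next
    assume "s \<otimes>\<^bsub>Sec F U\<^esub> inv\<^bsub>Sec F U\<^esub> t \<in> N U"
    then have "coset U s = coset U t" using coset_eq_iff[OF U cl] by simp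
    then show "quot_proj T F M N U s = quot_proj T F M N U t" by (simp add: quot_proj_def)
  }
qed

lemma quot_proj_Res:
  assumes U: "openin T U" "openin T V" "V \<subseteq> U" and s: "s \<in> M U"
  shows "quot_proj T F M N V (Res F U V s) = restrict (quot_proj T F M N U s) V"
proof
  fix x
  show "quot_proj T F M N V (Res F U V s) x = restrict (quot_proj T F M N U s) V x"
  proof (cases "x \<in> V")
    case True
    then show ?thesis
      using Q.germ_Res[OF U True, of "coset U s"] Res_Q_coset[OF U M_sub[OF U(1) s]] s U(3)
      by (auto simp: quot_proj_def carrier_Q)
  qed (simp add: quot_proj_def)
qed

lemma quot_proj_mult:
  assumes U: "openin T U" and st: "s \<in> M U" "t \<in> M U"
  shows "quot_proj T F M N U (s \<otimes>\<^bsub>Sec F U\<^esub> t) =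
    quot_proj T F M N U s \<otimes>\<^bsub>Sec (quot_sheaf T F M N) U\<^esub> quot_proj T F M N U t"
  using Q.germ_mult_germ[OF U, of _ "coset U s" "coset U t"] mult_Q_coset[OF U M_sub[OF U st(1)] M_sub[OF U st(2)]] st
  by (auto simp: quot_proj_def quot_sheaf_def sheafify_def carrier_Q fun_eq_iff restrict_def)

lemma quot_proj_closed:
  assumes U: "openin T U" and s: "s \<in> M U"
  shows "quot_proj T F M N U s \<in> carrier (Sec (quot_sheaf T F M N) U)"
  unfolding quot_sheaf_def sheafify_def
  using assms by (auto simp: quot_proj_def carrier_Q intro!: exI[of _ U] exI[of _ "coset U s"])

lemma quot_sheaf_locally_proj:
  assumes \<sigma>: "\<sigma> \<in> carrier (Sec (quot_sheaf T F M N) U)" and x: "x \<in> U"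
  shows "\<exists>V t. openin T V \<and> x \<in> V \<and> V \<subseteq> U \<and> t \<in> M V \<and> restrict \<sigma> V = quot_proj T F M N V t"
proof -
  obtain V c where V: "openin T V" "x \<in> V" "V \<subseteq> U" "c \<in> carrier (Sec Q V)" "\<forall>y\<in>V. \<sigma> y = germ T Q V c y"
    using \<sigma> x unfolding quot_sheaf_def sheafify_def by auto
  then obtain t where "t \<in> M V" "c = coset V t" unfolding carrier_Q by auto
  then show ?thesis
    using V by (intro exI[of _ V] exI[of _ t]) (auto simp: quot_proj_def fun_eq_iff)
qed

end

section \<open>Strictification of a prestack\<close>

context prestack_of_groupoids
begin

lemma cmp_closed:
  "\<lbrakk>openin X V; i \<in> Obj G V; j \<in> Obj G V; k \<in> Obj G V; f \<in> Hom G V i j; g \<in> Hom G V j k\<rbrakk>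
    \<Longrightarrow> Cmp G V g f \<in> Hom G V i k"
  using groupoid.comp_mor[OF groupoids] .

lemma cmp_assoc:
  "\<lbrakk>openin X V; i \<in> Obj G V; j \<in> Obj G V; k \<in> Obj G V; l \<in> Obj G V;
    f \<in> Hom G V i j; g \<in> Hom G V j k; h \<in> Hom G V k l\<rbrakk>
    \<Longrightarrow> Cmp G V (Cmp G V h g) f = Cmp G V h (Cmp G V g f)"
  using groupoid.comp_assoc[OF groupoids] by metis

lemma idn_closed: "\<lbrakk>openin X V; i \<in> Obj G V\<rbrakk> \<Longrightarrow> Idn G V i \<in> Hom G V i i"
  using groupoid.id_mor[OF groupoids] .

lemma cmp_idn: "\<lbrakk>openin X V; i \<in> Obj G V; j \<in> Obj G V; f \<in> Hom G V i j\<rbrakk> \<Longrightarrow> Cmp G V f (Idn G V i) = f"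
  using groupoid.comp_id[OF groupoids] .

lemma idn_cmp: "\<lbrakk>openin X V; i \<in> Obj G V; j \<in> Obj G V; f \<in> Hom G V i j\<rbrakk> \<Longrightarrow> Cmp G V (Idn G V j) f = f"
  using groupoid.id_comp[OF groupoids] .

lemma Inv:
  assumes V: "openin X V" and i: "i \<in> Obj G V" and j: "j \<in> Obj G V" and f: "f \<in> Hom G V i j"
  shows "Inv G V i j f \<in> Hom G V j i" "Cmp G V (Inv G V i j f) f = Idn G V i"
    "Cmp G V f (Inv G V i j f) = Idn G V j"
proof -
  obtain h where h: "h \<in> Hom G V j i" "Cmp G V h f = Idn G V i" "Cmp G V f h = Idn G V j"
    using groupoid.inverse_ex[OF groupoids[OF V] i j f] by blast
  have uniq: "h' = h" if h': "h' \<in> Hom G V j i" "Cmp G V h' f = Idn G V i" for h'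
  proof -
    have "h' = Cmp G V h' (Cmp G V f h)" using cmp_idn[OF V j i h'(1)] h(3) by simp
    also have "\<dots> = h" using cmp_assoc[OF V j i j i h(1) f h'(1)] h'(2) idn_cmp[OF V j i h(1)] by simp
    finally show ?thesis .
  qed
  have "Inv G V i j f = h"
    unfolding Inv_def by (rule the_equality) (use h in simp, elim conjE, rule uniq)
  then show "Inv G V i j f \<in> Hom G V j i" "Cmp G V (Inv G V i j f) f = Idn G V i"
    "Cmp G V f (Inv G V i j f) = Idn G V j"
    using h by simp_all
qed

lemma cmp_cancel_right:
  assumes V: "openin X V" and ob: "i \<in> Obj G V" "j \<in> Obj G V" "k \<in> Obj G V"
    and c: "c \<in> Hom G V i j" and h: "h \<in> Hom G V j k" "h' \<in> Hom G V j k" and eq: "Cmp G V h c = Cmp G V h' c"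
  shows "h = h'"
proof -
  note I = Inv[OF V ob(1,2) c]
  have "h = Cmp G V (Cmp G V h c) (Inv G V i j c)"
    using cmp_assoc[OF V ob(2,1,2,3) I(1) c h(1)] I(3) cmp_idn[OF V ob(2,3) h(1)] by simp
  also have "\<dots> = h'"
    unfolding eq using cmp_assoc[OF V ob(2,1,2,3) I(1) c h(2)] I(3) cmp_idn[OF V ob(2,3) h(2)] by simp
  finally show ?thesis .
qed

text \<open>\<open>hom_res\<close> is the only morphism that closes the square formed with the two
  coherence isomorphisms and the plain restriction of \<open>f\<close>. This characterization
  removes inverses from the computations with \<open>hom_res\<close> that follow.\<close>

lemma
  assumes o: "openin X U1" "openin X U2" "openin X V" "openin X W"
    and sub: "V \<subseteq> U1" "V \<subseteq> U2" "W \<subseteq> V" and i: "i \<in> Obj G U1" and j: "j \<in> Obj G U2"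
    and f: "f \<in> hom_sec G U1 i U2 j V"
  shows hom_res_closed: "hom_res G U1 i U2 j V W f \<in> hom_sec G U1 i U2 j W"
    and hom_res_Coh: "Cmp G W (hom_res G U1 i U2 j V W f) (Coh G U1 V W i) =
      Cmp G W (Coh G U2 V W j) (RHom G V W f)"
    and hom_res_eqI: "h \<in> hom_sec G U1 i U2 j W \<Longrightarrow>
      Cmp G W h (Coh G U1 V W i) = Cmp G W (Coh G U2 V W j) (RHom G V W f) \<Longrightarrow>
      hom_res G U1 i U2 j V W f = h"
proof -
  have W: "W \<subseteq> U1" "W \<subseteq> U2" using sub by auto
  note ob = robj[OF o(1,3) sub(1) i] robj[OF o(2,3) sub(2) j] robj[OF o(1,4) W(1) i] robj[OF o(2,4) W(2) j]
  note ob2 = robj[OF o(3,4) sub(3) ob(1)] robj[OF o(3,4) sub(3) ob(2)]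
  note c1 = coh[OF o(1,3,4) sub(1,3) i] and c2 = coh[OF o(2,3,4) sub(2,3) j]
  have f': "RHom G V W f \<in> Hom G W (RObj G V W (RObj G U1 V i)) (RObj G V W (RObj G U2 V j))"
    using rhom[OF o(3,4) sub(3) ob(1,2)] f unfolding hom_sec_def by blast
  note I = Inv[OF o(4) ob2(1) ob(3) c1]
  have d: "Cmp G W (RHom G V W f) (Inv G W (RObj G V W (RObj G U1 V i)) (RObj G U1 W i) (Coh G U1 V W i))
      \<in> Hom G W (RObj G U1 W i) (RObj G V W (RObj G U2 V j))"
    using cmp_closed[OF o(4) ob(3) ob2 I(1) f'] .
  show 1: "hom_res G U1 i U2 j V W f \<in> hom_sec G U1 i U2 j W"
    unfolding hom_res_def hom_sec_def using cmp_closed[OF o(4) ob(3) ob2(2) ob(4) d c2] .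
  show 2: "Cmp G W (hom_res G U1 i U2 j V W f) (Coh G U1 V W i) = Cmp G W (Coh G U2 V W j) (RHom G V W f)"
    unfolding hom_res_def
    using cmp_assoc[OF o(4) ob2(1) ob(3) ob2(2) ob(4) c1 d c2] cmp_assoc[OF o(4) ob2(1) ob(3) ob2(1) ob2(2) c1 I(1) f']
      I(2) cmp_idn[OF o(4) ob2(1,2) f'] by simp
  show "hom_res G U1 i U2 j V W f = h" if "h \<in> hom_sec G U1 i U2 j W"
    "Cmp G W h (Coh G U1 V W i) = Cmp G W (Coh G U2 V W j) (RHom G V W f)"
    by (rule cmp_cancel_right[OF o(4) ob2(1) ob(3,4) c1]) (use 1 2 that in \<open>simp_all add: hom_sec_def\<close>)
qed

text \<open>The squares that characterize the restrictions of \<open>f\<close> and \<open>g\<close>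
  are pasted side by side.\<close>

lemma hom_res_cmp:
  assumes o: "openin X U1" "openin X U2" "openin X U3" "openin X V" "openin X W"
    and sub: "V \<subseteq> U1" "V \<subseteq> U2" "V \<subseteq> U3" "W \<subseteq> V" and i: "i \<in> Obj G U1" and j: "j \<in> Obj G U2" and k: "k \<in> Obj G U3"
    and f: "f \<in> hom_sec G U1 i U2 j V" and g: "g \<in> hom_sec G U2 j U3 k V"
  shows "hom_res G U1 i U3 k V W (Cmp G V g f) = Cmp G W (hom_res G U2 j U3 k V W g) (hom_res G U1 i U2 j V W f)"
proof -
  have W: "W \<subseteq> U1" "W \<subseteq> U2" "W \<subseteq> U3" using sub by auto
  note ob = robj[OF o(1,4) sub(1) i] robj[OF o(2,4) sub(2) j] robj[OF o(3,4) sub(3) k]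
  note obW = robj[OF o(1,5) W(1) i] robj[OF o(2,5) W(2) j] robj[OF o(3,5) W(3) k]
  note ob2 = robj[OF o(4,5) sub(4) ob(1)] robj[OF o(4,5) sub(4) ob(2)] robj[OF o(4,5) sub(4) ob(3)]
  note c = coh[OF o(1,4,5) sub(1,4) i] coh[OF o(2,4,5) sub(2,4) j] coh[OF o(3,4,5) sub(3,4) k]
  have fg: "f \<in> Hom G V (RObj G U1 V i) (RObj G U2 V j)" "g \<in> Hom G V (RObj G U2 V j) (RObj G U3 V k)"
    using f g by (simp_all add: hom_sec_def)
  note r = rhom[OF o(4,5) sub(4) ob(1,2) fg(1)] rhom[OF o(4,5) sub(4) ob(2,3) fg(2)]
  have gf: "Cmp G V g f \<in> hom_sec G U1 i U3 k V"
    using cmp_closed[OF o(4) ob fg] by (simp add: hom_sec_def)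
  let ?f = "hom_res G U1 i U2 j V W f" and ?g = "hom_res G U2 j U3 k V W g"
  have F: "?f \<in> Hom G W (RObj G U1 W i) (RObj G U2 W j)" "?g \<in> Hom G W (RObj G U2 W j) (RObj G U3 W k)"
    using hom_res_closed[OF o(1,2,4,5) sub(1,2,4) i j f] hom_res_closed[OF o(2,3,4,5) sub(2,3,4) j k g]
    by (simp_all add: hom_sec_def)
  show ?thesis
  proof (rule hom_res_eqI[OF o(1,3,4,5) sub(1,3,4) i k gf])
    show "Cmp G W ?g ?f \<in> hom_sec G U1 i U3 k W" unfolding hom_sec_def using cmp_closed[OF o(5) obW F] .
    have "Cmp G W (Cmp G W ?g ?f) (Coh G U1 V W i) = Cmp G W ?g (Cmp G W ?f (Coh G U1 V W i))"
      using cmp_assoc[OF o(5) ob2(1) obW c(1) F] .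
    also have "\<dots> = Cmp G W ?g (Cmp G W (Coh G U2 V W j) (RHom G V W f))"
      using hom_res_Coh[OF o(1,2,4,5) sub(1,2,4) i j f] by simp
    also have "\<dots> = Cmp G W (Cmp G W ?g (Coh G U2 V W j)) (RHom G V W f)"
      using cmp_assoc[OF o(5) ob2(1,2) obW(2,3) r(1) c(2) F(2)] by simp
    also have "\<dots> = Cmp G W (Cmp G W (Coh G U3 V W k) (RHom G V W g)) (RHom G V W f)"
      using hom_res_Coh[OF o(2,3,4,5) sub(2,3,4) j k g] by simp
    also have "\<dots> = Cmp G W (Coh G U3 V W k) (RHom G V W (Cmp G V g f))"
      using cmp_assoc[OF o(5) ob2 obW(3) r c(3)] rhom_comp[OF o(4,5) sub(4) ob fg] by simp
    finally show "Cmp G W (Cmp G W ?g ?f) (Coh G U1 V W i) = Cmp G W (Coh G U3 V W k) (RHom G V W (Cmp G V g f))" .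
  qed
qed

text \<open>It suffices that the twofold restriction closes the square from \<open>V\<close> to
  \<open>Z\<close>. After composition with the coherence isomorphism through \<open>W\<close>,
  \<open>coh_assoc\<close> splits this square into the squares from \<open>V\<close> to
  \<open>W\<close> and from \<open>W\<close> to \<open>Z\<close>, and naturality of coherence
  recombines the other side.\<close>

lemma hom_res_hom_res:
  assumes o: "openin X U1" "openin X U2" "openin X V" "openin X W" "openin X Z"
    and sub: "V \<subseteq> U1" "V \<subseteq> U2" "W \<subseteq> V" "Z \<subseteq> W" and i: "i \<in> Obj G U1" and j: "j \<in> Obj G U2"
    and f: "f \<in> hom_sec G U1 i U2 j V"
  shows "hom_res G U1 i U2 j W Z (hom_res G U1 i U2 j V W f) = hom_res G U1 i U2 j V Z f"
proof -
  have s: "W \<subseteq> U1" "W \<subseteq> U2" "Z \<subseteq> U1" "Z \<subseteq> U2" "Z \<subseteq> V" using sub by auto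
  note obV = robj[OF o(1,3) sub(1) i] robj[OF o(2,3) sub(2) j]
  note obW = robj[OF o(1,4) s(1) i] robj[OF o(2,4) s(2) j]
  note obZ = robj[OF o(1,5) s(3) i] robj[OF o(2,5) s(4) j]
  note obVW = robj[OF o(3,4) sub(3) obV(1)] robj[OF o(3,4) sub(3) obV(2)]
  note obVZ = robj[OF o(3,5) s(5) obV(1)] robj[OF o(3,5) s(5) obV(2)]
  note obWZ = robj[OF o(4,5) sub(4) obW(1)] robj[OF o(4,5) sub(4) obW(2)]
  note obVWZ = robj[OF o(4,5) sub(4) obVW(1)] robj[OF o(4,5) sub(4) obVW(2)]
  have f': "f \<in> Hom G V (RObj G U1 V i) (RObj G U2 V j)" using f by (simp add: hom_sec_def)
  note fW = rhom[OF o(3,4) sub(3) obV f'] and fZ = rhom[OF o(3,5) s(5) obV f']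
  note fWZ = rhom[OF o(4,5) sub(4) obVW fW]
  note cVW = coh[OF o(1,3,4) sub(1,3) i] coh[OF o(2,3,4) sub(2,3) j]
  note cVZ = coh[OF o(1,3,5) sub(1) s(5) i] coh[OF o(2,3,5) sub(2) s(5) j]
  note cWZ = coh[OF o(1,4,5) s(1) sub(4) i] coh[OF o(2,4,5) s(2) sub(4) j]
  note c' = coh[OF o(3,4,5) sub(3,4) obV(1)] coh[OF o(3,4,5) sub(3,4) obV(2)]
  note rc = rhom[OF o(4,5) sub(4) obVW(1) obW(1) cVW(1)] rhom[OF o(4,5) sub(4) obVW(2) obW(2) cVW(2)]
  let ?g = "hom_res G U1 i U2 j V W f"
  have g: "?g \<in> hom_sec G U1 i U2 j W" by (rule hom_res_closed[OF o(1-4) sub(1-3) i j f])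
  then have g': "?g \<in> Hom G W (RObj G U1 W i) (RObj G U2 W j)" by (simp add: hom_sec_def)
  note gZ = rhom[OF o(4,5) sub(4) obW g']
  let ?h = "hom_res G U1 i U2 j W Z ?g"
  have h: "?h \<in> hom_sec G U1 i U2 j Z" by (rule hom_res_closed[OF o(1,2,4,5) s(1,2) sub(4) i j g])
  then have h': "?h \<in> Hom G Z (RObj G U1 Z i) (RObj G U2 Z j)" by (simp add: hom_sec_def)
  have "Cmp G Z (Cmp G Z ?h (Coh G U1 V Z i)) (Coh G V W Z (RObj G U1 V i)) =
      Cmp G Z (Cmp G Z (Coh G U2 V Z j) (RHom G V Z f)) (Coh G V W Z (RObj G U1 V i))"
  proof -
    have "Cmp G Z (Cmp G Z ?h (Coh G U1 V Z i)) (Coh G V W Z (RObj G U1 V i)) =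
        Cmp G Z ?h (Cmp G Z (Coh G U1 W Z i) (RHom G W Z (Coh G U1 V W i)))"
      using cmp_assoc[OF o(5) obVWZ(1) obVZ(1) obZ c'(1) cVZ(1) h'] coh_assoc[OF o(1,3,4,5) sub(1,3,4) i] by simp
    also have "\<dots> = Cmp G Z (Cmp G Z (Coh G U2 W Z j) (RHom G W Z ?g)) (RHom G W Z (Coh G U1 V W i))"
      using cmp_assoc[OF o(5) obVWZ(1) obWZ(1) obZ rc(1) cWZ(1) h'] hom_res_Coh[OF o(1,2,4,5) s(1,2) sub(4) i j g] by simp
    also have "\<dots> = Cmp G Z (Coh G U2 W Z j) (RHom G W Z (Cmp G W ?g (Coh G U1 V W i)))"
      using cmp_assoc[OF o(5) obVWZ(1) obWZ obZ(2) rc(1) gZ cWZ(2)] rhom_comp[OF o(4,5) sub(4) obVW(1) obW cVW(1) g'] by simp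
    also have "\<dots> = Cmp G Z (Coh G U2 W Z j) (Cmp G Z (RHom G W Z (Coh G U2 V W j)) (RHom G W Z (RHom G V W f)))"
      using hom_res_Coh[OF o(1-4) sub(1-3) i j f] rhom_comp[OF o(4,5) sub(4) obVW obW(2) fW cVW(2)] by simp
    also have "\<dots> = Cmp G Z (Cmp G Z (Coh G U2 V Z j) (Coh G V W Z (RObj G U2 V j))) (RHom G W Z (RHom G V W f))"
      using cmp_assoc[OF o(5) obVWZ obWZ(2) obZ(2) fWZ rc(2) cWZ(2)] coh_assoc[OF o(2,3,4,5) sub(2,3,4) j] by simp
    also have "\<dots> = Cmp G Z (Coh G U2 V Z j) (Cmp G Z (RHom G V Z f) (Coh G V W Z (RObj G U1 V i)))"
      using cmp_assoc[OF o(5) obVWZ obVZ(2) obZ(2) fWZ c'(2) cVZ(2)] coh_natural[OF o(3,4,5) sub(3,4) obV f'] by simp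
    also have "\<dots> = Cmp G Z (Cmp G Z (Coh G U2 V Z j) (RHom G V Z f)) (Coh G V W Z (RObj G U1 V i))"
      using cmp_assoc[OF o(5) obVWZ(1) obVZ obZ(2) c'(1) fZ cVZ(2)] by simp
    finally show ?thesis .
  qed
  \<comment> \<open>The auxiliary coherence isomorphism is cancelled on the right.\<close>
  then have "Cmp G Z ?h (Coh G U1 V Z i) = Cmp G Z (Coh G U2 V Z j) (RHom G V Z f)"
    by (rule cmp_cancel_right[OF o(5) obVWZ(1) obVZ(1) obZ(2) c'(1) cmp_closed[OF o(5) obVZ(1) obZ cVZ(1) h']
          cmp_closed[OF o(5) obVZ obZ(2) fZ cVZ(2)]])
  from hom_res_eqI[OF o(1-3,5) sub(1,2) s(5) i j f h this] show ?thesis by simp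
qed

text \<open>For \<open>W = V\<close> both coherence isomorphisms in the square are unit
  isomorphisms, and the square is their naturality.\<close>

lemma hom_res_self:
  assumes o: "openin X U1" "openin X U2" "openin X V"
    and sub: "V \<subseteq> U1" "V \<subseteq> U2" and i: "i \<in> Obj G U1" and j: "j \<in> Obj G U2"
    and f: "f \<in> hom_sec G U1 i U2 j V"
  shows "hom_res G U1 i U2 j V V f = f"
proof (rule hom_res_eqI[OF o o(3) sub subset_refl i j f f])
  show "Cmp G V f (Coh G U1 V V i) = Cmp G V (Coh G U2 V V j) (RHom G V V f)"
    using coh_unt_right[OF o(1,3) sub(1) i] coh_unt_right[OF o(2,3) sub(2) j]
      unt_natural[OF o(3) robj[OF o(1,3) sub(1) i] robj[OF o(2,3) sub(2) j]] f
    by (simp add: hom_sec_def)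
qed

end

section \<open>Arrows that store their support and end points\<close>

type_synonym ('x, 'o, 'm) local_arrow = "'x set \<times> ('x set \<times> 'o) \<times> 'm \<times> ('x set \<times> 'o)"

definition local_objects :: "'x topology \<Rightarrow> ('x, 'o, 'm) prestack_data \<Rightarrow> ('x set \<times> 'o) set" where
  "local_objects X G = {(U, i). openin X U \<and> i \<in> Obj G U}"

definition local_arrows :: "'x topology \<Rightarrow> ('x, 'o, 'm) prestack_data \<Rightarrow> ('x, 'o, 'm) local_arrow set" where
  "local_arrows X G = {(V, (U1, i), f, (U2, j)). openin X V \<and> openin X U1 \<and> openin X U2 \<and>
     V \<subseteq> U1 \<and> V \<subseteq> U2 \<and> i \<in> Obj G U1 \<and> j \<in> Obj G U2 \<and> f \<in> hom_sec G U1 i U2 j V}"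

fun arrow_src :: "('x, 'o, 'm) local_arrow \<Rightarrow> 'x set \<times> 'o" where "arrow_src (V, a, f, b) = a"

fun arrow_tgt :: "('x, 'o, 'm) local_arrow \<Rightarrow> 'x set \<times> 'o" where "arrow_tgt (V, a, f, b) = b"

fun arrow_idn :: "('x, 'o, 'm) prestack_data \<Rightarrow> 'x set \<Rightarrow> 'x set \<times> 'o \<Rightarrow> ('x, 'o, 'm) local_arrow" where
  "arrow_idn G V (U, i) = (V, (U, i), Idn G V (RObj G U V i), (U, i))"

fun arrow_cmp :: "('x, 'o, 'm) prestack_data \<Rightarrow> ('x, 'o, 'm) local_arrow \<Rightarrow> ('x, 'o, 'm) local_arrow \<Rightarrow>
    ('x, 'o, 'm) local_arrow" where
  "arrow_cmp G (V', b', g, c) (V, a, f, b) = (V, a, Cmp G V g f, c)"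

fun arrow_inv :: "('x, 'o, 'm) prestack_data \<Rightarrow> ('x, 'o, 'm) local_arrow \<Rightarrow> ('x, 'o, 'm) local_arrow" where
  "arrow_inv G (V, (U1, i), f, (U2, j)) = (V, (U2, j), Inv G V (RObj G U1 V i) (RObj G U2 V j) f, (U1, i))"

fun arrow_res :: "('x, 'o, 'm) prestack_data \<Rightarrow> 'x set \<Rightarrow> ('x, 'o, 'm) local_arrow \<Rightarrow> ('x, 'o, 'm) local_arrow" where
  "arrow_res G W (V, (U1, i), f, (U2, j)) = (W, (U1, i), hom_res G U1 i U2 j V W f, (U2, j))"

lemma local_arrows_iff:
  "(V, (U1, i), f, (U2, j)) \<in> local_arrows X G \<longleftrightarrow> openin X V \<and> openin X U1 \<and> openin X U2 \<and>
     V \<subseteq> U1 \<and> V \<subseteq> U2 \<and> i \<in> Obj G U1 \<and> j \<in> Obj G U2 \<and> f \<in> Hom G V (RObj G U1 V i) (RObj G U2 V j)"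
  by (simp add: local_arrows_def hom_sec_def)

lemma local_objects_iff: "(U, i) \<in> local_objects X G \<longleftrightarrow> openin X U \<and> i \<in> Obj G U"
  by (simp add: local_objects_def)

lemma local_arrow_cases:
  obtains V U1 i f U2 j where "F = (V, (U1, i), f, (U2, j))"
  by (cases F) auto

text \<open>The groupoid laws hold over each open set separately. Strict functoriality of
  restriction is \<open>hom_res_self\<close>, \<open>hom_res_hom_res\<close> and
  \<open>hom_res_cmp\<close>, which have absorbed the coherence isomorphisms.\<close>

sublocale prestack_of_groupoids \<subseteq> strict: strict_groupoid_prestack X "local_objects X G" fst
    "local_arrows X G" fst arrow_src arrow_tgt "arrow_idn G" "arrow_cmp G" "arrow_inv G" "arrow_res G"
proof (unfold_locales, goal_cases)
  case (1 F) then show ?case by (cases F rule: local_arrow_cases) (auto simp: local_arrows_iff)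
next
  case (2 F) then show ?case by (cases F rule: local_arrow_cases) (auto simp: local_arrows_iff local_objects_iff)
next
  case (3 F) then show ?case by (cases F rule: local_arrow_cases) (auto simp: local_arrows_iff local_objects_iff)
next
  case (4 F) then show ?case by (cases F rule: local_arrow_cases) (auto simp: local_arrows_iff)
next
  case (5 F) then show ?case by (cases F rule: local_arrow_cases) (auto simp: local_arrows_iff)
next
  case (6 a V) then show ?case by (cases a) (auto simp: local_arrows_iff local_objects_iff robj idn_closed)
next
  case (7 a V) then show ?case by (cases a) auto
next
  case (8 a V) then show ?case by (cases a) auto
next
  case (9 a V) then show ?case by (cases a) auto
next
  case (10 F H)
  then show ?case
    by (cases F rule: local_arrow_cases; cases H rule: local_arrow_cases)
      (auto simp: local_arrows_iff intro: cmp_closed[OF _ robj robj robj])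
next
  case (11 F H) then show ?case by (cases F rule: local_arrow_cases; cases H rule: local_arrow_cases) auto
next
  case (12 F H) then show ?case by (cases F rule: local_arrow_cases; cases H rule: local_arrow_cases) auto
next
  case (13 F H) then show ?case by (cases F rule: local_arrow_cases; cases H rule: local_arrow_cases) auto
next
  case (14 F H K)
  then show ?case
    by (cases F rule: local_arrow_cases; cases H rule: local_arrow_cases; cases K rule: local_arrow_cases)
      (auto simp: local_arrows_iff intro: cmp_assoc[OF _ robj robj robj robj])
next
  case (15 F) then show ?case
    by (cases F rule: local_arrow_cases) (auto simp: local_arrows_iff intro: cmp_idn[OF _ robj robj])
next
  case (16 F) then show ?case
    by (cases F rule: local_arrow_cases) (auto simp: local_arrows_iff intro: idn_cmp[OF _ robj robj])
next
  case (17 F) then show ?case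
    by (cases F rule: local_arrow_cases) (auto simp: local_arrows_iff intro: Inv(1)[OF _ robj robj])
next
  case (18 F) then show ?case by (cases F rule: local_arrow_cases) auto
next
  case (19 F) then show ?case by (cases F rule: local_arrow_cases) auto
next
  case (20 F) then show ?case by (cases F rule: local_arrow_cases) auto
next
  case (21 F) then show ?case
    by (cases F rule: local_arrow_cases) (auto simp: local_arrows_iff intro: Inv(2)[OF _ robj robj])
next
  case (22 F) then show ?case
    by (cases F rule: local_arrow_cases) (auto simp: local_arrows_iff intro: Inv(3)[OF _ robj robj])
next
  case (23 F V)
  obtain V' U1 i f U2 j where F: "F = (V', (U1, i), f, (U2, j))" by (rule local_arrow_cases)
  show ?case
    using 23 hom_res_closed[of U1 U2 V' V i j f] unfolding F by (auto simp: local_arrows_iff hom_sec_def)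
next
  case (24 F V) then show ?case by (cases F rule: local_arrow_cases) auto
next
  case (25 F V) then show ?case by (cases F rule: local_arrow_cases) auto
next
  case (26 F V) then show ?case by (cases F rule: local_arrow_cases) auto
next
  case (27 F) then show ?case
    by (cases F rule: local_arrow_cases) (auto simp: local_arrows_iff hom_sec_def intro: hom_res_self)
next
  case (28 F V W)
  obtain V' U1 i f U2 j where F: "F = (V', (U1, i), f, (U2, j))" by (rule local_arrow_cases)
  show ?case
    using 28 hom_res_hom_res[of U1 U2 V' V W i j f] unfolding F by (auto simp: local_arrows_iff hom_sec_def)
next
  case (29 F H V)
  obtain V1 U1 i f U2 j where F: "F = (V1, (U1, i), f, (U2, j))" by (rule local_arrow_cases)
  obtain V2 U2' j' h U3 k where H: "H = (V2, (U2', j'), h, (U3, k))" by (rule local_arrow_cases)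
  show ?case
    using 29 hom_res_cmp[of U1 U2 U3 V1 V i j k f h] unfolding F H by (auto simp: local_arrows_iff hom_sec_def)
qed

section \<open>The strict form of a filtered gerbe\<close>

locale filtered_gerbe_data =
  fixes X :: "'x topology" and G :: "('x, 'o, 'm) prestack_data" and N :: "nat \<Rightarrow> 'x set \<Rightarrow> 'o \<Rightarrow> 'm set"
    and A :: "nat \<Rightarrow> ('x, 'b) group_presheaf"
    and \<chi> :: "nat \<Rightarrow> 'x set \<Rightarrow> 'o \<Rightarrow> 'x set \<Rightarrow> 'b \<Rightarrow> 'x \<Rightarrow> ('x set \<times> 'm set) set"
  assumes gerbe: "gerbe X G" and filtration: "gerbe_central_filtration X G N"
    and quotient: "\<And>p. is_gerbe_quotient X G (N p) (N (Suc p)) (A p) (\<chi> p)"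
    and complete_data: "gerbe_complete X G N"

sublocale filtered_gerbe_data \<subseteq> prestack_of_groupoids X G
  using gerbe unfolding gerbe_def stack_of_groupoids_def by blast

context filtered_gerbe_data
begin

section \<open>The filtration on automorphism sheaves\<close>

lemma aut_sheaf_simps [simp]:
  "carrier (Sec (aut_sheaf G U i) V) = Hom G V (RObj G U V i) (RObj G U V i)"
  "(\<otimes>\<^bsub>Sec (aut_sheaf G U i) V\<^esub>) = Cmp G V"
  "\<one>\<^bsub>Sec (aut_sheaf G U i) V\<^esub> = Idn G V (RObj G U V i)"
  "Res (aut_sheaf G U i) = hom_res G U i U i"
  by (simp_all add: aut_sheaf_def aut_group_def)

lemma openin_sub: "openin X U \<Longrightarrow> openin (subtopology X U) V \<longleftrightarrow> openin X V \<and> V \<subseteq> U"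
  using openin_open_subtopology .

lemma
  assumes U: "openin X U" and i: "i \<in> Obj G U"
  shows sheaf_aut: "sheaf_of_groups (subtopology X U) (aut_sheaf G U i)"
    and normal_sub_sec: "\<And>V. \<lbrakk>openin X V; V \<subseteq> U\<rbrakk> \<Longrightarrow> N p V (RObj G U V i) \<lhd> Sec (aut_sheaf G U i) V"
    and sheaf_sub_sec: "sheaf_of_sets (subtopology X U) (sub_sec G (N p) U i) (hom_res G U i U i)"
    and N_0_raw: "\<And>V. \<lbrakk>openin X V; V \<subseteq> U\<rbrakk> \<Longrightarrow> N 0 V (RObj G U V i) = Hom G V (RObj G U V i) (RObj G U V i)"
    and N_separated_raw: "\<And>V. \<lbrakk>openin X V; V \<subseteq> U\<rbrakk> \<Longrightarrow> (\<Inter>p. N p V (RObj G U V i)) = {Idn G V (RObj G U V i)}"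
proof -
  have c: "central_filtration (subtopology X U) (aut_sheaf G U i) (\<lambda>p. sub_sec G (N p) U i)"
    using filtration U i unfolding gerbe_central_filtration_def by blast
  show "sheaf_of_groups (subtopology X U) (aut_sheaf G U i)"
    using c unfolding central_filtration_def by (elim conjE)
  have n: "\<forall>p. normal_subsheaf (subtopology X U) (aut_sheaf G U i) (sub_sec G (N p) U i)"
    using c unfolding central_filtration_def by (elim conjE)
  show "N p V (RObj G U V i) \<lhd> Sec (aut_sheaf G U i) V" if "openin X V" "V \<subseteq> U" for V
    using spec[OF n, of p] that unfolding normal_subsheaf_def openin_sub[OF U] sub_sec_def by simp
  show "sheaf_of_sets (subtopology X U) (sub_sec G (N p) U i) (hom_res G U i U i)"
    using spec[OF n, of p] unfolding normal_subsheaf_def by simp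
  have "\<forall>V. openin (subtopology X U) V \<longrightarrow> sub_sec G (N 0) U i V = carrier (Sec (aut_sheaf G U i) V)"
    using c unfolding central_filtration_def by (elim conjE)
  then show "N 0 V (RObj G U V i) = Hom G V (RObj G U V i) (RObj G U V i)" if "openin X V" "V \<subseteq> U" for V
    using that unfolding openin_sub[OF U] sub_sec_def by simp
  have "\<forall>V. openin (subtopology X U) V \<longrightarrow> (\<Inter>p. sub_sec G (N p) U i V) = {\<one>\<^bsub>Sec (aut_sheaf G U i) V\<^esub>}"
    using c unfolding central_filtration_def by (elim conjE)
  then show "(\<Inter>p. N p V (RObj G U V i)) = {Idn G V (RObj G U V i)}" if "openin X V" "V \<subseteq> U" for V
    using that unfolding openin_sub[OF U] sub_sec_def by simp
qed

lemma N_antimono: "\<lbrakk>p \<le> q; openin X V; i \<in> Obj G V\<rbrakk> \<Longrightarrow> N q V i \<subseteq> N p V i"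
proof (induction q rule: dec_induct)
  case (step q)
  have "\<forall>p U. openin X U \<longrightarrow> (\<forall>i\<in>Obj G U. N (Suc p) U i \<subseteq> N p U i)"
    using filtration unfolding gerbe_central_filtration_def by (elim conjE)
  then have "N (Suc q) V i \<subseteq> N q V i" using step.prems by simp
  with step show ?case by simp
qed simp

lemma N_closed: "\<lbrakk>openin X V; i \<in> Obj G V; f \<in> N p V i\<rbrakk> \<Longrightarrow> f \<in> Hom G V i i"
  and N_Ad: "\<lbrakk>openin X V; i \<in> Obj G V; j \<in> Obj G V; g \<in> Hom G V i j\<rbrakk> \<Longrightarrow> Ad G V i j g ` N p V i = N p V j"
proof -
  have n: "normal_subgroupoid X G (N p)"
    using filtration unfolding gerbe_central_filtration_def by blast
  have s: "\<forall>U. openin X U \<longrightarrow> (\<forall>i\<in>Obj G U. subgroup (N p U i) (aut_group G U i))"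
    using n unfolding normal_subgroupoid_def by (elim conjE)
  show "f \<in> Hom G V i i" if "openin X V" "i \<in> Obj G V" "f \<in> N p V i"
    using subgroup.subset[OF bspec[OF mp[OF spec[OF s] that(1)] that(2)]] that(3) by (auto simp: aut_group_def)
  have a: "\<forall>U. openin X U \<longrightarrow> (\<forall>i\<in>Obj G U. \<forall>j\<in>Obj G U. \<forall>g\<in>Hom G U i j. Ad G U i j g ` N p U i = N p U j)"
    using n unfolding normal_subgroupoid_def by (elim conjE)
  show "Ad G V i j g ` N p V i = N p V j" if "openin X V" "i \<in> Obj G V" "j \<in> Obj G V" "g \<in> Hom G V i j"
    using bspec[OF bspec[OF bspec[OF mp[OF spec[OF a] that(1)] that(2)] that(3)] that(4)] .
qed

lemma inv_aut_sheaf: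
  assumes U: "openin X U" "openin X V" "V \<subseteq> U" and i: "i \<in> Obj G U" and f: "f \<in> Hom G V (RObj G U V i) (RObj G U V i)"
  shows "inv\<^bsub>Sec (aut_sheaf G U i) V\<^esub> f = Inv G V (RObj G U V i) (RObj G U V i) f"
proof -
  have "group (Sec (aut_sheaf G U i) V)"
    using sheaf_aut[OF U(1) i] U unfolding sheaf_of_groups_def openin_sub[OF U(1)] by simp
  then show ?thesis
    using Inv[OF U(2) robj[OF U i] robj[OF U i] f] f by (intro group.inv_equality) simp_all
qed

lemma subquotient:
  assumes U: "openin X U" and i: "i \<in> Obj G U" and pq: "p \<le> q"
  shows "subquotient_sheaf (subtopology X U) (aut_sheaf G U i) (sub_sec G (N p) U i) (sub_sec G (N q) U i)"
proof (rule subquotient_sheaf.intro)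
  show "sheaf_of_groups (subtopology X U) (aut_sheaf G U i)" using sheaf_aut[OF U i] .
  show "subgroup (sub_sec G (N p) U i V) (Sec (aut_sheaf G U i) V)"
    "sub_sec G (N q) U i V \<lhd> Sec (aut_sheaf G U i) V" "sub_sec G (N q) U i V \<subseteq> sub_sec G (N p) U i V"
    if "openin (subtopology X U) V" for V
    using that normal_sub_sec[OF U i] N_antimono[OF pq _ robj[OF U _ _ i]]
    unfolding openin_sub[OF U] sub_sec_def by (auto intro: normal_imp_subgroup)
  show "Res (aut_sheaf G U i) W V s \<in> sub_sec G (N p) U i V"
    if "openin (subtopology X U) W" "openin (subtopology X U) V" "V \<subseteq> W" "s \<in> sub_sec G (N p) U i W" for W V s
    using presheaf_of_setsD(1)[of "subtopology X U" "sub_sec G (N p) U i" "hom_res G U i U i", OF _ that(1,2,3,4)]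
      sheaf_sub_sec[OF U i] unfolding sheaf_of_sets_def by simp
  show "sheaf_of_sets (subtopology X U) (sub_sec G (N q) U i) (Res (aut_sheaf G U i))"
    using sheaf_sub_sec[OF U i] by simp
qed

lemma subquotient_total:
  assumes U: "openin X U" and i: "i \<in> Obj G U"
  shows "subquotient_sheaf (subtopology X U) (aut_sheaf G U i) (total_sections (aut_sheaf G U i)) (sub_sec G (N q) U i)"
proof (rule subquotient_sheaf.intro)
  interpret S: subquotient_sheaf "subtopology X U" "aut_sheaf G U i" "sub_sec G (N 0) U i" "sub_sec G (N q) U i"
    using subquotient[OF U i] by simp
  show "sheaf_of_groups (subtopology X U) (aut_sheaf G U i)" using sheaf_aut[OF U i] .
  show "sheaf_of_sets (subtopology X U) (sub_sec G (N q) U i) (Res (aut_sheaf G U i))" using S.sheaf_N .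
  fix V assume V: "openin (subtopology X U) V"
  show "subgroup (total_sections (aut_sheaf G U i) V) (Sec (aut_sheaf G U i) V)"
    unfolding total_sections_def using group.subgroup_self[OF S.F.group_Sec[OF V]] .
  show "sub_sec G (N q) U i V \<lhd> Sec (aut_sheaf G U i) V" using S.normal_N[OF V] .
  show "sub_sec G (N q) U i V \<subseteq> total_sections (aut_sheaf G U i) V"
    unfolding total_sections_def using S.N_sub_M[OF V] S.M_sub[OF V] by blast
  show "Res (aut_sheaf G U i) V W s \<in> total_sections (aut_sheaf G U i) W"
    if "openin (subtopology X U) W" "W \<subseteq> V" "s \<in> total_sections (aut_sheaf G U i) V" for W s
    using that(3) unfolding total_sections_def by (rule S.F.Res_closed[OF V that(1,2)])
qed

section \<open>Classes in the sheaves \<open>A p\<close> and their invariance under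
  conjugation\<close>

abbreviation proj where
  "proj p U i \<equiv> quot_proj (subtopology X U) (aut_sheaf G U i) (sub_sec G (N p) U i) (sub_sec G (N (Suc p)) U i)"

text \<open>This is the composite of the projection from \<open>N\<^sub>p(i,i)\<close> to the
  quotient sheaf with the inverse of \<open>\<chi>\<^sub>i\<close>. Bijectivity of
  \<open>\<chi>\<close> makes the value of \<open>inv_into\<close> the only candidate.\<close>

definition section_class :: "nat \<Rightarrow> 'x set \<Rightarrow> 'o \<Rightarrow> 'x set \<Rightarrow> 'm \<Rightarrow> 'b" where
  "section_class p U i V f = inv_into (carrier (Sec (A p) V)) (\<chi> p U i V) (proj p U i V f)"

lemma abelian_A: "abelian_sheaf X (A p)"
  using quotient[of p] unfolding is_gerbe_quotient_def by (elim conjE)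

lemma \<chi>_iso:
  assumes "openin X U" "i \<in> Obj G U"
  shows "sheaf_iso (subtopology X U) (A p) (quot_sheaf (subtopology X U) (aut_sheaf G U i)
    (sub_sec G (N p) U i) (sub_sec G (N (Suc p)) U i)) (\<chi> p U i)"
proof -
  have "\<forall>U. openin X U \<longrightarrow> (\<forall>i\<in>Obj G U. sheaf_iso (subtopology X U) (A p) (local_quot X G (N p) (N (Suc p)) U i) (\<chi> p U i))"
    using quotient[of p] unfolding is_gerbe_quotient_def by (elim conjE)
  then show ?thesis using assms unfolding local_quot_def by simp
qed

lemma
  assumes U: "openin X U" "openin X V" "V \<subseteq> U" and i: "i \<in> Obj G U"
  shows \<chi>_bij: "bij_betw (\<chi> p U i V) (carrier (Sec (A p) V)) (carrier (Sec (quot_sheaf (subtopology X U) (aut_sheaf G U i)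
      (sub_sec G (N p) U i) (sub_sec G (N (Suc p)) U i)) V))"
    and \<chi>_mult: "\<lbrakk>a \<in> carrier (Sec (A p) V); b \<in> carrier (Sec (A p) V)\<rbrakk> \<Longrightarrow> \<chi> p U i V (a \<otimes>\<^bsub>Sec (A p) V\<^esub> b) =
      \<chi> p U i V a \<otimes>\<^bsub>Sec (quot_sheaf (subtopology X U) (aut_sheaf G U i) (sub_sec G (N p) U i) (sub_sec G (N (Suc p)) U i)) V\<^esub> \<chi> p U i V b"
    and \<chi>_Res: "\<lbrakk>openin X W; W \<subseteq> V; a \<in> carrier (Sec (A p) V)\<rbrakk> \<Longrightarrow>
      \<chi> p U i W (Res (A p) V W a) = restrict (\<chi> p U i V a) W"
proof -
  note iso = \<chi>_iso[OF U(1) i, of p]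
  have m: "sheaf_morphism (subtopology X U) (A p) (quot_sheaf (subtopology X U) (aut_sheaf G U i)
    (sub_sec G (N p) U i) (sub_sec G (N (Suc p)) U i)) (\<chi> p U i)"
    using iso unfolding sheaf_iso_def by (elim conjE)
  have V: "openin (subtopology X U) V" using U openin_sub by blast
  show "bij_betw (\<chi> p U i V) (carrier (Sec (A p) V)) (carrier (Sec (quot_sheaf (subtopology X U) (aut_sheaf G U i)
      (sub_sec G (N p) U i) (sub_sec G (N (Suc p)) U i)) V))"
    using iso V unfolding sheaf_iso_def iso_def by simp
  show "\<chi> p U i V (a \<otimes>\<^bsub>Sec (A p) V\<^esub> b) =
      \<chi> p U i V a \<otimes>\<^bsub>Sec (quot_sheaf (subtopology X U) (aut_sheaf G U i) (sub_sec G (N p) U i) (sub_sec G (N (Suc p)) U i)) V\<^esub> \<chi> p U i V b"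
    if "a \<in> carrier (Sec (A p) V)" "b \<in> carrier (Sec (A p) V)"
    using sheaf_morphismD(3)[OF m V that] .
  show "\<chi> p U i W (Res (A p) V W a) = restrict (\<chi> p U i V a) W"
    if "openin X W" "W \<subseteq> V" "a \<in> carrier (Sec (A p) V)"
    using sheaf_morphismD(4)[OF m V _ that(2,3)] that U openin_sub[OF U(1)]
    by (simp add: quot_sheaf_def sheafify_def)
qed

lemma \<chi>_inj:
  assumes "openin X U" "openin X V" "V \<subseteq> U" "i \<in> Obj G U"
    and "a \<in> carrier (Sec (A p) V)" "b \<in> carrier (Sec (A p) V)" "\<chi> p U i V a = \<chi> p U i V b"
  shows "a = b"
  using \<chi>_bij[OF assms(1-4)] assms(5-) unfolding bij_betw_def by (meson inj_onD)

lemma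
  assumes U: "openin X U" "openin X V" "V \<subseteq> U" and i: "i \<in> Obj G U" and f: "f \<in> N p V (RObj G U V i)"
  shows section_class_closed: "section_class p U i V f \<in> carrier (Sec (A p) V)"
    and \<chi>_section_class: "\<chi> p U i V (section_class p U i V f) = proj p U i V f"
proof -
  interpret S: subquotient_sheaf "subtopology X U" "aut_sheaf G U i" "sub_sec G (N p) U i" "sub_sec G (N (Suc p)) U i"
    using subquotient[OF U(1) i] by simp
  have "proj p U i V f \<in> carrier (Sec (quot_sheaf (subtopology X U) (aut_sheaf G U i)
      (sub_sec G (N p) U i) (sub_sec G (N (Suc p)) U i)) V)"
    by (rule S.quot_proj_closed) (use U f openin_sub in \<open>auto simp: sub_sec_def\<close>)
  then have "proj p U i V f \<in> \<chi> p U i V ` carrier (Sec (A p) V)"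
    using \<chi>_bij[OF U i, of p] unfolding bij_betw_def by simp
  then show "section_class p U i V f \<in> carrier (Sec (A p) V)" "\<chi> p U i V (section_class p U i V f) = proj p U i V f"
    unfolding section_class_def by (rule inv_into_into, rule f_inv_into_f)
qed

lemma section_class_eqI:
  assumes "openin X U" "openin X V" "V \<subseteq> U" "i \<in> Obj G U" "f \<in> N p V (RObj G U V i)"
    and "e \<in> carrier (Sec (A p) V)" "\<chi> p U i V e = proj p U i V f"
  shows "section_class p U i V f = e"
  using \<chi>_inj[OF assms(1-4) section_class_closed[OF assms(1-5)] assms(6)] \<chi>_section_class[OF assms(1-5)] assms(7) by simp

lemma Ad_coset:
  assumes o: "openin X U1" "openin X U2" "openin X V" "V \<subseteq> U1" "V \<subseteq> U2" and i: "i \<in> Obj G U1" and j: "j \<in> Obj G U2"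
    and g: "g \<in> hom_sec G U1 i U2 j V" and t: "t \<in> Hom G V (RObj G U1 V i) (RObj G U1 V i)"
  shows "Ad G V (RObj G U1 V i) (RObj G U2 V j) g ` (N p V (RObj G U1 V i) #>\<^bsub>Sec (aut_sheaf G U1 i) V\<^esub> t) =
    N p V (RObj G U2 V j) #>\<^bsub>Sec (aut_sheaf G U2 j) V\<^esub> Ad G V (RObj G U1 V i) (RObj G U2 V j) g t"
proof -
  let ?A = "Ad G V (RObj G U1 V i) (RObj G U2 V j) g"
  have ob: "RObj G U1 V i \<in> Obj G V" "RObj G U2 V j \<in> Obj G V" using robj o i j by auto
  have g': "g \<in> Hom G V (RObj G U1 V i) (RObj G U2 V j)" using g by (simp add: hom_sec_def)
  have mult: "?A (Cmp G V n t) = Cmp G V (?A n) (?A t)" if n: "n \<in> N p V (RObj G U1 V i)" for n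
  proof -
    have nh: "n \<in> Hom G V (RObj G U1 V i) (RObj G U1 V i)" using N_closed[OF o(3) ob(1) n] .
    \<comment> \<open>The identity is verified among strict arrows, where the simplifier normalizes
      composites, and then read off for the morphisms.\<close>
    let ?n = "(V, (U1, i), n, (U1, i))" and ?t = "(V, (U1, i), t, (U1, i))" and ?g = "(V, (U1, i), g, (U2, j))"
    have arr: "?n \<in> local_arrows X G" "?t \<in> local_arrows X G" "?g \<in> local_arrows X G"
      using o i j nh t g' by (simp_all add: local_arrows_iff)
    have "arrow_cmp G ?g (arrow_cmp G (arrow_cmp G ?n ?t) (arrow_inv G ?g)) =
      arrow_cmp G (arrow_cmp G ?g (arrow_cmp G ?n (arrow_inv G ?g))) (arrow_cmp G ?g (arrow_cmp G ?t (arrow_inv G ?g)))"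
      using arr by (simp add: strict.arrow_simps del: arrow_cmp.simps arrow_inv.simps)
    then show ?thesis by (simp add: Ad_def)
  qed
  have "?A ` (N p V (RObj G U1 V i) #>\<^bsub>Sec (aut_sheaf G U1 i) V\<^esub> t) = (\<lambda>n. Cmp G V (?A n) (?A t)) ` N p V (RObj G U1 V i)"
    using mult by (auto simp: r_coset_def image_iff)
  also have "\<dots> = (\<lambda>m. Cmp G V m (?A t)) ` (?A ` N p V (RObj G U1 V i))" by (simp add: image_image)
  also have "\<dots> = (\<lambda>m. Cmp G V m (?A t)) ` N p V (RObj G U2 V j)" using N_Ad[OF o(3) ob g'] by simp
  also have "\<dots> = N p V (RObj G U2 V j) #>\<^bsub>Sec (aut_sheaf G U2 j) V\<^esub> ?A t" by (auto simp: r_coset_def)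
  finally show ?thesis .
qed

text \<open>\<open>quot_Ad\<close> is a union over all representatives of a germ. Two
  representatives differ near \<open>x\<close> by a loop of \<open>N (Suc p)\<close>, and
  conjugation carries this loop into \<open>N (Suc p)\<close> at the other object; so every
  representative contributes the germ of the conjugate of \<open>f\<close>.\<close>

lemma quot_Ad_proj:
  assumes o: "openin X U1" "openin X U2" "openin X V" "V \<subseteq> U1" "V \<subseteq> U2" and i: "i \<in> Obj G U1" and j: "j \<in> Obj G U2"
    and g: "g \<in> hom_sec G U1 i U2 j V" and f: "f \<in> N p V (RObj G U1 V i)"
  shows "quot_Ad X G (N p) (N (Suc p)) U1 i U2 j V g V (proj p U1 i V f) =
    proj p U2 j V (Ad G V (RObj G U1 V i) (RObj G U2 V j) g f)"
proof
  fix x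
  interpret S1: subquotient_sheaf "subtopology X U1" "aut_sheaf G U1 i" "sub_sec G (N p) U1 i" "sub_sec G (N (Suc p)) U1 i"
    using subquotient[OF o(1) i] by simp
  interpret S2: subquotient_sheaf "subtopology X U2" "aut_sheaf G U2 j" "sub_sec G (N p) U2 j" "sub_sec G (N (Suc p)) U2 j"
    using subquotient[OF o(2) j] by simp
  have g': "g \<in> Hom G V (RObj G U1 V i) (RObj G U2 V j)" using g by (simp add: hom_sec_def)
  have ob: "RObj G U1 V i \<in> Obj G V" "RObj G U2 V j \<in> Obj G V" using robj o i j by auto
  have oV: "openin (subtopology X U1) V" "openin (subtopology X U2) V" using o openin_sub by auto
  have fN: "f \<in> sub_sec G (N p) U1 i V" using f by (simp add: sub_sec_def)
  have AN: "Ad G V (RObj G U1 V i) (RObj G U2 V j) g f \<in> sub_sec G (N p) U2 j V"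
    using N_Ad[OF o(3) ob g', of p] f by (auto simp: sub_sec_def)
  let ?g = "\<lambda>V'. hom_res G U1 i U2 j V V' g"
  let ?\<Phi> = "\<lambda>(V', c). germ (subtopology X U2) S2.Q V' (Ad G V' (RObj G U1 V' i) (RObj G U2 V' j) (?g V') ` c) x"
  let ?b = "germ (subtopology X U2) S2.Q V (S2.coset V (Ad G V (RObj G U1 V i) (RObj G U2 V j) g f)) x"
  show "quot_Ad X G (N p) (N (Suc p)) U1 i U2 j V g V (proj p U1 i V f) x =
    proj p U2 j V (Ad G V (RObj G U1 V i) (RObj G U2 V j) g f) x"
  proof (cases "x \<in> V")
    case x: True
    have each: "?\<Phi> (V', c) = ?b"
      if m: "(V', c) \<in> germ (subtopology X U1) S1.Q V (S1.coset V f) x" and V'V: "V' \<subseteq> V" for V' c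
    proof (rule S1.germ_cosetE[OF m oV(1) fN])
      fix t W
      assume V': "openin (subtopology X U1) V'" "x \<in> V'" and t: "t \<in> sub_sec G (N p) U1 i V'" "c = S1.coset V' t"
        and W: "openin (subtopology X U1) W" "x \<in> W" "W \<subseteq> V" "W \<subseteq> V'"
        and n: "Res (aut_sheaf G U1 i) V W f \<otimes>\<^bsub>Sec (aut_sheaf G U1 i) W\<^esub>
          inv\<^bsub>Sec (aut_sheaf G U1 i) W\<^esub> Res (aut_sheaf G U1 i) V' W t \<in> sub_sec G (N (Suc p)) U1 i W"
      have o': "openin X V'" "V' \<subseteq> U1" "V' \<subseteq> U2" "openin X W" "W \<subseteq> U1" "W \<subseteq> U2"
        using V' W V'V o openin_sub[OF o(1)] by auto
      have ob': "RObj G U1 V' i \<in> Obj G V'" "RObj G U2 V' j \<in> Obj G V'" "RObj G U1 W i \<in> Obj G W" "RObj G U2 W j \<in> Obj G W"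
        using robj o o' i j by auto
      have th: "t \<in> Hom G V' (RObj G U1 V' i) (RObj G U1 V' i)" and fh: "f \<in> Hom G V (RObj G U1 V i) (RObj G U1 V i)"
        using N_closed[OF o'(1) ob'(1)] t(1) N_closed[OF o(3) ob(1) f] by (auto simp: sub_sec_def)
      have gV': "?g V' \<in> hom_sec G U1 i U2 j V'" and gW: "?g W \<in> hom_sec G U1 i U2 j W"
        using hom_res_closed[OF o(1-3) o'(1) o(4,5) V'V i j g] hom_res_closed[OF o(1-3) o'(4) o(4,5) W(3) i j g] by auto
      let ?A = "\<lambda>V. Ad G V (RObj G U1 V i) (RObj G U2 V j) (?g V)"
      have AV: "?A V = Ad G V (RObj G U1 V i) (RObj G U2 V j) g" using hom_res_self[OF o(1-5) i j g] by simp
      have c: "?A V' ` c = S2.coset V' (?A V' t)"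
        using Ad_coset[OF o(1,2) o'(1-3) i j gV' th] t(2) by (simp add: sub_sec_def)
      have At: "?A V' t \<in> sub_sec G (N p) U2 j V'"
        using N_Ad[OF o'(1) ob'(1,2), of "?g V'" p] gV' t(1) by (auto simp: sub_sec_def hom_sec_def)
      let ?F = "(V, (U1, i), f, (U1, i))" and ?T = "(V', (U1, i), t, (U1, i))" and ?G = "(V, (U1, i), g, (U2, j))"
      have arr: "?F \<in> local_arrows X G" "?T \<in> local_arrows X G" "?G \<in> local_arrows X G"
        using o o' i j fh th g' by (simp_all add: local_arrows_iff)
      have st: "openin X V'" "openin X W" "V' \<subseteq> V" "W \<subseteq> V" "W \<subseteq> V'" using o' V'V W by auto
      let ?GF = "arrow_cmp G ?G (arrow_cmp G ?F (arrow_inv G ?G))"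
        and ?GT = "arrow_cmp G (arrow_res G V' ?G) (arrow_cmp G ?T (arrow_inv G (arrow_res G V' ?G)))"
      \<comment> \<open>The quotient of the two conjugates over \<open>W\<close> is the conjugate of
        the quotient.\<close>
      have "arrow_cmp G (arrow_res G W ?GF) (arrow_inv G (arrow_res G W ?GT)) =
          arrow_cmp G (arrow_res G W ?G) (arrow_cmp G (arrow_cmp G (arrow_res G W ?F) (arrow_inv G (arrow_res G W ?T)))
            (arrow_inv G (arrow_res G W ?G)))"
        using arr st by (simp add: strict.arrow_simps del: arrow_cmp.simps arrow_inv.simps arrow_res.simps)
      then have eq: "Cmp G W (hom_res G U2 j U2 j V W (Ad G V (RObj G U1 V i) (RObj G U2 V j) g f))
          (Inv G W (RObj G U2 W j) (RObj G U2 W j) (hom_res G U2 j U2 j V' W (?A V' t))) =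
        ?A W (Cmp G W (hom_res G U1 i U1 i V W f) (Inv G W (RObj G U1 W i) (RObj G U1 W i) (hom_res G U1 i U1 i V' W t)))"
        by (simp add: Ad_def)
      have Rt: "hom_res G U1 i U1 i V' W t \<in> Hom G W (RObj G U1 W i) (RObj G U1 W i)"
        using hom_res_closed[OF o(1,1) o'(1,4,2,2) W(4) i i, of t] th by (simp add: hom_sec_def)
      have RAt: "hom_res G U2 j U2 j V' W (?A V' t) \<in> Hom G W (RObj G U2 W j) (RObj G U2 W j)"
        using hom_res_closed[OF o(2,2) o'(1,4,3,3) W(4) j j, of "?A V' t"] N_closed[OF o'(1) ob'(2)] At
        by (simp add: hom_sec_def sub_sec_def)
      have "Cmp G W (hom_res G U1 i U1 i V W f) (Inv G W (RObj G U1 W i) (RObj G U1 W i) (hom_res G U1 i U1 i V' W t))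
          \<in> N (Suc p) W (RObj G U1 W i)"
        using n inv_aut_sheaf[OF o(1) o'(4,5) i Rt] by (simp add: sub_sec_def)
      then have "Cmp G W (hom_res G U2 j U2 j V W (Ad G V (RObj G U1 V i) (RObj G U2 V j) g f))
          (Inv G W (RObj G U2 W j) (RObj G U2 W j) (hom_res G U2 j U2 j V' W (?A V' t))) \<in> N (Suc p) W (RObj G U2 W j)"
        unfolding eq using N_Ad[OF o'(4) ob'(3,4), of "?g W" "Suc p"] gW by (auto simp: hom_sec_def)
      then have n2: "Res (aut_sheaf G U2 j) V W (Ad G V (RObj G U1 V i) (RObj G U2 V j) g f) \<otimes>\<^bsub>Sec (aut_sheaf G U2 j) W\<^esub>
          inv\<^bsub>Sec (aut_sheaf G U2 j) W\<^esub> Res (aut_sheaf G U2 j) V' W (?A V' t) \<in> sub_sec G (N (Suc p)) U2 j W"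
        using inv_aut_sheaf[OF o(2) o'(4,6) j RAt] by (simp add: sub_sec_def)
      have oo: "openin (subtopology X U2) V'" "openin (subtopology X U2) W" using o' openin_sub[OF o(2)] by auto
      show "?\<Phi> (V', c) = ?b"
        using S2.germ_coset_eqI[OF oV(2) oo W(2,3,4) AN At n2] c by simp
    qed
    have self: "(V, S1.coset V f) \<in> germ (subtopology X U1) S1.Q V (S1.coset V f) x"
      using S1.Q.germ_self_mem[OF oV(1) x, of "S1.coset V f"] fN by (auto simp: S1.carrier_Q)
    have "(\<Union>(V', c)\<in>{(V', c) \<in> germ (subtopology X U1) S1.Q V (S1.coset V f) x. V' \<subseteq> V}. ?\<Phi> (V', c)) = ?b"
    proof (intro equalityI subsetI)
      fix z assume "z \<in> ?b"
      then have "z \<in> ?\<Phi> (V, S1.coset V f)" using each[OF self subset_refl] by simp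
      with self show "z \<in> (\<Union>(V', c)\<in>{(V', c) \<in> germ (subtopology X U1) S1.Q V (S1.coset V f) x. V' \<subseteq> V}. ?\<Phi> (V', c))"
        by blast
    qed (use each in blast)
    then show ?thesis
      using x by (simp add: quot_Ad_def induced_map_def quot_proj_def)
  qed (simp add: quot_Ad_def induced_map_def quot_proj_def)
qed

text \<open>Conjugation takes the image of the class under \<open>\<chi>\<close> at \<open>i\<close>
  to its image under \<open>\<chi>\<close> at \<open>j\<close>, and it takes the projection of
  \<open>f\<close> to the projection of the conjugate; comparison at \<open>j\<close> shows that the
  class is the same.\<close>

lemma section_class_Ad:
  assumes o: "openin X U1" "openin X U2" "openin X V" "V \<subseteq> U1" "V \<subseteq> U2" and i: "i \<in> Obj G U1" and j: "j \<in> Obj G U2"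
    and g: "g \<in> hom_sec G U1 i U2 j V" and f: "f \<in> N p V (RObj G U1 V i)"
  shows "section_class p U2 j V (Ad G V (RObj G U1 V i) (RObj G U2 V j) g f) = section_class p U1 i V f"
proof (rule section_class_eqI[OF o(2,3,5) j])
  have ob: "RObj G U1 V i \<in> Obj G V" "RObj G U2 V j \<in> Obj G V" using robj o i j by auto
  show "Ad G V (RObj G U1 V i) (RObj G U2 V j) g f \<in> N p V (RObj G U2 V j)"
    using N_Ad[OF o(3) ob, of g p] g f by (auto simp: hom_sec_def)
  show cl: "section_class p U1 i V f \<in> carrier (Sec (A p) V)" using section_class_closed[OF o(1,3,4) i f] .
  have q: "\<forall>U1 U2 W V. openin X U1 \<and> openin X U2 \<and> openin X W \<and> openin X V \<and> W \<subseteq> U1 \<inter> U2 \<and> V \<subseteq> W \<longrightarrow>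
        (\<forall>i\<in>Obj G U1. \<forall>j\<in>Obj G U2. \<forall>g\<in>hom_sec G U1 i U2 j W. \<forall>a\<in>carrier (Sec (A p) V).
           quot_Ad X G (N p) (N (Suc p)) U1 i U2 j W g V (\<chi> p U1 i V a) = \<chi> p U2 j V a)"
    using quotient[of p] unfolding is_gerbe_quotient_def by (elim conjE)
  have "quot_Ad X G (N p) (N (Suc p)) U1 i U2 j V g V (\<chi> p U1 i V (section_class p U1 i V f)) =
      \<chi> p U2 j V (section_class p U1 i V f)"
    by (rule q[rule_format]) (use o i j g cl in auto)
  then show "\<chi> p U2 j V (section_class p U1 i V f) = proj p U2 j V (Ad G V (RObj G U1 V i) (RObj G U2 V j) g f)"
    using \<chi>_section_class[OF o(1,3,4) i f] quot_Ad_proj[OF o i j g f] by simp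
qed

end

section \<open>Completeness and the remaining axioms of the strict form\<close>

context filtered_gerbe_data
begin

text \<open>For fixed \<open>p\<close> the cosets of the \<open>f p x\<close> agree as germs and
  form one section of the quotient by \<open>N p\<close> over all of \<open>V\<close>. These
  sections are compatible in \<open>p\<close>, hence form a section of the limit sheaf, which
  completeness lifts to \<open>h\<close>.\<close>

lemma complete_raw:
  assumes U: "openin X U" and i: "i \<in> Obj G U" and V: "openin X V" "V \<subseteq> U"
    and W: "\<And>p x. x \<in> V \<Longrightarrow> openin X (W p x) \<and> x \<in> W p x \<and> W p x \<subseteq> V"
    and f: "\<And>p x. x \<in> V \<Longrightarrow> f p x \<in> Hom G (W p x) (RObj G U (W p x) i) (RObj G U (W p x) i)"
    and agree: "\<And>p q x y. \<lbrakk>p \<le> q; x \<in> V; y \<in> V\<rbrakk> \<Longrightarrow>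
      hom_res G U i U i (W q y) (W p x \<inter> W q y) (f q y) \<otimes>\<^bsub>Sec (aut_sheaf G U i) (W p x \<inter> W q y)\<^esub>
        inv\<^bsub>Sec (aut_sheaf G U i) (W p x \<inter> W q y)\<^esub> hom_res G U i U i (W p x) (W p x \<inter> W q y) (f p x)
      \<in> N p (W p x \<inter> W q y) (RObj G U (W p x \<inter> W q y) i)"
  shows "\<exists>h\<in>Hom G V (RObj G U V i) (RObj G U V i). \<forall>p. \<forall>x\<in>V. f p x \<otimes>\<^bsub>Sec (aut_sheaf G U i) (W p x)\<^esub>
      inv\<^bsub>Sec (aut_sheaf G U i) (W p x)\<^esub> hom_res G U i U i V (W p x) h \<in> N p (W p x) (RObj G U (W p x) i)"
proof -
  let ?T = "subtopology X U" and ?F = "aut_sheaf G U i"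
  let ?M = "total_sections ?F" and ?N = "\<lambda>p. sub_sec G (N p) U i"
  interpret S: subquotient_sheaf ?T ?F ?M "?N p" for p using subquotient_total[OF U i] .
  have oV: "openin ?T V" using V openin_sub[OF U] by simp
  have oW: "openin ?T (W p x)" "x \<in> W p x" "W p x \<subseteq> V" if "x \<in> V" for p x
    using W[OF that, of p] V openin_sub[OF U] by auto
  have oWW: "openin ?T (W p x \<inter> W q y)" if "x \<in> V" "y \<in> V" for p q x y
    using openin_Int[OF oW(1)[OF that(1)] oW(1)[OF that(2)]] .
  have fM: "f p x \<in> ?M (W p x)" if "x \<in> V" for p x
    using f[OF that] by (simp add: total_sections_def)
  define g where "g p x = germ ?T (S.Q p) (W p x) (S.coset p (W p x) (f p x))" for p x
  \<comment> \<open>The case \<open>p = q\<close> makes the local cosets agree on overlaps; the case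
    \<open>p < q\<close> makes the resulting sections compatible with the transition maps.\<close>
  have agree_germ: "germ ?T (S.Q p) (W q y) (S.coset p (W q y) (f q y)) z = g p x z"
    if "p \<le> q" and x: "x \<in> V" and y: "y \<in> V" and z: "z \<in> W p x" "z \<in> W q y" for p q x y z
    unfolding g_def
    by (rule S.germ_coset_eqI[OF oW(1)[OF y] oW(1)[OF x] oWW[OF x y]])
      (use z fM[OF x] fM[OF y] agree[OF that(1) x y] in \<open>auto simp: sub_sec_def\<close>)
  define \<sigma> where "\<sigma> p = (\<lambda>x\<in>V. g p x x)" for p
  have \<sigma>_eq: "\<sigma> p z = g p x z" if x: "x \<in> V" and z: "z \<in> W p x" for p x z
  proof -
    have zV: "z \<in> V" using oW(3)[OF x] z by auto
    show ?thesis
      using agree_germ[OF order_refl x zV z oW(2)[OF zV]] zV by (simp add: \<sigma>_def g_def)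
  qed
  have coset_Q: "S.coset p (W p x) (f p x) \<in> carrier (Sec (S.Q p) (W p x))" if "x \<in> V" for p x
    using fM[OF that] by (auto simp: S.carrier_Q)
  have \<sigma>_cl: "\<sigma> p \<in> carrier (Sec (quot_sheaf ?T ?F ?M (?N p)) V)" for p
  proof -
    have "\<exists>Z t. openin ?T Z \<and> x \<in> Z \<and> Z \<subseteq> V \<and> t \<in> carrier (Sec (S.Q p) Z) \<and> (\<forall>y\<in>Z. \<sigma> p y = germ ?T (S.Q p) Z t y)"
      if x: "x \<in> V" for x
      using oW[OF x, of p] coset_Q[OF x, of p] \<sigma>_eq[OF x, of _ p]
      by (intro exI[of _ "W p x"] exI[of _ "S.coset p (W p x) (f p x)"]) (simp add: g_def)
    then show ?thesis by (simp add: quot_sheaf_def sheafify_def \<sigma>_def)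
  qed
  have map: "quot_map ?T ?F ?M (?N p) V (\<sigma> q) = \<sigma> p" if pq: "p \<le> q" for p q
  proof
    fix x
    let ?\<Phi> = "\<lambda>(V', c). germ ?T (S.Q p) V' (?N p V' <#>\<^bsub>Sec ?F V'\<^esub> c) x"
    show "quot_map ?T ?F ?M (?N p) V (\<sigma> q) x = \<sigma> p x"
    proof (cases "x \<in> V")
      case x: True
      have xW: "x \<in> W p x" "x \<in> W q x" using oW(2)[OF x] by auto
      \<comment> \<open>\<open>quot_map\<close> is a union over the representatives of a germ modulo
        \<open>N q\<close>; all of them give the same germ modulo \<open>N p\<close>.\<close>
      have each: "?\<Phi> (V', c) = \<sigma> p x" if m: "(V', c) \<in> \<sigma> q x" for V' c
      proof -
        have "(V', c) \<in> germ ?T (S.Q q) (W q x) (S.coset q (W q x) (f q x)) x"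
          using m x by (simp add: \<sigma>_def g_def)
        then show ?thesis
        proof (rule S.germ_cosetE[OF _ oW(1)[OF x] fM[OF x]])
          fix t Z
          assume V': "openin ?T V'" "x \<in> V'" and t: "t \<in> ?M V'" "c = S.coset q V' t"
            and Z: "openin ?T Z" "x \<in> Z" "Z \<subseteq> W q x" "Z \<subseteq> V'"
            and n: "Res ?F (W q x) Z (f q x) \<otimes>\<^bsub>Sec ?F Z\<^esub> inv\<^bsub>Sec ?F Z\<^esub> Res ?F V' Z t \<in> ?N q Z"
          have sub: "?N q Y \<subseteq> ?N p Y" if "openin ?T Y" for Y
            using N_antimono[OF pq _ robj[OF U _ _ i]] that openin_sub[OF U] by (simp add: sub_sec_def)
          interpret H: normal "?N p V'" "Sec ?F V'" using S.normal_N[OF V'(1)] .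
          interpret H': normal "?N q V'" "Sec ?F V'" using S.normal_N[OF V'(1)] .
          have tF: "t \<in> carrier (Sec ?F V')" using S.M_sub[OF V'(1) t(1)] .
          have "?N p V' <#>\<^bsub>Sec ?F V'\<^esub> c = (?N p V' <#>\<^bsub>Sec ?F V'\<^esub> ?N q V') #>\<^bsub>Sec ?F V'\<^esub> t"
            unfolding t(2) using H.setmult_rcos_assoc[OF H.subset H'.subset tF] .
          \<comment> \<open>The smaller group \<open>N q\<close> is absorbed by
            \<open>N p\<close>.\<close>
          also have "?N p V' <#>\<^bsub>Sec ?F V'\<^esub> ?N q V' = ?N p V'"
          proof (intro equalityI subsetI)
            fix z assume "z \<in> ?N p V' <#>\<^bsub>Sec ?F V'\<^esub> ?N q V'"
            then show "z \<in> ?N p V'" using sub[OF V'(1)] H.m_closed unfolding set_mult_def by blast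
          next
            fix z assume z: "z \<in> ?N p V'"
            then have "z = z \<otimes>\<^bsub>Sec ?F V'\<^esub> \<one>\<^bsub>Sec ?F V'\<^esub>" using H.mem_carrier by (simp only: H.r_one)
            with z H'.one_closed show "z \<in> ?N p V' <#>\<^bsub>Sec ?F V'\<^esub> ?N q V'" unfolding set_mult_def by blast
          qed
          finally have c: "?N p V' <#>\<^bsub>Sec ?F V'\<^esub> c = S.coset p V' t" .
          have "germ ?T (S.Q p) (W q x) (S.coset p (W q x) (f q x)) x = germ ?T (S.Q p) V' (S.coset p V' t) x"
            by (rule S.germ_coset_eqI[OF oW(1)[OF x] V'(1) Z fM[OF x] t(1)]) (use n sub[OF Z(1)] in blast)
          with agree_germ[OF pq x x xW] show "?\<Phi> (V', c) = \<sigma> p x"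
            using c x by (simp add: \<sigma>_def)
        qed
      qed
      have self: "(W q x, S.coset q (W q x) (f q x)) \<in> \<sigma> q x"
        using S.Q.germ_self_mem[OF oW(1,2)[OF x] coset_Q[OF x]] x by (simp add: \<sigma>_def g_def)
      have top: "W q x \<subseteq> topspace ?T" using openin_subset[OF oW(1)[OF x]] .
      have "(\<Union>(V', c)\<in>{(V', c) \<in> \<sigma> q x. V' \<subseteq> topspace ?T}. ?\<Phi> (V', c)) = \<sigma> p x"
      proof (intro equalityI subsetI)
        fix z assume "z \<in> \<sigma> p x"
        then have "z \<in> ?\<Phi> (W q x, S.coset q (W q x) (f q x))" using each[OF self] by simp
        with self top show "z \<in> (\<Union>(V', c)\<in>{(V', c) \<in> \<sigma> q x. V' \<subseteq> topspace ?T}. ?\<Phi> (V', c))" by blast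
      qed (use each in blast)
      then show ?thesis using x by (simp add: quot_map_def induced_map_def)
    qed (simp add: quot_map_def induced_map_def \<sigma>_def)
  qed
  have "\<sigma> \<in> carrier (Sec (limit_sheaf ?T ?F ?N) V)"
    using \<sigma>_cl map by (simp add: limit_sheaf_def Let_def)
  moreover have "(\<lambda>s p. quot_proj ?T ?F ?M (?N p) V s) ` carrier (Sec ?F V) = carrier (Sec (limit_sheaf ?T ?F ?N) V)"
  proof -
    have "complete_filtration ?T ?F ?N"
      using complete_data U i unfolding gerbe_complete_def by simp
    then show ?thesis
      using oV unfolding complete_filtration_def sheaf_iso_def iso_def bij_betw_def by simp
  qed
  ultimately obtain h where h: "h \<in> carrier (Sec ?F V)" "\<sigma> = (\<lambda>p. quot_proj ?T ?F ?M (?N p) V h)"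
    by (metis (no_types, lifting) imageE)
  have "f p x \<otimes>\<^bsub>Sec ?F (W p x)\<^esub> inv\<^bsub>Sec ?F (W p x)\<^esub> Res ?F V (W p x) h \<in> ?N p (W p x)" if x: "x \<in> V" for p x
  proof -
    have hM: "h \<in> ?M V" using h(1) by (simp add: total_sections_def)
    have "quot_proj ?T ?F ?M (?N p) (W p x) (f p x) = restrict (\<sigma> p) (W p x)"
      using \<sigma>_eq[OF x, of _ p] by (auto simp: quot_proj_def g_def fun_eq_iff)
    also have "\<dots> = quot_proj ?T ?F ?M (?N p) (W p x) (Res ?F V (W p x) h)"
      using S.quot_proj_Res[OF oV oW(1)[OF x] oW(3)[OF x] hM] h(2) by simp
    finally show ?thesis
      using S.quot_proj_eq_iff[OF oW(1)[OF x] fM[OF x] S.M_Res[OF oV oW(1)[OF x] oW(3)[OF x] hM]] by simp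
  qed
  then show ?thesis
    using h(1) by (intro bexI[of _ h]) (simp_all add: sub_sec_def)
qed

definition loops :: "nat \<Rightarrow> ('x, 'o, 'm) local_arrow set" where
  "loops p = {(V, (U, i), f, b). (V, (U, i), f, b) \<in> local_arrows X G \<and> b = (U, i) \<and> f \<in> N p V (RObj G U V i)}"

lemma loops_iff: "(V, (U, i), f, b) \<in> loops p \<longleftrightarrow> openin X V \<and> openin X U \<and> V \<subseteq> U \<and> i \<in> Obj G U \<and>
    b = (U, i) \<and> f \<in> N p V (RObj G U V i)"
  unfolding loops_def using N_closed[OF _ robj] by (auto simp: local_arrows_iff)

lemma loopsE:
  assumes "F \<in> loops p"
  obtains V U i f where "F = (V, (U, i), f, (U, i))" "openin X V" "openin X U" "V \<subseteq> U" "i \<in> Obj G U"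
    "f \<in> N p V (RObj G U V i)" "f \<in> Hom G V (RObj G U V i) (RObj G U V i)"
  using assms N_closed[OF _ robj] by (cases F rule: local_arrow_cases) (auto simp: loops_iff)

fun loop_class :: "nat \<Rightarrow> ('x, 'o, 'm) local_arrow \<Rightarrow> 'b" where
  "loop_class p (V, (U, i), f, b) = section_class p U i V f"

lemma subgroup_raw:
  assumes "openin X V" "openin X U" "V \<subseteq> U" "i \<in> Obj G U"
  shows "Idn G V (RObj G U V i) \<in> N p V (RObj G U V i)"
    and "\<lbrakk>f \<in> N p V (RObj G U V i); g \<in> N p V (RObj G U V i)\<rbrakk> \<Longrightarrow> Cmp G V g f \<in> N p V (RObj G U V i)"
    and "f \<in> N p V (RObj G U V i) \<Longrightarrow> Inv G V (RObj G U V i) (RObj G U V i) f \<in> N p V (RObj G U V i)"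
proof -
  have s: "subgroup (N p V (RObj G U V i)) (Sec (aut_sheaf G U i) V)"
    using normal_imp_subgroup[OF normal_sub_sec[OF assms(2,4,1,3)]] .
  show "Idn G V (RObj G U V i) \<in> N p V (RObj G U V i)"
    using subgroup.one_closed[OF s] by simp
  show "Cmp G V g f \<in> N p V (RObj G U V i)" if "f \<in> N p V (RObj G U V i)" "g \<in> N p V (RObj G U V i)"
    using subgroup.m_closed[OF s that(2,1)] by simp
  show "Inv G V (RObj G U V i) (RObj G U V i) f \<in> N p V (RObj G U V i)" if "f \<in> N p V (RObj G U V i)"
    using subgroup.m_inv_closed[OF s that] subgroup.mem_carrier[OF s that] inv_aut_sheaf[OF assms(2,1,3,4)] by simp
qed

lemma section_class_cmp:
  assumes "openin X U" "openin X V" "V \<subseteq> U" "i \<in> Obj G U" "f \<in> N p V (RObj G U V i)" "g \<in> N p V (RObj G U V i)"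
  shows "section_class p U i V (Cmp G V g f) = section_class p U i V g \<otimes>\<^bsub>Sec (A p) V\<^esub> section_class p U i V f"
proof (rule section_class_eqI[OF assms(1-4)])
  interpret S: subquotient_sheaf "subtopology X U" "aut_sheaf G U i" "sub_sec G (N p) U i" "sub_sec G (N (Suc p)) U i"
    using subquotient[OF assms(1,4)] by simp
  interpret comm_group "Sec (A p) V" using abelian_sheafD(4)[OF abelian_A assms(2)] .
  note c = section_class_closed[OF assms(1-5)] section_class_closed[OF assms(1-4,6)]
  show "Cmp G V g f \<in> N p V (RObj G U V i)" using subgroup_raw(2)[OF assms(2,1,3-)] .
  show "section_class p U i V g \<otimes>\<^bsub>Sec (A p) V\<^esub> section_class p U i V f \<in> carrier (Sec (A p) V)" using c by simp
  show "\<chi> p U i V (section_class p U i V g \<otimes>\<^bsub>Sec (A p) V\<^esub> section_class p U i V f) = proj p U i V (Cmp G V g f)"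
    using \<chi>_mult[OF assms(1-4) c(2,1)] \<chi>_section_class[OF assms(1-5)] \<chi>_section_class[OF assms(1-4,6)]
      S.quot_proj_mult[of V g f] assms openin_sub by (simp add: sub_sec_def)
qed

lemma N_res_raw:
  assumes "openin X U" "openin X V" "openin X W" "V \<subseteq> U" "W \<subseteq> V" "i \<in> Obj G U" "f \<in> N p V (RObj G U V i)"
  shows "hom_res G U i U i V W f \<in> N p W (RObj G U W i)"
proof -
  interpret S: subquotient_sheaf "subtopology X U" "aut_sheaf G U i" "sub_sec G (N p) U i" "sub_sec G (N (Suc p)) U i"
    using subquotient[OF assms(1,6)] by simp
  show ?thesis
    using S.M_Res[of V W f] assms openin_sub by (simp add: sub_sec_def)
qed

lemma section_class_res:
  assumes "openin X U" "openin X V" "openin X W" "V \<subseteq> U" "W \<subseteq> V" "i \<in> Obj G U" "f \<in> N p V (RObj G U V i)"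
  shows "section_class p U i W (hom_res G U i U i V W f) = Res (A p) V W (section_class p U i V f)"
proof (rule section_class_eqI[OF assms(1,3) _ assms(6) N_res_raw[OF assms]])
  interpret S: subquotient_sheaf "subtopology X U" "aut_sheaf G U i" "sub_sec G (N p) U i" "sub_sec G (N (Suc p)) U i"
    using subquotient[OF assms(1,6)] by simp
  interpret P: presheaf_of_groups X "A p" using abelian_sheafD(2)[OF abelian_A] .
  show WU: "W \<subseteq> U" using assms by auto
  note c = section_class_closed[OF assms(1,2,4,6,7)]
  show "Res (A p) V W (section_class p U i V f) \<in> carrier (Sec (A p) W)" using P.Res_closed[OF assms(2,3,5) c] .
  show "\<chi> p U i W (Res (A p) V W (section_class p U i V f)) = proj p U i W (hom_res G U i U i V W f)"
    using \<chi>_Res[OF assms(1,2,4,6,3,5) c] \<chi>_section_class[OF assms(1,2,4,6,7)] S.quot_proj_Res[of V W f] assms WU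
      openin_sub[OF assms(1)] by (simp add: sub_sec_def)
qed

text \<open>The class of the identity is idempotent, hence trivial. So \<open>f\<close> and the
  identity have the same class and the same projection, and their quotient lies in
  \<open>N (Suc p)\<close>.\<close>

lemma section_class_kernel:
  assumes "openin X U" "openin X V" "V \<subseteq> U" "i \<in> Obj G U" "f \<in> N p V (RObj G U V i)"
    and one: "section_class p U i V f = \<one>\<^bsub>Sec (A p) V\<^esub>"
  shows "f \<in> N (Suc p) V (RObj G U V i)"
proof -
  interpret S: subquotient_sheaf "subtopology X U" "aut_sheaf G U i" "sub_sec G (N p) U i" "sub_sec G (N (Suc p)) U i"
    using subquotient[OF assms(1,4)] by simp
  interpret comm_group "Sec (A p) V" using abelian_sheafD(4)[OF abelian_A assms(2)] .
  have V: "openin (subtopology X U) V" using assms openin_sub by auto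
  interpret B: group "Sec (aut_sheaf G U i) V" using S.F.group_Sec[OF V] .
  have ob: "RObj G U V i \<in> Obj G V" using robj assms by auto
  let ?e = "Idn G V (RObj G U V i)"
  have e: "?e \<in> N p V (RObj G U V i)" using subgroup_raw(1)[OF assms(2,1,3,4)] .
  have "section_class p U i V ?e = \<one>\<^bsub>Sec (A p) V\<^esub>"
    using section_class_cmp[OF assms(1-4) e e] section_class_closed[OF assms(1-4) e]
      cmp_idn[OF assms(2) ob ob idn_closed[OF assms(2) ob]] by simp
  then have "proj p U i V f = proj p U i V ?e"
    using one \<chi>_section_class[OF assms(1-4) e] \<chi>_section_class[OF assms(1-5)] by simp
  then have "f \<otimes>\<^bsub>Sec (aut_sheaf G U i) V\<^esub> inv\<^bsub>Sec (aut_sheaf G U i) V\<^esub> \<one>\<^bsub>Sec (aut_sheaf G U i) V\<^esub> \<in> sub_sec G (N (Suc p)) U i V"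
    using S.quot_proj_eq_iff[OF V, of f ?e] e assms(5) by (simp add: sub_sec_def)
  then show ?thesis
    using N_closed[OF assms(2) ob assms(5)] B.inv_one B.r_one[of f] by (simp add: sub_sec_def del: B.inv_one)
qed

lemma section_class_locally_surjective:
  assumes "openin X U" "openin X V" "V \<subseteq> U" "i \<in> Obj G U" "e \<in> carrier (Sec (A p) V)" "x \<in> V"
  shows "\<exists>W f. openin X W \<and> x \<in> W \<and> W \<subseteq> V \<and> f \<in> N p W (RObj G U W i) \<and>
    section_class p U i W f = Res (A p) V W e"
proof -
  interpret S: subquotient_sheaf "subtopology X U" "aut_sheaf G U i" "sub_sec G (N p) U i" "sub_sec G (N (Suc p)) U i"
    using subquotient[OF assms(1,4)] by simp
  interpret P: presheaf_of_groups X "A p" using abelian_sheafD(2)[OF abelian_A] .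
  have "\<chi> p U i V e \<in> carrier (Sec (quot_sheaf (subtopology X U) (aut_sheaf G U i) (sub_sec G (N p) U i) (sub_sec G (N (Suc p)) U i)) V)"
    using \<chi>_bij[OF assms(1-4), of p] assms(5) unfolding bij_betw_def by blast
  from S.quot_sheaf_locally_proj[OF this assms(6)] obtain W f where W: "openin (subtopology X U) W" "x \<in> W" "W \<subseteq> V"
    "f \<in> sub_sec G (N p) U i W" "restrict (\<chi> p U i V e) W = proj p U i W f"
    by (elim exE conjE)
  have W': "openin X W" "W \<subseteq> U" using W(1) openin_sub[OF assms(1)] by auto
  have "section_class p U i W f = Res (A p) V W e"
    by (rule section_class_eqI[OF assms(1) W' assms(4)])
      (use W \<chi>_Res[OF assms(1-4) W'(1) W(3) assms(5)] P.Res_closed[OF assms(2) W'(1) W(3) assms(5)] in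
        \<open>simp_all add: sub_sec_def\<close>)
  then show ?thesis using W W' by (auto simp: sub_sec_def)
qed

lemma N_local_raw:
  assumes "openin X U" "openin X V" "V \<subseteq> U" "i \<in> Obj G U" "f \<in> Hom G V (RObj G U V i) (RObj G U V i)"
    and loc: "\<And>x. x \<in> V \<Longrightarrow> \<exists>W. openin X W \<and> x \<in> W \<and> W \<subseteq> V \<and> hom_res G U i U i V W f \<in> N p W (RObj G U W i)"
  shows "f \<in> N p V (RObj G U V i)"
proof -
  interpret S: subquotient_sheaf "subtopology X U" "aut_sheaf G U i" "sub_sec G (N p) U i" "sub_sec G (N p) U i"
    using subquotient[OF assms(1,4)] by simp
  have "f \<in> sub_sec G (N p) U i V"
  proof (rule S.N_local)
    fix x assume "x \<in> V"
    from loc[OF this] obtain W where W: "openin X W" "x \<in> W" "W \<subseteq> V" "hom_res G U i U i V W f \<in> N p W (RObj G U W i)"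
      by (elim exE conjE)
    then show "\<exists>W. openin (subtopology X U) W \<and> x \<in> W \<and> W \<subseteq> V \<and> Res (aut_sheaf G U i) V W f \<in> sub_sec G (N p) U i W"
      using openin_sub[OF assms(1)] assms(3) by (intro exI[of _ W]) (auto simp: sub_sec_def)
  qed (use assms openin_sub in auto)
  then show ?thesis by (simp add: sub_sec_def)
qed

lemma glue_raw:
  assumes U: "openin X U" and i: "i \<in> Obj G U" and j: "j \<in> Obj G U"
    and W: "\<And>x. x \<in> U \<Longrightarrow> openin X (W x) \<and> x \<in> W x \<and> W x \<subseteq> U"
    and s: "\<And>x. x \<in> U \<Longrightarrow> s x \<in> hom_sec G U i U j (W x)"
    and agree: "\<And>x y. x \<in> U \<Longrightarrow> y \<in> U \<Longrightarrow>
      hom_res G U i U j (W x) (W x \<inter> W y) (s x) = hom_res G U i U j (W y) (W x \<inter> W y) (s y)"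
  shows "hom_sec G U i U j U \<noteq> {}"
proof -
  have "\<forall>U. openin X U \<longrightarrow> (\<forall>i\<in>Obj G U. \<forall>j\<in>Obj G U.
      sheaf_of_sets (subtopology X U) (hom_sec G U i U j) (hom_res G U i U j))"
    using gerbe unfolding gerbe_def stack_of_groupoids_def by (elim conjE)
  then have S: "sheaf_of_sets (subtopology X U) (hom_sec G U i U j) (hom_res G U i U j)"
    using U i j by blast
  have UW: "U = (\<Union>x\<in>U. W x)" using W by blast
  obtain t where "t \<in> hom_sec G U i U j U"
    by (rule sheaf_of_sets_glue[OF S _ UW s agree]) (use W openin_sub[OF U] in auto)
  then show ?thesis by blast
qed

end

text \<open>The interface calls on the glueing of morphisms in a stack; effectiveness of descent
  data enters at the very end, when an object over \<open>U\<close> is produced.\<close>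

sublocale filtered_gerbe_data \<subseteq> filtered: filtered_gerbe X "local_objects X G" fst
    "local_arrows X G" fst arrow_src arrow_tgt "arrow_idn G" "arrow_cmp G" "arrow_inv G" "arrow_res G"
    loops A loop_class
proof (unfold_locales, goal_cases)
  case (1 a b k)
  obtain U i j where a: "a = (U, i)" and b: "b = (U, j)" using 1(3) by (cases a; cases b) auto
  have ob: "openin X U" "i \<in> Obj G U" "j \<in> Obj G U" using 1(1,2) unfolding a b by (simp_all add: local_objects_iff)
  define W where "W x = fst (k x)" for x
  define s where "s x = fst (snd (snd (k x)))" for x
  have k: "k x = (W x, (U, i), s x, (U, j)) \<and> x \<in> W x \<and> k x \<in> local_arrows X G" if "x \<in> U" for x
    using 1(4)[of x] that unfolding a b W_def s_def by (cases "k x" rule: local_arrow_cases) simp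
  have "hom_sec G U i U j U \<noteq> {}"
  proof (rule glue_raw[OF ob])
    show "openin X (W x) \<and> x \<in> W x \<and> W x \<subseteq> U" "s x \<in> hom_sec G U i U j (W x)" if "x \<in> U" for x
      using k[OF that] by (auto simp: local_arrows_iff hom_sec_def)
    show "hom_res G U i U j (W x) (W x \<inter> W y) (s x) = hom_res G U i U j (W y) (W x \<inter> W y) (s y)"
      if xy: "x \<in> U" "y \<in> U" for x y
    proof -
      have "arrow_res G (W x \<inter> W y) (k x) = arrow_res G (W x \<inter> W y) (k y)"
        using 1(5)[of x y] xy unfolding a W_def by simp
      then show ?thesis using conjunct1[OF k[OF xy(1)]] conjunct1[OF k[OF xy(2)]] by simp
    qed
  qed
  then obtain t where "t \<in> hom_sec G U i U j U" by blast
  then show ?case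
    unfolding a b using ob by (intro bexI[of _ "(U, (U, i), t, (U, j))"]) (simp_all add: local_arrows_iff hom_sec_def)
next
  case (2 a b x)
  obtain U i j where a: "a = (U, i)" and b: "b = (U, j)" using 2(3) by (cases a; cases b) auto
  have ob: "openin X U" "i \<in> Obj G U" "j \<in> Obj G U" "x \<in> U" using 2 unfolding a b by (simp_all add: local_objects_iff)
  have "\<forall>U. openin X U \<longrightarrow> (\<forall>i\<in>Obj G U. \<forall>j\<in>Obj G U. \<forall>x\<in>U.
        \<exists>V. openin X V \<and> x \<in> V \<and> V \<subseteq> U \<and> Hom G V (RObj G U V i) (RObj G U V j) \<noteq> {})"
    using gerbe unfolding gerbe_def by (elim conjE)
  then have "\<exists>V. openin X V \<and> x \<in> V \<and> V \<subseteq> U \<and> Hom G V (RObj G U V i) (RObj G U V j) \<noteq> {}"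
    using ob by simp
  then obtain V f where "openin X V" "x \<in> V" "V \<subseteq> U" "f \<in> Hom G V (RObj G U V i) (RObj G U V j)"
    by (elim exE conjE) blast
  then show ?case
    unfolding a b using ob by (intro bexI[of _ "(V, (U, i), f, (U, j))"]) (simp_all add: local_arrows_iff)
next
  case (3 a V)
  obtain U i where a: "a = (U, i)" by (cases a)
  have ob: "openin X U" "i \<in> Obj G U" "V \<subseteq> U" using 3 unfolding a by (simp_all add: local_objects_iff)
  \<comment> \<open>An arrow over \<open>V\<close> from \<open>(V, RObj G U V i)\<close> to
    \<open>(U, i)\<close> is a morphism from the twofold to the single restriction of
    \<open>i\<close>, and coherence supplies one.\<close>
  show ?case
    unfolding a using 3(2) ob robj[OF ob(1) 3(2) ob(3,2)] coh[OF ob(1) 3(2,2) ob(3) subset_refl ob(2)]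
    by (intro bexI[of _ "(V, (V, RObj G U V i), Coh G U V V i, (U, i))"]) (simp_all add: local_arrows_iff)
next
  case (4 F p)
  then show ?case by (rule loopsE) (simp add: local_arrows_iff)
next
  case (5 F p)
  then show ?case by (rule loopsE) simp
next
  case (6 F)
  then show ?case
    by (cases F rule: local_arrow_cases) (auto simp: local_arrows_iff loops_iff N_0_raw)
next
  case (7 F p)
  then show ?case
  proof (rule loopsE)
    fix V U i f assume F: "F = (V, (U, i), f, (U, i))" "openin X V" "openin X U" "V \<subseteq> U" "i \<in> Obj G U"
      "f \<in> N (Suc p) V (RObj G U V i)"
    then have "f \<in> N p V (RObj G U V i)" using N_antimono[of p "Suc p" V "RObj G U V i"] robj by auto
    with F show "F \<in> loops p" by (simp add: loops_iff)
  qed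
next
  case (8 F)
  obtain V U i f where F: "F = (V, (U, i), f, (U, i))" "openin X V" "openin X U" "V \<subseteq> U" "i \<in> Obj G U"
    by (rule loopsE[OF 8(2)])
  have "f \<in> (\<Inter>p. N p V (RObj G U V i))" using 8(2) unfolding F(1) by (simp add: loops_iff)
  then show ?case using N_separated_raw[OF F(3,5,2,4)] unfolding F(1) by simp
next
  case (9 a V p)
  then show ?case by (cases a) (auto simp: local_objects_iff loops_iff intro: subgroup_raw(1))
next
  case (10 F p H)
  obtain V U i f where F: "F = (V, (U, i), f, (U, i))" "openin X V" "openin X U" "V \<subseteq> U" "i \<in> Obj G U"
    "f \<in> N p V (RObj G U V i)"
    by (rule loopsE[OF 10(1)])
  obtain V' U' i' h where H: "H = (V', (U', i'), h, (U', i'))" "h \<in> N p V' (RObj G U' V' i')"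
    by (rule loopsE[OF 10(2)])
  show ?case using 10(3,4) F H subgroup_raw(2)[OF F(2-6)] by (simp add: loops_iff)
next
  case (11 F p)
  then show ?case by (rule loopsE) (auto simp: loops_iff intro: subgroup_raw(3))
next
  case (12 F p H)
  obtain V U i f where F: "F = (V, (U, i), f, (U, i))" "openin X V" "openin X U" "V \<subseteq> U" "i \<in> Obj G U"
    "f \<in> N p V (RObj G U V i)"
    by (rule loopsE[OF 12(1)])
  obtain V' U1 i1 h U2 j where H: "H = (V', (U1, i1), h, (U2, j))" by (rule local_arrow_cases)
  have e: "V' = V" "U1 = U" "i1 = i" using 12(3,4) unfolding F(1) H by auto
  have h: "openin X U2" "V \<subseteq> U2" "j \<in> Obj G U2" "h \<in> Hom G V (RObj G U V i) (RObj G U2 V j)"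
    using 12(2) unfolding H e by (auto simp: local_arrows_iff)
  have "Ad G V (RObj G U V i) (RObj G U2 V j) h f \<in> N p V (RObj G U2 V j)"
    using N_Ad[OF F(2) robj[OF F(3,2,4,5)] robj[OF h(1) F(2) h(2,3)] h(4), of p] F(6) by blast
  then show ?case unfolding F(1) H e using F h by (simp add: loops_iff Ad_def)
next
  case (13 F p V)
  obtain V' U i f where F: "F = (V', (U, i), f, (U, i))" "openin X V'" "openin X U" "V' \<subseteq> U" "i \<in> Obj G U"
    "f \<in> N p V' (RObj G U V' i)"
    by (rule loopsE[OF 13(1)])
  show ?case using 13(2,3) F N_res_raw[OF F(3,2) 13(2) F(4) _ F(5,6)] by (auto simp: loops_iff)
next
  case (14 F p)
  obtain V U i f U2 j where F: "F = (V, (U, i), f, (U2, j))" by (rule local_arrow_cases)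
  have e: "U2 = U" "j = i" using 14(2) unfolding F by auto
  have ob: "openin X U" "openin X V" "V \<subseteq> U" "i \<in> Obj G U" "f \<in> Hom G V (RObj G U V i) (RObj G U V i)"
    using 14(1) unfolding F e by (auto simp: local_arrows_iff)
  have "f \<in> N p V (RObj G U V i)"
  proof (rule N_local_raw[OF ob])
    fix x assume "x \<in> V"
    then have "x \<in> fst F" unfolding F by simp
    from 14(3)[OF this] obtain W where "openin X W" "x \<in> W" "W \<subseteq> V" "arrow_res G W F \<in> loops p"
      unfolding F by (elim exE conjE) simp
    then show "\<exists>W. openin X W \<and> x \<in> W \<and> W \<subseteq> V \<and> hom_res G U i U i V W f \<in> N p W (RObj G U W i)"
      unfolding F e by (intro exI[of _ W]) (simp add: loops_iff)
  qed
  then show ?case unfolding F e using ob by (simp add: loops_iff)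
next
  case (15 p)
  show ?case using abelian_A .
next
  case (16 F p)
  then show ?case by (rule loopsE) (use section_class_closed in simp)
next
  case (17 F p H)
  obtain V U i f where F: "F = (V, (U, i), f, (U, i))" "openin X V" "openin X U" "V \<subseteq> U" "i \<in> Obj G U"
    "f \<in> N p V (RObj G U V i)"
    by (rule loopsE[OF 17(1)])
  obtain V' U' i' h where H: "H = (V', (U', i'), h, (U', i'))" "h \<in> N p V' (RObj G U' V' i')"
    by (rule loopsE[OF 17(2)])
  show ?case using 17(3,4) F H section_class_cmp[OF F(3,2,4-6)] by simp
next
  case (18 F p V)
  obtain V' U i f where F: "F = (V', (U, i), f, (U, i))" "openin X V'" "openin X U" "V' \<subseteq> U" "i \<in> Obj G U"
    "f \<in> N p V' (RObj G U V' i)"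
    by (rule loopsE[OF 18(1)])
  show ?case using 18(2,3) F section_class_res[OF F(3,2) 18(2) F(4) _ F(5,6)] by simp
next
  case (19 F p)
  obtain V U i f where F: "F = (V, (U, i), f, (U, i))" "openin X V" "openin X U" "V \<subseteq> U" "i \<in> Obj G U"
    "f \<in> N p V (RObj G U V i)"
    by (rule loopsE[OF 19(1)])
  show ?case using 19(2) F section_class_kernel[OF F(3,2,4-6)] by (simp add: loops_iff)
next
  case (20 F p H)
  obtain V U i f where F: "F = (V, (U, i), f, (U, i))" "openin X V" "openin X U" "V \<subseteq> U" "i \<in> Obj G U"
    "f \<in> N p V (RObj G U V i)"
    by (rule loopsE[OF 20(1)])
  obtain V' U1 i1 h U2 j where H: "H = (V', (U1, i1), h, (U2, j))" by (rule local_arrow_cases)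
  have e: "V' = V" "U1 = U" "i1 = i" using 20(3,4) unfolding F(1) H by auto
  have h: "openin X U2" "V \<subseteq> U2" "j \<in> Obj G U2" "h \<in> hom_sec G U i U2 j V"
    using 20(2) unfolding H e by (auto simp: local_arrows_iff hom_sec_def)
  show ?case
    using section_class_Ad[OF F(3) h(1) F(2,4) h(2) F(5) h(3,4) F(6)] unfolding F(1) H e by (simp add: Ad_def)
next
  case (21 a V e p x)
  obtain U i where a: "a = (U, i)" by (cases a)
  have ob: "openin X U" "i \<in> Obj G U" "V \<subseteq> U" using 21 unfolding a by (simp_all add: local_objects_iff)
  from section_class_locally_surjective[OF ob(1) 21(2) ob(3,2) 21(4,5)] obtain W f where
    W: "openin X W" "x \<in> W" "W \<subseteq> V" "f \<in> N p W (RObj G U W i)" "section_class p U i W f = Res (A p) V W e"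
    by (elim exE conjE)
  then show ?case
    unfolding a using ob by (intro bexI[of _ "(W, (U, i), f, (U, i))"]) (auto simp: loops_iff)
next
  case (22 a V \<phi>)
  obtain U i where a: "a = (U, i)" by (cases a)
  have ob: "openin X U" "i \<in> Obj G U" "V \<subseteq> U" using 22(1-3) unfolding a by (simp_all add: local_objects_iff)
  define W where "W p x = fst (\<phi> p x)" for p x
  define f where "f p x = fst (snd (snd (\<phi> p x)))" for p x
  have \<phi>: "\<phi> p x = (W p x, (U, i), f p x, (U, i))" "x \<in> W p x" "W p x \<subseteq> V" "openin X (W p x)"
    "f p x \<in> Hom G (W p x) (RObj G U (W p x) i) (RObj G U (W p x) i)" "W p x \<subseteq> U" if "x \<in> V" for p x
  proof -
    show 1: "\<phi> p x = (W p x, (U, i), f p x, (U, i))"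
      using 22(4)[OF that, of p] unfolding a W_def f_def by (cases "\<phi> p x" rule: local_arrow_cases) simp
    show "x \<in> W p x" "W p x \<subseteq> V" using 22(4)[OF that, of p] unfolding W_def by auto
    show "openin X (W p x)" "f p x \<in> Hom G (W p x) (RObj G U (W p x) i) (RObj G U (W p x) i)" "W p x \<subseteq> U"
      using 22(4)[OF that, of p] unfolding 1 by (auto simp: local_arrows_iff)
  qed
  have "\<exists>h\<in>Hom G V (RObj G U V i) (RObj G U V i). \<forall>p. \<forall>x\<in>V. f p x \<otimes>\<^bsub>Sec (aut_sheaf G U i) (W p x)\<^esub>
      inv\<^bsub>Sec (aut_sheaf G U i) (W p x)\<^esub> hom_res G U i U i V (W p x) h \<in> N p (W p x) (RObj G U (W p x) i)"
  proof (rule complete_raw[OF ob(1,2) 22(2) ob(3)])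
    fix p q :: nat and x y assume pq: "p \<le> q" and x: "x \<in> V" and y: "y \<in> V"
    let ?Q = "W p x \<inter> W q y"
    have Q: "openin X ?Q" "?Q \<subseteq> U" "?Q \<subseteq> W p x" using \<phi>(3,4)[OF x, of p] \<phi>(4)[OF y, of q] ob by auto
    have "arrow_cmp G (arrow_res G ?Q (\<phi> q y)) (arrow_inv G (arrow_res G ?Q (\<phi> p x))) \<in> loops p"
      using 22(5)[OF pq x y] unfolding W_def .
    then have "Cmp G ?Q (hom_res G U i U i (W q y) ?Q (f q y))
        (Inv G ?Q (RObj G U ?Q i) (RObj G U ?Q i) (hom_res G U i U i (W p x) ?Q (f p x))) \<in> N p ?Q (RObj G U ?Q i)"
      using \<phi>(1)[OF x, of p] \<phi>(1)[OF y, of q] by (simp add: loops_iff)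
    moreover have "hom_res G U i U i (W p x) ?Q (f p x) \<in> Hom G ?Q (RObj G U ?Q i) (RObj G U ?Q i)"
      using hom_res_closed[OF ob(1,1) \<phi>(4)[OF x] Q(1) \<phi>(6,6)[OF x] Q(3) ob(2,2), of "f p x"] \<phi>(5)[OF x, of p]
      by (simp add: hom_sec_def)
    ultimately show "hom_res G U i U i (W q y) ?Q (f q y) \<otimes>\<^bsub>Sec (aut_sheaf G U i) ?Q\<^esub>
        inv\<^bsub>Sec (aut_sheaf G U i) ?Q\<^esub> hom_res G U i U i (W p x) ?Q (f p x) \<in> N p ?Q (RObj G U ?Q i)"
      using inv_aut_sheaf[OF ob(1) Q(1,2) ob(2)] by simp
  qed (use \<phi> in simp_all)
  then obtain h where h: "h \<in> Hom G V (RObj G U V i) (RObj G U V i)"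
    and h': "\<forall>p. \<forall>x\<in>V. f p x \<otimes>\<^bsub>Sec (aut_sheaf G U i) (W p x)\<^esub>
      inv\<^bsub>Sec (aut_sheaf G U i) (W p x)\<^esub> hom_res G U i U i V (W p x) h \<in> N p (W p x) (RObj G U (W p x) i)"
    by (elim bexE)
  let ?h = "(V, (U, i), h, (U, i))"
  have "arrow_cmp G (\<phi> p x) (arrow_inv G (arrow_res G (fst (\<phi> p x)) ?h)) \<in> loops p" if x: "x \<in> V" for p x
  proof -
    have "hom_res G U i U i V (W p x) h \<in> Hom G (W p x) (RObj G U (W p x) i) (RObj G U (W p x) i)"
      using hom_res_closed[OF ob(1,1) 22(2) \<phi>(4)[OF x] ob(3,3) \<phi>(3)[OF x] ob(2,2), of h p] h by (simp add: hom_sec_def)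
    then have "Cmp G (W p x) (f p x) (Inv G (W p x) (RObj G U (W p x) i) (RObj G U (W p x) i) (hom_res G U i U i V (W p x) h))
        \<in> N p (W p x) (RObj G U (W p x) i)"
      using bspec[OF spec[OF h'] x, of p] inv_aut_sheaf[OF ob(1) \<phi>(4,6)[OF x] ob(2)] by simp
    then show ?thesis
      unfolding \<phi>(1)[OF x] using \<phi>(4,6)[OF x, of p] ob by (simp add: loops_iff)
  qed
  then show ?case
    unfolding a using h ob 22(2) by (intro bexI[of _ ?h]) (simp_all add: local_arrows_iff)
qed

section \<open>The two conclusions for the gerbe\<close>

context filtered_gerbe_data
begin

lemma connected_of_cohomology:
  assumes U: "openin X U" and H: "\<And>p. cohomology_trivial X U (A p) 1"
  shows "connected_groupoid (Obj G U) (Hom G U)"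
  unfolding connected_groupoid_def
proof (intro ballI)
  fix i j assume i: "i \<in> Obj G U" and j: "j \<in> Obj G U"
  have "\<exists>h\<in>local_arrows X G. fst h = fst (U, i) \<and> arrow_src h = (U, i) \<and> arrow_tgt h = (U, j)"
    by (rule filtered.isomorphic_same_base)
      (use U i j H cech1_trivial_of_cohomology[OF abelian_A U] in \<open>simp_all add: local_objects_iff\<close>)
  then obtain h where h: "h \<in> local_arrows X G" "fst h = U" "arrow_src h = (U, i)" "arrow_tgt h = (U, j)" by auto
  obtain V U1 i1 f U2 j1 where F: "h = (V, (U1, i1), f, (U2, j1))" by (rule local_arrow_cases)
  have f: "f \<in> Hom G U (RObj G U U i) (RObj G U U j)"
    using h unfolding F by (simp add: local_arrows_iff)
  have ob: "RObj G U U i \<in> Obj G U" "RObj G U U j \<in> Obj G U" using robj U i j by auto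
  \<comment> \<open>The arrow obtained joins the restrictions of \<open>i\<close> and
    \<open>j\<close> from \<open>U\<close> to itself; the unit isomorphisms bring it back to
    \<open>i\<close> and \<open>j\<close>.\<close>
  have "Cmp G U (Unt G U j) (Cmp G U f (Inv G U (RObj G U U i) i (Unt G U i))) \<in> Hom G U i j"
    using cmp_closed[OF U i ob(2) j cmp_closed[OF U i ob Inv(1)[OF U ob(1) i unt[OF U i]] f] unt[OF U j]] .
  then show "Hom G U i j \<noteq> {}" by blast
qed

text \<open>Acyclicity speaks of the quotient sheaves on the subspace \<open>V\<close>, which
  \<open>\<chi>\<close> identifies with \<open>A p\<close> there. It lifts classes at objects given
  over \<open>V\<close>; for an object over a larger set the lift is found at a restriction and
  carried over by conjugation.\<close>

lemma
  assumes V: "gerbe_acyclic_open X G N V"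
  shows acyclic_cech1_trivial: "cech1_trivial X V (A p)"
    and acyclic_loop_class_surj: "\<lbrakk>a \<in> local_objects X G; V \<subseteq> fst a; e \<in> carrier (Sec (A p) V)\<rbrakk> \<Longrightarrow>
      \<exists>m\<in>loops p. fst m = V \<and> arrow_src m = a \<and> loop_class p m = e"
proof -
  have oV: "openin X V" and "Obj G V \<noteq> {}"
    and ac: "\<forall>i\<in>Obj G V. acyclic_wrt_filtration (subtopology X V) (aut_sheaf G V i) (\<lambda>p. sub_sec G (N p) V i) V"
    using V unfolding gerbe_acyclic_open_def by auto
  then obtain i where i: "i \<in> Obj G V" by blast
  show "cech1_trivial X V (A p)"
  proof (rule cech1_trivial_subtopology[OF oV subset_refl])
    have "cohomology_trivial (subtopology X V) V (quot_sheaf (subtopology X V) (aut_sheaf G V i)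
        (sub_sec G (N p) V i) (sub_sec G (N (Suc p)) V i)) 1"
      using bspec[OF ac i] unfolding acyclic_wrt_filtration_def by simp
    moreover have "openin (subtopology X V) V" using oV openin_sub by simp
    ultimately show "cech1_trivial (subtopology X V) V (A p)"
      using cech1_trivial_of_iso[OF abelian_sheaf_subtopology[OF abelian_A oV] _ \<chi>_iso[OF oV i]] by simp
  qed
  show "\<exists>m\<in>loops p. fst m = V \<and> arrow_src m = a \<and> loop_class p m = e"
    if a: "a \<in> local_objects X G" "V \<subseteq> fst a" and e: "e \<in> carrier (Sec (A p) V)"
  proof -
    obtain r where r: "r \<in> local_arrows X G" "fst r = V" "arrow_tgt r = a" "fst (arrow_src r) = V"
      using filtered.restrict_object[OF a(1) oV a(2)] by blast
    define j where "j = snd (arrow_src r)"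
    have rs: "arrow_src r = (V, j)" using r(4) unfolding j_def by (cases "arrow_src r") simp
    have j: "j \<in> Obj G V" using strict.arr(2)[OF r(1)] unfolding rs by (simp add: local_objects_iff)
    have "quot_proj (subtopology X V) (aut_sheaf G V j) (sub_sec G (N p) V j) (sub_sec G (N (Suc p)) V j) V ` sub_sec G (N p) V j V
        = carrier (Sec (quot_sheaf (subtopology X V) (aut_sheaf G V j) (sub_sec G (N p) V j) (sub_sec G (N (Suc p)) V j)) V)"
      using bspec[OF ac j] unfolding acyclic_wrt_filtration_def by simp
    moreover have "\<chi> p V j V e \<in> carrier (Sec (quot_sheaf (subtopology X V) (aut_sheaf G V j) (sub_sec G (N p) V j) (sub_sec G (N (Suc p)) V j)) V)"
      using \<chi>_bij[OF oV oV subset_refl j, of p] e unfolding bij_betw_def by blast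
    ultimately obtain f where f: "f \<in> N p V (RObj G V V j)" "\<chi> p V j V e = proj p V j V f"
      unfolding sub_sec_def by (metis (no_types, lifting) imageE)
    let ?F = "(V, (V, j), f, (V, j))"
    have F: "?F \<in> loops p" "loop_class p ?F = e"
      using f oV j section_class_eqI[OF oV oV subset_refl j f(1) e f(2)] by (simp_all add: loops_iff)
    \<comment> \<open>Conjugation by \<open>r\<close> moves the loop from \<open>(V, j)\<close> to
      \<open>a\<close> without changing its class.\<close>
    let ?m = "arrow_cmp G r (arrow_cmp G ?F (arrow_inv G r))"
    have FA: "?F \<in> local_arrows X G" using filtered.N_loop(1)[OF F(1)] .
    have "?m \<in> loops p" "loop_class p ?m = e"
      using filtered.N_conj[OF F(1) r(1)] filtered.\<kappa>_conj[OF F(1) r(1)] r(2) rs F(2) by simp_all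
    moreover have "fst ?m = V" "arrow_src ?m = a"
      using FA r rs by (simp_all add: strict.arrow_simps del: arrow_cmp.simps arrow_inv.simps)
    ultimately show ?thesis by blast
  qed
qed

lemma nonempty_of_cohomology:
  assumes U: "openin X U" and enough: "enough_acyclic_coverings X G N" and H: "\<And>p. cohomology_trivial X U (A p) 2"
  shows "Obj G U \<noteq> {}"
proof -
  \<comment> \<open>Refining the covering by \<open>U\<close> alone yields an acyclic covering of
    \<open>U\<close>.\<close>
  have "open_cover X U {U}" using U unfolding open_cover_def by simp
  then obtain \<V> where \<V>: "open_cover X U \<V>" "gerbe_acyclic_collection X G N \<V>"
    using enough U unfolding enough_acyclic_coverings_def by blast
  have ac: "gerbe_acyclic_open X G N (V \<inter> W)" if "V \<in> \<V>" "W \<in> \<V>" for V W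
  proof -
    have "gerbe_acyclic_open X G N (\<Inter>{V, W})"
      by (rule \<V>(2)[unfolded gerbe_acyclic_collection_def, rule_format]) (use that in auto)
    then show ?thesis by simp
  qed
  have ac1: "gerbe_acyclic_open X G N V" if "V \<in> \<V>" for V using ac[OF that that] by simp
  have oV: "openin X V" if "V \<in> \<V>" for V using \<V>(1) that unfolding open_cover_def by blast
  have "\<forall>V\<in>\<V>. \<exists>i. i \<in> Obj G V" using ac1 unfolding gerbe_acyclic_open_def by blast
  from bchoice[OF this] obtain i where i: "\<And>V. V \<in> \<V> \<Longrightarrow> i V \<in> Obj G V" by blast
  \<comment> \<open>The covering is indexed by itself, so that \<open>base (a V)\<close> is
    \<open>V\<close>.\<close>
  define a where "a V = (V, i V)" for V
  have a: "fst (a V) = V" for V by (simp add: a_def)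
  have "\<exists>g. filtered.frame \<V> a g \<and> (\<forall>k\<in>\<V>. \<forall>l\<in>\<V>. \<forall>m\<in>\<V>.
    arrow_cmp G (arrow_res G (fst (a k) \<inter> fst (a l) \<inter> fst (a m)) (g l m)) (arrow_res G (fst (a k) \<inter> fst (a l) \<inter> fst (a m)) (g k l)) =
    arrow_res G (fst (a k) \<inter> fst (a l) \<inter> fst (a m)) (g k m))"
  proof (rule filtered.ex_descent_datum, unfold a)
    show "a V \<in> local_objects X G" if "V \<in> \<V>" for V using i[OF that] oV[OF that] by (simp add: a_def local_objects_iff)
    show "openin X V" if "V \<in> \<V>" for V using oV[OF that] .
    show "\<exists>m\<in>loops p. fst m = V \<inter> W \<and> arrow_src m = a V \<and> loop_class p m = e"
      if "V \<in> \<V>" "W \<in> \<V>" "e \<in> carrier (Sec (A p) (V \<inter> W))" for p V W e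
      by (rule acyclic_loop_class_surj[OF ac[OF that(1,2)]])
        (use that i oV in \<open>auto simp: a_def local_objects_iff\<close>)
    \<comment> \<open>The members are acyclic and thus have vanishing Cech H^1, which is what lets
      the derived H^2 control 2-cocycles on this covering.\<close>
    show "\<exists>b. cech2_bounds (A p) \<V> (\<lambda>k. k) c b" if "cech2_cocycle (A p) \<V> (\<lambda>k. k) c" for p c
      by (rule cech2_bounds_of_cohomology[OF abelian_A U H _ _ _ that])
        (use \<V>(1) oV acyclic_cech1_trivial[OF ac1] in \<open>auto simp: open_cover_def\<close>)
    show "cech1_trivial X (V \<inter> W) (A p)" if "V \<in> \<V>" "W \<in> \<V>" for p V W
      using acyclic_cech1_trivial[OF ac[OF that]] .
  qed
  then obtain g where g: "filtered.frame \<V> a g" and coc: "\<forall>k\<in>\<V>. \<forall>l\<in>\<V>. \<forall>m\<in>\<V>.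
    arrow_cmp G (arrow_res G (k \<inter> l \<inter> m) (g l m)) (arrow_res G (k \<inter> l \<inter> m) (g k l)) = arrow_res G (k \<inter> l \<inter> m) (g k m)"
    unfolding a by (elim exE conjE)
  define \<gamma> where "\<gamma> V W = fst (snd (snd (g V W)))" for V W
  have \<gamma>: "g V W = (V \<inter> W, (V, i V), \<gamma> V W, (W, i W)) \<and> \<gamma> V W \<in> hom_sec G V (i V) W (i W) (V \<inter> W)"
    if "V \<in> \<V>" "W \<in> \<V>" for V W
  proof -
    obtain Z U1 i1 f U2 j1 where F: "g V W = (Z, (U1, i1), f, (U2, j1))" by (rule local_arrow_cases)
    show ?thesis
      using filtered.frameD(1-4)[OF g that] unfolding a unfolding F \<gamma>_def by (auto simp: a_def local_arrows_iff hom_sec_def)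
  qed
  have "descent_datum G \<V> i \<gamma>"
    unfolding descent_datum_def
  proof (intro conjI ballI)
    fix V W Z assume VWZ: "V \<in> \<V>" "W \<in> \<V>" "Z \<in> \<V>"
    show "Cmp G (V \<inter> W \<inter> Z) (hom_res G W (i W) Z (i Z) (W \<inter> Z) (V \<inter> W \<inter> Z) (\<gamma> W Z))
        (hom_res G V (i V) W (i W) (V \<inter> W) (V \<inter> W \<inter> Z) (\<gamma> V W)) =
      hom_res G V (i V) Z (i Z) (V \<inter> Z) (V \<inter> W \<inter> Z) (\<gamma> V Z)"
      using bspec[OF bspec[OF bspec[OF coc VWZ(1)] VWZ(2)] VWZ(3)]
        conjunct1[OF \<gamma>[OF VWZ(1,2)]] conjunct1[OF \<gamma>[OF VWZ(2,3)]] conjunct1[OF \<gamma>[OF VWZ(1,3)]] by simp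
  qed (use i \<gamma> in auto)
  moreover have "\<forall>U \<U> i g. openin X U \<and> open_cover X U \<U> \<and> descent_datum G \<U> i g \<longrightarrow>
      effective_descent_datum G U \<U> i g"
    using gerbe unfolding gerbe_def stack_of_groupoids_def by (elim conjE)
  \<comment> \<open>The arrows \<open>g\<close> now satisfy the cocycle condition exactly, and
    descent along the covering yields an object over \<open>U\<close>.\<close>
  ultimately have "effective_descent_datum G U \<V> i \<gamma>" using U \<V>(1) by simp
  then show ?thesis unfolding effective_descent_datum_def by (elim bexE) auto
qed

end

theorem theorem6p10:
  fixes X :: "'x topology"
    and G :: "('x, 'o, 'm) prestack_data"
    and N :: "nat \<Rightarrow> 'x set \<Rightarrow> 'o \<Rightarrow> 'm set"
    and A :: "nat \<Rightarrow> ('x, 'b) group_presheaf"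
    and \<chi> :: "nat \<Rightarrow> 'x set \<Rightarrow> 'o \<Rightarrow> 'x set \<Rightarrow> 'b \<Rightarrow> 'x \<Rightarrow> ('x set \<times> 'm set) set"
    and U :: "'x set"
  assumes "gerbe X G"
    and "gerbe_central_filtration X G N"
    and "\<And>p. is_gerbe_quotient X G (N p) (N (Suc p)) (A p) (\<chi> p)"
    and "gerbe_complete X G N"
    and "enough_acyclic_coverings X G N"
    and "openin X U"
  shows "((\<forall>p. cohomology_trivial X U (A p) 1) \<longrightarrow> connected_groupoid (Obj G U) (Hom G U)) \<and>
         ((\<forall>p. cohomology_trivial X U (A p) 2) \<longrightarrow> Obj G U \<noteq> {})"
proof -
  interpret filtered_gerbe_data X G N A \<chi>
    using assms(1-4) by (rule filtered_gerbe_data.intro)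
  show ?thesis
    using connected_of_cohomology[OF assms(6)] nonempty_of_cohomology[OF assms(6,5)] by simp
qed

end
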